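(* Let $u_0\in L^2_\sigma(\mathbb{R}^3)$ and let $u(\cdot,t)$, $t>0$, be any particular Leray-Hopf solution of the incompressible Navier-Stokes equations in $\mathbb{R}^3$ with initial data $u_0$ (in the sense described in the context). Given any pair of initial times $\tilde t_0>t_0\ge 0$, let $v(\cdot,t)=e^{\Delta(t-t_0)}u(\cdot,t_0)$ and $\tilde v(\cdot,t)=e^{\Delta(t-\tilde t_0)}u(\cdot,\tilde t_0)$ be the corresponding heat flows. Then $$\|v(\cdot,t)-\tilde v(\cdot,t)\|_{L^2(\mathbb{R}^3)}\le \frac{K}{\sqrt2}\,\|u_0\|_{L^2(\mathbb{R}^3)}^2\,(\tilde t_0-t_0)^{1/2}\,(t-\tilde t_0)^{-3/4}$$ for all $t>\tilde t_0$, where $K=(8\pi)^{-3/4}$.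
   Context: $L^2_\sigma(\mathbb{R}^3)$ is the space of vector fields $\mathrm{u}=(\mathrm{u}_1,\mathrm{u}_2,\mathrm{u}_3)\in L^2(\mathbb{R}^3)$ with $\nabla\cdot \mathrm{u}=0$ in the distributional sense. The Navier-Stokes problem is $$u_t+u\cdot\nabla u+\nabla p=\Delta u,\qquad \nabla\cdot u(\cdot,t)=0,\qquad u(\cdot,0)=u_0\in L^2_\sigma(\mathbb{R}^3).$$ A Leray-Hopf solution is a global weak solution as constructed by Leray: $u\in L^\infty([0,\infty),L^2_\sigma(\mathbb{R}^3))\cap L^2([0,\infty),\dot H^1(\mathbb{R}^3))$, weakly continuous in $L^2(\mathbb{R}^3)$ on $[0,\infty)$, solving the equations in the distributional sense, with $\|u(\cdot,t)-u_0\|_{L^2}\to 0$ as $t\searrow 0$, and satisfying the energy inequality $\|u(\cdot,t)\|_{L^2}^2+2\int_0^t\|Du(\cdot,s)\|_{L^2}^2\,ds\le\|u_0\|_{L^2}^2$ for all $t\ge 0$. It is obtained as follows: for a nonnegative $G\in C_0^\infty(\mathbb{R}^3)$ with $\int G=1$, put $G_\delta(x)=\delta^{-3}G(x/\delta)$, and let $u_\delta,p_\delta\in C^\infty(\mathbb{R}^3\times[0,\infty))$ be the unique global classical $L^2$ solutions of $\partial_t u_\delta+(G_\delta * u_\delta)\cdot\nabla u_\delta+\nabla p_\delta=\Delta u_\delta$, $\nabla\cdot u_\delta=0$, $u_\delta(\cdot,0)=G_\delta * u_0$; then for some sequence $\delta'\to 0$ one has $u_{\delta'}(\cdot,t)\rightharpoonup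 u(\cdot,t)$ weakly in $L^2(\mathbb{R}^3)$ for every $t\ge 0$. Such a solution has the property (shown by Leray) that there is $t_*$ (depending on $u$) with $u\in C^\infty(\mathbb{R}^3\times[t_*,\infty))$ and $u\in L^\infty([t_*,T],H^m(\mathbb{R}^3))$ for each $m\ge 1$ and each $t_*<T<\infty$. $e^{\Delta\tau}$, $\tau\ge 0$, is the heat semigroup on $\mathbb{R}^3$ (acting componentwise). Norms: $\|u\|_{L^2}^2=\sum_{i}\int|u_i|^2dx$, $\|Du\|_{L^2}^2=\sum_{i,j}\int|D_ju_i|^2dx$ with $D_j=\partial/\partial x_j$. *)

theory Defs
  imports "HOL-Analysis.Analysis"
begin

type_synonym R3 = "real ^ 3"


subsection \<open>Smooth functions, test functions, distributions\<close>

text \<open>Derivatives are taken within \<open>S\<close>, so that on \<open>{0..} \<times> UNIV\<close> they are one-sided in time at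
  the boundary. The sets used below are convex with nonempty interior, hence these derivatives are
  unique.\<close>

primrec iter_deriv ::
  "'a::euclidean_space set \<Rightarrow> 'a list \<Rightarrow> ('a \<Rightarrow> 'b::real_normed_vector) \<Rightarrow> 'a \<Rightarrow> 'b" where
  "iter_deriv S [] f = f"
| "iter_deriv S (v # vs) f = (\<lambda>x. frechet_derivative (iter_deriv S vs f) (at x within S) v)"

definition smooth_on :: "'a::euclidean_space set \<Rightarrow> ('a \<Rightarrow> 'b::real_normed_vector) \<Rightarrow> bool" where
  "smooth_on S f \<longleftrightarrow> (\<forall>vs. \<forall>x\<in>S. iter_deriv S vs f differentiable (at x within S))"

definition test_function :: "'a::euclidean_space set \<Rightarrow> ('a \<Rightarrow> 'b::real_normed_vector) \<Rightarrow> bool" where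
  "test_function \<Omega> \<phi> \<longleftrightarrow> smooth_on UNIV \<phi> \<and>
     compact (closure {x. \<phi> x \<noteq> 0}) \<and> closure {x. \<phi> x \<noteq> 0} \<subseteq> \<Omega>"

text \<open>Linear functionals on the test functions on \<open>\<Omega>\<close> that are sequentially continuous.\<close>

definition distribution_on :: "'a::euclidean_space set \<Rightarrow> (('a \<Rightarrow> real) \<Rightarrow> real) \<Rightarrow> bool" where
  "distribution_on \<Omega> T \<longleftrightarrow>
     (\<forall>\<phi> \<psi>. test_function \<Omega> \<phi> \<longrightarrow> test_function \<Omega> \<psi> \<longrightarrow> T (\<lambda>x. \<phi> x + \<psi> x) = T \<phi> + T \<psi>) \<and>
     (\<forall>c \<phi>. test_function \<Omega> \<phi> \<longrightarrow> T (\<lambda>x. c * \<phi> x) = c * T \<phi>) \<and>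
     (\<forall>\<phi> K. compact K \<longrightarrow> K \<subseteq> \<Omega> \<longrightarrow>
        (\<forall>n. test_function \<Omega> (\<phi> n) \<and> (\<forall>x. x \<notin> K \<longrightarrow> \<phi> n x = 0)) \<longrightarrow>
        (\<forall>vs. uniform_limit UNIV (\<lambda>n. iter_deriv UNIV vs (\<phi> n)) (\<lambda>_. 0) sequentially) \<longrightarrow>
        (\<lambda>n::nat. T (\<phi> n)) \<longlonglongrightarrow> 0)"


subsection \<open>Spatial derivatives\<close>

definition partial :: "3 \<Rightarrow> (R3 \<Rightarrow> 'b::real_normed_vector) \<Rightarrow> R3 \<Rightarrow> 'b" where
  "partial j f x = frechet_derivative f (at x) (axis j 1)"

definition laplacian :: "(R3 \<Rightarrow> 'b::real_normed_vector) \<Rightarrow> R3 \<Rightarrow> 'b" where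
  "laplacian f x = (\<Sum>j\<in>UNIV. partial j (partial j f) x)"

definition divergence :: "(R3 \<Rightarrow> R3) \<Rightarrow> R3 \<Rightarrow> real" where
  "divergence f x = (\<Sum>j\<in>UNIV. partial j f x $ j)"

definition gradient :: "(R3 \<Rightarrow> real) \<Rightarrow> R3 \<Rightarrow> R3" where
  "gradient p x = (\<chi> i. partial i p x)"


subsection \<open>The space \<open>L\<^sup>2\<close>\<close>

definition in_L2 :: "(R3 \<Rightarrow> 'b::euclidean_space) \<Rightarrow> bool" where
  "in_L2 f \<longleftrightarrow> f \<in> borel_measurable lebesgue \<and> integrable lebesgue (\<lambda>x. (norm (f x))\<^sup>2)"

text \<open>The norms on \<open>real^3\<close> and \<open>real^3^3\<close> are the Euclidean and the Frobenius norm, so this is the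
  root of the sum of the squared \<open>L\<^sup>2\<close> norms of all components.\<close>

definition L2_norm :: "(R3 \<Rightarrow> 'b::euclidean_space) \<Rightarrow> real" where
  "L2_norm f = sqrt (LINT x|lebesgue. (norm (f x))\<^sup>2)"

definition L2_inner :: "(R3 \<Rightarrow> 'b::euclidean_space) \<Rightarrow> (R3 \<Rightarrow> 'b) \<Rightarrow> real" where
  "L2_inner f g = (LINT x|lebesgue. f x \<bullet> g x)"

definition L2_sigma :: "(R3 \<Rightarrow> R3) \<Rightarrow> bool" where
  "L2_sigma f \<longleftrightarrow> in_L2 f \<and>
     (\<forall>\<phi> :: R3 \<Rightarrow> real. test_function UNIV \<phi> \<longrightarrow> L2_inner f (gradient \<phi>) = 0)"

text \<open>\<open>g x $ i $ j\<close> is the distributional derivative \<open>D\<^sub>j f\<^sub>i\<close>.\<close>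

definition weak_gradient :: "(R3 \<Rightarrow> R3) \<Rightarrow> (R3 \<Rightarrow> real^3^3) \<Rightarrow> bool" where
  "weak_gradient f g \<longleftrightarrow>
     (\<forall>i j. \<forall>\<phi> :: R3 \<Rightarrow> real. test_function UNIV \<phi> \<longrightarrow>
        (LINT x|lebesgue. f x $ i * partial j \<phi> x) = - (LINT x|lebesgue. g x $ i $ j * \<phi> x))"


subsection \<open>Convolution and the heat semigroup\<close>

definition convolve :: "(R3 \<Rightarrow> real) \<Rightarrow> (R3 \<Rightarrow> R3) \<Rightarrow> R3 \<Rightarrow> R3" where
  "convolve g f x = (LINT y|lebesgue. g (x - y) *\<^sub>R f y)"

definition heat_kernel :: "real \<Rightarrow> R3 \<Rightarrow> real" where
  "heat_kernel \<tau> x = (4 * pi * \<tau>) powr (- 3 / 2) * exp (- (norm x)\<^sup>2 / (4 * \<tau>))"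

definition heat_semigroup :: "real \<Rightarrow> (R3 \<Rightarrow> R3) \<Rightarrow> R3 \<Rightarrow> R3" where
  "heat_semigroup \<tau> f = (if \<tau> = 0 then f else convolve (heat_kernel \<tau>) f)"


subsection \<open>Leray's regularized problem\<close>

definition mollifier :: "(R3 \<Rightarrow> real) \<Rightarrow> bool" where
  "mollifier G \<longleftrightarrow> test_function UNIV G \<and> (\<forall>x. 0 \<le> G x) \<and> (LINT x|lebesgue. G x) = 1"

definition rescale :: "(R3 \<Rightarrow> real) \<Rightarrow> real \<Rightarrow> R3 \<Rightarrow> real" where
  "rescale G \<delta> x = G (x /\<^sub>R \<delta>) / \<delta> ^ 3"

text \<open>Being an \<open>L\<^sup>2\<close> solution is read as \<open>w \<in> C([0,\<infinity>), L\<^sup>2)\<close>; in this class the velocity \<open>w\<close> is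
  unique and the pressure \<open>q\<close> is unique up to a function of time.\<close>

definition regularized_solution ::
  "(R3 \<Rightarrow> real) \<Rightarrow> real \<Rightarrow> (R3 \<Rightarrow> R3) \<Rightarrow> (real \<Rightarrow> R3 \<Rightarrow> R3) \<Rightarrow> (real \<Rightarrow> R3 \<Rightarrow> real) \<Rightarrow> bool" where
  "regularized_solution G \<delta> u0 w q \<longleftrightarrow>
     smooth_on ({0..} \<times> UNIV) (\<lambda>(t, x). w t x) \<and>
     smooth_on ({0..} \<times> UNIV) (\<lambda>(t, x). q t x) \<and>
     (\<forall>t\<ge>0. in_L2 (w t)) \<and>
     (\<forall>s\<ge>0. ((\<lambda>t. L2_norm (\<lambda>x. w t x - w s x)) \<longlongrightarrow> 0) (at s within {0..})) \<and>
     (\<forall>t\<ge>0. \<forall>x.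
        vector_derivative (\<lambda>s. w s x) (at t within {0..})
          + (\<Sum>j\<in>UNIV. convolve (rescale G \<delta>) (w t) x $ j *\<^sub>R partial j (w t) x)
          + gradient (q t) x
        = laplacian (w t) x) \<and>
     (\<forall>t\<ge>0. \<forall>x. divergence (w t) x = 0) \<and>
     (\<forall>x. w 0 x = convolve (rescale G \<delta>) u0 x)"

definition leray_limit :: "(R3 \<Rightarrow> R3) \<Rightarrow> (real \<Rightarrow> R3 \<Rightarrow> R3) \<Rightarrow> bool" where
  "leray_limit u0 u \<longleftrightarrow>
     (\<exists>G (\<delta> :: nat \<Rightarrow> real) w q.
        mollifier G \<and> (\<forall>n. 0 < \<delta> n) \<and> \<delta> \<longlonglongrightarrow> 0 \<and>
        (\<forall>n. regularized_solution G (\<delta> n) u0 (w n) (q n)) \<and>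
        (\<forall>t\<ge>0. \<forall>g. in_L2 g \<longrightarrow> (\<lambda>n. L2_inner (w n t) g) \<longlonglongrightarrow> L2_inner (u t) g))"


subsection \<open>Leray-Hopf solutions\<close>

text \<open>\<open>u\<^sub>t + u \<cdot> \<nabla>u + \<nabla>p = \<Delta>u\<close> in the sense of distributions on \<open>(0,\<infinity>) \<times> \<real>\<^sup>3\<close>, the pressure being a
  distribution. \<open>Du\<close> is the spatial weak gradient of \<open>u\<close>, so \<open>(Du *v u)\<^sub>i = \<Sum>\<^sub>j u\<^sub>j D\<^sub>j u\<^sub>i\<close>. For \<open>u\<close> weakly
  continuous and bounded in \<open>L\<^sup>2\<close> with \<open>Du \<in> L\<^sup>2(L\<^sup>2)\<close> the iterated integral converges absolutely,
  without any further joint measurability assumption.\<close>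

definition navier_stokes_distributional ::
  "(real \<Rightarrow> R3 \<Rightarrow> R3) \<Rightarrow> (real \<Rightarrow> R3 \<Rightarrow> real^3^3) \<Rightarrow> ((real \<times> R3 \<Rightarrow> real) \<Rightarrow> real) \<Rightarrow> bool" where
  "navier_stokes_distributional u Du p \<longleftrightarrow>
     distribution_on ({0<..} \<times> UNIV) p \<and>
     (\<forall>\<phi> :: real \<times> R3 \<Rightarrow> R3. test_function ({0<..} \<times> UNIV) \<phi> \<longrightarrow>
        (LINT t:{0<..}|lebesgue. LINT x|lebesgue.
            - (u t x \<bullet> vector_derivative (\<lambda>s. \<phi> (s, x)) (at t))
            + (Du t x *v u t x) \<bullet> \<phi> (t, x))
          - p (\<lambda>(t, x). divergence (\<lambda>y. \<phi> (t, y)) x)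
        = (LINT t:{0<..}|lebesgue. LINT x|lebesgue. u t x \<bullet> laplacian (\<lambda>y. \<phi> (t, y)) x))"

text \<open>Since \<open>u\<close> is weakly continuous into \<open>L\<^sup>2\<close>, it is automatically strongly measurable as a map
  into \<open>L\<^sup>2\<close>.\<close>

definition leray_hopf_solution :: "(R3 \<Rightarrow> R3) \<Rightarrow> (real \<Rightarrow> R3 \<Rightarrow> R3) \<Rightarrow> bool" where
  "leray_hopf_solution u0 u \<longleftrightarrow>
     (\<forall>t\<ge>0. L2_sigma (u t)) \<and>
     (\<exists>M. AE t in lebesgue. 0 \<le> t \<longrightarrow> L2_norm (u t) \<le> M) \<and>
     (\<forall>g. in_L2 g \<longrightarrow> continuous_on {0..} (\<lambda>t. L2_inner (u t) g)) \<and>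
     (AE x in lebesgue. u 0 x = u0 x) \<and>
     ((\<lambda>t. L2_norm (\<lambda>x. u t x - u0 x)) \<longlongrightarrow> 0) (at_right 0) \<and>
     (\<exists>Du p.
        (AE t in lebesgue. 0 \<le> t \<longrightarrow> in_L2 (Du t) \<and> weak_gradient (u t) (Du t)) \<and>
        set_integrable lebesgue {0..} (\<lambda>t. (L2_norm (Du t))\<^sup>2) \<and>
        navier_stokes_distributional u Du p \<and>
        (\<forall>t\<ge>0. (L2_norm (u t))\<^sup>2 + 2 * (LINT s:{0..t}|lebesgue. (L2_norm (Du s))\<^sup>2)
                  \<le> (L2_norm u0)\<^sup>2)) \<and>
     leray_limit u0 u"

end

theory Submission
  imports Defs "HOL-Probability.Probability"
begin

text \<open>Let \<open>N = (Du) u\<close> be the convection term and \<open>E = \<parallel>u0\<parallel>\<close>. The estimate follows by duality from the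
  Duhamel identity

    \<open>\<langle>u(t0), e\<^bsup>(r-t0)\<Delta>\<^esup> g\<rangle> - \<langle>u(t0'), e\<^bsup>(r-t0')\<Delta>\<^esup> g\<rangle> = \<integral>\<^bsub>t0\<^esub>\<^bsup>t0'\<^esup> \<langle>N(s), e\<^bsup>(r-s)\<Delta>\<^esup> g\<rangle> ds\<close>

  for divergence-free \<open>g\<close> in \<open>L\<^sup>2\<close> and \<open>r > t0'\<close> (\<open>heat_flow_identity\<close>). Take \<open>r = t\<close> and let \<open>g\<close> be the
  difference of the two heat flows at time \<open>t\<close>. As the heat semigroup is symmetric, the left-hand side
  is \<open>\<parallel>g\<parallel>\<^sup>2\<close>. The heat kernel at time \<open>\<tau>\<close> has \<open>L\<^sup>2\<close> norm \<open>(8 \<pi> \<tau>)\<^bsup>-3/4\<^esup>\<close>, which bounds the supremum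
  norm of \<open>e\<^bsup>\<tau>\<Delta>\<^esup> g\<close> by \<open>(8 \<pi> \<tau>)\<^bsup>-3/4\<^esup> \<parallel>g\<parallel>\<close>; the \<open>L\<^sup>1\<close> norm of \<open>N(s)\<close> is at most \<open>E \<parallel>Du(s)\<parallel>\<close>; and by
  Cauchy-Schwarz in time and the energy inequality, the integral of \<open>\<parallel>Du\<parallel>\<close> over \<open>{t0..t0'}\<close> is at most
  \<open>(t0' - t0)\<^bsup>1/2\<^esup> E / \<surd>2\<close>. Cancelling one factor \<open>\<parallel>g\<parallel>\<close> gives the claim.

  The identity is what one gets by testing the equations with the backward heat flow of \<open>g\<close>. Since the
  pressure is only a distribution, the test fields must be smooth, compactly supported and exactly
  divergence free. A field of the form \<open>\<partial>\<^sub>kf e\<^sub>j - \<partial>\<^sub>jf e\<^sub>k\<close> is divergence free for every scalar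
  function \<open>f\<close>, so the cutoff is put on \<open>f\<close> and not on the field. With \<open>f\<close> the cut off derivative
  \<open>\<partial>\<^sub>i\<Gamma>\<close> of the backward heat kernel \<open>\<Gamma>\<close> with pole \<open>(r, y)\<close>, removing the cutoffs in space and
  in time gives \<open>curl_identity\<close>. Setting \<open>i = k\<close> and summing over \<open>k\<close> gives the identity for column
  \<open>j\<close> of \<open>(\<Delta> I - \<nabla>\<nabla>) \<Gamma>\<close> in place of the heat flow of \<open>g\<close> (\<open>kernel_identity\<close>).
  Multiply by \<open>g\<^sub>j(y)\<close>, sum over \<open>j\<close> and integrate over \<open>y\<close>: the Hessian part drops out because \<open>g\<close> is
  divergence free, and the Laplacian part is the derivative of \<open>e\<^bsup>(r-s)\<Delta>\<^esup> g\<close> in \<open>r\<close>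
  (\<open>kernel_identity_integrated\<close>). Thus the two sides of the Duhamel identity have the same derivative in \<open>r\<close>.
  Both tend to 0 as \<open>r \<rightarrow> \<infinity>\<close>, so they agree.

  One point needs care throughout: \<open>u\<close> and \<open>Du\<close> are families of functions of \<open>x\<close> without any joint
  measurability, so that even the measurability of \<open>s \<mapsto> \<langle>N(s), \<phi>\<rangle>\<close> has to be derived from the weak
  continuity of \<open>u\<close> (\<open>component_pairing_measurable\<close>).\<close>

section \<open>Repeated differentiability and dominated convergence of derivatives\<close>

definition dd :: "'a::euclidean_space \<Rightarrow> ('a \<Rightarrow> 'b::real_normed_vector) \<Rightarrow> 'a \<Rightarrow> 'b" where
  "dd v f x = frechet_derivative f (at x) v"

lemma dd_eq: "(f has_derivative f') (at x) \<Longrightarrow> dd v f x = f' v"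
  unfolding dd_def by (metis frechet_derivative_at)

lemma has_derivative_dd: "f differentiable at x \<Longrightarrow> (f has_derivative (\<lambda>v. dd v f x)) (at x)"
  unfolding dd_def by (simp add: frechet_derivative_works)

lemma dd_cong:
  assumes "open U" "x \<in> U" "\<And>y. y \<in> U \<Longrightarrow> f y = g y"
  shows "dd v f x = dd v g x"
proof (cases "f differentiable at x")
  case True
  then have "(g has_derivative (\<lambda>v. dd v f x)) (at x)"
    using has_derivative_transform_within_open[OF has_derivative_dd[OF True] assms(1,2)] assms(3) by blast
  then show ?thesis by (simp add: dd_eq)
next
  case False
  have "\<And>f'. (f has_derivative f') (at x) = (g has_derivative f') (at x)"
    using assms by (metis has_derivative_transform_within_open)
  then show ?thesis by (simp add: dd_def frechet_derivative_def)
qed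

lemma differentiable_cong_open:
  assumes "open U" "x \<in> U" "\<And>y. y \<in> U \<Longrightarrow> f y = g y" "f differentiable at x"
  shows "g differentiable at x"
  using assms unfolding differentiable_def by (metis has_derivative_transform_within_open)

text \<open>Differentiability up to order \<open>n\<close> on \<open>U\<close>, in a form that lends itself to induction on \<open>n\<close> and
  localizes to subsets. Derivatives of order \<open>n\<close> need not be continuous themselves; one further
  order gives that.\<close>

primrec Ck :: "nat \<Rightarrow> 'a::euclidean_space set \<Rightarrow> ('a \<Rightarrow> 'b::real_normed_vector) \<Rightarrow> bool" where
  "Ck 0 U f \<longleftrightarrow> True"
| "Ck (Suc n) U f \<longleftrightarrow> (\<forall>x\<in>U. f differentiable at x) \<and> (\<forall>v. Ck n U (dd v f))"

lemma Ck_cong: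
  assumes "open U" "\<And>x. x \<in> U \<Longrightarrow> f x = g x" "Ck n U f"
  shows "Ck n U g"
  using assms(2,3)
proof (induction n arbitrary: f g)
  case (Suc n)
  have "Ck n U (dd v g)" for v
    by (rule Suc.IH[of "dd v f"]) (use Suc.prems assms(1) in \<open>auto intro: dd_cong\<close>)
  then show ?case using Suc.prems assms(1) by (auto intro: differentiable_cong_open[of U _ f g])
qed simp

lemma Ck_Suc_D: "Ck (Suc n) U f \<Longrightarrow> Ck n U f"
proof (induction n arbitrary: f)
  case (Suc n)
  then show ?case by (auto simp del: Ck.simps(2) simp: Ck.simps(2)[of "Suc n"] Ck.simps(2)[of n f for f])
qed simp

lemma Ck_Un: "Ck n U f \<Longrightarrow> Ck n V f \<Longrightarrow> Ck n (U \<union> V) f"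
  by (induction n arbitrary: f) auto

lemma Ck_subset: "Ck n U f \<Longrightarrow> V \<subseteq> U \<Longrightarrow> Ck n V f"
  by (induction n arbitrary: f) auto

lemma Ck_const: "open U \<Longrightarrow> Ck n U (\<lambda>x. c)"
proof (induction n arbitrary: c)
  case (Suc n)
  have "dd v (\<lambda>x. c) = (\<lambda>x. 0)" for v :: 'a by (auto simp: dd_def)
  then show ?case using Suc by (simp add: Suc)
qed simp

lemma Ck_add:
  assumes "open U" "Ck n U f" "Ck n U g"
  shows "Ck n U (\<lambda>x. f x + g x)"
  using assms(2,3)
proof (induction n arbitrary: f g)
  case (Suc n)
  have "Ck n U (dd v (\<lambda>x. f x + g x))" for v
  proof (rule Ck_cong[OF assms(1)])
    show "Ck n U (\<lambda>x. dd v f x + dd v g x)" using Suc by auto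
    show "dd v f x + dd v g x = dd v (\<lambda>x. f x + g x) x" if "x \<in> U" for x
      using Suc.prems that by (subst dd_eq[OF has_derivative_add[OF has_derivative_dd has_derivative_dd]]) auto
  qed
  then show ?case using Suc.prems by auto
qed simp

lemma Ck_linear:
  assumes "open U" "bounded_linear L" "Ck n U f"
  shows "Ck n U (\<lambda>x. L (f x))"
  using assms(3)
proof (induction n arbitrary: f)
  case (Suc n)
  have *: "((\<lambda>x. L (f x)) has_derivative (\<lambda>v. L (dd v f x))) (at x)" if "x \<in> U" for x
    using Suc.prems that
    by (intro bounded_linear.has_derivative[OF assms(2)] has_derivative_dd) auto
  have "Ck n U (dd v (\<lambda>x. L (f x)))" for v
    by (rule Ck_cong[OF assms(1), of "\<lambda>x. L (dd v f x)"]) (use Suc in \<open>auto simp: dd_eq[OF *]\<close>)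
  then show ?case using * by (auto simp: differentiable_def)
qed simp

lemma Ck_mult:
  fixes f g :: "'a::euclidean_space \<Rightarrow> real"
  assumes "open U" "Ck n U f" "Ck n U g"
  shows "Ck n U (\<lambda>x. f x * g x)"
  using assms(2,3)
proof (induction n arbitrary: f g)
  case (Suc n)
  have *: "((\<lambda>x. f x * g x) has_derivative (\<lambda>v. f x * dd v g x + dd v f x * g x)) (at x)" if "x \<in> U" for x
    using Suc.prems that by (intro has_derivative_mult has_derivative_dd) auto
  have "Ck n U (dd v (\<lambda>x. f x * g x))" for v
  proof (rule Ck_cong[OF assms(1), of "\<lambda>x. f x * dd v g x + dd v f x * g x"])
    show "Ck n U (\<lambda>x. f x * dd v g x + dd v f x * g x)"
      using Suc.prems Suc.prems[THEN Ck_Suc_D] by (intro Ck_add[OF assms(1)] Suc.IH) auto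
  qed (auto simp: dd_eq[OF *])
  then show ?case using * by (auto simp: differentiable_def)
qed simp

lemma Ck_affine:
  fixes f :: "'b::euclidean_space \<Rightarrow> 'c::real_normed_vector" and L :: "'a::euclidean_space \<Rightarrow> 'b"
  assumes "bounded_linear L" "Ck n UNIV f"
  shows "Ck n UNIV (\<lambda>x. f (a + L x))"
  using assms(2)
proof (induction n arbitrary: f)
  case (Suc n)
  have *: "((\<lambda>x. f (a + L x)) has_derivative (\<lambda>v. dd (L v) f (a + L x))) (at x)" for x
  proof -
    have "((\<lambda>x. a + L x) has_derivative (\<lambda>v. 0 + L v)) (at x)"
      by (intro has_derivative_add has_derivative_const bounded_linear_imp_has_derivative assms)
    from has_derivative_compose[OF this, of f "\<lambda>v. dd v f (a + L x)"] show ?thesis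
      using has_derivative_dd[of f "a + L x"] Suc.prems by simp
  qed
  have "Ck n UNIV (dd v (\<lambda>x. f (a + L x)))" for v
    by (rule Ck_cong[of _ "\<lambda>x. dd (L v) f (a + L x)"]) (use Suc in \<open>auto simp: dd_eq[OF *]\<close>)
  then show ?case using * by (auto simp: differentiable_def)
qed simp

lemma Ck_inverse:
  fixes f :: "'a::euclidean_space \<Rightarrow> real"
  assumes "open U" "Ck n U f" "\<And>x. x \<in> U \<Longrightarrow> f x \<noteq> 0"
  shows "Ck n U (\<lambda>x. inverse (f x))"
  using assms(2)
proof (induction n)
  case (Suc n)
  have *: "((\<lambda>x. inverse (f x)) has_derivative (\<lambda>v. - (inverse (f x) * dd v f x * inverse (f x)))) (at x)" if "x \<in> U" for x
    using Suc.prems that assms(3) by (intro Deriv.has_derivative_inverse has_derivative_dd) auto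
  have "Ck n U (dd v (\<lambda>x. inverse (f x)))" for v
  proof (rule Ck_cong[OF assms(1), of "\<lambda>x. -1 * (inverse (f x) * dd v f x * inverse (f x))"])
    show "Ck n U (\<lambda>x. -1 * (inverse (f x) * dd v f x * inverse (f x)))"
      using Suc Ck_Suc_D[OF Suc.prems] by (intro Ck_mult Ck_const assms(1)) auto
  qed (auto simp: dd_eq[OF *])
  then show ?case using * by (auto simp: differentiable_def)
qed simp

text \<open>\<open>iter_deriv\<close> takes the derivative at the head of the list last, while \<open>Ck\<close> takes it first; moving
  the other end of the list is what reconciles the two.\<close>

lemma iter_deriv_append:
  fixes f :: "'a::euclidean_space \<Rightarrow> 'b::real_normed_vector"
  shows "iter_deriv UNIV (vs @ [v]) f = iter_deriv UNIV vs (dd v f)"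
proof (induction vs)
  case Nil then show ?case by (simp add: dd_def[abs_def])
qed simp

lemma smooth_on_UNIV_iff:
  fixes f :: "'a::euclidean_space \<Rightarrow> 'b::real_normed_vector"
  shows "smooth_on UNIV f \<longleftrightarrow> (\<forall>n. Ck n UNIV f)"
proof -
  have "(\<forall>(vs::'a list) x. length vs < n \<longrightarrow> iter_deriv UNIV vs f differentiable (at x)) \<longleftrightarrow> Ck n UNIV f"
    for n and f :: "'a::euclidean_space \<Rightarrow> 'b::real_normed_vector"
  proof (induction n arbitrary: f)
    case (Suc n)
    show ?case unfolding Ck.simps Suc.IH[symmetric]
    proof safe
      fix x assume "\<forall>(vs::'a list) x. length vs < Suc n \<longrightarrow> iter_deriv UNIV vs f differentiable at x"
      from this[rule_format, of "[]" x] show "f differentiable at x" by simp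
    next
      fix v x and vs :: "'a list" assume "\<forall>(vs::'a list) x. length vs < Suc n \<longrightarrow> iter_deriv UNIV vs f differentiable at x" "length vs < n"
      then show "iter_deriv UNIV vs (dd v f) differentiable at x"
        using iter_deriv_append[of vs v f] by (metis length_append_singleton not_less_eq)
    next
      fix x and vs :: "'a list" assume a: "\<forall>x\<in>UNIV. f differentiable at x" "length vs < Suc n"
        "\<forall>v (vs::'a list) x. length vs < n \<longrightarrow> iter_deriv UNIV vs (dd v f) differentiable at x"
      show "iter_deriv UNIV vs f differentiable at x"
        using a by (cases vs rule: rev_cases) (auto simp: iter_deriv_append)
    qed
  qed simp
  from this show ?thesis unfolding smooth_on_def by (metis UNIV_I lessI)
qed

text \<open>The mean value theorem, in direction \<open>v\<close> and then in direction \<open>w\<close>. The second difference on the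
  left is symmetric in \<open>v\<close> and \<open>w\<close>, so it is close to both mixed derivatives.\<close>

lemma second_difference:
  fixes f :: "'a::euclidean_space \<Rightarrow> real"
  assumes "0 < h" "\<And>a b. 0 \<le> a \<Longrightarrow> a \<le> h \<Longrightarrow> 0 \<le> b \<Longrightarrow> b \<le> h \<Longrightarrow> x + a *\<^sub>R v + b *\<^sub>R w \<in> U"
    "\<And>x. x \<in> U \<Longrightarrow> f differentiable at x" "\<And>x. x \<in> U \<Longrightarrow> dd v f differentiable at x"
  shows "\<exists>a b. 0 \<le> a \<and> a \<le> h \<and> 0 \<le> b \<and> b \<le> h \<and>
    f (x + h *\<^sub>R v + h *\<^sub>R w) - f (x + h *\<^sub>R v) - f (x + h *\<^sub>R w) + f x = h * h * dd w (dd v f) (x + a *\<^sub>R v + b *\<^sub>R w)"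
proof -
  have d: "((\<lambda>a. g (y + a *\<^sub>R z)) has_real_derivative dd z g (y + a *\<^sub>R z)) (at a)"
    if "g differentiable at (y + a *\<^sub>R z)" for g :: "'a \<Rightarrow> real" and y z a
  proof -
    have 1: "((\<lambda>a. y + a *\<^sub>R z) has_derivative (\<lambda>t. t *\<^sub>R z)) (at a)" by (auto intro!: derivative_eq_intros)
    have "dd (t *\<^sub>R z) g (y + a *\<^sub>R z) = dd z g (y + a *\<^sub>R z) * t" for t
      using linear_frechet_derivative[OF that] by (simp add: dd_def linear_cmul)
    with has_derivative_compose[OF 1 has_derivative_dd[OF that]] show ?thesis
      by (simp add: has_field_derivative_def)
  qed
  define p where "p a = f ((x + h *\<^sub>R w) + a *\<^sub>R v) - f (x + a *\<^sub>R v)" for a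
  have e: "(x + h *\<^sub>R w) + a *\<^sub>R v = x + a *\<^sub>R v + h *\<^sub>R w" for a by simp
  have "(p has_real_derivative dd v f ((x + h *\<^sub>R w) + a *\<^sub>R v) - dd v f (x + a *\<^sub>R v)) (at a)"
    if "0 \<le> a" "a \<le> h" for a
  proof -
    have "f differentiable at ((x + h *\<^sub>R w) + a *\<^sub>R v)" unfolding e
      by (intro assms(3,2)) (use that \<open>0<h\<close> in auto)
    moreover have "f differentiable at (x + a *\<^sub>R v)"
      using assms(3)[OF assms(2)[of a 0]] that \<open>0<h\<close> by simp
    ultimately show ?thesis unfolding p_def by (intro DERIV_diff d)
  qed
  with MVT2[OF assms(1), of p "\<lambda>a. dd v f ((x + h *\<^sub>R w) + a *\<^sub>R v) - dd v f (x + a *\<^sub>R v)"] obtain a where a: "0 < a" "a < h"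
    "p h - p 0 = (h - 0) * (dd v f ((x + h *\<^sub>R w) + a *\<^sub>R v) - dd v f (x + a *\<^sub>R v))" by metis
  have "((\<lambda>b. dd v f (x + a *\<^sub>R v + b *\<^sub>R w)) has_real_derivative dd w (dd v f) (x + a *\<^sub>R v + b *\<^sub>R w)) (at b)"
    if "0 \<le> b" "b \<le> h" for b
    by (intro d assms(4,2)) (use that a in auto)
  with MVT2[OF assms(1), of "\<lambda>b. dd v f (x + a *\<^sub>R v + b *\<^sub>R w)" "\<lambda>b. dd w (dd v f) (x + a *\<^sub>R v + b *\<^sub>R w)"] obtain b where b: "0 < b" "b < h"
    "dd v f (x + a *\<^sub>R v + h *\<^sub>R w) - dd v f (x + a *\<^sub>R v + 0 *\<^sub>R w) = (h - 0) * dd w (dd v f) (x + a *\<^sub>R v + b *\<^sub>R w)" by metis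
  have "f (x + h *\<^sub>R v + h *\<^sub>R w) - f (x + h *\<^sub>R v) - f (x + h *\<^sub>R w) + f x = p h - p 0"
    by (simp add: p_def e)
  also have "\<dots> = h * h * dd w (dd v f) (x + a *\<^sub>R v + b *\<^sub>R w)"
    using a b by (simp add: e)
  finally show ?thesis using a b by (intro exI[of _ a] exI[of _ b]) auto
qed

lemma dd_commute:
  fixes f :: "'a::euclidean_space \<Rightarrow> real"
  assumes U: "open U" "x \<in> U" and f: "Ck 3 U f"
  shows "dd v (dd w f) x = dd w (dd v f) x"
proof (rule ccontr)
  have f': "\<And>x. x \<in> U \<Longrightarrow> f differentiable at x" "\<And>x v. x \<in> U \<Longrightarrow> dd v f differentiable at x"
    "\<And>x v w. x \<in> U \<Longrightarrow> dd w (dd v f) differentiable at x"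
    using f by (auto simp: numeral_3_eq_3)
  assume ne: "dd v (dd w f) x \<noteq> dd w (dd v f) x"
  define e where "e = \<bar>dd v (dd w f) x - dd w (dd v f) x\<bar> / 2"
  have "e > 0" using ne by (simp add: e_def)
  have c: "\<exists>d>0. \<forall>y. dist y x < d \<longrightarrow> dist (g y) (g x) < e" if "g differentiable at x" for g :: "'a \<Rightarrow> real"
    using differentiable_imp_continuous_within[OF that] \<open>e>0\<close> unfolding continuous_at_eps_delta
    by (auto simp: dist_real_def)
  obtain d0 where d0: "d0 > 0" "ball x d0 \<subseteq> U" using U open_contains_ball by blast
  obtain d1 where d1: "d1 > 0" "\<And>y. dist y x < d1 \<Longrightarrow> dist (dd v (dd w f) y) (dd v (dd w f) x) < e"
    using c[OF f'(3)[OF U(2), of v w]] by blast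
  obtain d2 where d2: "d2 > 0" "\<And>y. dist y x < d2 \<Longrightarrow> dist (dd w (dd v f) y) (dd w (dd v f) x) < e"
    using c[OF f'(3)[OF U(2), of w v]] by blast
  define d where "d = min d0 (min d1 d2)"
  define h where "h = d / (norm v + norm w + 1)"
  have npos: "norm v + norm w + 1 > 0" using norm_ge_zero[of v] norm_ge_zero[of w] by linarith
  have "d > 0" using d0 d1 d2 by (simp add: d_def)
  then have h: "h > 0" using npos by (simp add: h_def)
  have near: "dist (x + a *\<^sub>R v + b *\<^sub>R w) x < d" if "0 \<le> a" "a \<le> h" "0 \<le> b" "b \<le> h" for a b
  proof -
    have "dist (x + a *\<^sub>R v + b *\<^sub>R w) x \<le> a * norm v + b * norm w"
      using norm_triangle_ineq[of "a *\<^sub>R v" "b *\<^sub>R w"] that by (simp add: dist_norm add.assoc)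
    also have "\<dots> \<le> h * norm v + h * norm w" using that by (intro add_mono mult_right_mono) auto
    also have "\<dots> < h * (norm v + norm w + 1)" using h by (simp add: algebra_simps)
    also have "\<dots> = d" using npos by (simp add: h_def)
    finally show ?thesis .
  qed
  have near': "dist (x + a *\<^sub>R w + b *\<^sub>R v) x < d" if "0 \<le> a" "a \<le> h" "0 \<le> b" "b \<le> h" for a b
    using near[of b a] that by (simp add: add.commute add.left_commute)
  have inU: "y \<in> U" if "dist y x < d" for y using that d0 by (auto simp: d_def dist_commute)
  obtain a b where ab: "0 \<le> a" "a \<le> h" "0 \<le> b" "b \<le> h"
    "f (x + h *\<^sub>R v + h *\<^sub>R w) - f (x + h *\<^sub>R v) - f (x + h *\<^sub>R w) + f x = h * h * dd w (dd v f) (x + a *\<^sub>R v + b *\<^sub>R w)"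
    using second_difference[OF h, of x v w U f, OF inU[OF near] f'(1,2)] by blast
  obtain a' b' where ab': "0 \<le> a'" "a' \<le> h" "0 \<le> b'" "b' \<le> h"
    "f (x + h *\<^sub>R w + h *\<^sub>R v) - f (x + h *\<^sub>R w) - f (x + h *\<^sub>R v) + f x = h * h * dd v (dd w f) (x + a' *\<^sub>R w + b' *\<^sub>R v)"
    using second_difference[OF h, of x w v U f, OF inU[OF near'] f'(1,2)] by blast
  have "x + h *\<^sub>R w + h *\<^sub>R v = x + h *\<^sub>R v + h *\<^sub>R w" by simp
  then have "h * h * dd w (dd v f) (x + a *\<^sub>R v + b *\<^sub>R w) = h * h * dd v (dd w f) (x + a' *\<^sub>R w + b' *\<^sub>R v)"
    using ab(5) ab'(5) by (metis (no_types, lifting) add.commute diff_diff_eq)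
  then have eq: "dd w (dd v f) (x + a *\<^sub>R v + b *\<^sub>R w) = dd v (dd w f) (x + a' *\<^sub>R w + b' *\<^sub>R v)" using h by simp
  have "dist (dd v (dd w f) (x + a' *\<^sub>R w + b' *\<^sub>R v)) (dd v (dd w f) x) < e"
    using d1(2) near'[OF ab'(1-4)] by (simp add: d_def)
  moreover have "dist (dd w (dd v f) (x + a *\<^sub>R v + b *\<^sub>R w)) (dd w (dd v f) x) < e"
    using d2(2) near[OF ab(1-4)] by (simp add: d_def)
  ultimately have "dist (dd v (dd w f) x) (dd w (dd v f) x) < 2 * e"
    using eq dist_triangle2[of "dd v (dd w f) x" "dd w (dd v f) x" "dd v (dd w f) (x + a' *\<^sub>R w + b' *\<^sub>R v)"]
    by (auto simp: dist_commute)
  then show False by (simp add: e_def dist_real_def)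
qed

lemma Ck_dd: "Ck (Suc n) U f \<Longrightarrow> Ck n U (dd v f)" by simp
lemma Ck_differentiable: "Ck (Suc n) U f \<Longrightarrow> x \<in> U \<Longrightarrow> f differentiable at x" by simp

text \<open>These are the hypotheses of dominated convergence, with the bound given as a multiple of a weight
  \<open>w\<close>; \<open>Ck_lim\<close> asks for them for all derivatives up to order \<open>n\<close>. Weights multiply under
  products, so that cutoffs (weight 1) can be combined with the heat kernel (Gaussian weight). For
  a constant sequence the predicate just says that \<open>f\<close> and its derivatives are \<open>O(w)\<close>.\<close>

definition dominated_lim :: "'a set \<Rightarrow> ('a \<Rightarrow> real) \<Rightarrow> (nat \<Rightarrow> 'a \<Rightarrow> real) \<Rightarrow> ('a \<Rightarrow> real) \<Rightarrow> bool" where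
  "dominated_lim U w F f \<longleftrightarrow> (\<exists>C. \<forall>n. \<forall>x\<in>U. \<bar>F n x\<bar> \<le> C * w x) \<and> (\<forall>x\<in>U. (\<lambda>n. F n x) \<longlonglongrightarrow> f x)"

primrec Ck_lim :: "nat \<Rightarrow> 'a::euclidean_space set \<Rightarrow> ('a \<Rightarrow> real) \<Rightarrow> (nat \<Rightarrow> 'a \<Rightarrow> real) \<Rightarrow> ('a \<Rightarrow> real) \<Rightarrow> bool" where
  "Ck_lim 0 U w F f \<longleftrightarrow> dominated_lim U w F f"
| "Ck_lim (Suc n) U w F f \<longleftrightarrow> dominated_lim U w F f \<and> (\<forall>x\<in>U. f differentiable at x) \<and>
     (\<forall>m. \<forall>x\<in>U. F m differentiable at x) \<and> (\<forall>v. Ck_lim n U w (\<lambda>m. dd v (F m)) (dd v f))"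

lemma Ck_lim_dominated: "Ck_lim n U w F f \<Longrightarrow> dominated_lim U w F f"
  by (cases n) auto

lemma Ck_lim_Suc_D: "Ck_lim (Suc n) U w F f \<Longrightarrow> Ck_lim n U w F f"
  by (induction n arbitrary: F f) auto

lemma Ck_lim_dd: "Ck_lim (Suc n) U w F f \<Longrightarrow> Ck_lim n U w (\<lambda>m. dd v (F m)) (dd v f)" by simp

lemma Ck_lim_subset: "Ck_lim n U w F f \<Longrightarrow> V \<subseteq> U \<Longrightarrow> Ck_lim n V w F f"
proof (induction n arbitrary: F f)
  case 0 then show ?case unfolding Ck_lim.simps dominated_lim_def by blast
next
  case (Suc n)
  have "dominated_lim V w F f" using Ck_lim_dominated[OF Suc.prems(1)] Suc.prems(2) unfolding dominated_lim_def by blast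
  moreover have "Ck_lim n V w (\<lambda>m. dd v (F m)) (dd v f)" for v by (rule Suc.IH[OF Ck_lim_dd[OF Suc.prems(1)] Suc.prems(2)])
  ultimately show ?case using Suc.prems by auto
qed

lemma Ck_lim_cong:
  assumes "open U" "\<And>m x. x \<in> U \<Longrightarrow> F m x = G m x" "\<And>x. x \<in> U \<Longrightarrow> f x = g x" "Ck_lim n U w F f"
  shows "Ck_lim n U w G g"
  using assms(2-4)
proof (induction n arbitrary: F f G g)
  case 0 then show ?case by (auto simp: dominated_lim_def)
next
  case (Suc n)
  have "Ck_lim n U w (\<lambda>m. dd v (G m)) (dd v g)" for v
  proof (rule Suc.IH)
    show "Ck_lim n U w (\<lambda>m. dd v (F m)) (dd v f)" using Suc.prems by simp
  qed (use Suc.prems assms(1) in \<open>auto intro!: dd_cong[of U]\<close>)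
  moreover have "dominated_lim U w G g" using Suc.prems by (auto simp: dominated_lim_def)
  moreover have "\<And>x. x \<in> U \<Longrightarrow> g differentiable at x" "\<And>m x. x \<in> U \<Longrightarrow> G m differentiable at x"
    using Suc.prems assms(1) differentiable_cong_open[of U _ f g] differentiable_cong_open[of U _ "F m" "G m" for m]
    by auto
  ultimately show ?case by simp
qed

lemma Ck_lim_imp_Ck: "Ck_lim n U w F f \<Longrightarrow> Ck n U (F m)" 
  proof (induction n arbitrary: F f)
  case (Suc n)
  then show ?case using Suc.IH[of "\<lambda>m. dd v (F m)" "dd v f" for v] by auto
qed simp

lemma Ck_lim_imp_Ck_limit: "Ck_lim n U w F f \<Longrightarrow> Ck n U f" 
proof (induction n arbitrary: F f)
  case (Suc n)
  then show ?case using Suc.IH[of "\<lambda>m. dd v (F m)" "dd v f" for v] by auto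
qed simp

lemma dominated_lim_add: "dominated_lim U w F f \<Longrightarrow> dominated_lim U w G g \<Longrightarrow> dominated_lim U w (\<lambda>m x. F m x + G m x) (\<lambda>x. f x + g x)"
  unfolding dominated_lim_def
proof safe
  fix C C'
  assume "\<forall>n. \<forall>x\<in>U. \<bar>F n x\<bar> \<le> C * w x" "\<forall>n. \<forall>x\<in>U. \<bar>G n x\<bar> \<le> C' * w x"
  then have "\<bar>F n x + G n x\<bar> \<le> (C + C') * w x" if "x \<in> U" for n x
  proof -
    have "\<bar>F n x\<bar> \<le> C * w x" "\<bar>G n x\<bar> \<le> C' * w x"
      using \<open>\<forall>n. \<forall>x\<in>U. \<bar>F n x\<bar> \<le> C * w x\<close> \<open>\<forall>n. \<forall>x\<in>U. \<bar>G n x\<bar> \<le> C' * w x\<close> that by auto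
    then show ?thesis using abs_triangle_ineq[of "F n x" "G n x"] by (simp add: distrib_right)
  qed
  then show "\<exists>C. \<forall>n. \<forall>x\<in>U. \<bar>F n x + G n x\<bar> \<le> C * w x" by blast
qed (auto intro: tendsto_add)

lemma dominated_lim_mult: "dominated_lim U w F f \<Longrightarrow> dominated_lim U w' G g \<Longrightarrow> dominated_lim U (\<lambda>x. w x * w' x) (\<lambda>m x. F m x * G m x) (\<lambda>x. f x * g x)"
  unfolding dominated_lim_def
proof safe
  fix C C'
  assume *: "\<forall>n. \<forall>x\<in>U. \<bar>F n x\<bar> \<le> C * w x" "\<forall>n. \<forall>x\<in>U. \<bar>G n x\<bar> \<le> C' * w' x"
  have "\<bar>F n x * G n x\<bar> \<le> (C * C') * (w x * w' x)" if "x \<in> U" for n x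
  proof -
    have "\<bar>F n x\<bar> * \<bar>G n x\<bar> \<le> (C * w x) * (C' * w' x)" 
      using * that by (intro mult_mono) (auto intro: order_trans[OF abs_ge_zero])
    then show ?thesis by (simp add: abs_mult mult_ac)
  qed
  then show "\<exists>C. \<forall>n. \<forall>x\<in>U. \<bar>F n x * G n x\<bar> \<le> C * (w x * w' x)" by blast
qed (auto intro: tendsto_mult)

lemma Ck_lim_add:
  assumes "open U" "Ck_lim n U w F f" "Ck_lim n U w G g"
  shows "Ck_lim n U w (\<lambda>m x. F m x + G m x) (\<lambda>x. f x + g x)"
  using assms(2,3)
proof (induction n arbitrary: F f G g)
  case (Suc n)
  have "Ck_lim n U w (\<lambda>m. dd v (\<lambda>x. F m x + G m x)) (dd v (\<lambda>x. f x + g x))" for v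
  proof (rule Ck_lim_cong[OF assms(1)])
    show "Ck_lim n U w (\<lambda>m x. dd v (F m) x + dd v (G m) x) (\<lambda>x. dd v f x + dd v g x)" using Suc by auto
  qed (use Suc.prems in \<open>auto simp: dd_eq[OF has_derivative_add[OF has_derivative_dd has_derivative_dd]]\<close>)
  moreover have "dominated_lim U w (\<lambda>m x. F m x + G m x) (\<lambda>x. f x + g x)"
    by (intro dominated_lim_add Ck_lim_dominated[OF Suc.prems(1)] Ck_lim_dominated[OF Suc.prems(2)])
  ultimately show ?case using Suc.prems by auto
qed (simp add: dominated_lim_add)

lemma Ck_lim_mult:
  assumes "open U" "Ck_lim n U w F f" "Ck_lim n U w' G g"
  shows "Ck_lim n U (\<lambda>x. w x * w' x) (\<lambda>m x. F m x * G m x) (\<lambda>x. f x * g x)"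
  using assms(2,3)
proof (induction n arbitrary: F f G g)
  case (Suc n)
  have d: "dd v (\<lambda>x. p x * q x) x = p x * dd v q x + dd v p x * q x"
    if "p differentiable at x" "q differentiable at x" for v x and p q :: "'a \<Rightarrow> real"
    by (rule dd_eq[OF has_derivative_mult[OF has_derivative_dd[OF that(1)] has_derivative_dd[OF that(2)]]])
  have "Ck_lim n U (\<lambda>x. w x * w' x) (\<lambda>m. dd v (\<lambda>x. F m x * G m x)) (dd v (\<lambda>x. f x * g x))" for v
  proof (rule Ck_lim_cong[OF assms(1)])
    show "Ck_lim n U (\<lambda>x. w x * w' x) (\<lambda>m x. F m x * dd v (G m) x + dd v (F m) x * G m x)
        (\<lambda>x. f x * dd v g x + dd v f x * g x)" 
      using Suc.prems Suc.prems[THEN Ck_lim_Suc_D] by (intro Ck_lim_add assms(1) Suc.IH) auto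
  qed (use Suc.prems in \<open>auto simp: d\<close>)
  moreover have "dominated_lim U (\<lambda>x. w x * w' x) (\<lambda>m x. F m x * G m x) (\<lambda>x. f x * g x)"
    by (intro dominated_lim_mult Ck_lim_dominated[OF Suc.prems(1)] Ck_lim_dominated[OF Suc.prems(2)])
  ultimately show ?case using Suc.prems by auto
qed (simp add: dominated_lim_mult)

lemma dd_slice:
  fixes f :: "'a::euclidean_space \<times> 'b::euclidean_space \<Rightarrow> 'c::real_normed_vector"
  assumes "f differentiable at (t, x)"
  shows "((\<lambda>y. f (t, y)) has_derivative (\<lambda>v. dd (0, v) f (t, x))) (at x)"
    and "((\<lambda>s. f (s, x)) has_derivative (\<lambda>v. dd (v, 0) f (t, x))) (at t)"
proof -
  have 1: "((\<lambda>y. (t, y)) has_derivative (\<lambda>v. (0, v))) (at x)"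
    by (auto intro!: derivative_eq_intros)
  show "((\<lambda>y. f (t, y)) has_derivative (\<lambda>v. dd (0, v) f (t, x))) (at x)"
    using has_derivative_compose[OF 1 has_derivative_dd[OF assms]] by simp
  have 2: "((\<lambda>s. (s, x)) has_derivative (\<lambda>v. (v, 0))) (at t)"
    by (auto intro!: derivative_eq_intros)
  show "((\<lambda>s. f (s, x)) has_derivative (\<lambda>v. dd (v, 0) f (t, x))) (at t)"
    using has_derivative_compose[OF 2 has_derivative_dd[OF assms]] by simp
qed

lemma Ck_lim_slice:
  fixes F :: "nat \<Rightarrow> 'a::euclidean_space \<times> 'b::euclidean_space \<Rightarrow> real"
  assumes "Ck_lim n U w F f" "\<And>y. (t, y) \<in> U" "open U"
  shows "Ck_lim n UNIV (\<lambda>y. w (t, y)) (\<lambda>m y. F m (t, y)) (\<lambda>y. f (t, y))"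
  using assms(1)
proof (induction n arbitrary: F f)
  case 0 then show ?case using assms(2) unfolding Ck_lim.simps dominated_lim_def by fast
next
  case (Suc n)
  have "Ck_lim n UNIV (\<lambda>y. w (t, y)) (\<lambda>m. dd v (\<lambda>y. F m (t, y))) (dd v (\<lambda>y. f (t, y)))" for v
  proof -
    have "dd v (\<lambda>y. F m (t, y)) = (\<lambda>y. dd (0, v) (F m) (t, y))" 
      "dd v (\<lambda>y. f (t, y)) = (\<lambda>y. dd (0, v) f (t, y))" for m
      using Suc.prems assms(2) by (auto simp: dd_eq[OF dd_slice(1)])
    moreover have "Ck_lim n U w (\<lambda>m. dd (0, v) (F m)) (dd (0, v) f)" using Suc.prems by auto
    ultimately show ?thesis using Suc.IH[of "\<lambda>m. dd (0, v) (F m)" "dd (0, v) f"] by simp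
  qed
  moreover have "dominated_lim UNIV (\<lambda>y. w (t, y)) (\<lambda>m y. F m (t, y)) (\<lambda>y. f (t, y))"
    using Ck_lim_dominated[OF Suc.prems] assms(2) unfolding dominated_lim_def by fast
  moreover have "(\<lambda>y. f (t, y)) differentiable at x" "(\<lambda>y. F m (t, y)) differentiable at x" for m x
    using Suc.prems assms(2) dd_slice(1)[of f t x] dd_slice(1)[of "F m" t x] by (auto simp: differentiable_def)
  ultimately show ?case by simp
qed

section \<open>Smooth steps and spatial cutoffs\<close>

text \<open>The derivative of a member of this family is a linear combination of members, also at 0; hence all
  of them are smooth.\<close>

definition flat :: "nat \<Rightarrow> real \<Rightarrow> real" where
  "flat k x = (if x \<le> 0 then 0 else inverse x ^ k * exp (- inverse x))"

lemma power_le_fact_exp: "0 \<le> (y::real) \<Longrightarrow> y ^ n \<le> fact n * exp y"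
proof -
  assume y: "0 \<le> y"
  have s: "(\<lambda>n. y ^ n /\<^sub>R fact n) sums exp y" by (rule exp_converges)
  have "sum (\<lambda>n. y ^ n /\<^sub>R fact n) {n} \<le> exp y"
    using y by (subst sums_unique[OF s], intro sum_le_suminf sums_summable[OF s]) auto
  then show ?thesis by (simp add: field_simps)
qed

lemma flat_bound: "0 \<le> flat k x" "flat k x \<le> fact (Suc k) * \<bar>x\<bar>"
proof -
  show "0 \<le> flat k x" by (simp add: flat_def)
  show "flat k x \<le> fact (Suc k) * \<bar>x\<bar>"
  proof (cases "x \<le> 0")
    case False
    then have "inverse x ^ k * inverse x \<le> fact (Suc k) * exp (inverse x)"
      using power_le_fact_exp[of "inverse x" "Suc k"] by (simp add: mult.commute)
    with False show ?thesis by (simp add: flat_def exp_minus field_simps)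
  next
    case True
    then have "flat k x = 0" by (simp add: flat_def)
    then show ?thesis using mult_nonneg_nonneg[of "fact (Suc k)" "\<bar>x\<bar>"] by (simp del: fact_Suc)
  qed
qed

text \<open>At 0 the difference quotient \<open>flat k h / h\<close> equals \<open>flat (Suc k) h\<close>, which is \<open>O(h)\<close>.\<close>

lemma flat_deriv: "(flat k has_real_derivative - real k * flat (Suc k) x + flat (k + 2) x) (at x)"
proof (cases x "0::real" rule: linorder_cases)
  case less
  have "(flat k has_real_derivative 0) (at x)"
    by (rule DERIV_cong_ev[THEN iffD2, of x x _ "\<lambda>_. 0"])
       (use less eventually_nhds_in_open[of "{..<0}" x] in \<open>auto simp: flat_def elim!: eventually_mono\<close>)
  then show ?thesis using less by (simp add: flat_def)
next
  case greater
  have "((\<lambda>x. inverse x ^ k * exp (- inverse x)) has_real_derivative - real k * flat (Suc k) x + flat (k + 2) x) (at x)"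
  proof (cases k)
    case 0
    then show ?thesis using greater
      by (auto intro!: derivative_eq_intros simp: flat_def power2_eq_square)
  next
    case (Suc j)
    have "((\<lambda>x. inverse x ^ Suc j * exp (- inverse x)) has_real_derivative 
      inverse x ^ Suc j * (exp (- inverse x) * (inverse x * inverse x)) +
      real (Suc j) * (inverse x ^ j * - (inverse x * inverse x)) * exp (- inverse x)) (at x)"
      using greater by (auto intro!: derivative_eq_intros simp: algebra_simps simp del: power_Suc)
    moreover have "inverse x ^ Suc j * (exp (- inverse x) * (inverse x * inverse x)) +
      real (Suc j) * (inverse x ^ j * - (inverse x * inverse x)) * exp (- inverse x) = 
      - real k * flat (Suc k) x + flat (k + 2) x"
      using greater by (simp add: flat_def Suc algebra_simps del: of_nat_Suc)
    ultimately show ?thesis by (simp only: Suc)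
  qed
  then show ?thesis
    by (rule DERIV_cong_ev[THEN iffD1, rotated 3])
       (use greater eventually_nhds_in_open[of "{0<..}" x] in \<open>auto simp: flat_def elim!: eventually_mono\<close>)
next
  case equal
  have "((\<lambda>h. flat k h / h) \<longlongrightarrow> 0) (at 0)"
  proof (rule Lim_null_comparison[where g="\<lambda>h. fact (k+2) * \<bar>h\<bar>"])
    have "norm (flat k h / h) \<le> fact (k+2) * \<bar>h\<bar>" for h
    proof -
      have "norm (flat k h / h) = flat (Suc k) h" by (simp add: flat_def field_simps)
      then show ?thesis using flat_bound(2)[of "Suc k" h] by simp
    qed
    then show "\<forall>\<^sub>F h in at 0. norm (flat k h / h) \<le> fact (k+2) * \<bar>h\<bar>" by simp
    show "((\<lambda>h. fact (k+2) * \<bar>h\<bar>) \<longlongrightarrow> (0::real)) (at 0)" by (auto intro!: tendsto_eq_intros)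
  qed
  then show ?thesis using equal by (simp add: flat_def[of _ 0] DERIV_def)
qed

lemma Ck_flat: "Ck n UNIV (flat k)"
proof (induction n arbitrary: k)
  case (Suc n)
  have d: "(flat k has_derivative (\<lambda>v. (- real k * flat (Suc k) x + flat (k + 2) x) * v)) (at x)" for x
    using flat_deriv[of k x] by (simp add: has_field_derivative_def)
  have "Ck n UNIV (dd v (flat k))" for v
  proof -
    have "dd v (flat k) = (\<lambda>x. (- real k) * v * flat (Suc k) x + v * flat (k + 2) x)"
      by (auto simp: dd_eq[OF d] algebra_simps)
    then show ?thesis by (simp only:) (intro Ck_add Ck_mult Ck_const Suc open_UNIV)
  qed
  then show ?case using d by (auto simp: differentiable_def)
qed simp

definition smooth_step :: "real \<Rightarrow> real" where
  "smooth_step x = flat 0 x * inverse (flat 0 x + flat 0 (1 - x))"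

lemma flat_pos: "x > 0 \<Longrightarrow> flat k x > 0" by (simp add: flat_def)

lemma flat_denominator_pos: "flat 0 x + flat 0 (1 - x) > 0"
  using flat_pos[of x 0] flat_pos[of "1 - x" 0] flat_bound(1)[of 0 x] flat_bound(1)[of 0 "1 - x"]
  by (cases "x > 0") auto

lemma Ck_smooth_step: "Ck n UNIV smooth_step"
proof -
  have "Ck n UNIV (\<lambda>x. flat 0 (1 + (- x)))"
    by (rule Ck_affine[OF bounded_linear_minus[OF bounded_linear_ident] Ck_flat])
  then have "Ck n UNIV (\<lambda>x. flat 0 x + flat 0 (1 - x))" by (intro Ck_add Ck_flat) auto
  then have "Ck n UNIV (\<lambda>x. inverse (flat 0 x + flat 0 (1 - x)))" 
    by (intro Ck_inverse) (use flat_denominator_pos in \<open>auto simp: less_le[of 0]\<close>)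
  then show ?thesis unfolding smooth_step_def[abs_def] by (intro Ck_mult Ck_flat) auto
qed

lemma smooth_step_0: "x \<le> 0 \<Longrightarrow> smooth_step x = 0" by (simp add: smooth_step_def flat_def)
lemma smooth_step_1: "x \<ge> 1 \<Longrightarrow> smooth_step x = 1" by (simp add: smooth_step_def flat_def)
lemma smooth_step_range: "0 \<le> smooth_step x" "smooth_step x \<le> 1"
proof -
  have *: "smooth_step x = flat 0 x / (flat 0 x + flat 0 (1 - x))" by (simp add: smooth_step_def divide_inverse)
  show "0 \<le> smooth_step x" unfolding *
    using flat_denominator_pos[of x] flat_bound(1)[of 0 x] by (intro divide_nonneg_pos)
  show "smooth_step x \<le> 1" unfolding *
    by (subst pos_divide_le_eq[OF flat_denominator_pos]) (use flat_bound(1)[of 0 "1 - x"] in simp)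
qed

definition step_deriv :: "nat \<Rightarrow> real \<Rightarrow> real" where
  "step_deriv k = iter_deriv UNIV (replicate k 1) smooth_step"

lemma step_deriv_0: "step_deriv 0 = smooth_step" by (simp add: step_deriv_def)

lemma step_deriv_has_derivative: "(step_deriv k has_real_derivative step_deriv (Suc k) x) (at x)"
proof -
  have "smooth_on UNIV smooth_step" using Ck_smooth_step by (simp add: smooth_on_UNIV_iff)
  then have d: "step_deriv k differentiable at x" unfolding smooth_on_def step_deriv_def by blast
  have "step_deriv (Suc k) x = dd 1 (step_deriv k) x" by (simp add: step_deriv_def dd_def)
  moreover have "dd v (step_deriv k) x = dd 1 (step_deriv k) x * v" for v
  proof -
    have "frechet_derivative (step_deriv k) (at x) (v *\<^sub>R 1) = v *\<^sub>R frechet_derivative (step_deriv k) (at x) 1"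
      by (rule linear_cmul[OF linear_frechet_derivative[OF d]])
    then show ?thesis unfolding dd_def by (simp only: real_scaleR_def mult_1_right mult_1 mult.commute[of v])
  qed
  ultimately have "(\<lambda>v. dd v (step_deriv k) x) = (*) (step_deriv (Suc k) x)" by (intro ext) metis
  then show ?thesis using has_derivative_dd[OF d] by (simp add: has_field_derivative_def)
qed

text \<open>Outside \<open>{0..1}\<close> the step is locally constant, so each of its derivatives is constant on either
  side; on \<open>{0..1}\<close> continuity gives a bound.\<close>

lemma step_deriv_bounded: "\<exists>C. \<forall>x. \<bar>step_deriv k x\<bar> \<le> C"
proof -
  have loc: "\<exists>c. \<forall>x\<in>S. step_deriv k x = c" if "open S" "\<exists>c. \<forall>x\<in>S. smooth_step x = c" for S
  proof (induction k)
    case 0 then show ?case using that by (simp add: step_deriv_0)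
  next
    case (Suc k)
    then obtain c where c: "\<forall>x\<in>S. step_deriv k x = c" by blast
    have "step_deriv (Suc k) x = 0" if "x \<in> S" for x
    proof -
      have "(step_deriv k has_real_derivative 0) (at x)"
        by (rule DERIV_cong_ev[THEN iffD2, of x x _ "\<lambda>_. c"])
           (use c that eventually_nhds_in_open[of S x] \<open>open S\<close> in \<open>auto elim!: eventually_mono\<close>)
      then show ?thesis using step_deriv_has_derivative DERIV_unique by blast
    qed
    then show ?case by blast
  qed
  obtain c1 where c1: "\<And>x. x < 0 \<Longrightarrow> step_deriv k x = c1"
    using loc[of "{..<0}"] smooth_step_0 by (metis lessThan_iff less_imp_le open_lessThan)
  obtain c2 where c2: "\<And>x. x > 1 \<Longrightarrow> step_deriv k x = c2"
    using loc[of "{1<..}"] smooth_step_1 by (metis greaterThan_iff less_imp_le open_greaterThan)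
  have "continuous_on {0..1} (step_deriv k)"
    by (intro continuous_at_imp_continuous_on ballI DERIV_isCont[OF step_deriv_has_derivative])
  then have "bounded (step_deriv k ` {0..1})"
    by (intro compact_imp_bounded compact_continuous_image) auto
  then obtain C where C: "\<And>x. x \<in> {0..1} \<Longrightarrow> \<bar>step_deriv k x\<bar> \<le> C"
    unfolding bounded_iff by (metis imageI real_norm_def)
  have "\<bar>step_deriv k x\<bar> \<le> max C (max \<bar>c1\<bar> \<bar>c2\<bar>)" for x
    using C[of x] c1[of x] c2[of x] by (cases "x < 0"; cases "x > 1") auto
  then show ?thesis by blast
qed

text \<open>Every derivative of the rescaled step carries another factor \<open>1 / Suc n\<close>, hence tends to 0 and
  stays bounded. The constants \<open>c\<close> and \<open>k\<close> collect the factors produced by differentiation, which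
  makes the statement inductive.\<close>

lemma Ck_lim_step:
  fixes L :: "'a::euclidean_space \<Rightarrow> real"
  assumes L: "bounded_linear L"
  shows "Ck_lim m UNIV (\<lambda>_. 1) (\<lambda>n z. c * (inverse (real (Suc n)) ^ k * step_deriv k (a + inverse (real (Suc n)) * L z)))
     (\<lambda>_. c * (0 ^ k * step_deriv k a))"
proof (induction m arbitrary: k c)
  have base: "dominated_lim UNIV (\<lambda>_. 1) (\<lambda>n z. c * (inverse (real (Suc n)) ^ k * step_deriv k (a + inverse (real (Suc n)) * L z)))
     (\<lambda>_. c * (0 ^ k * step_deriv k a))" for c k
  proof -
    obtain C where C: "\<And>x. \<bar>step_deriv k x\<bar> \<le> C" using step_deriv_bounded by blast
    have "\<bar>c * (inverse (real (Suc n)) ^ k * step_deriv k x)\<bar> \<le> \<bar>c\<bar> * C * 1" for n x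
    proof -
      have "\<bar>inverse (real (Suc n)) ^ k\<bar> * \<bar>step_deriv k x\<bar> \<le> 1 * C"
        using C[of x] by (intro mult_mono) (auto intro!: power_le_one simp: inverse_le_1_iff)
      then show ?thesis by (simp only: abs_mult mult.assoc mult_1 mult_1_right mult_left_mono abs_ge_zero)
    qed
    moreover have "(\<lambda>n. c * (inverse (real (Suc n)) ^ k * step_deriv k (a + inverse (real (Suc n)) * L z)))
       \<longlonglongrightarrow> c * (0 ^ k * step_deriv k (a + 0 * L z))" for z
      by (intro tendsto_intros LIMSEQ_inverse_real_of_nat isCont_tendsto_compose[OF DERIV_isCont[OF step_deriv_has_derivative]])
    ultimately show ?thesis unfolding dominated_lim_def by auto
  qed
  { case 0 then show ?case by (simp only: Ck_lim.simps base) }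
  case (Suc m)
  have d: "((\<lambda>z. c * (e ^ k * step_deriv k (a + e * L z))) has_derivative
     (\<lambda>v. (c * L v) * (e ^ Suc k * step_deriv (Suc k) (a + e * L z)))) (at z)" for e z
  proof -
    have "((\<lambda>z. a + e * L z) has_derivative (\<lambda>v. e * L v)) (at z)"
      using bounded_linear_imp_has_derivative[OF L] by (auto intro!: derivative_eq_intros)
    from has_derivative_compose[OF this step_deriv_has_derivative[unfolded has_field_derivative_def]]
    show ?thesis by (auto intro!: derivative_eq_intros simp: algebra_simps)
  qed
  have "dd v (\<lambda>z. c * (e ^ k * step_deriv k (a + e * L z))) = (\<lambda>z. (c * L v) * (e ^ Suc k * step_deriv (Suc k) (a + e * L z)))" for v e
    using dd_eq[OF d] by blast
  moreover have "dd v (\<lambda>_::'a. c * (0 ^ k * step_deriv k a)) = (\<lambda>_. (c * L v) * (0 ^ Suc k * step_deriv (Suc k) a))" for v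
    by (auto simp: dd_def)
  ultimately have "Ck_lim m UNIV (\<lambda>_. 1)
     (\<lambda>n. dd v (\<lambda>z. c * (inverse (real (Suc n)) ^ k * step_deriv k (a + inverse (real (Suc n)) * L z))))
     (dd v (\<lambda>_. c * (0 ^ k * step_deriv k a)))" for v
    using Suc[of "c * L v" "Suc k"] by simp
  then show ?case using base[of c k] d by (auto simp: differentiable_def simp del: of_nat_Suc)
qed

lemma Ck_lim_mult1:
  assumes "open U" "Ck_lim n U w F f" "Ck_lim n U (\<lambda>_. 1) G g"
  shows "Ck_lim n U w (\<lambda>m x. G m x * F m x) (\<lambda>x. g x * f x)"
  using Ck_lim_mult[OF assms(1,3,2)] by simp

text \<open>The shift by 2 makes the cutoff equal to 1 where all \<open>\<bar>x $ i\<bar> \<le> Suc n\<close>, and 0 where some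
  \<open>\<bar>x $ i\<bar> \<ge> 2 * Suc n\<close>.\<close>

definition cutoff :: "nat \<Rightarrow> R3 \<Rightarrow> real" where
  "cutoff n x = (\<Prod>i\<in>UNIV. smooth_step (2 + inverse (real (Suc n)) * x $ i) * smooth_step (2 + inverse (real (Suc n)) * (- x $ i)))"

lemma Ck_lim_cutoff:
  fixes P :: "'a::euclidean_space \<Rightarrow> R3"
  assumes "bounded_linear P"
  shows "Ck_lim m UNIV (\<lambda>_. 1) (\<lambda>n z. cutoff n (P z)) (\<lambda>_. 1)"
proof -
  have one: "Ck_lim m UNIV (\<lambda>_. 1) (\<lambda>n z. smooth_step (2 + inverse (real (Suc n)) * L z)) (\<lambda>_. 1)"
    if "bounded_linear L" for L :: "'a \<Rightarrow> real"
    using Ck_lim_step[OF that, of m 1 0 2] by (simp add: step_deriv_0 smooth_step_1 del: of_nat_Suc)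
  have l: "bounded_linear (\<lambda>z. P z $ i)" for i
    using bounded_linear_compose[OF bounded_linear_vec_nth assms] .
  have "Ck_lim m UNIV (\<lambda>_. 1) (\<lambda>n z. smooth_step (2 + inverse (real (Suc n)) * P z $ i) * 
     smooth_step (2 + inverse (real (Suc n)) * (- P z $ i))) (\<lambda>_. 1)" for i
    using Ck_lim_mult1[OF _ one[OF bounded_linear_minus[OF l]] one[OF l]] by simp
  note 1 = this
  show ?thesis unfolding cutoff_def UNIV_3
    using Ck_lim_mult1[OF _ Ck_lim_mult1[OF _ 1[of 3] 1[of 2]] 1[of 1]] by (simp add: mult.assoc)
qed

lemma cutoff_support: "cutoff n x \<noteq> 0 \<Longrightarrow> \<bar>x $ i\<bar> \<le> 2 * real (Suc n)"
proof (rule ccontr)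
  assume "\<not> \<bar>x $ i\<bar> \<le> 2 * real (Suc n)" and nz: "cutoff n x \<noteq> 0"
  then have "2 + inverse (real (Suc n)) * x $ i \<le> 0 \<or> 2 + inverse (real (Suc n)) * (- x $ i) \<le> 0"
    by (auto simp: field_simps)
  then have "smooth_step (2 + inverse (real (Suc n)) * x $ i) * smooth_step (2 + inverse (real (Suc n)) * (- x $ i)) = 0"
    using smooth_step_0 by auto
  then show False using nz unfolding cutoff_def by (metis (no_types, lifting) UNIV_I finite prod_zero)
qed

section \<open>The backward heat kernel\<close>

text \<open>Polynomials in \<open>1 / (r - s)\<close> and \<open>x - y\<close>, where \<open>z = (s, x)\<close>. Their products with the backward
  heat kernel form a class that is closed under differentiation in time and space, and each
  product has Gaussian decay. So one bound for the whole class controls all derivatives of the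
  kernel at once.\<close>

inductive_set heat_poly :: "real \<Rightarrow> R3 \<Rightarrow> (real \<times> R3 \<Rightarrow> real) set" for r :: real and y :: R3 where
  const: "(\<lambda>z. c) \<in> heat_poly r y"
| time: "(\<lambda>z. inverse (r - fst z)) \<in> heat_poly r y"
| space: "(\<lambda>z. (snd z - y) $ i) \<in> heat_poly r y"
| add: "p \<in> heat_poly r y \<Longrightarrow> q \<in> heat_poly r y \<Longrightarrow> (\<lambda>z. p z + q z) \<in> heat_poly r y"
| mult: "p \<in> heat_poly r y \<Longrightarrow> q \<in> heat_poly r y \<Longrightarrow> (\<lambda>z. p z * q z) \<in> heat_poly r y"

text \<open>As a function of \<open>z = (s, x)\<close> this solves \<open>\<partial>\<^sub>s f + \<Delta>f = 0\<close> for \<open>s < r\<close>, with pole at \<open>(r, y)\<close>.\<close>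

definition backward_heat :: "real \<Rightarrow> R3 \<Rightarrow> real \<times> R3 \<Rightarrow> real" where
  "backward_heat r y z = heat_kernel (r - fst z) (snd z - y)"

lemma heat_poly_has_derivative:
  "p \<in> heat_poly r y \<Longrightarrow> \<exists>p'. (\<forall>v. p' v \<in> heat_poly r y) \<and> (\<forall>z. fst z < r \<longrightarrow> (p has_derivative (\<lambda>v. p' v z)) (at z))"
proof (induction rule: heat_poly.induct)
  case (const c)
  show ?case by (rule exI[of _ "\<lambda>v z. 0"]) (auto intro: heat_poly.const)
next
  case time
  have "((\<lambda>z::real\<times>R3. inverse (r - fst z)) has_derivative (\<lambda>v. fst v * (inverse (r - fst z) * inverse (r - fst z)))) (at z)"
    if "fst z < r" for z
    using that by (auto intro!: derivative_eq_intros)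
  then show ?case 
    by (intro exI[of _ "\<lambda>v z. fst v * (inverse (r - fst z) * inverse (r - fst z))"])
       (auto intro!: heat_poly.mult[OF heat_poly.const heat_poly.mult[OF heat_poly.time heat_poly.time]])
next
  case (space i)
  have "((\<lambda>z. (snd z - y) $ i) has_derivative (\<lambda>v. snd v $ i)) (at z)" for z :: "real \<times> R3"
    by (auto intro!: derivative_eq_intros bounded_linear.has_derivative[OF bounded_linear_vec_nth])
  then show ?case by (intro exI[of _ "\<lambda>v z. snd v $ i"]) (auto intro: heat_poly.const)
next
  case (add p q)
  then obtain p' q' where "\<forall>v. p' v \<in> heat_poly r y" "\<forall>z. fst z < r \<longrightarrow> (p has_derivative (\<lambda>v. p' v z)) (at z)"
    "\<forall>v. q' v \<in> heat_poly r y" "\<forall>z. fst z < r \<longrightarrow> (q has_derivative (\<lambda>v. q' v z)) (at z)" by blast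
  then show ?case by (intro exI[of _ "\<lambda>v z. p' v z + q' v z"]) (auto intro: heat_poly.add has_derivative_add)
next
  case (mult p q)
  then obtain p' q' where "\<forall>v. p' v \<in> heat_poly r y" "\<forall>z. fst z < r \<longrightarrow> (p has_derivative (\<lambda>v. p' v z)) (at z)"
    "\<forall>v. q' v \<in> heat_poly r y" "\<forall>z. fst z < r \<longrightarrow> (q has_derivative (\<lambda>v. q' v z)) (at z)" by blast
  with mult show ?case
    by (intro exI[of _ "\<lambda>v z. p z * q' v z + p' v z * q z"])
      (auto intro!: heat_poly.add heat_poly.mult has_derivative_mult)
qed

text \<open>Written out in the generators of \<open>heat_poly\<close>, so that membership is immediate.\<close>

definition backward_heat_log_deriv :: "real \<Rightarrow> R3 \<Rightarrow> real \<times> R3 \<Rightarrow> real \<times> R3 \<Rightarrow> real" where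
  "backward_heat_log_deriv r y v z = fst v * (3/2 * inverse (r - fst z) 
     + (-1/4) * ((\<Sum>i\<in>UNIV. (snd z - y) $ i * (snd z - y) $ i) * (inverse (r - fst z) * inverse (r - fst z))))
     + (-1/2) * ((\<Sum>i\<in>UNIV. snd v $ i * (snd z - y) $ i) * inverse (r - fst z))"

lemma backward_heat_log_deriv_heat_poly: "backward_heat_log_deriv r y v \<in> heat_poly r y"
  unfolding backward_heat_log_deriv_def[abs_def] sum_3 by (rule heat_poly.intros)+

lemma backward_heat_has_derivative:
  assumes "fst z < r"
  shows "(backward_heat r y has_derivative (\<lambda>v. backward_heat_log_deriv r y v z * backward_heat r y z)) (at z)"
proof -
  define t where "t = r - fst z"
  have t: "t > 0" using assms by (simp add: t_def)
  have 1: "((\<lambda>t. (4 * pi * t) powr (-3/2)) has_real_derivative (-3/2) * inverse t * (4 * pi * t) powr (-3/2)) (at t)"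
  proof -
    have "((\<lambda>t. (4 * pi * t) powr (-3/2)) has_real_derivative (-3/2) * (4 * pi * t) powr (-3/2 - 1) * (4 * pi)) (at t)"
      using t by (auto intro!: derivative_eq_intros)
    moreover have "(4 * pi * t) powr (-3/2 - 1) * (4 * pi) = inverse t * (4 * pi * t) powr (-3/2)"
      using t powr_diff[of "4 * pi * t" "-3/2" 1] by (simp add: field_simps)
    ultimately show ?thesis by (simp only: mult.assoc)
  qed
  have 2: "((\<lambda>z::real\<times>R3. r - fst z) has_derivative (\<lambda>v. - fst v)) (at z)"
    by (auto intro!: derivative_eq_intros)
  have 3: "((\<lambda>z. (4 * pi * (r - fst z)) powr (-3/2)) has_derivative
     (\<lambda>v. (-3/2) * inverse t * (4 * pi * t) powr (-3/2) * (- fst v))) (at z)"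
    by (rule has_derivative_eq_rhs[OF has_derivative_compose[OF 2 1[unfolded has_field_derivative_def t_def]]])
       (simp add: t_def)
  have 4: "((\<lambda>z::real\<times>R3. (norm (snd z - y))\<^sup>2) has_derivative (\<lambda>v. 2 * ((snd z - y) \<bullet> snd v))) (at z)"
    unfolding power2_norm_eq_inner
    by (auto intro!: derivative_eq_intros simp: inner_commute)
  have 5: "((\<lambda>z::real\<times>R3. - (norm (snd z - y))\<^sup>2 / (4 * (r - fst z))) has_derivative
     (\<lambda>v. - (2 * ((snd z - y) \<bullet> snd v)) * inverse (4 * t) - (norm (snd z - y))\<^sup>2 * (4 * fst v) * (inverse (4 * t) * inverse (4 * t)))) (at z)"
    unfolding divide_inverse
    by (rule has_derivative_eq_rhs[OF has_derivative_mult[OF has_derivative_minus[OF 4]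
          Deriv.has_derivative_inverse[of "\<lambda>z. 4 * (r - fst z)" z "\<lambda>v. - (4 * fst v)"]]])
       (use t in \<open>auto intro!: derivative_eq_intros simp: t_def algebra_simps\<close>)
  have 6: "(backward_heat r y has_derivative (\<lambda>v. (4 * pi * (r - fst z)) powr (-3/2) * 
     (exp (- (norm (snd z - y))\<^sup>2 / (4 * (r - fst z))) * 
      (- (2 * ((snd z - y) \<bullet> snd v)) * inverse (4 * t) - (norm (snd z - y))\<^sup>2 * (4 * fst v) * (inverse (4 * t) * inverse (4 * t)))) +
      (-3/2) * inverse t * (4 * pi * t) powr (-3/2) * (- fst v) * exp (- (norm (snd z - y))\<^sup>2 / (4 * (r - fst z))))) (at z)"
    unfolding backward_heat_def[abs_def] heat_kernel_def minus_divide_left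
    by (intro has_derivative_mult 3 has_derivative_eq_rhs[OF has_derivative_exp[OF 5]]) (simp add: mult.commute)
  have n: "(norm (snd z - y))\<^sup>2 = (\<Sum>i\<in>UNIV. (snd z - y) $ i * (snd z - y) $ i)"
    unfolding power2_norm_eq_inner inner_vec_def by simp
  have i: "(snd z - y) \<bullet> w = (\<Sum>i\<in>UNIV. w $ i * (snd z - y) $ i)" for w
    unfolding inner_vec_def by (simp add: mult.commute)
  define S where "S v = (snd z - y) \<bullet> snd v" for v :: "real \<times> R3"
  define N where "N = (norm (snd z - y))\<^sup>2"
  have L: "backward_heat_log_deriv r y v z = fst v * (3/2 * inverse t + (-1/4) * (N * (inverse t * inverse t))) 
     + (-1/2) * (((snd z - y) \<bullet> snd v) * inverse t)" for v
    unfolding backward_heat_log_deriv_def N_def n i t_def ..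
  have B: "backward_heat r y z = (4 * pi * t) powr (-3/2) * exp (- N / (4 * t))"
    unfolding backward_heat_def heat_kernel_def N_def t_def ..
  show ?thesis
    by (rule has_derivative_eq_rhs[OF 6], unfold L B, fold t_def, fold N_def S_def)
       (simp add: fun_eq_iff algebra_simps)
qed

lemma heat_poly_bound:
  assumes "p \<in> heat_poly r y" "b < r"
  shows "\<exists>C m. 0 \<le> C \<and> 0 \<le> m \<and> (\<forall>z. fst z < b \<longrightarrow> \<bar>p z\<bar> \<le> C * exp (m * norm (snd z - y)))"
  using assms(1)
proof (induction rule: heat_poly.induct)
  case (const c)
  show ?case by (rule exI[of _ "\<bar>c\<bar>"], rule exI[of _ 0]) auto
next
  case time
  have "\<bar>inverse (r - fst z)\<bar> \<le> inverse (r - b)" if "fst z < b" for z :: "real \<times> R3"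
    using that assms(2) by (auto simp: abs_if intro!: le_imp_inverse_le)
  then show ?case using assms(2) by (intro exI[of _ "inverse (r - b)"] exI[of _ 0]) auto
next
  case (space i)
  have "\<bar>(snd z - y) $ i\<bar> \<le> exp (norm (snd z - y))" for z :: "real \<times> R3"
    using component_le_norm_cart[of "snd z - y" i] exp_ge_add_one_self[of "norm (snd z - y)"] by linarith
  then show ?case by (intro exI[of _ 1]) auto
next
  case (add p q)
  then obtain C m C' m' where h: "0 \<le> C" "0 \<le> m" "\<And>z. fst z < b \<Longrightarrow> \<bar>p z\<bar> \<le> C * exp (m * norm (snd z - y))"
    "0 \<le> C'" "0 \<le> m'" "\<And>z. fst z < b \<Longrightarrow> \<bar>q z\<bar> \<le> C' * exp (m' * norm (snd z - y))" by blast
  have "\<bar>p z + q z\<bar> \<le> (C + C') * exp ((m + m') * norm (snd z - y))" if "fst z < b" for z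
  proof -
    have "C * exp (m * norm (snd z - y)) \<le> C * exp ((m + m') * norm (snd z - y))"
      "C' * exp (m' * norm (snd z - y)) \<le> C' * exp ((m + m') * norm (snd z - y))"
      using h by (auto intro!: mult_left_mono mult_right_mono)
    then show ?thesis using h(3)[OF that] h(6)[OF that] by (simp add: algebra_simps)
  qed
  then show ?case using h by (intro exI[of _ "C + C'"] exI[of _ "m + m'"]) auto
next
  case (mult p q)
  then obtain C m C' m' where h: "0 \<le> C" "0 \<le> m" "\<And>z. fst z < b \<Longrightarrow> \<bar>p z\<bar> \<le> C * exp (m * norm (snd z - y))"
    "0 \<le> C'" "0 \<le> m'" "\<And>z. fst z < b \<Longrightarrow> \<bar>q z\<bar> \<le> C' * exp (m' * norm (snd z - y))" by blast
  have "\<bar>p z * q z\<bar> \<le> (C * C') * exp ((m + m') * norm (snd z - y))" if "fst z < b" for z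
  proof -
    have "\<bar>p z\<bar> * \<bar>q z\<bar> \<le> (C * exp (m * norm (snd z - y))) * (C' * exp (m' * norm (snd z - y)))"
      using h that by (intro mult_mono) auto
    then show ?thesis by (simp add: abs_mult distrib_right exp_add mult_ac)
  qed
  then show ?case using h by (intro exI[of _ "C * C'"] exI[of _ "m + m'"]) auto
qed

text \<open>Half of the exponent of the heat kernel at time \<open>A\<close>; the other half is spent on polynomial
  factors.\<close>

definition gauss_weight :: "real \<Rightarrow> R3 \<Rightarrow> real" where
  "gauss_weight A x = exp (- (norm x)\<^sup>2 / (8 * A))"

lemma heat_poly_backward_heat_bound:
  assumes "p \<in> heat_poly r y" "b < r" "a < b"
  shows "\<exists>C. \<forall>z\<in>{a<..<b} \<times> UNIV. \<bar>p z * backward_heat r y z\<bar> \<le> C * gauss_weight (r - a) (snd z - y)"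
proof -
  obtain C m where C: "0 \<le> C" "0 \<le> m" "\<And>z. fst z < b \<Longrightarrow> \<bar>p z\<bar> \<le> C * exp (m * norm (snd z - y))"
    using heat_poly_bound[OF assms(1,2)] by blast
  define A where "A = r - a"
  have A: "A > 0" using assms by (simp add: A_def)
  define K where "K = C * (4 * pi * (r - b)) powr (-3/2) * exp (2 * A * m\<^sup>2)"
  have "\<bar>p z * backward_heat r y z\<bar> \<le> K * gauss_weight A (snd z - y)" if "z \<in> {a<..<b} \<times> UNIV" for z
  proof -
    define t R where "t = r - fst z" and "R = norm (snd z - y)"
    have t: "r - b < t" "t < A" "0 < t" "0 < r - b" using that assms by (auto simp: t_def A_def)
    have "(4 * pi * t) powr (-3/2) \<le> (4 * pi * (r - b)) powr (-3/2)"
      by (rule powr_mono2') (use t in auto)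
    moreover have "exp (- R\<^sup>2 / (4 * t)) \<le> exp (- R\<^sup>2 / (4 * A))"
      using t A by (auto intro!: divide_left_mono)
    ultimately have h: "\<bar>backward_heat r y z\<bar> \<le> (4 * pi * (r - b)) powr (-3/2) * exp (- R\<^sup>2 / (4 * A))"
      unfolding backward_heat_def heat_kernel_def t_def[symmetric] R_def[symmetric] abs_mult by (intro mult_mono) auto
    \<comment> \<open>Young's inequality: half of the Gaussian exponent absorbs the exponential growth.\<close>
    have "m * R + - R\<^sup>2 / (4 * A) \<le> 2 * A * m\<^sup>2 + - R\<^sup>2 / (8 * A)"
    proof -
      have "0 \<le> (R - 4 * A * m)\<^sup>2 / (8 * A)" using A by simp
      also have "\<dots> = R\<^sup>2 / (8 * A) + 2 * A * m\<^sup>2 - m * R"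
        using A by (simp add: power2_diff field_simps power2_eq_square)
      finally have "m * R \<le> R\<^sup>2 / (8 * A) + 2 * A * m\<^sup>2" by simp
      moreover have "- R\<^sup>2 / (4 * A) = 2 * (- R\<^sup>2 / (8 * A))" by simp
      moreover have "- R\<^sup>2 / (8 * A) = - (R\<^sup>2 / (8 * A))" by simp
      ultimately show ?thesis by linarith
    qed
    then have e: "exp (m * R) * exp (- R\<^sup>2 / (4 * A)) \<le> exp (2 * A * m\<^sup>2) * exp (- R\<^sup>2 / (8 * A))"
      unfolding exp_add[symmetric] by simp
    have "\<bar>p z * backward_heat r y z\<bar> \<le> (C * exp (m * R)) * ((4 * pi * (r - b)) powr (-3/2) * exp (- R\<^sup>2 / (4 * A)))"
      unfolding abs_mult by (intro mult_mono h) (use C that in \<open>auto simp: R_def\<close>)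
    also have "\<dots> = C * (4 * pi * (r - b)) powr (-3/2) * (exp (m * R) * exp (- R\<^sup>2 / (4 * A)))" by (simp only: mult_ac)
    also have "\<dots> \<le> C * (4 * pi * (r - b)) powr (-3/2) * (exp (2 * A * m\<^sup>2) * exp (- R\<^sup>2 / (8 * A)))"
      using e C by (intro mult_left_mono) auto
    finally show ?thesis by (simp add: K_def gauss_weight_def R_def mult_ac)
  qed
  then show ?thesis unfolding A_def by blast
qed

lemma heat_poly_backward_heat_derivative:
  assumes "p \<in> heat_poly r y"
  shows "\<exists>q. (\<forall>v. q v \<in> heat_poly r y) \<and> (\<forall>z. fst z < r \<longrightarrow> 
     ((\<lambda>z. p z * backward_heat r y z) has_derivative (\<lambda>v. q v z * backward_heat r y z)) (at z))"
proof -
  obtain p' where p': "\<forall>v. p' v \<in> heat_poly r y" "\<And>z. fst z < r \<Longrightarrow> (p has_derivative (\<lambda>v. p' v z)) (at z)"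
    using heat_poly_has_derivative[OF assms] by blast
  have "((\<lambda>z. p z * backward_heat r y z) has_derivative (\<lambda>v. (p z * backward_heat_log_deriv r y v z + p' v z) * backward_heat r y z)) (at z)"
    if "fst z < r" for z
    by (rule has_derivative_eq_rhs[OF has_derivative_mult[OF p'(2)[OF that] backward_heat_has_derivative[OF that]]])
       (simp add: algebra_simps)
  then show ?thesis
    by (intro exI[of _ "\<lambda>v z. p z * backward_heat_log_deriv r y v z + p' v z"])
       (use p' assms backward_heat_log_deriv_heat_poly in \<open>auto intro!: heat_poly.add heat_poly.mult\<close>)
qed

lemma Ck_lim_heat_poly:
  assumes "p \<in> heat_poly r y" "b < r" "a < b"
  shows "Ck_lim n ({a<..<b} \<times> UNIV) (\<lambda>z. gauss_weight (r - a) (snd z - y)) (\<lambda>_ z. p z * backward_heat r y z) (\<lambda>z. p z * backward_heat r y z)"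
  using assms(1)
proof (induction n arbitrary: p)
  case 0
  then show ?case using heat_poly_backward_heat_bound[OF 0 assms(2,3)] by (auto simp: dominated_lim_def)
next
  case (Suc n)
  obtain q where q: "\<And>v. q v \<in> heat_poly r y" "\<And>z. fst z < r \<Longrightarrow> 
     ((\<lambda>z. p z * backward_heat r y z) has_derivative (\<lambda>v. q v z * backward_heat r y z)) (at z)"
    using heat_poly_backward_heat_derivative[OF Suc.prems] by blast
  have op: "open ({a<..<b} \<times> (UNIV::R3 set))" by (intro open_Times) auto
  have "Ck_lim n ({a<..<b} \<times> UNIV) (\<lambda>z. gauss_weight (r - a) (snd z - y)) (\<lambda>_. dd v (\<lambda>z. p z * backward_heat r y z)) (dd v (\<lambda>z. p z * backward_heat r y z))" for v
    by (rule Ck_lim_cong[OF op _ _ Suc.IH[OF q(1)[of v]]]) (use assms(2) in \<open>auto simp: dd_eq[OF q(2)]\<close>)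
  moreover have "dominated_lim ({a<..<b} \<times> UNIV) (\<lambda>z. gauss_weight (r - a) (snd z - y)) (\<lambda>_ z. p z * backward_heat r y z) (\<lambda>z. p z * backward_heat r y z)"
    using heat_poly_backward_heat_bound[OF Suc.prems assms(2,3)] by (auto simp: dominated_lim_def)
  moreover have "(\<lambda>z. p z * backward_heat r y z) differentiable (at z)" if "z \<in> {a<..<b} \<times> UNIV" for z
    using q(2)[of z] that assms by (auto simp: differentiable_def)
  ultimately show ?case by simp
qed

text \<open>The Hessian of the heat kernel in space, see \<open>dd_dd_backward_heat\<close>.\<close>

definition heat_hess :: "real \<Rightarrow> R3 \<Rightarrow> 3 \<Rightarrow> 3 \<Rightarrow> real" where
  "heat_hess t x i j = (x $ i * x $ j / (4 * t\<^sup>2) - (if i = j then 1 else 0) / (2 * t)) * heat_kernel t x"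

text \<open>The coordinate directions of space, as directions in space-time.\<close>

abbreviation sp :: "3 \<Rightarrow> real \<times> R3" where "sp i \<equiv> (0, axis i 1)"

lemma dd_backward_heat:
  assumes "fst z < r"
  shows "dd (sp i) (backward_heat r y) z = - ((snd z - y) $ i / (2 * (r - fst z))) * backward_heat r y z"
    and "dd (1, 0) (backward_heat r y) z = (3 / (2 * (r - fst z)) - (norm (snd z - y))\<^sup>2 / (4 * (r - fst z)\<^sup>2)) * backward_heat r y z"
proof -
  have s: "(\<Sum>ia\<in>UNIV. axis i 1 $ ia * w $ ia) = w $ i" for w :: R3
    using inner_axis[of w i 1] by (simp add: inner_vec_def mult.commute)
  show "dd (sp i) (backward_heat r y) z = - ((snd z - y) $ i / (2 * (r - fst z))) * backward_heat r y z"
    unfolding dd_eq[OF backward_heat_has_derivative[OF assms]] backward_heat_log_deriv_def snd_conv s by (simp add: field_simps)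
  have "(norm (snd z - y))\<^sup>2 = (\<Sum>i\<in>UNIV. (snd z - y) $ i * (snd z - y) $ i)"
    unfolding power2_norm_eq_inner inner_vec_def by simp
  then show "dd (1, 0) (backward_heat r y) z = (3 / (2 * (r - fst z)) - (norm (snd z - y))\<^sup>2 / (4 * (r - fst z)\<^sup>2)) * backward_heat r y z"
    unfolding dd_eq[OF backward_heat_has_derivative[OF assms]] backward_heat_log_deriv_def snd_conv fst_conv 
    by (simp add: field_simps power2_eq_square)
qed

lemma dd_dd_backward_heat:
  assumes "fst z < r"
  shows "dd (sp j) (dd (sp i) (backward_heat r y)) z = heat_hess (r - fst z) (snd z - y) i j"
proof -
  let ?U = "{..<r} \<times> (UNIV :: R3 set)"
  have op: "open ?U" by (intro open_Times) auto
  have "dd (sp j) (dd (sp i) (backward_heat r y)) z = dd (sp j) (\<lambda>z. - ((snd z - y) $ i / (2 * (r - fst z))) * backward_heat r y z) z"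
    by (rule dd_cong[OF op]) (use assms in \<open>auto simp: dd_backward_heat mem_Times_iff\<close>)
  also have "\<dots> = heat_hess (r - fst z) (snd z - y) i j"
  proof -
    have 1: "((\<lambda>z. (snd z - y) $ i) has_derivative (\<lambda>v. snd v $ i)) (at z)" for z :: "real \<times> R3"
      by (auto intro!: derivative_eq_intros bounded_linear.has_derivative[OF bounded_linear_vec_nth])
    have 2: "((\<lambda>z. - ((snd z - y) $ i / (2 * (r - fst z)))) has_derivative 
       (\<lambda>v. - (snd v $ i * inverse (2 * (r - fst z)) + (snd z - y) $ i * (2 * fst v * (inverse (2 * (r - fst z)) * inverse (2 * (r - fst z))))))) (at z)"
      unfolding divide_inverse
      by (rule has_derivative_eq_rhs[OF has_derivative_minus[OF has_derivative_mult[OF 1 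
           Deriv.has_derivative_inverse[of "\<lambda>z. 2 * (r - fst z)" z "\<lambda>v. - (2 * fst v)"]]]])
         (use assms in \<open>auto intro!: derivative_eq_intros simp: algebra_simps\<close>)
    have ax: "axis j (1::real) $ i = (if i = j then 1 else 0)" by (simp add: axis_def)
    have b: "backward_heat_log_deriv r y (sp j) z * backward_heat r y z = - ((snd z - y) $ j / (2 * (r - fst z))) * backward_heat r y z"
      using dd_backward_heat(1)[OF assms, of j y] dd_eq[OF backward_heat_has_derivative[OF assms, of y], of "sp j"] by simp
    show ?thesis unfolding dd_eq[OF has_derivative_mult[OF 2 backward_heat_has_derivative[OF assms]]] b
      using assms unfolding heat_hess_def backward_heat_def
      by (simp add: ax field_simps power2_eq_square)
  qed
  finally show ?thesis .
qed

lemma backward_heat_heat_equation: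
  assumes "fst z < r"
  shows "dd (1, 0) (backward_heat r y) z + (\<Sum>i\<in>UNIV. dd (sp i) (dd (sp i) (backward_heat r y)) z) = 0"
proof -
  have n: "(norm (snd z - y))\<^sup>2 = (\<Sum>i\<in>UNIV. (snd z - y) $ i * (snd z - y) $ i)"
    unfolding power2_norm_eq_inner inner_vec_def by simp
  define t H w where "t = r - fst z" and "H = heat_kernel t (snd z - y)" and "w i = (snd z - y) $ i" for i
  have t: "t > 0" using assms by (simp add: t_def)
  have "(3 / (2 * t) - (w 1 * w 1 + w 2 * w 2 + w 3 * w 3) / (4 * t\<^sup>2)) * H +
    ((w 1 * w 1 / (4 * t\<^sup>2) - 1 / (2 * t)) * H + (w 2 * w 2 / (4 * t\<^sup>2) - 1 / (2 * t)) * H + (w 3 * w 3 / (4 * t\<^sup>2) - 1 / (2 * t)) * H) = 0"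
    using t by (simp add: field_simps power2_eq_square)
  then show ?thesis unfolding dd_dd_backward_heat[OF assms] dd_backward_heat(2)[OF assms] heat_hess_def backward_heat_def n sum_3
    t_def[symmetric] H_def[symmetric] w_def[symmetric] if_P[OF refl] .
qed

section \<open>The space \<open>L\<^sup>2\<close> and density of test functions\<close>

lemma integral_Cauchy_Schwarz:
  fixes a b :: "'a \<Rightarrow> real"
  assumes [measurable]: "a \<in> borel_measurable M" "b \<in> borel_measurable M"
    and i: "integrable M (\<lambda>x. (a x)\<^sup>2)" "integrable M (\<lambda>x. (b x)\<^sup>2)"
  shows "integrable M (\<lambda>x. \<bar>a x\<bar> * \<bar>b x\<bar>)"
    and "(LINT x|M. \<bar>a x\<bar> * \<bar>b x\<bar>) \<le> sqrt (LINT x|M. (a x)\<^sup>2) * sqrt (LINT x|M. (b x)\<^sup>2)"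
proof -
  show int: "integrable M (\<lambda>x. \<bar>a x\<bar> * \<bar>b x\<bar>)"
  proof (rule Bochner_Integration.integrable_bound[OF Bochner_Integration.integrable_add[OF i]])
    have "\<bar>a x\<bar> * \<bar>b x\<bar> \<le> (a x)\<^sup>2 + (b x)\<^sup>2" for x
      using sum_squares_bound[of "\<bar>a x\<bar>" "\<bar>b x\<bar>"] mult_nonneg_nonneg[OF abs_ge_zero[of "a x"] abs_ge_zero[of "b x"]]
      unfolding power2_abs by linarith
    then show "AE x in M. norm (\<bar>a x\<bar> * \<bar>b x\<bar>) \<le> norm ((a x)\<^sup>2 + (b x)\<^sup>2)" by (simp add: abs_mult)
  qed measurable
  have "(\<integral>\<^sup>+x. ennreal \<bar>a x\<bar> * ennreal \<bar>b x\<bar> \<partial>M)\<^sup>2 \<le> (\<integral>\<^sup>+x. (ennreal \<bar>a x\<bar>)\<^sup>2 \<partial>M) * (\<integral>\<^sup>+x. (ennreal \<bar>b x\<bar>)\<^sup>2 \<partial>M)"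
    by (rule Cauchy_Schwarz_nn_integral) measurable
  also have "(\<integral>\<^sup>+x. (ennreal \<bar>a x\<bar>)\<^sup>2 \<partial>M) = ennreal (LINT x|M. (a x)\<^sup>2)"
    using nn_integral_eq_integral[OF i(1)] by (simp add: ennreal_power)
  also have "(\<integral>\<^sup>+x. (ennreal \<bar>b x\<bar>)\<^sup>2 \<partial>M) = ennreal (LINT x|M. (b x)\<^sup>2)"
    using nn_integral_eq_integral[OF i(2)] by (simp add: ennreal_power)
  also have "(\<integral>\<^sup>+x. ennreal \<bar>a x\<bar> * ennreal \<bar>b x\<bar> \<partial>M) = ennreal (LINT x|M. \<bar>a x\<bar> * \<bar>b x\<bar>)"
    using nn_integral_eq_integral[OF int] by (simp add: ennreal_mult)
  finally have "(LINT x|M. \<bar>a x\<bar> * \<bar>b x\<bar>)\<^sup>2 \<le> (LINT x|M. (a x)\<^sup>2) * (LINT x|M. (b x)\<^sup>2)"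
    by (simp add: ennreal_power ennreal_mult[symmetric])
  then show "(LINT x|M. \<bar>a x\<bar> * \<bar>b x\<bar>) \<le> sqrt (LINT x|M. (a x)\<^sup>2) * sqrt (LINT x|M. (b x)\<^sup>2)"
    by (metis real_le_rsqrt real_sqrt_mult)
qed

lemma borel_imp_lebesgue_measurable:
  fixes f :: "'a::euclidean_space \<Rightarrow> 'b::topological_space"
  shows "f \<in> borel_measurable borel \<Longrightarrow> f \<in> borel_measurable lebesgue"
  by (rule measurable_completion) simp

lemma in_L2D: "in_L2 f \<Longrightarrow> f \<in> borel_measurable lebesgue" "in_L2 f \<Longrightarrow> integrable lebesgue (\<lambda>x. (norm (f x))\<^sup>2)"
  by (auto simp: in_L2_def)

lemma L2_norm_nonneg: "0 \<le> L2_norm f" by (simp add: L2_norm_def)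

lemma L2_norm_power2: "(L2_norm f)\<^sup>2 = (LINT x|lebesgue. (norm (f x))\<^sup>2)"
  by (simp add: L2_norm_def)

lemma L2_Cauchy_Schwarz:
  assumes "in_L2 f" "in_L2 g"
  shows "integrable lebesgue (\<lambda>x. norm (f x) * norm (g x))"
    and "(LINT x|lebesgue. norm (f x) * norm (g x)) \<le> L2_norm f * L2_norm g"
  using integral_Cauchy_Schwarz[of "\<lambda>x. norm (f x)" lebesgue "\<lambda>x. norm (g x)"] assms
  by (auto simp: in_L2_def L2_norm_def)

lemma integrable_inner_L2:
  assumes "in_L2 f" "in_L2 g"
  shows "integrable lebesgue (\<lambda>x. f x \<bullet> g x)"
  by (rule Bochner_Integration.integrable_bound[OF L2_Cauchy_Schwarz(1)[OF assms]])
     (use assms[THEN in_L2D(1)] in \<open>auto intro: order_trans[OF Cauchy_Schwarz_ineq2]\<close>)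

lemma abs_L2_inner_le:
  assumes "in_L2 f" "in_L2 g"
  shows "\<bar>L2_inner f g\<bar> \<le> L2_norm f * L2_norm g"
proof -
  have "\<bar>L2_inner f g\<bar> \<le> (LINT x|lebesgue. norm (f x) * norm (g x))"
    unfolding L2_inner_def
    using Bochner_Integration.integral_norm_bound_integral[OF integrable_inner_L2[OF assms] L2_Cauchy_Schwarz(1)[OF assms]]
    by (simp add: Cauchy_Schwarz_ineq2)
  then show ?thesis using L2_Cauchy_Schwarz(2)[OF assms] by linarith
qed

lemma in_L2_bound:
  fixes f :: "R3 \<Rightarrow> 'b::euclidean_space" and g :: "R3 \<Rightarrow> 'c::euclidean_space"
  assumes "in_L2 g" "f \<in> borel_measurable lebesgue" "\<And>x. norm (f x) \<le> norm (g x)"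
  shows "in_L2 f" "L2_norm f \<le> L2_norm g"
proof -
  have le: "(norm (f x))\<^sup>2 \<le> (norm (g x))\<^sup>2" for x using assms(3) by (intro power_mono) auto
  show *: "in_L2 f" unfolding in_L2_def
    by (intro conjI assms(2) Bochner_Integration.integrable_bound[OF in_L2D(2)[OF assms(1)]])
       (use assms(2) le in auto)
  show "L2_norm f \<le> L2_norm g" unfolding L2_norm_def
    by (intro real_sqrt_le_mono integral_mono in_L2D(2)[OF *] in_L2D(2)[OF assms(1)] le)
qed

lemma in_L2_scaleR: "in_L2 f \<Longrightarrow> in_L2 (\<lambda>x. c *\<^sub>R f x)"
  by (auto simp: in_L2_def power_mult_distrib)

lemma L2_norm_scaleR: "L2_norm (\<lambda>x. c *\<^sub>R f x) = \<bar>c\<bar> * L2_norm f"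
  by (auto simp: L2_norm_def power_mult_distrib real_sqrt_mult)

lemma in_L2_add:
  assumes "in_L2 f" "in_L2 g"
  shows "in_L2 (\<lambda>x. f x + g x)"
proof -
  have "(norm (f x + g x))\<^sup>2 \<le> 2 * (norm (f x))\<^sup>2 + 2 * (norm (g x))\<^sup>2" for x
  proof -
    have "(norm (f x + g x))\<^sup>2 \<le> (norm (f x) + norm (g x))\<^sup>2" by (intro power_mono norm_triangle_ineq) auto
    also have "\<dots> \<le> 2 * (norm (f x))\<^sup>2 + 2 * (norm (g x))\<^sup>2"
      using sum_squares_bound[of "norm (f x)" "norm (g x)"] by (simp add: power2_sum)
    finally show ?thesis .
  qed
  note le = this
  have m [measurable]: "(\<lambda>x. f x + g x) \<in> borel_measurable lebesgue"
    by (intro borel_measurable_add assms[THEN in_L2D(1)])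
  have "integrable lebesgue (\<lambda>x. (norm (f x + g x))\<^sup>2)"
  proof (rule Bochner_Integration.integrable_bound)
    show "integrable lebesgue (\<lambda>x. 2 * (norm (f x))\<^sup>2 + 2 * (norm (g x))\<^sup>2)"
      by (intro Bochner_Integration.integrable_add integrable_mult_right in_L2D(2) assms)
    show "(\<lambda>x. (norm (f x + g x))\<^sup>2) \<in> borel_measurable lebesgue"
      by measurable
    show "AE x in lebesgue. norm ((norm (f x + g x))\<^sup>2) \<le> norm (2 * (norm (f x))\<^sup>2 + 2 * (norm (g x))\<^sup>2)"
      using le by (intro AE_I2) (simp add: order_trans[OF _ abs_ge_self])
  qed
  then show ?thesis using m by (simp add: in_L2_def)
qed

lemma in_L2_diff: "in_L2 f \<Longrightarrow> in_L2 g \<Longrightarrow> in_L2 (\<lambda>x. f x - g x)"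
  using in_L2_add[OF _ in_L2_scaleR[of g "-1"]] by simp

lemma L2_norm_triangle:
  assumes "in_L2 f" "in_L2 g"
  shows "L2_norm (\<lambda>x. f x + g x) \<le> L2_norm f + L2_norm g"
proof (rule power2_le_imp_le)
  have "(L2_norm (\<lambda>x. f x + g x))\<^sup>2 = (L2_norm f)\<^sup>2 + 2 * L2_inner f g + (L2_norm g)\<^sup>2"
    unfolding L2_norm_power2 L2_inner_def
    using in_L2D(2)[OF assms(1)] in_L2D(2)[OF assms(2)] integrable_inner_L2[OF assms]
    by (simp add: power2_norm_eq_inner inner_add inner_commute[of "g _" "f _"])
  also have "\<dots> \<le> (L2_norm f + L2_norm g)\<^sup>2"
    using abs_L2_inner_le[OF assms] by (simp add: power2_sum)
  finally show "(L2_norm (\<lambda>x. f x + g x))\<^sup>2 \<le> (L2_norm f + L2_norm g)\<^sup>2" .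
qed (simp add: L2_norm_nonneg)

lemma L2_norm_triangle_diff:
  assumes "in_L2 f" "in_L2 g" "in_L2 h"
  shows "L2_norm (\<lambda>x. f x - h x) \<le> L2_norm (\<lambda>x. f x - g x) + L2_norm (\<lambda>x. g x - h x)"
  using L2_norm_triangle[OF in_L2_diff[OF assms(1,2)] in_L2_diff[OF assms(2,3)]] by simp

lemma in_L2_component: 
  fixes f :: "R3 \<Rightarrow> real ^ 'n"
  shows "in_L2 f \<Longrightarrow> in_L2 (\<lambda>x. f x $ i)"
  by (rule in_L2_bound[of f]) (auto simp: in_L2_def intro!: component_le_norm_cart 
     measurable_compose[OF _ borel_measurable_continuous_onI[of "\<lambda>x. x $ i"]] continuous_intros)

lemma L2_inner_diff_left:
  "in_L2 f \<Longrightarrow> in_L2 f' \<Longrightarrow> in_L2 g \<Longrightarrow> L2_inner (\<lambda>x. f x - f' x) g = L2_inner f g - L2_inner f' g"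
  unfolding L2_inner_def by (simp add: inner_diff_left integrable_inner_L2)

lemma L2_inner_diff_right:
  "in_L2 f \<Longrightarrow> in_L2 g \<Longrightarrow> in_L2 g' \<Longrightarrow> L2_inner f (\<lambda>x. g x - g' x) = L2_inner f g - L2_inner f g'"
  unfolding L2_inner_def by (simp add: inner_diff_right integrable_inner_L2)

lemma L2_dominated_convergence:
  fixes F :: "nat \<Rightarrow> R3 \<Rightarrow> 'b::euclidean_space" and W :: "R3 \<Rightarrow> real"
  assumes "in_L2 W" "\<And>n. F n \<in> borel_measurable lebesgue" "f \<in> borel_measurable lebesgue"
    "\<And>n x. norm (F n x) \<le> W x" "\<And>x. (\<lambda>n. F n x) \<longlonglongrightarrow> f x"
  shows "in_L2 f" "(\<lambda>n. L2_norm (\<lambda>x. F n x - f x)) \<longlonglongrightarrow> 0"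
proof -
  have fW: "norm (f x) \<le> W x" for x
    by (rule LIMSEQ_le_const2[OF tendsto_norm[OF assms(5)[of x]]]) (use assms(4) in auto)
  show "in_L2 f" by (rule in_L2_bound(1)[OF assms(1,3)]) (use order_trans[OF fW abs_ge_self] in auto)
  have "(\<lambda>n. LINT x|lebesgue. (norm (F n x - f x))\<^sup>2) \<longlonglongrightarrow> (LINT x|(lebesgue::R3 measure). (0::real))"
  proof (rule integral_dominated_convergence[where w="\<lambda>x. 4 * (norm (W x))\<^sup>2"])
    show "integrable lebesgue (\<lambda>x. 4 * (norm (W x))\<^sup>2)" using in_L2D(2)[OF assms(1)] by simp
    have "(\<lambda>n. (norm (F n x - f x))\<^sup>2) \<longlonglongrightarrow> 0" for x
      using tendsto_power[OF tendsto_norm[OF LIM_zero[OF assms(5)[of x]]], of 2] by simp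
    then show "AE x in lebesgue. (\<lambda>n. (norm (F n x - f x))\<^sup>2) \<longlonglongrightarrow> 0" by simp
    have "(norm (F n x - f x))\<^sup>2 \<le> 4 * (norm (W x))\<^sup>2" for n x
    proof -
      have "norm (F n x - f x) \<le> 2 * norm (W x)" 
        using norm_triangle_ineq4[of "F n x" "f x"] assms(4)[of n x] fW[of x] by (simp add: abs_if)
      then have "(norm (F n x - f x))\<^sup>2 \<le> (2 * norm (W x))\<^sup>2" by (intro power_mono) auto
      then show ?thesis by (simp add: power_mult_distrib)
    qed
    then show "AE x in lebesgue. norm ((norm (F n x - f x))\<^sup>2) \<le> 4 * (norm (W x))\<^sup>2" for n by simp
  qed (use assms(2,3) in measurable)
  then show "(\<lambda>n. L2_norm (\<lambda>x. F n x - f x)) \<longlonglongrightarrow> 0"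
    unfolding L2_norm_def using tendsto_real_sqrt by fastforce
qed

lemma L2_inner_limit:
  fixes F :: "nat \<Rightarrow> R3 \<Rightarrow> R3" and W :: "R3 \<Rightarrow> real"
  assumes "in_L2 f" "in_L2 W" "\<And>n. F n \<in> borel_measurable lebesgue" "F' \<in> borel_measurable lebesgue"
    "\<And>n x. norm (F n x) \<le> W x" "\<And>x. (\<lambda>n. F n x) \<longlonglongrightarrow> F' x"
  shows "(\<lambda>n. L2_inner f (F n)) \<longlonglongrightarrow> L2_inner f F'"
proof -
  note dc = L2_dominated_convergence[OF assms(2-6)]
  have in2: "in_L2 (F n)" for n
    by (rule in_L2_bound(1)[OF assms(2,3)]) (use order_trans[OF assms(5) abs_ge_self] in simp)
  have "(\<lambda>n. L2_inner f (F n) - L2_inner f F') \<longlonglongrightarrow> 0"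
  proof (rule Lim_null_comparison[OF always_eventually])
    show "(\<lambda>n. L2_norm f * L2_norm (\<lambda>y. F n y - F' y)) \<longlonglongrightarrow> 0"
      using tendsto_mult[OF tendsto_const dc(2), of "L2_norm f"] by simp
    show "\<forall>n. norm (L2_inner f (F n) - L2_inner f F') \<le> L2_norm f * L2_norm (\<lambda>y. F n y - F' y)"
      using abs_L2_inner_le[OF assms(1) in_L2_diff[OF in2 dc(1)]] L2_inner_diff_right[OF assms(1) in2 dc(1)] by simp
  qed
  then show ?thesis by (rule LIM_zero_cancel)
qed

lemma test_functionI:
  assumes "\<And>n. Ck n UNIV f" "compact K" "K \<subseteq> \<Omega>" "\<And>x. f x \<noteq> 0 \<Longrightarrow> x \<in> K"
  shows "test_function \<Omega> f"
proof -
  have "closure {x. f x \<noteq> 0} \<subseteq> K" using assms(2,4) by (intro closure_minimal compact_imp_closed) auto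
  moreover have "compact (closure {x. f x \<noteq> 0})"
    using compact_Int_closed[OF assms(2) closed_closure, of "{x. f x \<noteq> 0}"] calculation by (simp add: inf.absorb2)
  ultimately show ?thesis unfolding test_function_def smooth_on_UNIV_iff using assms(1,3) by auto
qed

lemma test_function_Ck: "test_function \<Omega> f \<Longrightarrow> Ck n UNIV f"
  by (simp add: test_function_def smooth_on_UNIV_iff)

lemma Ck_continuous: "Ck (Suc n) UNIV f \<Longrightarrow> continuous_on UNIV f"
  by (intro continuous_at_imp_continuous_on ballI differentiable_imp_continuous_within) auto

lemma test_function_bounded_support:
  assumes "test_function \<Omega> f"
  shows "\<exists>K. compact K \<and> (\<forall>x. x \<notin> K \<longrightarrow> f x = 0)"
proof (intro exI conjI allI impI)
  show "compact (closure {x. f x \<noteq> 0})" using assms by (simp add: test_function_def)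
  show "f x = 0" if "x \<notin> closure {x. f x \<noteq> 0}" for x
    using that closure_subset[of "{x. f x \<noteq> 0}"] by auto
qed

lemma compact_support_in_L2:
  fixes f :: "R3 \<Rightarrow> 'b::euclidean_space"
  assumes "continuous_on UNIV f" "compact K" "\<And>x. x \<notin> K \<Longrightarrow> f x = 0"
  shows "in_L2 f" "integrable lebesgue f" "\<exists>C. \<forall>x. norm (f x) \<le> C"
proof -
  have "bounded (f ` K)" using assms by (intro compact_imp_bounded compact_continuous_image continuous_on_subset[OF assms(1)]) auto
  then obtain C where "\<forall>y\<in>f ` K. norm y \<le> C" unfolding bounded_iff by blast
  then have C: "norm (f x) \<le> max C 0" for x using assms(3)[of x] by (cases "x \<in> K") (auto simp: le_max_iff_disj)
  then show "\<exists>C. \<forall>x. norm (f x) \<le> C" by blast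
  have [measurable]: "f \<in> borel_measurable lebesgue"
    by (rule borel_imp_lebesgue_measurable[OF borel_measurable_continuous_onI[OF assms(1)]])
  have "integrable lebesgue (indicator K :: R3 \<Rightarrow> real)"
    using lmeasurable_compact[OF assms(2)] by (auto simp: fmeasurable_def intro!: integrable_real_indicator)
  then have i: "integrable lebesgue (\<lambda>x. c * (indicator K x :: real))" for c by simp
  show "integrable lebesgue f"
  proof (rule Bochner_Integration.integrable_bound[OF i[of "max C 0"]])
    show "AE x in lebesgue. norm (f x) \<le> norm (max C 0 * indicator K x)"
      using C assms(3) by (intro AE_I2) (auto simp: indicator_def)
  qed measurable
  have "integrable lebesgue (\<lambda>x. (norm (f x))\<^sup>2)"
  proof (rule Bochner_Integration.integrable_bound[OF i[of "(max C 0)\<^sup>2"]])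
    have "(norm (f x))\<^sup>2 \<le> (max C 0)\<^sup>2 * indicator K x" for x
      using power_mono[OF C norm_ge_zero, of x 2] assms(3)[of x] by (cases "x \<in> K") simp_all
    then show "AE x in lebesgue. norm ((norm (f x))\<^sup>2) \<le> norm ((max C 0)\<^sup>2 * indicator K x)"
      by (intro AE_I2) (simp add: order_trans[OF _ abs_ge_self])
  qed measurable
  then show "in_L2 f" by (simp add: in_L2_def)
qed

lemma test_function_in_L2:
  fixes f :: "R3 \<Rightarrow> 'b::euclidean_space"
  assumes "test_function \<Omega> f"
  shows "in_L2 f" "integrable lebesgue f" "\<exists>C. \<forall>x. norm (f x) \<le> C"
proof -
  obtain K where K: "compact K" "\<And>x. x \<notin> K \<Longrightarrow> f x = 0" using test_function_bounded_support[OF assms] by blast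
  note c = Ck_continuous[OF test_function_Ck[OF assms, of "Suc 0"]]
  show "in_L2 f" "integrable lebesgue f" "\<exists>C. \<forall>x. norm (f x) \<le> C"
    by (rule compact_support_in_L2[OF c K]; assumption)+
qed

lemma test_function_add:
  assumes "test_function \<Omega> f" "test_function \<Omega> g"
  shows "test_function \<Omega> (\<lambda>x. f x + g x)"
proof (rule test_functionI)
  let ?K = "closure {x. f x \<noteq> 0} \<union> closure {x. g x \<noteq> 0}"
  show "Ck n UNIV (\<lambda>x. f x + g x)" for n using assms by (intro Ck_add test_function_Ck[of \<Omega>]) auto
  show "compact ?K" "?K \<subseteq> \<Omega>" using assms by (auto simp: test_function_def)
  show "f x + g x \<noteq> 0 \<Longrightarrow> x \<in> ?K" for x
    using closure_subset[of "{x. f x \<noteq> 0}"] closure_subset[of "{x. g x \<noteq> 0}"] by (cases "f x = 0") auto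
qed

lemma test_function_scaleR:
  assumes "test_function \<Omega> f"
  shows "test_function \<Omega> (\<lambda>x. c *\<^sub>R f x)"
proof (rule test_functionI)
  let ?K = "closure {x. f x \<noteq> 0}"
  show "Ck n UNIV (\<lambda>x. c *\<^sub>R f x)" for n
    using assms by (intro Ck_linear[OF _ bounded_linear_scaleR_right] test_function_Ck[of \<Omega>]) auto
  show "compact ?K" "?K \<subseteq> \<Omega>" using assms by (auto simp: test_function_def)
  show "c *\<^sub>R f x \<noteq> 0 \<Longrightarrow> x \<in> ?K" for x
    using closure_subset[of "{x. f x \<noteq> 0}"] by auto
qed

lemma test_function_dd:
  assumes "test_function \<Omega> f"
  shows "test_function \<Omega> (dd v f)"
proof (rule test_functionI)
  let ?K = "closure {x. f x \<noteq> 0}"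
  show "Ck n UNIV (dd v f)" for n using test_function_Ck[OF assms, of "Suc n"] by simp
  show "compact ?K" "?K \<subseteq> \<Omega>" using assms by (auto simp: test_function_def)
  show "x \<in> ?K" if "dd v f x \<noteq> 0" for x
  proof (rule ccontr)
    assume "x \<notin> ?K"
    then have "dd v f x = dd v (\<lambda>_. 0) x"
      using closure_subset[of "{x. f x \<noteq> 0}"] by (intro dd_cong[of "- ?K"]) auto
    then show False using that by (simp add: dd_def)
  qed
qed

lemma gradient_measurable:
  fixes \<phi> :: "R3 \<Rightarrow> real"
  assumes "\<And>n. Ck n UNIV \<phi>"
  shows "gradient \<phi> \<in> borel_measurable borel"
  unfolding gradient_def[abs_def] partial_def[abs_def] dd_def[symmetric]
  by (intro borel_measurable_continuous_onI continuous_on_vec_lambda Ck_continuous[OF Ck_dd[OF assms]])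

text \<open>Membership in the \<open>L\<^sup>2\<close> closure of the test functions, as a predicate that is inherited by linear
  combinations and limits and can therefore be carried through a Dynkin system argument.\<close>

definition test_approx :: "(R3 \<Rightarrow> real) \<Rightarrow> bool" where
  "test_approx f \<longleftrightarrow> in_L2 f \<and> (\<forall>e>0. \<exists>\<psi>. test_function UNIV \<psi> \<and> L2_norm (\<lambda>x. f x - \<psi> x) < e)"

lemma test_approx_add:
  assumes "test_approx f" "test_approx g"
  shows "test_approx (\<lambda>x. f x + g x)"
  unfolding test_approx_def
proof (intro conjI allI impI)
  show "in_L2 (\<lambda>x. f x + g x)" using assms by (auto simp: test_approx_def intro: in_L2_add)
  fix e :: real assume "e > 0"
  then obtain p q where pq: "test_function UNIV p" "L2_norm (\<lambda>x. f x - p x) < e / 2"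
    "test_function UNIV q" "L2_norm (\<lambda>x. g x - q x) < e / 2"
    using assms unfolding test_approx_def by (meson half_gt_zero)
  have "L2_norm (\<lambda>x. (f x - p x) + (g x - q x)) \<le> L2_norm (\<lambda>x. f x - p x) + L2_norm (\<lambda>x. g x - q x)"
    using assms pq by (intro L2_norm_triangle in_L2_diff test_function_in_L2(1)[of UNIV p] test_function_in_L2(1)[of UNIV q]) (auto simp: test_approx_def)
  then show "\<exists>\<psi>. test_function UNIV \<psi> \<and> L2_norm (\<lambda>x. f x + g x - \<psi> x) < e"
    using pq by (intro exI[of _ "\<lambda>x. p x + q x"]) (auto intro!: test_function_add simp: algebra_simps)
qed

lemma test_approx_scale:
  assumes "test_approx f"
  shows "test_approx (\<lambda>x. c * f x)"
  unfolding test_approx_def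
proof (intro conjI allI impI)
  show "in_L2 (\<lambda>x. c * f x)" using assms in_L2_scaleR[of f c] by (auto simp: test_approx_def)
  fix e :: real assume "e > 0"
  then obtain p where p: "test_function UNIV p" "L2_norm (\<lambda>x. f x - p x) < e / (\<bar>c\<bar> + 1)"
    using assms unfolding test_approx_def by (meson abs_ge_zero divide_pos_pos less_add_same_cancel2 not_one_le_zero zero_less_one add_nonneg_pos)
  have "L2_norm (\<lambda>x. c *\<^sub>R (f x - p x)) \<le> \<bar>c\<bar> * (e / (\<bar>c\<bar> + 1))"
    unfolding L2_norm_scaleR using p by (intro mult_left_mono) auto
  also have "\<dots> < e" using \<open>e > 0\<close> by (simp add: field_simps)
  finally show "\<exists>\<psi>. test_function UNIV \<psi> \<and> L2_norm (\<lambda>x. c * f x - \<psi> x) < e"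
    using p test_function_scaleR[OF p(1), of c]
    by (intro exI[of _ "\<lambda>x. c * p x"]) (auto simp: algebra_simps)
qed

lemma test_approx_limit:
  assumes "\<And>n::nat. test_approx (F n)" "in_L2 f" "(\<lambda>n. L2_norm (\<lambda>x. F n x - f x)) \<longlonglongrightarrow> 0"
  shows "test_approx f"
  unfolding test_approx_def
proof (intro conjI allI impI)
  fix e :: real assume "e > 0"
  then have "\<forall>\<^sub>F n in sequentially. L2_norm (\<lambda>x. F n x - f x) < e / 2"
    using assms(3) by (intro order_tendstoD) auto
  then obtain n where n: "L2_norm (\<lambda>x. F n x - f x) < e / 2" by (meson eventually_sequentially order_refl)
  obtain p where p: "test_function UNIV p" "L2_norm (\<lambda>x. F n x - p x) < e / 2"
    using assms(1)[of n] \<open>e > 0\<close> unfolding test_approx_def by (meson half_gt_zero)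
  have "L2_norm (\<lambda>x. f x - p x) \<le> L2_norm (\<lambda>x. f x - F n x) + L2_norm (\<lambda>x. F n x - p x)"
    using assms p by (intro L2_norm_triangle_diff test_function_in_L2(1)[of UNIV p]) (auto simp: test_approx_def)
  moreover have "L2_norm (\<lambda>x. f x - F n x) = L2_norm (\<lambda>x. F n x - f x)"
    unfolding L2_norm_def by (simp only: norm_minus_commute)
  ultimately show "\<exists>\<psi>. test_function UNIV \<psi> \<and> L2_norm (\<lambda>x. f x - \<psi> x) < e"
    using p n by (intro exI[of _ p]) auto
qed (rule assms)

lemma test_approx_test_function: "test_function UNIV f \<Longrightarrow> test_approx f"
  unfolding test_approx_def by (auto intro!: exI[of _ f] test_function_in_L2 simp: L2_norm_def)

definition box_bump :: "R3 \<Rightarrow> R3 \<Rightarrow> nat \<Rightarrow> R3 \<Rightarrow> real" where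
  "box_bump a b n x = (\<Prod>i\<in>UNIV. smooth_step (real n * (x $ i - a $ i)) * smooth_step (real n * (b $ i - x $ i)))"

lemma Ck_smooth_step_affine:
  fixes L :: "'a::euclidean_space \<Rightarrow> real"
  assumes "bounded_linear L"
  shows "Ck n UNIV (\<lambda>x. smooth_step (c + L x))"
  by (rule Ck_affine[OF assms Ck_smooth_step])

lemma box_bump_test_function: "test_function UNIV (box_bump a b n)"
proof (rule test_functionI)
  have 1: "Ck m UNIV (\<lambda>x::R3. smooth_step (real n * (x $ i - a $ i)))" for m i
    using Ck_smooth_step_affine[of "\<lambda>x::R3. real n * x $ i" m "- real n * a $ i"] 
      bounded_linear_compose[OF bounded_linear_mult_right bounded_linear_vec_nth, of "real n" i]
    by (simp add: algebra_simps)
  have 2: "Ck m UNIV (\<lambda>x::R3. smooth_step (real n * (b $ i - x $ i)))" for m i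
    using Ck_smooth_step_affine[of "\<lambda>x::R3. (- real n) * x $ i" m "real n * b $ i"] 
      bounded_linear_compose[OF bounded_linear_mult_right bounded_linear_vec_nth, of "- real n" i]
    by (simp add: algebra_simps)
  show "Ck m UNIV (box_bump a b n)" for m
    unfolding box_bump_def[abs_def] UNIV_3 by (simp, intro Ck_mult 1 2 open_UNIV)
  show "compact (cbox a b)" by simp
  show "x \<in> cbox a b" if "box_bump a b n x \<noteq> 0" for x
  proof -
    have "smooth_step (real n * (x $ i - a $ i)) \<noteq> 0 \<and> smooth_step (real n * (b $ i - x $ i)) \<noteq> 0" for i
      using that unfolding box_bump_def by (auto simp: prod_zero_iff)
    then have "0 < real n * (x $ i - a $ i) \<and> 0 < real n * (b $ i - x $ i)" for i
      by (meson not_le smooth_step_0)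
    then show ?thesis by (simp add: mem_box_cart zero_less_mult_iff less_imp_le)
  qed
qed simp

lemma box_bump_range: "0 \<le> box_bump a b n x" "box_bump a b n x \<le> 1"
  unfolding box_bump_def using smooth_step_range
  by (auto intro!: prod_nonneg prod_le_1 mult_le_one)

lemma box_bump_tendsto: "(\<lambda>n. box_bump a b n x) \<longlonglongrightarrow> indicator (box a b) x"
proof -
  have s: "(\<lambda>n. smooth_step (real n * c)) \<longlonglongrightarrow> (if c > 0 then 1 else 0)" for c
  proof (cases "c > 0")
    case True
    obtain N where N: "real N * c \<ge> 1" using reals_Archimedean3[OF True] by (meson less_imp_le)
    have "smooth_step (real n * c) = 1" if "n \<ge> N" for n
      using that True N by (intro smooth_step_1) (meson mult_right_mono less_imp_le of_nat_mono order_trans)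
    then have "\<forall>\<^sub>F n in sequentially. smooth_step (real n * c) = 1" unfolding eventually_sequentially by blast
    then show ?thesis using True by (simp add: tendsto_eventually)
  next
    case False
    then have "smooth_step (real n * c) = 0" for n by (intro smooth_step_0) (simp add: mult_nonneg_nonpos)
    then show ?thesis using False by simp
  qed
  have "(\<lambda>n. box_bump a b n x) \<longlonglongrightarrow> (\<Prod>i\<in>UNIV. (if x $ i - a $ i > 0 then 1 else 0) * (if b $ i - x $ i > 0 then 1 else 0))"
    unfolding box_bump_def by (intro tendsto_prod tendsto_mult s)
  also have "(\<Prod>i\<in>UNIV. (if x $ i - a $ i > 0 then 1 else 0) * (if b $ i - x $ i > 0 then 1 else 0)) = (indicator (box a b) x :: real)"
    unfolding indicator_def mem_box_cart UNIV_3 forall_3 by auto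
  finally show ?thesis .
qed

lemma in_L2_indicator:
  assumes "A \<in> sets lebesgue" "bounded A"
  shows "in_L2 (indicator A :: R3 \<Rightarrow> real)"
proof -
  have "A \<in> lmeasurable" using assms bounded_set_imp_lmeasurable by blast
  then have "integrable lebesgue (indicator A :: R3 \<Rightarrow> real)" by (auto simp: fmeasurable_def intro!: integrable_real_indicator)
  moreover have "(\<lambda>x. (norm (indicator A x :: real))\<^sup>2) = indicator A" by (auto simp: indicator_def)
  ultimately show ?thesis unfolding in_L2_def using assms by auto
qed

lemma test_approx_indicator_box: "test_approx (indicator (box a b))"
proof (rule test_approx_limit)
  have W: "in_L2 (indicator (cbox a b) :: R3 \<Rightarrow> real)" by (intro in_L2_indicator) auto
  have b: "norm (box_bump a b n x) \<le> indicator (cbox a b) x" for n x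
  proof (cases "x \<in> cbox a b")
    case False
    have "box_bump a b n x = 0"
    proof (rule ccontr)
      assume "box_bump a b n x \<noteq> 0"
      then have "smooth_step (real n * (x $ i - a $ i)) \<noteq> 0 \<and> smooth_step (real n * (b $ i - x $ i)) \<noteq> 0" for i
        unfolding box_bump_def by (auto simp: prod_zero_iff)
      then have "0 < real n * (x $ i - a $ i) \<and> 0 < real n * (b $ i - x $ i)" for i
        by (meson not_le smooth_step_0)
      then show False using False by (simp add: mem_box_cart zero_less_mult_iff less_imp_le)
    qed
    then show ?thesis by simp
  qed (simp add: box_bump_range abs_of_nonneg)
  show "test_approx (box_bump a b n)" for n by (intro test_approx_test_function box_bump_test_function)
  show "in_L2 (indicator (box a b) :: R3 \<Rightarrow> real)" by (intro in_L2_indicator) auto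
  show "(\<lambda>n. L2_norm (\<lambda>x. box_bump a b n x - indicator (box a b) x)) \<longlonglongrightarrow> 0"
    by (rule L2_dominated_convergence(2)[OF W _ _ b box_bump_tendsto])
       (auto intro!: in_L2D(1) test_function_in_L2(1)[OF box_bump_test_function] in_L2_indicator)
qed

text \<open>Open boxes generate the Borel sets and are stable under intersection, so it suffices to pass to
  relative complements and disjoint unions. Intersecting with a fixed box keeps all indicators in
  \<open>L\<^sup>2\<close>.\<close>

lemma test_approx_indicator:
  assumes "A \<in> sets borel"
  shows "test_approx (indicator (A \<inter> box a b))"
proof -
  let ?E = "range (\<lambda>(a, b). box a b :: R3 set)"
  have in2: "in_L2 (indicator (A \<inter> box a b) :: R3 \<Rightarrow> real)" if "A \<in> sigma_sets UNIV ?E" for A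
  proof (rule in_L2_indicator)
    have "A \<in> sets borel" using that unfolding borel_eq_box[where 'a=R3] by (simp add: sets_measure_of)
    then have "A \<inter> box a b \<in> sets borel" by simp
    then show "A \<inter> box a b \<in> sets lebesgue" by (metis sets_completionI_sets sets_lborel)
  qed (auto intro: bounded_subset[OF bounded_box])
  have "Int_stable ?E" by (auto simp: Int_stable_def image_iff box_Int_box)
  moreover have "?E \<subseteq> Pow UNIV" by simp
  moreover have "A \<in> sigma_sets UNIV ?E"
    using assms unfolding borel_eq_box[where 'a=R3] by (simp add: sets_measure_of)
  ultimately show ?thesis
  proof (induction rule: sigma_sets_induct_disjoint)
    case (basic A)
    then obtain c d where "A = box c d" by auto
    then show ?case by (auto simp: box_Int_box test_approx_indicator_box)
  next
    case empty
    then show ?case using test_approx_scale[OF test_approx_indicator_box[of a b], of 0] by simp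
  next
    case (compl A)
    have "test_approx (\<lambda>x. indicator (box a b) x + (-1) * indicator (A \<inter> box a b) x)"
      by (intro test_approx_add test_approx_scale compl test_approx_indicator_box)
    also have "(\<lambda>x. indicator (box a b) x + (-1) * indicator (A \<inter> box a b) x) = (indicator ((UNIV - A) \<inter> box a b) :: R3 \<Rightarrow> real)"
      by (auto simp: indicator_def)
    finally show ?case .
  next
    case (union A)
    have fin: "test_approx (\<lambda>x. \<Sum>i<n. indicator (A i \<inter> box a b) x)" for n
    proof (induction n)
      case 0 then show ?case using test_approx_scale[OF test_approx_indicator_box[of a b], of 0] by simp
    qed (auto intro: test_approx_add union)
    have eq: "(\<Sum>i<n. indicator (A i \<inter> box a b) x) = (indicator ((\<Union>i<n. A i) \<inter> box a b) x :: real)" for n x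
      using union(1) by (simp add: indicator_inter_arith sum_distrib_right[symmetric] indicator_UN_disjoint 
          disjoint_family_on_mono[of "{..<n}" UNIV])
    have W: "in_L2 (indicator (box a b) :: R3 \<Rightarrow> real)" by (intro in_L2_indicator) auto
    have "sigma_sets UNIV ?E = sets borel" unfolding borel_eq_box[where 'a=R3] by (simp add: sets_measure_of)
    then have Am: "A i \<in> sets borel" for i using union(2) by auto
    show ?case
    proof (rule test_approx_limit[OF fin in2])
      show "\<Union> (range A) \<in> sigma_sets UNIV ?E" using union(2) by (auto intro: sigma_sets.Union)
      have lim: "(\<lambda>n. indicator ((\<Union>i<n. A i) \<inter> box a b) x) \<longlonglongrightarrow> (indicator (\<Union> (range A) \<inter> box a b) x :: real)" for x
      proof (cases "x \<in> \<Union> (range A)")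
        case True
        then obtain i where i: "x \<in> A i" by auto
        have "\<forall>\<^sub>F n in sequentially. indicator ((\<Union>i<n. A i) \<inter> box a b) x = (indicator (\<Union> (range A) \<inter> box a b) x :: real)"
          unfolding eventually_sequentially by (rule exI[of _ "Suc i"]) (use i in \<open>auto simp: indicator_def\<close>)
        then show ?thesis by (rule tendsto_eventually)
      qed (auto simp: indicator_def)
      show "(\<lambda>n. L2_norm (\<lambda>x. (\<Sum>i<n. indicator (A i \<inter> box a b) x) - (indicator (\<Union> (range A) \<inter> box a b) x :: real))) \<longlonglongrightarrow> 0"
        unfolding eq
        by (rule L2_dominated_convergence(2)[OF W _ _ _ lim])
             (use Am in \<open>auto simp: indicator_inter_arith intro!: borel_imp_lebesgue_measurable mult_left_le_one_le\<close>)
    qed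
  qed
qed

text \<open>A square integrable function is the limit of simple functions cut off to growing boxes, dominated
  by \<open>2 \<bar>g\<bar>\<close>.\<close>

lemma test_functions_dense:
  fixes f :: "R3 \<Rightarrow> real"
  assumes "in_L2 f"
  shows "test_approx f"
proof -
  obtain g where g: "g \<in> borel_measurable lborel" "AE x in lborel. f x = g x"
    using completion_ex_borel_measurable_real[OF in_L2D(1)[OF assms]] by blast
  have gm [measurable]: "g \<in> borel_measurable lebesgue" by (rule measurable_completion[OF g(1)])
  have AE: "AE x in lebesgue. f x = g x" using AE_completion[OF g(2)] .
  have g2: "in_L2 g"
    unfolding in_L2_def
  proof
    show "integrable lebesgue (\<lambda>x. (norm (g x))\<^sup>2)"
      by (rule integrable_cong_AE_imp[OF in_L2D(2)[OF assms]]) (use AE in auto)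
  qed measurable
  obtain s where s: "\<And>i. simple_function lborel (s i)" "\<And>x. (\<lambda>i. s i x) \<longlonglongrightarrow> g x" "\<And>i x. \<bar>s i x\<bar> \<le> 2 * \<bar>g x\<bar>"
    using borel_measurable_implies_sequence_metric[OF g(1), of 0] by (auto simp: dist_real_def)
  define B where "B n = (box (\<chi> i. - real n) (\<chi> i. real n) :: R3 set)" for n
  define F where "F n x = s n x * indicator (B n) x" for n :: nat and x :: R3
  have Fa: "test_approx (F n)" for n
  proof -
    have fin: "finite (s n ` UNIV)" using s(1)[of n] unfolding simple_function_def by simp
    have "F n = (\<lambda>x. \<Sum>y\<in>s n ` UNIV. y * indicator (s n -` {y} \<inter> B n) x)"
    proof
      fix x
      have "(\<Sum>y\<in>s n ` UNIV. y * indicator (s n -` {y} \<inter> B n) x) = (\<Sum>y\<in>s n ` UNIV. if y = s n x then s n x * indicator (B n) x else 0)"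
        by (rule sum.cong) (auto simp: indicator_def)
      then show "F n x = (\<Sum>y\<in>s n ` UNIV. y * indicator (s n -` {y} \<inter> B n) x)"
        using fin by (simp add: F_def)
    qed
    moreover have "test_approx (\<lambda>x. \<Sum>y\<in>S. y * indicator (s n -` {y} \<inter> B n) x)" if "finite S" for S
      using that
    proof induction
      case empty then show ?case using test_approx_scale[OF test_approx_indicator_box[of 0 0], of 0] by simp
    next
      case (insert y S)
      have "s n -` {y} \<in> sets borel"
        using simple_functionD(2)[OF s(1)[of n], of "{y}"] by simp
      then have "test_approx (\<lambda>x. y * indicator (s n -` {y} \<inter> B n) x)"
        unfolding B_def by (intro test_approx_scale test_approx_indicator)
      from test_approx_add[OF this insert(3)] show ?case unfolding sum.insert[OF insert(1,2)] .
    qed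
    ultimately show ?thesis using fin by simp
  qed
  have "test_approx g"
  proof (rule test_approx_limit[OF Fa g2])
    have W: "in_L2 (\<lambda>x. 2 * \<bar>g x\<bar>)" using in_L2_scaleR[OF g2, of 2] by (auto simp: in_L2_def power_mult_distrib)
    have lim: "(\<lambda>n. F n x) \<longlonglongrightarrow> g x" for x
    proof -
      obtain N where N: "real N > norm x" using reals_Archimedean2 by blast
      have "indicator (B n) x = (1::real)" if "n \<ge> N" for n
      proof -
        have "\<bar>x $ i\<bar> < real n" for i
          using N of_nat_mono[OF that, where 'a=real] component_le_norm_cart[of x i] by linarith
        then show ?thesis unfolding B_def indicator_def mem_box_cart by (simp add: abs_less_iff minus_less_iff)
      qed
      then have "\<forall>\<^sub>F n in sequentially. s n x = F n x"
        unfolding eventually_sequentially F_def by (intro exI[of _ N]) simp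
      from Lim_transform_eventually[OF s(2)[of x] this] show ?thesis .
    qed
    have "\<bar>F n x\<bar> \<le> 2 * \<bar>g x\<bar>" for n x using s(3)[of n x] by (auto simp: F_def indicator_def)
    then show "(\<lambda>n. L2_norm (\<lambda>x. F n x - g x)) \<longlonglongrightarrow> 0"
      by (intro L2_dominated_convergence(2)[OF W _ _ _ lim]) (use Fa in \<open>auto simp: test_approx_def in_L2_def\<close>)
  qed
  moreover have "L2_norm (\<lambda>x. f x - p x) = L2_norm (\<lambda>x. g x - p x)" if "test_function UNIV p" for p
    unfolding L2_norm_def
    by (rule arg_cong[where f=sqrt], rule integral_cong_AE)
       (use AE in_L2D(1)[OF assms] in_L2D(1)[OF test_function_in_L2(1)[OF that]] in auto)
  ultimately show ?thesis unfolding test_approx_def using assms by metis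
qed

lemma integral_lebesgue_lborel: 
  fixes f :: "'a::euclidean_space \<Rightarrow> 'b::{banach, second_countable_topology}"
  shows "f \<in> borel_measurable borel \<Longrightarrow> (LINT x|lebesgue. f x) = (LINT x|lborel. f x)"
  by (rule integral_completion) simp

lemma integrable_lebesgue_lborel: 
  fixes f :: "'a::euclidean_space \<Rightarrow> 'b::{banach, second_countable_topology}"
  shows "f \<in> borel_measurable borel \<Longrightarrow> integrable lebesgue f \<longleftrightarrow> integrable lborel f"
  by (rule integrable_completion) simp

text \<open>Fubini is applied on products of \<open>lborel\<close>, where Lebesgue measurability of the factors is not
  enough; there functions are replaced by Borel measurable versions.\<close>

lemma borel_version:
  fixes f :: "R3 \<Rightarrow> 'b::euclidean_space"
  assumes "f \<in> borel_measurable lebesgue"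
  obtains f' where "f' \<in> borel_measurable borel" "AE x in lebesgue. f x = f' x"
proof -
  have "\<exists>h\<in>borel_measurable lborel. AE x in lborel. f x \<bullet> b = h x" for b
    by (rule completion_ex_borel_measurable_real) (use assms in measurable)
  then obtain h where h: "\<And>b. h b \<in> borel_measurable lborel" "\<And>b. AE x in lborel. f x \<bullet> b = h b x" by metis
  have "AE x in lborel. \<forall>b\<in>Basis. f x \<bullet> b = h b x" using h(2) by (intro AE_finite_allI) auto
  then have ae: "AE x in lborel. f x = (\<Sum>b\<in>Basis. h b x *\<^sub>R b)"
  proof eventually_elim
    fix x assume *: "\<forall>b\<in>Basis. f x \<bullet> b = h b x"
    have "f x = (\<Sum>b\<in>Basis. (f x \<bullet> b) *\<^sub>R b)" by (rule euclidean_representation[symmetric])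
    also have "\<dots> = (\<Sum>b\<in>Basis. h b x *\<^sub>R b)" using * by (intro sum.cong) auto
    finally show "f x = (\<Sum>b\<in>Basis. h b x *\<^sub>R b)" .
  qed
  have m: "(\<lambda>x. \<Sum>b\<in>Basis. h b x *\<^sub>R b) \<in> borel_measurable borel"
    using h(1) by (intro borel_measurable_sum borel_measurable_scaleR) auto
  show ?thesis by (rule that[OF m]) (use ae in \<open>rule AE_completion\<close>)
qed

lemma in_L2_cong_AE:
  assumes "in_L2 f" "AE x in lebesgue. f x = f' x" "f' \<in> borel_measurable borel"
  shows "in_L2 f'"
  unfolding in_L2_def
proof
  show m: "f' \<in> borel_measurable lebesgue" by (rule borel_imp_lebesgue_measurable[OF assms(3)])
  show "integrable lebesgue (\<lambda>x. (norm (f' x))\<^sup>2)"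
    by (rule integrable_cong_AE_imp[OF in_L2D(2)[OF assms(1)]]) (use assms m in auto)
qed

lemma L2_inner_cong_AE:
  assumes "in_L2 f" "AE x in lebesgue. f x = f' x" "f' \<in> borel_measurable borel" "\<phi> \<in> borel_measurable borel"
  shows "L2_inner f \<phi> = L2_inner f' \<phi>"
  unfolding L2_inner_def
  by (rule integral_cong_AE)
     (use assms in_L2D(1)[OF assms(1)] borel_imp_lebesgue_measurable[OF assms(3)] borel_imp_lebesgue_measurable[OF assms(4)] in auto)

lemma L2_sigma_cong_AE:
  assumes "L2_sigma f" "AE x in lebesgue. f x = f' x" "f' \<in> borel_measurable borel"
  shows "L2_sigma f'"
  unfolding L2_sigma_def
proof (intro conjI allI impI)
  have f: "in_L2 f" using assms(1) by (simp add: L2_sigma_def)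
  show "in_L2 f'" by (rule in_L2_cong_AE[OF f assms(2,3)])
  fix \<phi> :: "R3 \<Rightarrow> real" assume \<phi>: "test_function UNIV \<phi>"
  have "L2_inner f (gradient \<phi>) = L2_inner f' (gradient \<phi>)"
    by (rule L2_inner_cong_AE[OF f assms(2,3) gradient_measurable[OF test_function_Ck[OF \<phi>]]])
  then show "L2_inner f' (gradient \<phi>) = 0" using assms(1) \<phi> by (simp add: L2_sigma_def)
qed

text \<open>Since Lebesgue measure is complete, \<open>F\<close> inherits measurability from \<open>G\<close>.\<close>

lemma lebesgue_integral_cong_AE_total:
  fixes F G :: "real \<Rightarrow> real"
  assumes "G \<in> borel_measurable lebesgue" "AE t in lebesgue. G t = F t"
  shows "integral\<^sup>L lebesgue F = integral\<^sup>L lebesgue G"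
  using borel_measurable_AE[OF assms] assms by (intro integral_cong_AE) auto

lemma bounded_continuous_set_integrable:
  assumes "continuous_on {a..b} (f :: real \<Rightarrow> real)"
  shows "set_integrable lebesgue {a..b} f"
  using borel_integrable_atLeastAtMost'[OF assms]
  unfolding set_integrable_def by (subst integrable_completion) (auto dest: borel_measurable_integrable)

section \<open>Pairings with the convection term\<close>

lemma norm_matrix_vector_le: "norm (A *v x) \<le> norm A * norm (x :: real^'n)" for A :: "real^'n^'m"
proof -
  have "norm (A *v x) = L2_set (\<lambda>i. norm (A $ i \<bullet> x)) UNIV"
    by (simp add: norm_vec_def matrix_vector_mul_component)
  also have "\<dots> \<le> L2_set (\<lambda>i. norm (A $ i) * norm x) UNIV"
    by (intro L2_set_mono) (auto simp: Cauchy_Schwarz_ineq2)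
  also have "\<dots> = norm A * norm x"
    by (simp add: L2_set_left_distrib norm_vec_def[of A])
  finally show ?thesis .
qed

text \<open>The reason is \<open>2 \<langle>F, \<psi>\<rangle> - \<parallel>\<psi>\<parallel>\<^sup>2 = \<parallel>F\<parallel>\<^sup>2 - \<parallel>F - \<psi>\<parallel>\<^sup>2\<close> together with density. If \<open>F\<close> depends on a
  parameter, this exhibits its squared norm as a supremum of pairings with test functions, hence
  as lower semicontinuous when these pairings are continuous.\<close>

lemma test_function_sup_L2_norm:
  assumes "in_L2 F"
  shows "(\<exists>\<psi>. test_function UNIV \<psi> \<and> r < 2 * L2_inner F \<psi> - (L2_norm \<psi>)\<^sup>2) \<longleftrightarrow> r < (L2_norm (F :: R3 \<Rightarrow> real))\<^sup>2"
proof -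
  have eq: "2 * L2_inner F \<psi> - (L2_norm \<psi>)\<^sup>2 = (L2_norm F)\<^sup>2 - (L2_norm (\<lambda>x. F x - \<psi> x))\<^sup>2" if "in_L2 \<psi>" for \<psi>
    unfolding L2_norm_power2 L2_inner_def
    using in_L2D(2)[OF assms] in_L2D(2)[OF that] integrable_inner_L2[OF assms that]
    by (simp add: power2_diff mult.assoc)
  show ?thesis
  proof safe
    fix \<psi> :: "R3 \<Rightarrow> real"
    assume "test_function UNIV \<psi>" "r < 2 * L2_inner F \<psi> - (L2_norm \<psi>)\<^sup>2"
    then show "r < (L2_norm F)\<^sup>2"
      using eq[OF test_function_in_L2(1), of UNIV \<psi>] zero_le_power2[of "L2_norm (\<lambda>x. F x - \<psi> x)"] by linarith
  next
    assume r: "r < (L2_norm F)\<^sup>2"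
    then obtain \<psi> where \<psi>: "test_function UNIV \<psi>" "L2_norm (\<lambda>x. F x - \<psi> x) < sqrt ((L2_norm F)\<^sup>2 - r)"
      using test_functions_dense[OF assms] unfolding test_approx_def by (meson diff_gt_0_iff_gt real_sqrt_gt_zero)
    then have "(L2_norm (\<lambda>x. F x - \<psi> x))\<^sup>2 < (sqrt ((L2_norm F)\<^sup>2 - r))\<^sup>2"
      by (intro power_strict_mono) (auto simp: L2_norm_nonneg)
    then have "(L2_norm (\<lambda>x. F x - \<psi> x))\<^sup>2 < (L2_norm F)\<^sup>2 - r" using r by simp
    then show "\<exists>\<psi>. test_function UNIV \<psi> \<and> r < 2 * L2_inner F \<psi> - (L2_norm \<psi>)\<^sup>2"
      using \<psi>(1) eq[OF test_function_in_L2(1)[OF \<psi>(1)]] by (intro exI[of _ \<psi>]) auto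
  qed
qed

lemma in_L2_bounded_mult:
  fixes f :: "R3 \<Rightarrow> real" and g :: "R3 \<Rightarrow> 'b::euclidean_space"
  assumes "in_L2 g" "f \<in> borel_measurable lebesgue" "\<And>x. \<bar>f x\<bar> \<le> C"
  shows "in_L2 (\<lambda>x. f x *\<^sub>R g x)"
proof (rule in_L2_bound(1)[OF in_L2_scaleR[OF assms(1), of C]])
  show "(\<lambda>x. f x *\<^sub>R g x) \<in> borel_measurable lebesgue"
    using assms(2) in_L2D(1)[OF assms(1)] by measurable
  show "norm (f x *\<^sub>R g x) \<le> norm (C *\<^sub>R g x)" for x
    using assms(3)[of x] by (auto intro!: mult_right_mono)
qed

text \<open>The features of a Leray-Hopf solution from which the Duhamel identity is derived. The Borel set
  \<open>T\<close> of full measure in \<open>{0..}\<close> consists of times at which \<open>Du\<close> is the weak gradient of \<open>u\<close>.\<close>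

locale weak_solution =
  fixes u :: "real \<Rightarrow> R3 \<Rightarrow> R3" and Du :: "real \<Rightarrow> R3 \<Rightarrow> real^3^3" and p :: "(real \<times> R3 \<Rightarrow> real) \<Rightarrow> real"
    and E :: real and T :: "real set"
  assumes u_L2: "0 \<le> t \<Longrightarrow> in_L2 (u t)"
    and u_bound: "0 \<le> t \<Longrightarrow> L2_norm (u t) \<le> E"
    and u_weakly_continuous: "in_L2 g \<Longrightarrow> continuous_on {0..} (\<lambda>t. L2_inner (u t) g)"
    and T_borel: "T \<in> sets borel" and T_nonneg: "t \<in> T \<Longrightarrow> 0 \<le> t"
    and T_full: "AE t in lebesgue. 0 \<le> t \<longrightarrow> t \<in> T"
    and Du_L2: "t \<in> T \<Longrightarrow> in_L2 (Du t)" and Du_grad: "t \<in> T \<Longrightarrow> weak_gradient (u t) (Du t)"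
    and Du_square_integrable: "set_integrable lebesgue {0..} (\<lambda>t. (L2_norm (Du t))\<^sup>2)"
    and NS: "navier_stokes_distributional u Du p"
begin

definition convection :: "real \<Rightarrow> R3 \<Rightarrow> R3" where
  "convection t x = Du t x *v u t x"

lemma E_nonneg: "0 \<le> E"
  using u_bound[of 0] L2_norm_nonneg[of "u 0"] by simp

text \<open>Weak continuity of \<open>u\<close> pairs with strong continuity of \<open>\<Psi>\<close>, which dominated convergence extracts
  from pointwise continuity.\<close>

lemma inner_continuous:
  fixes P :: "'z::euclidean_space set" and \<Psi> :: "'z \<Rightarrow> R3 \<Rightarrow> R3" and W :: "R3 \<Rightarrow> real"
  assumes "in_L2 W" "continuous_on P \<sigma>" "\<And>p. p \<in> P \<Longrightarrow> 0 \<le> \<sigma> p"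
    "\<And>p. p \<in> P \<Longrightarrow> \<Psi> p \<in> borel_measurable lebesgue"
    "\<And>p x. p \<in> P \<Longrightarrow> norm (\<Psi> p x) \<le> W x" "\<And>x. continuous_on P (\<lambda>p. \<Psi> p x)"
  shows "continuous_on P (\<lambda>p. L2_inner (u (\<sigma> p)) (\<Psi> p))"
proof (rule continuous_on_sequentiallyI)
  fix q :: "nat \<Rightarrow> 'z" and a assume q: "\<forall>n. q n \<in> P" "a \<in> P" "q \<longlonglongrightarrow> a"
  have L2: "in_L2 (\<Psi> p)" if "p \<in> P" for p
    by (rule in_L2_bound(1)[OF assms(1)]) (use assms(4) that order_trans[OF assms(5) abs_ge_self] in auto)
  have lim: "(\<lambda>n. \<Psi> (q n) x) \<longlonglongrightarrow> \<Psi> a x" for x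
    using continuous_on_tendsto_compose[OF assms(6) q(3,2)] q(1) by auto
  have 1: "(\<lambda>n. L2_norm (\<lambda>x. \<Psi> (q n) x - \<Psi> a x)) \<longlonglongrightarrow> 0"
    by (rule L2_dominated_convergence(2)[OF assms(1) _ _ _ lim]) (use assms(4,5) q in auto)
  have 2: "(\<lambda>n. L2_inner (u (\<sigma> (q n))) (\<Psi> a)) \<longlonglongrightarrow> L2_inner (u (\<sigma> a)) (\<Psi> a)"
  proof (rule continuous_on_tendsto_compose[OF u_weakly_continuous[OF L2[OF q(2)]]])
    show "(\<lambda>n. \<sigma> (q n)) \<longlonglongrightarrow> \<sigma> a" using continuous_on_tendsto_compose[OF assms(2) q(3,2)] q(1) by auto
  qed (use assms(3) q in auto)
  have 3: "(\<lambda>n. L2_inner (u (\<sigma> (q n))) (\<lambda>x. \<Psi> (q n) x - \<Psi> a x)) \<longlonglongrightarrow> 0"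
  proof (rule Lim_null_comparison)
    show "\<forall>\<^sub>F n in sequentially. norm (L2_inner (u (\<sigma> (q n))) (\<lambda>x. \<Psi> (q n) x - \<Psi> a x)) \<le> E * L2_norm (\<lambda>x. \<Psi> (q n) x - \<Psi> a x)"
    proof (intro always_eventually allI)
      fix n
      have s: "0 \<le> \<sigma> (q n)" using assms(3) q by auto
      have "\<bar>L2_inner (u (\<sigma> (q n))) (\<lambda>x. \<Psi> (q n) x - \<Psi> a x)\<bar> \<le> L2_norm (u (\<sigma> (q n))) * L2_norm (\<lambda>x. \<Psi> (q n) x - \<Psi> a x)"
        using q by (intro abs_L2_inner_le u_L2[OF s] in_L2_diff L2) auto
      also have "\<dots> \<le> E * L2_norm (\<lambda>x. \<Psi> (q n) x - \<Psi> a x)"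
        by (intro mult_right_mono u_bound[OF s] L2_norm_nonneg)
      finally show "norm (L2_inner (u (\<sigma> (q n))) (\<lambda>x. \<Psi> (q n) x - \<Psi> a x)) \<le> E * L2_norm (\<lambda>x. \<Psi> (q n) x - \<Psi> a x)" by simp
    qed
    show "(\<lambda>n. E * L2_norm (\<lambda>x. \<Psi> (q n) x - \<Psi> a x)) \<longlonglongrightarrow> 0" using tendsto_mult[OF tendsto_const 1, of E] by simp
  qed
  have "L2_inner (u (\<sigma> (q n))) (\<lambda>x. \<Psi> (q n) x - \<Psi> a x) + L2_inner (u (\<sigma> (q n))) (\<Psi> a) = L2_inner (u (\<sigma> (q n))) (\<Psi> (q n))" for n
    using q assms(3) by (subst L2_inner_diff_right) (auto intro!: u_L2 L2)
  then show "(\<lambda>n. L2_inner (u (\<sigma> (q n))) (\<Psi> (q n))) \<longlonglongrightarrow> L2_inner (u (\<sigma> a)) (\<Psi> a)"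
    using tendsto_add[OF 3 2] by simp
qed

text \<open>Here \<open>u\<close> and \<open>Du\<close> are not known to be measurable in time and space jointly. By polarization the
  pairing is a difference of squared norms of \<open>D\<^sub>j u\<^sub>i \<plusminus> \<phi> u\<^sub>j\<close>. Paired with a test function, the
  weak derivative moves to the test function, and what remains are pairings with \<open>u\<close> alone, which
  are continuous in the parameter; so \<open>test_function_sup_L2_norm\<close> makes the squared norms lower
  semicontinuous. Below, the parameter is either the time or a pair of a time and a point in
  space.\<close>

lemma component_pairing_measurable:
  fixes P :: "'z::euclidean_space set" and \<phi> :: "'z \<Rightarrow> R3 \<Rightarrow> real"
  assumes P: "P \<in> sets borel" "\<sigma> \<in> borel_measurable borel" "continuous_on P \<sigma>" 
    and \<phi>: "\<And>p. p \<in> P \<Longrightarrow> \<phi> p \<in> borel_measurable lebesgue"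
    "\<And>p x. p \<in> P \<Longrightarrow> \<bar>\<phi> p x\<bar> \<le> C" "\<And>x. continuous_on P (\<lambda>p. \<phi> p x)"
    and nonneg: "\<And>p. p \<in> P \<Longrightarrow> 0 \<le> \<sigma> p"
  shows "(\<lambda>p. LINT x|lebesgue. Du (\<sigma> p) x $ i $ j * (u (\<sigma> p) x $ j * \<phi> p x))
     \<in> borel_measurable (restrict_space borel {p \<in> P. \<sigma> p \<in> T})" (is "_ \<in> borel_measurable ?M")
proof -
  let ?S = "{p \<in> P. \<sigma> p \<in> T}"
  \<comment> \<open>Only \<open>c = 1\<close> and \<open>c = -1\<close> matter, for the polarization.\<close>
  define F where "F c p x = Du (\<sigma> p) x $ i $ j + c * (u (\<sigma> p) x $ j * \<phi> p x)" for c p x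
  have D2: "in_L2 (\<lambda>x. Du (\<sigma> p) x $ i $ j)" and U2: "in_L2 (\<lambda>x. u (\<sigma> p) x $ j * \<phi> p x)" if "p \<in> ?S" for p
  proof -
    show "in_L2 (\<lambda>x. Du (\<sigma> p) x $ i $ j)"
    proof (rule in_L2_bound(1)[OF Du_L2[of "\<sigma> p"]])
      have "(\<lambda>A :: real^3^3. A $ i $ j) \<in> borel_measurable borel"
        by (intro borel_measurable_continuous_onI continuous_intros)
      from measurable_compose[OF in_L2D(1)[OF Du_L2[of "\<sigma> p"]] this]
      show "(\<lambda>x. Du (\<sigma> p) x $ i $ j) \<in> borel_measurable lebesgue" using that by simp
      show "norm (Du (\<sigma> p) x $ i $ j) \<le> norm (Du (\<sigma> p) x)" for x
        using component_le_norm_cart[of "Du (\<sigma> p) x $ i" j] Finite_Cartesian_Product.norm_nth_le[of "Du (\<sigma> p) x" i] by simp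
    qed (use that in simp)
    show "in_L2 (\<lambda>x. u (\<sigma> p) x $ j * \<phi> p x)"
      using in_L2_bounded_mult[OF in_L2_component[OF u_L2[of "\<sigma> p"]] \<phi>(1), of p C j] \<phi>(2) that nonneg
      by (auto simp: mult.commute)
  qed
  have F2: "in_L2 (F c p)" if "p \<in> ?S" for c p
    using in_L2_add[OF D2[OF that] in_L2_scaleR[OF U2[OF that], of c]] by (simp add: F_def[abs_def])
  \<comment> \<open>On \<open>?S\<close> this is the pairing of \<open>F c p\<close> with \<open>\<psi>\<close>, the derivative having been moved to \<open>\<psi>\<close>; in
    this form it makes sense, and is continuous, on all of \<open>P\<close>.\<close>
  define l where "l c \<psi> p = L2_inner (u (\<sigma> p)) (\<lambda>x. (- partial j \<psi> x) *\<^sub>R axis i 1 + (c * (\<phi> p x * \<psi> x)) *\<^sub>R axis j 1)" for c \<psi> p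
  have partial: "partial j \<psi> = dd (axis j 1) \<psi>" for \<psi> :: "R3 \<Rightarrow> real" by (auto simp: partial_def dd_def)
  have l_cont: "continuous_on P (l c \<psi>)" if \<psi>: "test_function UNIV \<psi>" for c \<psi>
    unfolding l_def[abs_def]
  proof (rule inner_continuous)
    have d: "test_function UNIV (partial j \<psi>)" unfolding partial by (rule test_function_dd[OF \<psi>])
    have m [measurable]: "\<psi> \<in> borel_measurable lebesgue" "partial j \<psi> \<in> borel_measurable lebesgue"
      using in_L2D(1)[OF test_function_in_L2(1)[OF \<psi>]] in_L2D(1)[OF test_function_in_L2(1)[OF d]] by auto
    let ?W = "\<lambda>x. \<bar>partial j \<psi> x\<bar> + (\<bar>c\<bar> * \<bar>C\<bar>) *\<^sub>R \<bar>\<psi> x\<bar>"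
    have "in_L2 (\<lambda>x. \<bar>partial j \<psi> x\<bar>)" "in_L2 (\<lambda>x. \<bar>\<psi> x\<bar>)"
      using test_function_in_L2(1)[OF d] test_function_in_L2(1)[OF \<psi>] by (auto simp: in_L2_def)
    then show "in_L2 ?W" by (intro in_L2_add in_L2_scaleR)
    fix p assume p: "p \<in> P"
    have [measurable]: "\<phi> p \<in> borel_measurable lebesgue" using \<phi>(1)[OF p] .
    show "(\<lambda>x. (- partial j \<psi> x) *\<^sub>R axis i 1 + (c * (\<phi> p x * \<psi> x)) *\<^sub>R axis j 1 :: R3) \<in> borel_measurable lebesgue"
      by measurable
    show "norm ((- partial j \<psi> x) *\<^sub>R axis i 1 + (c * (\<phi> p x * \<psi> x)) *\<^sub>R axis j 1 :: R3) \<le> ?W x" for x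
    proof -
      have "norm ((- partial j \<psi> x) *\<^sub>R axis i 1 + (c * (\<phi> p x * \<psi> x)) *\<^sub>R axis j 1 :: R3)
        \<le> \<bar>partial j \<psi> x\<bar> + \<bar>c * (\<phi> p x * \<psi> x)\<bar>"
        by (rule order_trans[OF norm_triangle_ineq]) (simp add: norm_axis_1)
      also have "\<bar>c * (\<phi> p x * \<psi> x)\<bar> \<le> (\<bar>c\<bar> * \<bar>C\<bar>) * \<bar>\<psi> x\<bar>"
        unfolding abs_mult mult.assoc using order_trans[OF \<phi>(2)[OF p] abs_ge_self]
        by (intro mult_left_mono mult_right_mono) auto
      finally show ?thesis by simp
    qed
  next
    show "continuous_on P (\<lambda>p. (- partial j \<psi> x) *\<^sub>R axis i 1 + (c * (\<phi> p x * \<psi> x)) *\<^sub>R axis j 1 :: R3)" for x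
      by (intro continuous_intros \<phi>(3))
  qed (use P nonneg in auto)
  have l_eq: "l c \<psi> p = L2_inner (F c p) \<psi>" if \<psi>: "test_function UNIV \<psi>" and p: "p \<in> ?S" for c \<psi> p
  proof -
    have d: "test_function UNIV (partial j \<psi>)" unfolding partial by (rule test_function_dd[OF \<psi>])
    have ui: "in_L2 (\<lambda>x. u (\<sigma> p) x $ i)" using p nonneg by (intro in_L2_component u_L2) auto
    have i1: "integrable lebesgue (\<lambda>x. u (\<sigma> p) x $ i * partial j \<psi> x)"
      using integrable_inner_L2[OF ui test_function_in_L2(1)[OF d]] by simp
    have i2: "integrable lebesgue (\<lambda>x. (u (\<sigma> p) x $ j * \<phi> p x) * \<psi> x)"
      using integrable_inner_L2[OF U2[OF p] test_function_in_L2(1)[OF \<psi>]] by simp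
    have i3: "integrable lebesgue (\<lambda>x. Du (\<sigma> p) x $ i $ j * \<psi> x)"
      using integrable_inner_L2[OF D2[OF p] test_function_in_L2(1)[OF \<psi>]] by simp
    have g: "(LINT x|lebesgue. u (\<sigma> p) x $ i * partial j \<psi> x) = - (LINT x|lebesgue. Du (\<sigma> p) x $ i $ j * \<psi> x)"
      using Du_grad[of "\<sigma> p"] p \<psi> unfolding weak_gradient_def by auto
    have "l c \<psi> p = (LINT x|lebesgue. c * ((u (\<sigma> p) x $ j * \<phi> p x) * \<psi> x) - u (\<sigma> p) x $ i * partial j \<psi> x)"
      unfolding l_def L2_inner_def
      by (intro Bochner_Integration.integral_cong refl) (simp add: inner_add_right inner_axis algebra_simps)
    also have "\<dots> = c * (LINT x|lebesgue. (u (\<sigma> p) x $ j * \<phi> p x) * \<psi> x) + (LINT x|lebesgue. Du (\<sigma> p) x $ i $ j * \<psi> x)"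
      using i1 i2 g by simp
    also have "\<dots> = L2_inner (F c p) \<psi>"
      unfolding F_def L2_inner_def using i2 i3 by (simp add: distrib_right mult.assoc)
    finally show ?thesis .
  qed
  have q: "(\<lambda>p. (L2_norm (F c p))\<^sup>2) \<in> borel_measurable ?M" for c
    unfolding borel_measurable_iff_greater
  proof
    fix r
    \<comment> \<open>The superlevel set of a supremum of continuous functions is relatively open.\<close>
    have "openin (top_of_set P) (\<Union>\<psi>\<in>{\<psi>. test_function UNIV \<psi>}. P \<inter> (\<lambda>p. 2 * l c \<psi> p - (L2_norm \<psi>)\<^sup>2) -` {r<..})"
      by (intro openin_Union) (auto intro!: continuous_openin_preimage_gen continuous_intros l_cont)
    then obtain V where V: "open V" "(\<Union>\<psi>\<in>{\<psi>. test_function UNIV \<psi>}. P \<inter> (\<lambda>p. 2 * l c \<psi> p - (L2_norm \<psi>)\<^sup>2) -` {r<..}) = P \<inter> V"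
      unfolding openin_open by auto
    have "r < (L2_norm (F c p))\<^sup>2 \<longleftrightarrow> p \<in> V" if "p \<in> ?S" for p
    proof -
      have "r < (L2_norm (F c p))\<^sup>2 \<longleftrightarrow> p \<in> (\<Union>\<psi>\<in>{\<psi>. test_function UNIV \<psi>}. P \<inter> (\<lambda>p. 2 * l c \<psi> p - (L2_norm \<psi>)\<^sup>2) -` {r<..})"
        unfolding test_function_sup_L2_norm[OF F2[OF that], symmetric] using that l_eq by auto
      then show ?thesis unfolding V(2) using that by simp
    qed
    then have "{p \<in> space ?M. r < (L2_norm (F c p))\<^sup>2} = V \<inter> space ?M" by (auto simp: space_restrict_space)
    also have "\<dots> \<in> sets ?M" using V(1) by (auto simp: sets_restrict_space space_restrict_space)
    finally show "{p \<in> space ?M. r < (L2_norm (F c p))\<^sup>2} \<in> sets ?M" .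
  qed
  have eq: "(LINT x|lebesgue. Du (\<sigma> p) x $ i $ j * (u (\<sigma> p) x $ j * \<phi> p x)) = ((L2_norm (F 1 p))\<^sup>2 - (L2_norm (F (-1) p))\<^sup>2) / 4"
    if p: "p \<in> ?S" for p
  proof -
    have "(L2_norm (F 1 p))\<^sup>2 - (L2_norm (F (-1) p))\<^sup>2 = (LINT x|lebesgue. (norm (F 1 p x))\<^sup>2 - (norm (F (-1) p x))\<^sup>2)"
      unfolding L2_norm_power2 using in_L2D(2)[OF F2[OF p]] by simp
    also have "\<dots> = (LINT x|lebesgue. 4 * (Du (\<sigma> p) x $ i $ j * (u (\<sigma> p) x $ j * \<phi> p x)))"
      by (intro Bochner_Integration.integral_cong refl) (simp add: F_def power2_eq_square algebra_simps)
    finally show ?thesis by simp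
  qed
  have "(\<lambda>p. ((L2_norm (F 1 p))\<^sup>2 - (L2_norm (F (-1) p))\<^sup>2) / 4) \<in> borel_measurable ?M"
    using q by measurable
  then show ?thesis by (subst measurable_cong) (auto simp: space_restrict_space eq)
qed

lemma convection_L1:
  assumes "t \<in> T"
  shows "convection t \<in> borel_measurable lebesgue" "integrable lebesgue (\<lambda>x. norm (convection t x))"
    "(LINT x|lebesgue. norm (convection t x)) \<le> E * L2_norm (Du t)"
proof -
  have t: "0 \<le> t" using T_nonneg[OF assms] .
  have "(\<lambda>z :: (real^3^3) \<times> R3. fst z *v snd z) \<in> borel_measurable borel"
    by (intro borel_measurable_continuous_onI)
       (auto simp: matrix_vector_mult_def intro!: continuous_intros)
  then have b: "(\<lambda>z :: (real^3^3) \<times> R3. fst z *v snd z) \<in> borel_measurable (borel \<Otimes>\<^sub>M borel)"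
    by (simp add: borel_prod)
  show m: "convection t \<in> borel_measurable lebesgue"
    using measurable_compose[OF measurable_Pair[OF in_L2D(1)[OF Du_L2[OF assms]] in_L2D(1)[OF u_L2[OF t]]] b]
    by (simp add: convection_def[abs_def])
  have le: "norm (convection t x) \<le> norm (Du t x) * norm (u t x)" for x unfolding convection_def by (rule norm_matrix_vector_le)
  show int: "integrable lebesgue (\<lambda>x. norm (convection t x))"
    by (rule Bochner_Integration.integrable_bound[OF L2_Cauchy_Schwarz(1)[OF Du_L2[OF assms] u_L2[OF t]]])
       (use m le in \<open>auto intro!: AE_I2\<close>)
  have "(LINT x|lebesgue. norm (convection t x)) \<le> (LINT x|lebesgue. norm (Du t x) * norm (u t x))"
    by (intro integral_mono int le L2_Cauchy_Schwarz(1)[OF Du_L2[OF assms] u_L2[OF t]])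
  also have "\<dots> \<le> L2_norm (Du t) * L2_norm (u t)"
    by (rule L2_Cauchy_Schwarz(2)[OF Du_L2[OF assms] u_L2[OF t]])
  also have "\<dots> \<le> L2_norm (Du t) * E" by (intro mult_left_mono u_bound t L2_norm_nonneg)
  finally show "(LINT x|lebesgue. norm (convection t x)) \<le> E * L2_norm (Du t)" by (simp add: mult.commute)
qed

lemma convection_pairing:
  assumes "t \<in> T" "\<phi> \<in> borel_measurable lebesgue" "\<And>x. norm (\<phi> x :: R3) \<le> C"
  shows "integrable lebesgue (\<lambda>x. convection t x \<bullet> \<phi> x)"
    "\<bar>LINT x|lebesgue. convection t x \<bullet> \<phi> x\<bar> \<le> C * (E * L2_norm (Du t))"
proof -
  have C: "0 \<le> C" using order_trans[OF norm_ge_zero assms(3)] .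
  have le: "\<bar>convection t x \<bullet> \<phi> x\<bar> \<le> C * norm (convection t x)" for x
    using mult_left_mono[OF assms(3)[of x] norm_ge_zero[of "convection t x"]] Cauchy_Schwarz_ineq2[of "convection t x" "\<phi> x"]
    by (simp add: mult.commute)
  have [measurable]: "convection t \<in> borel_measurable lebesgue" "\<phi> \<in> borel_measurable lebesgue"
    using convection_L1(1)[OF assms(1)] assms(2) by auto
  have int: "integrable lebesgue (\<lambda>x. C * norm (convection t x))" using convection_L1(2)[OF assms(1)] by simp
  show i: "integrable lebesgue (\<lambda>x. convection t x \<bullet> \<phi> x)"
    by (rule Bochner_Integration.integrable_bound[OF int]) (use le C in \<open>auto intro!: AE_I2 simp: abs_mult\<close>)
  have "\<bar>LINT x|lebesgue. convection t x \<bullet> \<phi> x\<bar> \<le> (LINT x|lebesgue. C * norm (convection t x))"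
    using Bochner_Integration.integral_norm_bound_integral[OF i int] le by simp
  also have "\<dots> \<le> C * (E * L2_norm (Du t))" using mult_left_mono[OF convection_L1(3)[OF assms(1)] C] by simp
  finally show "\<bar>LINT x|lebesgue. convection t x \<bullet> \<phi> x\<bar> \<le> C * (E * L2_norm (Du t))" .
qed

lemma convection_pairing_measurable:
  fixes P :: "'z::euclidean_space set" and \<phi> :: "'z \<Rightarrow> R3 \<Rightarrow> R3"
  assumes P: "P \<in> sets borel" "\<sigma> \<in> borel_measurable borel" "continuous_on P \<sigma>" 
    and \<phi>: "\<And>p. p \<in> P \<Longrightarrow> \<phi> p \<in> borel_measurable lebesgue"
    "\<And>p x. p \<in> P \<Longrightarrow> norm (\<phi> p x) \<le> C" "\<And>x. continuous_on P (\<lambda>p. \<phi> p x)"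
    and nonneg: "\<And>p. p \<in> P \<Longrightarrow> 0 \<le> \<sigma> p"
  shows "(\<lambda>p. indicator {p \<in> P. \<sigma> p \<in> T} p * (LINT x|lebesgue. convection (\<sigma> p) x \<bullet> \<phi> p x)) \<in> borel_measurable borel"
proof -
  let ?S = "{p \<in> P. \<sigma> p \<in> T}"
  have S: "?S \<in> sets borel"
  proof -
    have "?S = P \<inter> (\<sigma> -` T \<inter> space borel)" by auto
    then show ?thesis using P(1) measurable_sets[OF P(2) T_borel] by auto
  qed
  have c: "norm (\<phi> p x $ i) \<le> C" if "p \<in> P" for p x i
    using order_trans[OF component_le_norm_cart \<phi>(2)[OF that]] by simp
  have m: "(\<lambda>x. \<phi> p x $ i) \<in> borel_measurable lebesgue" if "p \<in> P" for p i
    by (rule measurable_compose[OF \<phi>(1)[OF that] borel_measurable_continuous_onI]) (intro continuous_intros)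
  have comp: "(\<lambda>p. LINT x|lebesgue. Du (\<sigma> p) x $ i $ j * (u (\<sigma> p) x $ j * \<phi> p x $ i)) \<in> borel_measurable (restrict_space borel ?S)" for i j
    by (rule component_pairing_measurable[OF P _ _ _ nonneg, where \<phi>="\<lambda>p x. \<phi> p x $ i" and C=C])
       (use c m \<phi>(3) in \<open>auto intro!: continuous_intros\<close>)
  have eq: "(LINT x|lebesgue. convection (\<sigma> p) x \<bullet> \<phi> p x) = 
     (\<Sum>i\<in>UNIV. \<Sum>j\<in>UNIV. LINT x|lebesgue. Du (\<sigma> p) x $ i $ j * (u (\<sigma> p) x $ j * \<phi> p x $ i))" if "p \<in> ?S" for p
  proof -
    have p: "p \<in> P" "\<sigma> p \<in> T" using that by auto
    have D2: "in_L2 (\<lambda>x. Du (\<sigma> p) x $ i $ j)" for i j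
    proof (rule in_L2_bound(1)[OF Du_L2[OF p(2)]])
      have "(\<lambda>A :: real^3^3. A $ i $ j) \<in> borel_measurable borel"
        by (intro borel_measurable_continuous_onI continuous_intros)
      from measurable_compose[OF in_L2D(1)[OF Du_L2[OF p(2)]] this]
      show "(\<lambda>x. Du (\<sigma> p) x $ i $ j) \<in> borel_measurable lebesgue" .
      show "norm (Du (\<sigma> p) x $ i $ j) \<le> norm (Du (\<sigma> p) x)" for x
        using component_le_norm_cart[of "Du (\<sigma> p) x $ i" j] Finite_Cartesian_Product.norm_nth_le[of "Du (\<sigma> p) x" i] by simp
    qed
    have U2: "in_L2 (\<lambda>x. u (\<sigma> p) x $ j * \<phi> p x $ i)" for i j
      using in_L2_bounded_mult[OF in_L2_component[OF u_L2[OF nonneg[OF p(1)]], of j] m[OF p(1), of i], of C] c[OF p(1)]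
      by (auto simp: mult.commute)
    have int: "integrable lebesgue (\<lambda>x. Du (\<sigma> p) x $ i $ j * (u (\<sigma> p) x $ j * \<phi> p x $ i))" for i j
      using integrable_inner_L2[OF D2 U2] by simp
    have "convection (\<sigma> p) x \<bullet> \<phi> p x = (\<Sum>i\<in>UNIV. \<Sum>j\<in>UNIV. Du (\<sigma> p) x $ i $ j * (u (\<sigma> p) x $ j * \<phi> p x $ i))" for x
      unfolding convection_def inner_vec_def matrix_vector_mult_def by (simp add: sum_distrib_right mult.assoc)
    then show ?thesis using int by (simp add: integral_sum)
  qed
  have "(\<lambda>p. \<Sum>i\<in>UNIV. \<Sum>j\<in>UNIV. LINT x|lebesgue. Du (\<sigma> p) x $ i $ j * (u (\<sigma> p) x $ j * \<phi> p x $ i)) \<in> borel_measurable (restrict_space borel ?S)"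
    by (intro borel_measurable_sum comp)
  then have "(\<lambda>p. LINT x|lebesgue. convection (\<sigma> p) x \<bullet> \<phi> p x) \<in> borel_measurable (restrict_space borel ?S)"
    by (subst measurable_cong) (auto simp: space_restrict_space eq)
  then show ?thesis using S by (subst (asm) borel_measurable_restrict_space_iff) auto
qed

context
  fixes t0 t0' :: real
  assumes t: "0 \<le> t0" "t0 < t0'"
begin

abbreviation good_times :: "real set" where "good_times \<equiv> T \<inter> {t0..t0'}"

lemma good_times_AE: "AE s in lebesgue. s \<in> {t0..t0'} \<longleftrightarrow> s \<in> good_times"
  using T_full by eventually_elim (use t in auto)

lemma Du_integrable: "set_integrable lebesgue {t0..t0'} (\<lambda>s. L2_norm (Du s))"
    "set_integrable lebesgue {t0..t0'} (\<lambda>s. (L2_norm (Du s))\<^sup>2)"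
proof -
  show 2: "set_integrable lebesgue {t0..t0'} (\<lambda>s. (L2_norm (Du s))\<^sup>2)"
    by (rule set_integrable_subset[OF Du_square_integrable]) (use t in auto)
  have m: "(\<lambda>s. indicator {t0..t0'} s * L2_norm (Du s)) \<in> borel_measurable lebesgue"
  proof -
    have "(\<lambda>s. sqrt (indicator {t0..t0'} s *\<^sub>R (L2_norm (Du s))\<^sup>2)) \<in> borel_measurable lebesgue"
      using borel_measurable_integrable[OF 2[unfolded set_integrable_def]] by measurable
    moreover have "sqrt (indicator {t0..t0'} s *\<^sub>R (L2_norm (Du s))\<^sup>2) = indicator {t0..t0'} s * L2_norm (Du s)" for s
      by (auto simp: indicator_def L2_norm_nonneg)
    ultimately show ?thesis by simp
  qed
  show "set_integrable lebesgue {t0..t0'} (\<lambda>s. L2_norm (Du s))"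
    unfolding set_integrable_def
  proof (rule Bochner_Integration.integrable_bound)
    show "integrable lebesgue (\<lambda>s. indicator {t0..t0'} s *\<^sub>R (1 + (L2_norm (Du s))\<^sup>2))"
      using Bochner_Integration.integrable_add[OF bounded_continuous_set_integrable[of t0 t0' "\<lambda>_. 1", unfolded set_integrable_def] 2[unfolded set_integrable_def]]
      by (simp add: distrib_left)
    have "L2_norm (Du s) \<le> 1 + (L2_norm (Du s))\<^sup>2" for s
      using sum_squares_bound[of 1 "L2_norm (Du s)"] L2_norm_nonneg[of "Du s"] by (simp add: power2_eq_square)
    then show "AE s in lebesgue. norm (indicator {t0..t0'} s *\<^sub>R L2_norm (Du s)) \<le> norm (indicator {t0..t0'} s *\<^sub>R (1 + (L2_norm (Du s))\<^sup>2))"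
      by (intro AE_I2) (auto simp: indicator_def L2_norm_nonneg)
  qed (use m in simp)
qed

lemma convection_pairing_time_integrable:
  fixes \<phi> :: "real \<Rightarrow> R3 \<Rightarrow> R3"
  assumes "\<And>s. s \<in> {t0..t0'} \<Longrightarrow> \<phi> s \<in> borel_measurable lebesgue" "\<And>s x. s \<in> {t0..t0'} \<Longrightarrow> norm (\<phi> s x) \<le> C"
    "\<And>x. continuous_on {t0..t0'} (\<lambda>s. \<phi> s x)"
  shows "(\<lambda>s. indicator good_times s * (LINT x|lebesgue. convection s x \<bullet> \<phi> s x)) \<in> borel_measurable borel"
    "set_integrable lebesgue {t0..t0'} (\<lambda>s. LINT x|lebesgue. convection s x \<bullet> \<phi> s x)"
proof -
  have eq: "{s \<in> {t0..t0'}. s \<in> T} = good_times" by auto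
  show m: "(\<lambda>s. indicator good_times s * (LINT x|lebesgue. convection s x \<bullet> \<phi> s x)) \<in> borel_measurable borel"
    using convection_pairing_measurable[of "{t0..t0'}" "\<lambda>s. s" \<phi> C] assms t unfolding eq by auto
  have b: "norm (indicator good_times s * (LINT x|lebesgue. convection s x \<bullet> \<phi> s x)) \<le> norm (C * E * (indicator {t0..t0'} s *\<^sub>R L2_norm (Du s)))" for s
  proof (cases "s \<in> good_times")
    case True
    then have s: "s \<in> T" "s \<in> {t0..t0'}" by auto
    have "\<bar>LINT x|lebesgue. convection s x \<bullet> \<phi> s x\<bar> \<le> C * (E * L2_norm (Du s))"
      by (rule convection_pairing(2)[OF s(1) assms(1)[OF s(2)] assms(2)[OF s(2)]])
    also have "\<dots> \<le> \<bar>C * (E * L2_norm (Du s))\<bar>" by (rule abs_ge_self)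
    finally show ?thesis using True s by (simp add: abs_mult mult.assoc)
  qed simp
  have i: "integrable lebesgue (\<lambda>s. indicator good_times s * (LINT x|lebesgue. convection s x \<bullet> \<phi> s x))"
  proof (rule Bochner_Integration.integrable_bound)
    show "integrable lebesgue (\<lambda>s. C * E * (indicator {t0..t0'} s *\<^sub>R L2_norm (Du s)))"
      using Du_integrable(1) unfolding set_integrable_def by (intro integrable_mult_right)
  qed (use borel_imp_lebesgue_measurable[OF m] b in auto)
  show "set_integrable lebesgue {t0..t0'} (\<lambda>s. LINT x|lebesgue. convection s x \<bullet> \<phi> s x)"
    unfolding set_integrable_def
  proof (rule integrable_cong_AE_imp[OF i])
    show ae: "AE s in lebesgue. indicator good_times s * (LINT x|lebesgue. convection s x \<bullet> \<phi> s x) = indicator {t0..t0'} s *\<^sub>R (LINT x|lebesgue. convection s x \<bullet> \<phi> s x)"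
      using good_times_AE by eventually_elim (auto simp: indicator_def)
    show "(\<lambda>s. indicator {t0..t0'} s *\<^sub>R (LINT x|lebesgue. convection s x \<bullet> \<phi> s x)) \<in> borel_measurable lebesgue"
      by (rule borel_measurable_AE[OF borel_imp_lebesgue_measurable[OF m] ae])
  qed
qed

lemma convection_pairing_time_limit:
  fixes \<phi> :: "nat \<Rightarrow> real \<Rightarrow> R3 \<Rightarrow> R3"
  assumes "\<And>N s. s \<in> {t0..t0'} \<Longrightarrow> \<phi> N s \<in> borel_measurable lebesgue" "\<And>N s x. s \<in> {t0..t0'} \<Longrightarrow> norm (\<phi> N s x) \<le> C"
    "\<And>N x. continuous_on {t0..t0'} (\<lambda>s. \<phi> N s x)" 
    "\<And>s. s \<in> {t0..t0'} \<Longrightarrow> \<phi>' s \<in> borel_measurable lebesgue" "\<And>x. continuous_on {t0..t0'} (\<lambda>s. \<phi>' s x)" 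
    and lim: "\<And>s x. s \<in> {t0<..<t0'} \<Longrightarrow> (\<lambda>N. \<phi> N s x) \<longlonglongrightarrow> \<phi>' s x" and C': "\<And>s x. s \<in> {t0..t0'} \<Longrightarrow> norm (\<phi>' s x) \<le> C"
  shows "(\<lambda>N. LINT s:{t0..t0'}|lebesgue. (LINT x|lebesgue. convection s x \<bullet> \<phi> N s x)) \<longlonglongrightarrow> 
     (LINT s:{t0..t0'}|lebesgue. (LINT x|lebesgue. convection s x \<bullet> \<phi>' s x))"
proof -
  note m = convection_pairing_time_integrable(2)[of "\<phi> _", OF assms(1-3)]
  have m': "set_integrable lebesgue {t0..t0'} (\<lambda>s. LINT x|lebesgue. convection s x \<bullet> \<phi>' s x)"
    by (rule convection_pairing_time_integrable(2)[OF assms(4) C' assms(5)])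
  show ?thesis
    unfolding set_lebesgue_integral_def
  proof (rule integral_dominated_convergence[where w="\<lambda>s. C * E * (indicator {t0..t0'} s *\<^sub>R L2_norm (Du s))"])
    show "(\<lambda>s. indicator {t0..t0'} s *\<^sub>R (LINT x|lebesgue. convection s x \<bullet> \<phi> N s x)) \<in> borel_measurable lebesgue" for N
      using m[of N] unfolding set_integrable_def by (rule borel_measurable_integrable)
    show "(\<lambda>s. indicator {t0..t0'} s *\<^sub>R (LINT x|lebesgue. convection s x \<bullet> \<phi>' s x)) \<in> borel_measurable lebesgue"
      using m' unfolding set_integrable_def by (rule borel_measurable_integrable)
    show "integrable lebesgue (\<lambda>s. C * E * (indicator {t0..t0'} s *\<^sub>R L2_norm (Du s)))"
      using Du_integrable(1) unfolding set_integrable_def by (intro integrable_mult_right)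
    show "AE s in lebesgue. norm (indicator {t0..t0'} s *\<^sub>R (LINT x|lebesgue. convection s x \<bullet> \<phi> N s x)) \<le> C * E * (indicator {t0..t0'} s *\<^sub>R L2_norm (Du s))" for N
      using good_times_AE
    proof eventually_elim
      fix s assume *: "s \<in> {t0..t0'} \<longleftrightarrow> s \<in> good_times"
      show "norm (indicator {t0..t0'} s *\<^sub>R (LINT x|lebesgue. convection s x \<bullet> \<phi> N s x)) \<le> C * E * (indicator {t0..t0'} s *\<^sub>R L2_norm (Du s))"
      proof (cases "s \<in> {t0..t0'}")
        case True
        then have "s \<in> T" using * by simp
        from convection_pairing(2)[OF this assms(1)[OF True] assms(2)[OF True]] show ?thesis using True by (simp add: mult.assoc)
      qed simp
    qed
    have e: "AE s in lebesgue. s \<noteq> t0 \<and> s \<noteq> t0'"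
      by (intro AE_conjI AE_completion AE_lborel_singleton)
    show "AE s in lebesgue. (\<lambda>N. indicator {t0..t0'} s *\<^sub>R (LINT x|lebesgue. convection s x \<bullet> \<phi> N s x)) \<longlonglongrightarrow> indicator {t0..t0'} s *\<^sub>R (LINT x|lebesgue. convection s x \<bullet> \<phi>' s x)"
      using good_times_AE e
    proof eventually_elim
      fix s assume *: "s \<in> {t0..t0'} \<longleftrightarrow> s \<in> good_times" and ne: "s \<noteq> t0 \<and> s \<noteq> t0'"
      show "(\<lambda>N. indicator {t0..t0'} s *\<^sub>R (LINT x|lebesgue. convection s x \<bullet> \<phi> N s x)) \<longlonglongrightarrow> indicator {t0..t0'} s *\<^sub>R (LINT x|lebesgue. convection s x \<bullet> \<phi>' s x)"
      proof (cases "s \<in> {t0..t0'}")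
        case True
        then have s: "s \<in> T" "s \<in> {t0<..<t0'}" using * ne by auto
        have [measurable]: "convection s \<in> borel_measurable lebesgue" by (rule convection_L1(1)[OF s(1)])
        have [measurable]: "\<phi> N s \<in> borel_measurable lebesgue" "\<phi>' s \<in> borel_measurable lebesgue" for N
          using assms(1,4)[OF True] by auto
        have "(\<lambda>N. LINT x|lebesgue. convection s x \<bullet> \<phi> N s x) \<longlonglongrightarrow> (LINT x|lebesgue. convection s x \<bullet> \<phi>' s x)"
        proof (rule integral_dominated_convergence[where w="\<lambda>x. C * norm (convection s x)"])
          show "integrable lebesgue (\<lambda>x. C * norm (convection s x))" using convection_L1(2)[OF s(1)] by simp
          show "AE x in lebesgue. (\<lambda>N. convection s x \<bullet> \<phi> N s x) \<longlonglongrightarrow> convection s x \<bullet> \<phi>' s x"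
            by (intro AE_I2 tendsto_intros lim s)
          have "\<bar>convection s x \<bullet> \<phi> N s x\<bar> \<le> C * norm (convection s x)" for N x
            using mult_left_mono[OF assms(2)[OF True, of N x] norm_ge_zero[of "convection s x"]] Cauchy_Schwarz_ineq2[of "convection s x" "\<phi> N s x"]
            by (simp add: mult.commute)
          then show "AE x in lebesgue. norm (convection s x \<bullet> \<phi> N s x) \<le> C * norm (convection s x)" for N by simp
        qed measurable
        then show ?thesis by (intro tendsto_intros)
      qed simp
    qed
  qed
qed

lemma good_times_integral:
  fixes F :: "real \<Rightarrow> real"
  assumes "(\<lambda>s. indicator good_times s * F s) \<in> borel_measurable borel"
  shows "(LINT s:{t0..t0'}|lebesgue. F s) = (LINT s|lborel. indicator good_times s * F s)"
proof -
  have "(LINT s:{t0..t0'}|lebesgue. F s) = (LINT s|lebesgue. indicator good_times s * F s)"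
    unfolding set_lebesgue_integral_def
  proof (rule lebesgue_integral_cong_AE_total)
    show "(\<lambda>s. indicator good_times s * F s) \<in> borel_measurable lebesgue" by (rule borel_imp_lebesgue_measurable[OF assms])
    show "AE s in lebesgue. indicator good_times s * F s = indicator {t0..t0'} s *\<^sub>R F s"
      using good_times_AE by eventually_elim (auto simp: indicator_def)
  qed
  also have "\<dots> = (LINT s|lborel. indicator good_times s * F s)" by (rule integral_lebesgue_lborel[OF assms])
  finally show ?thesis .
qed

lemma convection_pairing_time_linear:
  fixes \<phi> \<psi> :: "real \<Rightarrow> R3 \<Rightarrow> R3"
  assumes \<phi>: "\<And>s. s \<in> {t0..t0'} \<Longrightarrow> \<phi> s \<in> borel_measurable lebesgue" "\<And>s x. s \<in> {t0..t0'} \<Longrightarrow> norm (\<phi> s x) \<le> C"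
    "\<And>x. continuous_on {t0..t0'} (\<lambda>s. \<phi> s x)"
    and \<psi>: "\<And>s. s \<in> {t0..t0'} \<Longrightarrow> \<psi> s \<in> borel_measurable lebesgue" "\<And>s x. s \<in> {t0..t0'} \<Longrightarrow> norm (\<psi> s x) \<le> D"
    "\<And>x. continuous_on {t0..t0'} (\<lambda>s. \<psi> s x)"
  shows "(LINT s:{t0..t0'}|lebesgue. LINT x|lebesgue. convection s x \<bullet> (c *\<^sub>R (\<phi> s x - \<psi> s x))) =
    c * ((LINT s:{t0..t0'}|lebesgue. LINT x|lebesgue. convection s x \<bullet> \<phi> s x) - (LINT s:{t0..t0'}|lebesgue. LINT x|lebesgue. convection s x \<bullet> \<psi> s x))"
proof -
  note i1 = convection_pairing_time_integrable(2)[OF \<phi>]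
  note i2 = convection_pairing_time_integrable(2)[OF \<psi>]
  have i: "set_integrable lebesgue {t0..t0'} (\<lambda>s. c * ((LINT x|lebesgue. convection s x \<bullet> \<phi> s x) - (LINT x|lebesgue. convection s x \<bullet> \<psi> s x)))"
    by (intro set_integrable_mult_right set_integral_diff(1) i1 i2)
  have "(LINT s:{t0..t0'}|lebesgue. LINT x|lebesgue. convection s x \<bullet> (c *\<^sub>R (\<phi> s x - \<psi> s x))) =
    (LINT s:{t0..t0'}|lebesgue. c * ((LINT x|lebesgue. convection s x \<bullet> \<phi> s x) - (LINT x|lebesgue. convection s x \<bullet> \<psi> s x)))"
    unfolding set_lebesgue_integral_def
  proof (rule lebesgue_integral_cong_AE_total)
    show "(\<lambda>s. indicator {t0..t0'} s *\<^sub>R (c * ((LINT x|lebesgue. convection s x \<bullet> \<phi> s x) - (LINT x|lebesgue. convection s x \<bullet> \<psi> s x)))) \<in> borel_measurable lebesgue"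
      using i unfolding set_integrable_def by (rule borel_measurable_integrable)
    show "AE s in lebesgue. indicator {t0..t0'} s *\<^sub>R (c * ((LINT x|lebesgue. convection s x \<bullet> \<phi> s x) - (LINT x|lebesgue. convection s x \<bullet> \<psi> s x))) =
      indicator {t0..t0'} s *\<^sub>R (LINT x|lebesgue. convection s x \<bullet> (c *\<^sub>R (\<phi> s x - \<psi> s x)))"
      using good_times_AE
    proof eventually_elim
      fix s assume *: "s \<in> {t0..t0'} \<longleftrightarrow> s \<in> T \<inter> {t0..t0'}"
      show "indicator {t0..t0'} s *\<^sub>R (c * ((LINT x|lebesgue. convection s x \<bullet> \<phi> s x) - (LINT x|lebesgue. convection s x \<bullet> \<psi> s x))) =
        indicator {t0..t0'} s *\<^sub>R (LINT x|lebesgue. convection s x \<bullet> (c *\<^sub>R (\<phi> s x - \<psi> s x)))"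
      proof (cases "s \<in> {t0..t0'}")
        case True
        then have "s \<in> T" using * by simp
        from convection_pairing(1)[OF this \<phi>(1,2)] convection_pairing(1)[OF this \<psi>(1,2)] True
        show ?thesis by (simp add: inner_diff_right)
      qed simp
    qed
  qed
  also have "\<dots> = c * ((LINT s:{t0..t0'}|lebesgue. LINT x|lebesgue. convection s x \<bullet> \<phi> s x) - (LINT s:{t0..t0'}|lebesgue. LINT x|lebesgue. convection s x \<bullet> \<psi> s x))"
    by (simp only: set_integral_mult_right set_integral_diff(2)[OF i1 i2])
  finally show ?thesis .
qed

definition gradient_time_integral :: real where
  "gradient_time_integral = (LINT s:{t0..t0'}|lebesgue. L2_norm (Du s))"

lemma convection_pairing_time_bound:
  fixes \<phi> :: "real \<Rightarrow> R3 \<Rightarrow> R3"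
  assumes "\<And>s. s \<in> {t0..t0'} \<Longrightarrow> \<phi> s \<in> borel_measurable lebesgue" "\<And>s x. s \<in> {t0..t0'} \<Longrightarrow> norm (\<phi> s x) \<le> C"
    "\<And>x. continuous_on {t0..t0'} (\<lambda>s. \<phi> s x)"
  shows "\<bar>LINT s:{t0..t0'}|lebesgue. LINT x|lebesgue. convection s x \<bullet> \<phi> s x\<bar> \<le> C * E * gradient_time_integral"
proof -
  note i = convection_pairing_time_integrable(2)[OF assms]
  note d = Du_integrable(1)
  have i': "integrable lebesgue (\<lambda>s. indicator {t0..t0'} s *\<^sub>R (LINT x|lebesgue. convection s x \<bullet> \<phi> s x))"
    using i by (simp add: set_integrable_def)
  have d': "integrable lebesgue (\<lambda>s. C * E * (indicator {t0..t0'} s *\<^sub>R L2_norm (Du s)))"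
    using d by (intro integrable_mult_right) (simp add: set_integrable_def)
  have "\<bar>LINT s:{t0..t0'}|lebesgue. LINT x|lebesgue. convection s x \<bullet> \<phi> s x\<bar> \<le> (LINT s|lebesgue. norm (indicator {t0..t0'} s *\<^sub>R (LINT x|lebesgue. convection s x \<bullet> \<phi> s x)))"
    unfolding set_lebesgue_integral_def real_norm_def[symmetric] by (rule integral_norm_bound)
  also have "\<dots> \<le> (LINT s|lebesgue. C * E * (indicator {t0..t0'} s *\<^sub>R L2_norm (Du s)))"
  proof (rule integral_mono_AE[OF integrable_norm[OF i'] d'])
    show "AE s in lebesgue. norm (indicator {t0..t0'} s *\<^sub>R (LINT x|lebesgue. convection s x \<bullet> \<phi> s x)) \<le> C * E * (indicator {t0..t0'} s *\<^sub>R L2_norm (Du s))"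
      using good_times_AE
    proof eventually_elim
      fix s assume *: "s \<in> {t0..t0'} \<longleftrightarrow> s \<in> good_times"
      show "norm (indicator {t0..t0'} s *\<^sub>R (LINT x|lebesgue. convection s x \<bullet> \<phi> s x)) \<le> C * E * (indicator {t0..t0'} s *\<^sub>R L2_norm (Du s))"
      proof (cases "s \<in> {t0..t0'}")
        case True
        then have "s \<in> T" using * by simp
        from convection_pairing(2)[OF this assms(1)[OF True] assms(2)[OF True]] show ?thesis using True by (simp add: mult.assoc)
      qed simp
    qed
  qed
  also have "\<dots> = C * E * gradient_time_integral" by (simp add: gradient_time_integral_def set_lebesgue_integral_def)
  finally show ?thesis .
qed

lemma gradient_time_integral_bound:
  "gradient_time_integral \<le> sqrt (t0' - t0) * sqrt (LINT s:{t0..t0'}|lebesgue. (L2_norm (Du s))\<^sup>2)"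
proof -
  let ?a = "\<lambda>s. indicator {t0..t0'} s :: real" and ?b = "\<lambda>s. indicator {t0..t0'} s *\<^sub>R L2_norm (Du s)"
  note i = Du_integrable
  have sq: "(?a s)\<^sup>2 = ?a s" "(?b s)\<^sup>2 = indicator {t0..t0'} s *\<^sub>R (L2_norm (Du s))\<^sup>2" "\<bar>?a s\<bar> * \<bar>?b s\<bar> = ?b s" for s
    by (auto simp: indicator_def L2_norm_nonneg)
  have ia: "integrable lebesgue ?a"
    using bounded_continuous_set_integrable[of t0 t0' "\<lambda>_. 1"] by (simp add: set_integrable_def)
  have "(LINT s|lebesgue. \<bar>?a s\<bar> * \<bar>?b s\<bar>) \<le> sqrt (LINT s|lebesgue. (?a s)\<^sup>2) * sqrt (LINT s|lebesgue. (?b s)\<^sup>2)"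
  proof (rule integral_Cauchy_Schwarz(2))
    show "?a \<in> borel_measurable lebesgue" using ia by (rule borel_measurable_integrable)
    show "?b \<in> borel_measurable lebesgue" using i(1) unfolding set_integrable_def by (rule borel_measurable_integrable)
    show "integrable lebesgue (\<lambda>s. (?a s)\<^sup>2)" "integrable lebesgue (\<lambda>s. (?b s)\<^sup>2)"
      unfolding sq using ia i(2) by (auto simp: set_integrable_def)
  qed
  moreover have "(LINT s|lebesgue. ?a s) = t0' - t0" using t by simp
  ultimately show ?thesis unfolding sq by (simp add: gradient_time_integral_def set_lebesgue_integral_def)
qed

end

end

section \<open>Gaussian integrals and cutoffs in time\<close>

text \<open>The heat kernel is the product of three normal densities of variance \<open>2 t\<close>, whose integrals are
  known.\<close>

lemma heat_kernel_eq_prod: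
  assumes "t > 0"
  shows "heat_kernel t (x - y) = (\<Prod>b\<in>Basis. normal_density (y \<bullet> b) (sqrt (2 * t)) (x \<bullet> b))"
proof -
  have "(\<Prod>b\<in>(Basis::R3 set). normal_density (y \<bullet> b) (sqrt (2 * t)) (x \<bullet> b)) =
     (\<Prod>b\<in>(Basis::R3 set). 1 / sqrt (4 * pi * t)) * (\<Prod>b\<in>Basis. exp (- (x \<bullet> b - y \<bullet> b)\<^sup>2 / (4 * t)))"
    unfolding prod.distrib[symmetric] using assms by (intro prod.cong refl) (simp add: normal_density_def)
  also have "(\<Prod>b\<in>(Basis::R3 set). 1 / sqrt (4 * pi * t)) = (1 / sqrt (4 * pi * t)) ^ 3" by simp
  also have "\<dots> = (4 * pi * t) powr (- 3 / 2)"
  proof -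
    have p: "4 * pi * t > 0" using assms by simp
    have "1 / sqrt (4 * pi * t) = (4 * pi * t) powr (-1/2)"
      using powr_minus_divide[of "4 * pi * t" "1/2"] p by (simp add: powr_half_sqrt)
    then show ?thesis using assms powr_realpow[of "(4 * pi * t) powr (-1/2)" 3] by (simp add: powr_powr)
  qed
  also have "(\<Prod>b\<in>Basis. exp (- (x \<bullet> b - y \<bullet> b)\<^sup>2 / (4 * t))) = exp (- (norm (x - y))\<^sup>2 / (4 * t))"
  proof -
    have "(norm (x - y))\<^sup>2 = (\<Sum>b\<in>Basis. (x \<bullet> b - y \<bullet> b)\<^sup>2)"
      unfolding norm_eq_sqrt_inner euclidean_inner[of "x - y" "x - y"]
      by (simp add: inner_diff_left power2_eq_square sum_nonneg)
    then show ?thesis by (simp add: exp_sum[symmetric] sum_divide_distrib sum_negf)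
  qed
  finally show ?thesis by (simp add: heat_kernel_def)
qed

lemma heat_kernel_nonneg: "0 \<le> heat_kernel t x" by (simp add: heat_kernel_def)

lemma heat_kernel_continuous: "continuous_on UNIV (heat_kernel t)"
  unfolding heat_kernel_def[abs_def] divide_inverse by (intro continuous_intros)

lemma heat_kernel_measurable [measurable]: "heat_kernel t \<in> borel_measurable borel"
  by (intro borel_measurable_continuous_onI heat_kernel_continuous)

lemma heat_kernel_integral:
  assumes "t > 0"
  shows "integrable lborel (\<lambda>x. heat_kernel t (x - y))" "(LINT x|lborel. heat_kernel t (x - y)) = 1"
proof -
  have "(\<integral>\<^sup>+x. ennreal (heat_kernel t (x - y)) \<partial>lborel) = (\<integral>\<^sup>+x. (\<Prod>b\<in>Basis. ennreal (normal_density (y \<bullet> b) (sqrt (2 * t)) (x \<bullet> b))) \<partial>lborel)"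
    by (intro nn_integral_cong) (simp add: heat_kernel_eq_prod[OF assms] prod_ennreal)
  also have "\<dots> = (\<Prod>b\<in>(Basis::R3 set). \<integral>\<^sup>+s. ennreal (normal_density (y \<bullet> b) (sqrt (2 * t)) s) \<partial>lborel)"
    by (intro nn_integral_lborel_prod) auto
  also have "\<dots> = 1"
    using assms by (intro prod.neutral ballI) (simp add: nn_integral_eq_integral)
  finally have 1: "(\<integral>\<^sup>+x. ennreal (heat_kernel t (x - y)) \<partial>lborel) = 1" .
  then have "has_bochner_integral lborel (\<lambda>x. heat_kernel t (x - y)) 1"
    by (intro has_bochner_integral_nn_integral) (auto simp: heat_kernel_nonneg)
  then show "integrable lborel (\<lambda>x. heat_kernel t (x - y))" "(LINT x|lborel. heat_kernel t (x - y)) = 1"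
    by (auto simp: has_bochner_integral_iff)
qed

text \<open>The square of a Gaussian is a Gaussian at half the time. This is where the constant \<open>(8 \<pi> t)\<^bsup>-3/4\<^esup>\<close>
  comes from, as the \<open>L\<^sup>2\<close> norm of the heat kernel.\<close>

lemma heat_kernel_square:
  assumes "t > 0"
  shows "(heat_kernel t x)\<^sup>2 = (8 * pi * t) powr (- 3 / 2) * heat_kernel (t / 2) x"
proof -
  have "((4 * pi * t) powr (- 3 / 2))\<^sup>2 = ((4 * pi * t)\<^sup>2) powr (- 3 / 2)"
    unfolding power2_eq_square by (rule powr_mult[symmetric])
  also have "(4 * pi * t)\<^sup>2 = (8 * pi * t) * (4 * pi * (t / 2))" by (simp add: power2_eq_square)
  also have "((8 * pi * t) * (4 * pi * (t / 2))) powr (- 3 / 2) = (8 * pi * t) powr (- 3 / 2) * (4 * pi * (t / 2)) powr (- 3 / 2)"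
    by (rule powr_mult)
  finally have 1: "((4 * pi * t) powr (- 3 / 2))\<^sup>2 = (8 * pi * t) powr (- 3 / 2) * (4 * pi * (t / 2)) powr (- 3 / 2)" .
  have 2: "(exp (- (norm x)\<^sup>2 / (4 * t)))\<^sup>2 = exp (- (norm x)\<^sup>2 / (4 * (t / 2)))"
    by (simp add: exp_double[symmetric] mult.commute)
  show ?thesis unfolding heat_kernel_def power_mult_distrib 1 2 by simp
qed

lemma heat_kernel_L2:
  assumes "t > 0"
  shows "in_L2 (\<lambda>x. heat_kernel t (x - y))" "L2_norm (\<lambda>x. heat_kernel t (x - y)) = (8 * pi * t) powr (- 3 / 4)"
proof -
  have m: "(\<lambda>x. heat_kernel t (x - y)) \<in> borel_measurable borel" by measurable
  have eq: "(norm (heat_kernel t (x - y)))\<^sup>2 = (8 * pi * t) powr (- 3 / 2) * heat_kernel (t / 2) (x - y)" for x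
    using heat_kernel_square[OF assms] by simp
  have t2: "t / 2 > 0" using assms by simp
  have i: "integrable lebesgue (\<lambda>x. heat_kernel (t / 2) (x - y))"
    using heat_kernel_integral(1)[OF t2, of y] by (subst integrable_completion) auto
  then show "in_L2 (\<lambda>x. heat_kernel t (x - y))"
    unfolding in_L2_def eq using borel_imp_lebesgue_measurable[OF m] by simp
  have "(LINT x|lebesgue. heat_kernel (t / 2) (x - y)) = 1"
    using heat_kernel_integral(2)[OF t2, of y] by (subst integral_completion) auto
  then have "L2_norm (\<lambda>x. heat_kernel t (x - y)) = sqrt ((8 * pi * t) powr (- 3 / 2))"
    unfolding L2_norm_def eq using i by simp
  also have "\<dots> = (8 * pi * t) powr (- 3 / 4)"
    using assms by (simp add: powr_half_sqrt[symmetric] powr_powr)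
  finally show "L2_norm (\<lambda>x. heat_kernel t (x - y)) = (8 * pi * t) powr (- 3 / 4)" .
qed

lemma gauss_weight_eq:
  assumes "A > 0"
  shows "gauss_weight A x = (8 * pi * A) powr (3 / 2) * heat_kernel (2 * A) x"
  using assms by (simp add: gauss_weight_def heat_kernel_def powr_minus field_simps)

lemma gauss_weight_range: "A > 0 \<Longrightarrow> 0 < gauss_weight A x" "A > 0 \<Longrightarrow> gauss_weight A x \<le> 1"
  by (auto simp: gauss_weight_def)

lemma gauss_weight_L2:
  assumes "A > 0" shows "in_L2 (\<lambda>x. gauss_weight A (x - y))"
  using in_L2_scaleR[OF heat_kernel_L2(1)[of "2 * A" y], of "(8 * pi * A) powr (3 / 2)"] assms by (simp add: gauss_weight_eq)

lemma step_deriv_support: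
  assumes "x < 0 \<or> x > 1"
  shows "step_deriv 1 x = 0"
proof -
  have 1: "(smooth_step has_real_derivative step_deriv 1 x) (at x)"
    using step_deriv_has_derivative[of 0 x] by (simp add: step_deriv_0)
  have "(smooth_step has_real_derivative 0) (at x)"
  proof (cases "x < 0")
    case True
    have "\<forall>\<^sub>F y in nhds x. smooth_step y = 0"
      using eventually_nhds_in_open[of "{..<0}" x] True by (auto elim!: eventually_mono simp: smooth_step_0)
    then show ?thesis by (subst DERIV_cong_ev[OF refl _ refl, of _ "\<lambda>_. 0"]) auto
  next
    case False
    then have "\<forall>\<^sub>F y in nhds x. smooth_step y = 1"
      using eventually_nhds_in_open[of "{1<..}" x] assms by (auto elim!: eventually_mono simp: smooth_step_1)
    then show ?thesis by (subst DERIV_cong_ev[OF refl _ refl, of _ "\<lambda>_. 1"]) auto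
  qed
  with 1 show ?thesis by (rule DERIV_unique)
qed

lemma step_deriv_continuous: "continuous_on UNIV (step_deriv k)"
  by (intro continuous_at_imp_continuous_on ballI DERIV_isCont[OF step_deriv_has_derivative])

lemma step_deriv_measurable [measurable]: "step_deriv k \<in> borel_measurable borel"
  by (intro borel_measurable_continuous_onI step_deriv_continuous)

lemma smooth_step_measurable [measurable]: "smooth_step \<in> borel_measurable borel"
  using step_deriv_measurable[of 0] by (simp add: step_deriv_0)

lemma step_deriv_integral: "(LINT s|lborel. step_deriv 1 s) = 1"
proof -
  have "(LINT s|lborel. step_deriv 1 s) = (LINT s|lborel. step_deriv 1 s * indicator {0..1} s)"
  proof (intro Bochner_Integration.integral_cong refl)
    show "step_deriv 1 s = step_deriv 1 s * indicator {0..1} s" for s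
      using step_deriv_support[of s] by (cases "s < 0 \<or> s > 1") auto
  qed
  also have "\<dots> = smooth_step 1 - smooth_step 0"
    by (rule integral_FTC_Icc_real)
       (use step_deriv_has_derivative[of 0] step_deriv_continuous[of 1] in \<open>auto simp: step_deriv_0 continuous_on_eq_continuous_at\<close>)
  finally show ?thesis by (simp add: smooth_step_0 smooth_step_1)
qed

text \<open>After the substitution \<open>t = a + e (s + 1) / Suc m\<close> with \<open>e = 1\<close> or \<open>e = -1\<close>, one flank of the
  derivative of a time cutoff becomes \<open>step_deriv 1\<close>, of unit mass; the factor \<open>smooth_step\<close> is
  the other flank, which is eventually 1.\<close>

lemma approximate_identity_at_point:
  fixes H :: "real \<Rightarrow> real"
  assumes H: "continuous_on UNIV H" "\<And>t. \<bar>H t\<bar> \<le> B" and d: "d > 0"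
  shows "(\<lambda>m::nat. LINT s|lborel. step_deriv 1 s * smooth_step (real (Suc m) * d - s - 2) * H (a + e * ((s + 1) / real (Suc m)))) \<longlonglongrightarrow> H a"
proof -
  obtain C where C: "\<And>x. \<bar>step_deriv 1 x\<bar> \<le> C" using step_deriv_bounded by blast
  have [measurable]: "H \<in> borel_measurable borel" by (intro borel_measurable_continuous_onI H)
  have lim: "(\<lambda>m::nat. step_deriv 1 s * smooth_step (real (Suc m) * d - s - 2) * H (a + e * ((s + 1) / real (Suc m)))) \<longlonglongrightarrow> step_deriv 1 s * 1 * H (a + e * 0)" for s
  proof (intro tendsto_mult tendsto_const)
    obtain N where N: "real N * d > s + 3" using reals_Archimedean3[OF d] by blast
    have "smooth_step (real (Suc m) * d - s - 2) = 1" if "m \<ge> N" for m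
    proof (rule smooth_step_1)
      have "real N * d \<le> real (Suc m) * d" using that d by (intro mult_right_mono) auto
      then show "1 \<le> real (Suc m) * d - s - 2" using N by linarith
    qed
    then show "(\<lambda>m. smooth_step (real (Suc m) * d - s - 2)) \<longlonglongrightarrow> 1"
      by (intro tendsto_eventually) (auto simp: eventually_sequentially intro!: exI[of _ N])
    have "(\<lambda>m. (s + 1) / real (Suc m)) \<longlonglongrightarrow> 0"
      using tendsto_mult[OF tendsto_const LIMSEQ_inverse_real_of_nat, of "s + 1"] by (simp add: divide_inverse)
    then have "(\<lambda>m. a + e * ((s + 1) / real (Suc m))) \<longlonglongrightarrow> a + e * 0" by (intro tendsto_intros)
    from continuous_on_tendsto_compose[OF H(1) this] show "(\<lambda>m. H (a + e * ((s + 1) / real (Suc m)))) \<longlonglongrightarrow> H (a + e * 0)" by simp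
  qed
  have "(\<lambda>m::nat. LINT s|lborel. step_deriv 1 s * smooth_step (real (Suc m) * d - s - 2) * H (a + e * ((s + 1) / real (Suc m)))) \<longlonglongrightarrow>
     (LINT s|lborel. step_deriv 1 s * 1 * H (a + e * 0))"
  proof (rule integral_dominated_convergence[where w="\<lambda>s. C * B * indicator {0..1} s"])
    show "integrable lborel (\<lambda>s::real. C * B * indicator {0..1} s)" by (intro integrable_mult_right) simp
    show "AE s in lborel. norm (step_deriv 1 s * smooth_step (real (Suc m) * d - s - 2) * H (a + e * ((s + 1) / real (Suc m)))) \<le> C * B * indicator {0..1} s" for m
    proof (intro AE_I2)
      fix s
      have "\<bar>step_deriv 1 s\<bar> \<le> C * indicator {0..1} s"
        using C[of s] step_deriv_support[of s] by (auto simp: indicator_def not_le)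
      moreover have "\<bar>smooth_step (real (Suc m) * d - s - 2)\<bar> \<le> 1" using smooth_step_range by (simp add: abs_of_nonneg)
      ultimately have "\<bar>step_deriv 1 s\<bar> * \<bar>smooth_step (real (Suc m) * d - s - 2)\<bar> * \<bar>H (a + e * ((s + 1) / real (Suc m)))\<bar> \<le> (C * indicator {0..1} s) * 1 * B"
        using H(2) order_trans[OF abs_ge_zero C] by (intro mult_mono mult_nonneg_nonneg) auto
      then show "norm (step_deriv 1 s * smooth_step (real (Suc m) * d - s - 2) * H (a + e * ((s + 1) / real (Suc m)))) \<le> C * B * indicator {0..1} s"
        by (simp add: abs_mult mult_ac)
    qed
  qed (use lim in auto)
  also have "(LINT s|lborel. step_deriv 1 s * 1 * H (a + e * 0)) = H a" using step_deriv_integral by simp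
  finally show ?thesis .
qed

text \<open>The cutoff vanishes within distance \<open>1 / Suc m\<close> of the endpoints. Multiplied with it, a field is
  supported in positive times even if \<open>a = 0\<close>.\<close>

definition time_cutoff :: "real \<Rightarrow> real \<Rightarrow> nat \<Rightarrow> real \<Rightarrow> real" where
  "time_cutoff a b m t = smooth_step (real (Suc m) * (t - a) - 1) * smooth_step (real (Suc m) * (b - t) - 1)"

definition time_cutoff_deriv :: "real \<Rightarrow> real \<Rightarrow> nat \<Rightarrow> real \<Rightarrow> real" where
  "time_cutoff_deriv a b m t = real (Suc m) * step_deriv 1 (real (Suc m) * (t - a) - 1) * smooth_step (real (Suc m) * (b - t) - 1)
     - real (Suc m) * smooth_step (real (Suc m) * (t - a) - 1) * step_deriv 1 (real (Suc m) * (b - t) - 1)"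

lemma time_cutoff_has_derivative: "(time_cutoff a b m has_real_derivative time_cutoff_deriv a b m t) (at t)"
proof -
  have s: "(smooth_step has_real_derivative step_deriv 1 x) (at x)" for x
    using step_deriv_has_derivative[of 0 x] by (simp add: step_deriv_0)
  have 1: "((\<lambda>t. smooth_step (real (Suc m) * (t - a) - 1)) has_real_derivative step_deriv 1 (real (Suc m) * (t - a) - 1) * real (Suc m)) (at t)"
    by (rule DERIV_chain2[OF s]) (auto intro!: derivative_eq_intros)
  have 2: "((\<lambda>t. smooth_step (real (Suc m) * (b - t) - 1)) has_real_derivative step_deriv 1 (real (Suc m) * (b - t) - 1) * (- real (Suc m))) (at t)"
    by (rule DERIV_chain2[OF s]) (auto intro!: derivative_eq_intros)
  show ?thesis unfolding time_cutoff_def[abs_def] time_cutoff_deriv_def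
    by (rule DERIV_cong[OF DERIV_mult[OF 1 2]]) (simp add: algebra_simps)
qed

lemma Ck_time_cutoff: "Ck n UNIV (time_cutoff a b m)"
proof -
  have "Ck n UNIV (\<lambda>t. smooth_step ((- real (Suc m) * a - 1) + real (Suc m) * t))"
    "Ck n UNIV (\<lambda>t. smooth_step ((real (Suc m) * b - 1) + (- real (Suc m)) * t))"
    by (intro Ck_smooth_step_affine bounded_linear_mult_right)+
  then have "Ck n UNIV (\<lambda>t. smooth_step ((- real (Suc m) * a - 1) + real (Suc m) * t) * smooth_step ((real (Suc m) * b - 1) + (- real (Suc m)) * t))"
    by (intro Ck_mult) auto
  moreover have "(\<lambda>t. smooth_step ((- real (Suc m) * a - 1) + real (Suc m) * t) * smooth_step ((real (Suc m) * b - 1) + (- real (Suc m)) * t)) = time_cutoff a b m"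
    by (simp add: fun_eq_iff time_cutoff_def algebra_simps)
  ultimately show ?thesis by simp
qed

lemma time_cutoff_support:
  assumes "time_cutoff a b m t \<noteq> 0 \<or> time_cutoff_deriv a b m t \<noteq> 0"
  shows "a + 1 / real (Suc m) \<le> t \<and> t \<le> b - 1 / real (Suc m)"
proof -
  have "\<not> real (Suc m) * (t - a) - 1 < 0" "\<not> real (Suc m) * (b - t) - 1 < 0"
    using assms step_deriv_support smooth_step_0 unfolding time_cutoff_def time_cutoff_deriv_def
    by (metis less_imp_le mult_zero_left mult_zero_right diff_self)+
  then show ?thesis by (auto simp: field_simps)
qed

lemma time_cutoff_range: "\<bar>time_cutoff a b m t\<bar> \<le> 1"
  unfolding time_cutoff_def using smooth_step_range by (auto simp: abs_mult abs_of_nonneg intro!: mult_le_one)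

lemma time_cutoff_tendsto:
  assumes "a < t" "t < b" shows "(\<lambda>m. time_cutoff a b m t) \<longlonglongrightarrow> 1"
proof -
  obtain N1 where N1: "real N1 * (t - a) > 2" using reals_Archimedean3[of "t - a"] assms by fastforce
  obtain N2 where N2: "real N2 * (b - t) > 2" using reals_Archimedean3[of "b - t"] assms by fastforce
  have "time_cutoff a b m t = 1" if "m \<ge> max N1 N2" for m
  proof -
    have "real N1 * (t - a) \<le> real (Suc m) * (t - a)" "real N2 * (b - t) \<le> real (Suc m) * (b - t)"
      using that assms by (auto intro!: mult_right_mono)
    then show ?thesis unfolding time_cutoff_def using N1 N2 by (simp add: smooth_step_1 del: of_nat_Suc)
  qed
  then show ?thesis by (intro tendsto_eventually) (auto simp: eventually_sequentially intro!: exI[of _ "max N1 N2"])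
qed

lemma time_cutoff_continuous: "continuous_on S (time_cutoff a b m)" "continuous_on S (time_cutoff_deriv a b m)"
proof -
  show "continuous_on S (time_cutoff a b m)"
    by (intro continuous_at_imp_continuous_on ballI DERIV_isCont[OF time_cutoff_has_derivative])
  have s: "continuous_on UNIV smooth_step" using step_deriv_continuous[of 0] by (simp add: step_deriv_0)
  show "continuous_on S (time_cutoff_deriv a b m)"
    unfolding time_cutoff_deriv_def[abs_def]
    by (intro continuous_intros continuous_on_compose2[OF s] continuous_on_compose2[OF step_deriv_continuous]) auto
qed

text \<open>The derivative of a smoothed indicator of \<open>{a..b}\<close> approximates the difference of point masses at
  \<open>a\<close> and \<open>b\<close>.\<close>

lemma time_cutoff_deriv_limit:
  fixes h :: "real \<Rightarrow> real"
  assumes "a < b" "continuous_on {a..b} h"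
  shows "(\<lambda>m. LINT t:{a..b}|lebesgue. time_cutoff_deriv a b m t * h t) \<longlonglongrightarrow> h a - h b"
proof -
  \<comment> \<open>A continuous bounded extension of \<open>h\<close> to the line.\<close>
  define H where "H t = h (max a (min b t))" for t
  have Hc: "continuous_on UNIV H" unfolding H_def[abs_def]
    by (rule continuous_on_compose2[OF assms(2)]) (use assms(1) in \<open>auto intro!: continuous_intros\<close>)
  have "bounded (h ` {a..b})" by (intro compact_imp_bounded compact_continuous_image assms(2)) auto
  then obtain B where "\<forall>y\<in>h ` {a..b}. norm y \<le> B" unfolding bounded_iff by blast
  then have B: "\<bar>H t\<bar> \<le> B" for t using assms(1) unfolding H_def by auto
  have [measurable]: "H \<in> borel_measurable borel" by (intro borel_measurable_continuous_onI Hc)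
  \<comment> \<open>The contributions of the rising and of the falling flank.\<close>
  define c1 where "c1 m t = real (Suc m) * step_deriv 1 (real (Suc m) * (t - a) - 1) * smooth_step (real (Suc m) * (b - t) - 1) * H t" for m t
  define c2 where "c2 m t = real (Suc m) * smooth_step (real (Suc m) * (t - a) - 1) * step_deriv 1 (real (Suc m) * (b - t) - 1) * H t" for m t
  obtain C where C: "\<And>x. \<bar>step_deriv 1 x\<bar> \<le> C" using step_deriv_bounded by blast
  have C0: "0 \<le> C" using order_trans[OF abs_ge_zero C] .
  have [measurable]: "c1 m \<in> borel_measurable borel" "c2 m \<in> borel_measurable borel" for m
    unfolding c1_def[abs_def] c2_def[abs_def] by measurable
  have i: "integrable lborel (c1 m)" "integrable lborel (c2 m)" for m
  proof -
    have bd: "integrable lborel (\<lambda>t. real (Suc m) * C * B * indicator {a..b} t)"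
      by (intro integrable_mult_right integrable_real_indicator) (auto simp: emeasure_lborel_Icc_eq)
    have ss: "\<bar>smooth_step x\<bar> \<le> 1" for x using smooth_step_range by (simp add: abs_of_nonneg)
    have "\<bar>c1 m t\<bar> \<le> real (Suc m) * C * B * indicator {a..b} t \<and> \<bar>c2 m t\<bar> \<le> real (Suc m) * C * B * indicator {a..b} t" for t
    proof (cases "t \<in> {a..b}")
      case True
      have "real (Suc m) * \<bar>step_deriv 1 (real (Suc m) * (t - a) - 1)\<bar> * \<bar>smooth_step (real (Suc m) * (b - t) - 1)\<bar> * \<bar>H t\<bar> \<le> real (Suc m) * C * 1 * B"
        "real (Suc m) * \<bar>smooth_step (real (Suc m) * (t - a) - 1)\<bar> * \<bar>step_deriv 1 (real (Suc m) * (b - t) - 1)\<bar> * \<bar>H t\<bar> \<le> real (Suc m) * 1 * C * B"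
        using C0 by (intro mult_mono C B ss mult_nonneg_nonneg; simp)+
      then show ?thesis using True by (simp add: c1_def c2_def abs_mult del: of_nat_Suc)
    next
      case False
      then consider "t < a" | "t > b" by fastforce
      then have "c1 m t = 0 \<and> c2 m t = 0"
      proof cases
        case 1
        then have "real (Suc m) * (t - a) - 1 < 0" using mult_pos_neg[of "real (Suc m)" "t - a"] by simp
        then show ?thesis by (simp add: c1_def c2_def step_deriv_support[unfolded One_nat_def] smooth_step_0 del: of_nat_Suc)
      next
        case 2
        then have "real (Suc m) * (b - t) - 1 < 0" using mult_pos_neg[of "real (Suc m)" "b - t"] by simp
        then show ?thesis by (simp add: c1_def c2_def step_deriv_support[unfolded One_nat_def] smooth_step_0 del: of_nat_Suc)
      qed
      then show ?thesis using False by simp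
    qed
    then have le: "norm (c1 m t) \<le> norm (real (Suc m) * C * B * indicator {a..b} t)" "norm (c2 m t) \<le> norm (real (Suc m) * C * B * indicator {a..b} t)" for t
      using order_trans[OF _ abs_ge_self] by auto
    show "integrable lborel (c1 m)" by (rule Bochner_Integration.integrable_bound[OF bd]) (use le in auto)
    show "integrable lborel (c2 m)" by (rule Bochner_Integration.integrable_bound[OF bd]) (use le in auto)
  qed
  have eq: "(LINT t:{a..b}|lebesgue. time_cutoff_deriv a b m t * h t) = (LINT t|lborel. c1 m t) - (LINT t|lborel. c2 m t)" for m
  proof -
    have "(LINT t:{a..b}|lebesgue. time_cutoff_deriv a b m t * h t) = (LINT t|lebesgue. c1 m t - c2 m t)"
      unfolding set_lebesgue_integral_def
    proof (intro Bochner_Integration.integral_cong refl)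
      fix t
      show "indicat_real {a..b} t *\<^sub>R (time_cutoff_deriv a b m t * h t) = c1 m t - c2 m t"
      proof (cases "time_cutoff_deriv a b m t = 0")
        case True
        have "c1 m t - c2 m t = time_cutoff_deriv a b m t * H t"
          by (simp add: c1_def c2_def time_cutoff_deriv_def algebra_simps)
        with True show ?thesis by simp
      next
        case False
        then have "a + 1 / real (Suc m) \<le> t \<and> t \<le> b - 1 / real (Suc m)" by (intro time_cutoff_support) auto
        moreover have "1 / real (Suc m) > 0" by simp
        ultimately have "a \<le> t \<and> t \<le> b" by linarith
        then have "t \<in> {a..b}" by simp
        then have "H t = h t" "t \<in> {a..b}" by (auto simp: H_def)
        then show ?thesis by (simp add: c1_def c2_def time_cutoff_deriv_def algebra_simps)
      qed
    qed
    also have "\<dots> = (LINT t|lborel. c1 m t - c2 m t)" by (rule integral_completion) measurable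
    finally show ?thesis using i by simp
  qed
  have 1: "(LINT t|lborel. c1 m t) = (LINT s|lborel. step_deriv 1 s * smooth_step (real (Suc m) * (b - a) - s - 2) * H (a + 1 * ((s + 1) / real (Suc m))))" for m
  proof -
    have p: "real (Suc m) > 0" by simp
    have "(LINT t|lborel. c1 m t) = \<bar>inverse (real (Suc m))\<bar> *\<^sub>R (LINT s|lborel. c1 m ((a + inverse (real (Suc m))) + inverse (real (Suc m)) * s))"
      by (rule lborel_integral_real_affine) simp
    also have "\<dots> = (LINT s|lborel. inverse (real (Suc m)) * c1 m ((a + inverse (real (Suc m))) + inverse (real (Suc m)) * s))" by simp
    also have "\<dots> = (LINT s|lborel. step_deriv 1 s * smooth_step (real (Suc m) * (b - a) - s - 2) * H (a + 1 * ((s + 1) / real (Suc m))))"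
    proof (intro Bochner_Integration.integral_cong refl)
      fix s
      have e: "real (Suc m) * ((a + inverse (real (Suc m)) + inverse (real (Suc m)) * s) - a) - 1 = s"
        "real (Suc m) * (b - (a + inverse (real (Suc m)) + inverse (real (Suc m)) * s)) - 1 = real (Suc m) * (b - a) - s - 2"
        "a + inverse (real (Suc m)) + inverse (real (Suc m)) * s = a + 1 * ((s + 1) / real (Suc m))"
        using p by (simp_all add: field_simps del: of_nat_Suc)
      then show "inverse (real (Suc m)) * c1 m ((a + inverse (real (Suc m))) + inverse (real (Suc m)) * s) = step_deriv 1 s * smooth_step (real (Suc m) * (b - a) - s - 2) * H (a + 1 * ((s + 1) / real (Suc m)))"
        unfolding c1_def e(1,2) unfolding e(3) using p by (simp add: field_simps del: of_nat_Suc)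
    qed
    finally show ?thesis .
  qed
  have 2: "(LINT t|lborel. c2 m t) = (LINT s|lborel. step_deriv 1 s * smooth_step (real (Suc m) * (b - a) - s - 2) * H (b + (-1) * ((s + 1) / real (Suc m))))" for m
  proof -
    have p: "real (Suc m) > 0" by simp
    have "(LINT t|lborel. c2 m t) = \<bar>- inverse (real (Suc m))\<bar> *\<^sub>R (LINT s|lborel. c2 m ((b - inverse (real (Suc m))) + (- inverse (real (Suc m))) * s))"
      by (rule lborel_integral_real_affine) simp
    also have "\<dots> = (LINT s|lborel. inverse (real (Suc m)) * c2 m ((b - inverse (real (Suc m))) + (- inverse (real (Suc m))) * s))" by simp
    also have "\<dots> = (LINT s|lborel. step_deriv 1 s * smooth_step (real (Suc m) * (b - a) - s - 2) * H (b + (-1) * ((s + 1) / real (Suc m))))"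
    proof (intro Bochner_Integration.integral_cong refl)
      fix s
      have e: "real (Suc m) * (b - (b - inverse (real (Suc m)) + (- inverse (real (Suc m))) * s)) - 1 = s"
        "real (Suc m) * ((b - inverse (real (Suc m)) + (- inverse (real (Suc m))) * s) - a) - 1 = real (Suc m) * (b - a) - s - 2"
        "b - inverse (real (Suc m)) + (- inverse (real (Suc m))) * s = b + (-1) * ((s + 1) / real (Suc m))"
        using p by (simp_all add: field_simps del: of_nat_Suc)
      then show "inverse (real (Suc m)) * c2 m ((b - inverse (real (Suc m))) + (- inverse (real (Suc m))) * s) = step_deriv 1 s * smooth_step (real (Suc m) * (b - a) - s - 2) * H (b + (-1) * ((s + 1) / real (Suc m)))"
        unfolding c2_def e(1,2) unfolding e(3) using p by (simp add: field_simps del: of_nat_Suc)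
    qed
    finally show ?thesis .
  qed
  have "H a = h a" "H b = h b" using assms(1) by (auto simp: H_def)
  then show ?thesis unfolding eq 1 2 using assms(1)
    using tendsto_diff[OF approximate_identity_at_point[OF Hc B, of "b - a" a 1] approximate_identity_at_point[OF Hc B, of "b - a" b "-1"]] by simp
qed

section \<open>Testing the equations with localized curls\<close>

lemma Ck_slice_continuous:
  fixes f :: "real \<times> R3 \<Rightarrow> 'b::real_normed_vector"
  assumes "Ck (Suc 0) (S \<times> UNIV) f"
  shows "t \<in> S \<Longrightarrow> continuous_on UNIV (\<lambda>x. f (t, x))" "continuous_on S (\<lambda>t. f (t, x))"
proof -
  have c: "isCont f (t, x)" if "t \<in> S" for t x
    using assms that by (intro differentiable_imp_continuous_within) auto
  have "isCont (\<lambda>x. f (t, x)) x" if "t \<in> S" for t x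
    by (rule continuous_within_compose3[where g=f and f="\<lambda>x. (t, x)", OF c[OF that]]) (intro continuous_intros)
  then show "t \<in> S \<Longrightarrow> continuous_on UNIV (\<lambda>x. f (t, x))" by (simp add: continuous_at_imp_continuous_on)
  have "isCont (\<lambda>t. f (t, x)) t" if "t \<in> S" for t x
    by (rule continuous_within_compose3[where g=f and f="\<lambda>t. (t, x)", OF c[OF that]]) (intro continuous_intros)
  then show "continuous_on S (\<lambda>t. f (t, x))" by (simp add: continuous_at_imp_continuous_on)
qed

text \<open>The backward heat operator \<open>\<partial>\<^sub>t + \<Delta>\<close>, up to sign the adjoint of \<open>\<partial>\<^sub>t - \<Delta>\<close>.\<close>

definition heat_op :: "(real \<times> R3 \<Rightarrow> real) \<Rightarrow> real \<times> R3 \<Rightarrow> real" where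
  "heat_op f z = dd (1, 0) f z + (\<Sum>l\<in>UNIV. dd (sp l) (dd (sp l) f) z)"

lemma dd_heat_op:
  assumes "Ck 4 U f" "z \<in> U"
  shows "dd v (heat_op f) z = dd v (dd (1, 0) f) z + (\<Sum>l\<in>UNIV. dd v (dd (sp l) (dd (sp l) f)) z)"
proof -
  have "4 = Suc (Suc (Suc (Suc 0)))" by simp
  then have f: "Ck (Suc (Suc (Suc (Suc 0)))) U f" using assms(1) by metis
  have "dd (1, 0) f differentiable at z" by (rule Ck_differentiable[OF Ck_dd[OF f] assms(2)])
  moreover have "dd (sp l) (dd (sp l) f) differentiable at z" for l
    by (rule Ck_differentiable[OF Ck_dd[OF Ck_dd[OF f]] assms(2)])
  ultimately have "(heat_op f has_derivative (\<lambda>v. dd v (dd (1, 0) f) z + (\<Sum>l\<in>UNIV. dd v (dd (sp l) (dd (sp l) f)) z))) (at z)"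
    unfolding heat_op_def[abs_def] by (intro has_derivative_add has_derivative_sum has_derivative_dd)
  from dd_eq[OF this] show ?thesis .
qed

lemma heat_op_dd:
  assumes U: "open U" and f: "\<And>n. Ck n U f" and h: "\<And>z. z \<in> U \<Longrightarrow> heat_op f z = 0" and z: "z \<in> U"
  shows "heat_op (dd v f) z = 0"
proof -
  have C: "Ck n U (dd v f)" for n v by (intro Ck_dd f)
  have 1: "dd (1, 0) (dd v f) z = dd v (dd (1, 0) f) z" by (rule dd_commute[OF U z f])
  have 2: "dd w (dd w (dd v f)) z = dd v (dd w (dd w f)) z" for w
  proof -
    have "dd w (dd w (dd v f)) z = dd w (dd v (dd w f)) z"
      by (rule dd_cong[OF U z]) (rule dd_commute[OF U _ f])
    also have "\<dots> = dd v (dd w (dd w f)) z" by (rule dd_commute[OF U z C])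
    finally show ?thesis .
  qed
  have "heat_op (dd v f) z = dd v (heat_op f) z"
    unfolding dd_heat_op[OF f z] unfolding heat_op_def 1 2 ..
  also have "\<dots> = dd v (\<lambda>_. 0) z" by (rule dd_cong[OF U z]) (simp add: h)
  also have "\<dots> = 0" by (simp add: dd_def)
  finally show ?thesis .
qed

text \<open>For \<open>j \<noteq> k\<close> this is, up to sign, the curl of \<open>f\<close> times the third unit vector. It is divergence
  free whatever \<open>f\<close> is. Hence the potential \<open>f\<close> may be cut off in space without creating a
  divergence, which would not be true of the field.\<close>

definition curl :: "3 \<Rightarrow> 3 \<Rightarrow> (real \<times> R3 \<Rightarrow> real) \<Rightarrow> real \<times> R3 \<Rightarrow> R3" where
  "curl j k f z = dd (sp k) f z *\<^sub>R axis j 1 - dd (sp j) f z *\<^sub>R axis k 1"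

lemma curl_has_derivative:
  assumes "open U" "Ck 2 U f" "z \<in> U"
  shows "(curl j k f has_derivative (\<lambda>v. dd v (dd (sp k) f) z *\<^sub>R axis j 1 - dd v (dd (sp j) f) z *\<^sub>R axis k 1)) (at z)"
proof -
  have d: "dd v f differentiable at z" for v
    using Ck_differentiable[OF Ck_dd assms(3), of 0 f v] assms(2) by (simp only: numeral_2_eq_2)
  show ?thesis unfolding curl_def[abs_def]
    by (intro has_derivative_diff bounded_linear.has_derivative[OF bounded_linear_scaleR_left] has_derivative_dd d)
qed

lemma curl_dd:
  assumes "open U" "Ck 3 U f" "z \<in> U"
  shows "dd v (curl j k f) z = curl j k (dd v f) z"
proof -
  have "Ck 2 U f" using assms(2) Ck_Suc_D[of 2] by (simp add: eval_nat_numeral)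
  from dd_eq[OF curl_has_derivative[OF assms(1) this assms(3)]] show ?thesis
    unfolding curl_def using dd_commute[OF assms(1,3,2)] by simp
qed

lemma Ck_curl:
  assumes "open U" "Ck (Suc n) U f"
  shows "Ck n U (curl j k f)"
proof -
  have "Ck n U (\<lambda>z. dd (sp k) f z *\<^sub>R axis j 1 + (-1) *\<^sub>R (dd (sp j) f z *\<^sub>R axis k 1 :: R3))"
    using assms by (intro Ck_add Ck_linear[OF _ bounded_linear_scaleR_left] Ck_linear[OF _ bounded_linear_scaleR_right]) auto
  then show ?thesis by (simp add: curl_def[abs_def])
qed

lemma curl_norm: "norm (curl j k f z) \<le> \<bar>dd (sp k) f z\<bar> + \<bar>dd (sp j) f z\<bar>"
  unfolding curl_def by (rule order_trans[OF norm_triangle_ineq4]) simp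

lemma curl_div_free:
  assumes "open U" "Ck 3 U f" "z \<in> U"
  shows "(\<Sum>i\<in>UNIV. dd (sp i) (curl j k f) z $ i) = 0"
proof -
  have "(\<Sum>i\<in>UNIV. dd (sp i) (curl j k f) z $ i) = (\<Sum>i\<in>UNIV. (if i = j then dd (sp k) (dd (sp i) f) z else 0) - (if i = k then dd (sp j) (dd (sp i) f) z else 0))"
    unfolding curl_dd[OF assms] curl_def by (intro sum.cong refl) (simp add: axis_def)
  also have "\<dots> = dd (sp k) (dd (sp j) f) z - dd (sp j) (dd (sp k) f) z"
    by (simp add: sum_subtractf)
  also have "\<dots> = 0" using dd_commute[OF assms(1,3,2)] by simp
  finally show ?thesis .
qed

definition test_field :: "(real \<Rightarrow> real) \<Rightarrow> 3 \<Rightarrow> 3 \<Rightarrow> (real \<times> R3 \<Rightarrow> real) \<Rightarrow> real \<times> R3 \<Rightarrow> R3" where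
  "test_field \<eta> j k g z = \<eta> (fst z) *\<^sub>R curl j k g z"

context
  fixes a b \<alpha> \<beta> :: real and \<eta> \<eta>' :: "real \<Rightarrow> real" and g :: "real \<times> R3 \<Rightarrow> real" and j k :: 3 and R :: real
  assumes ab: "a < \<alpha>" "\<beta> < b"
    and \<eta>: "\<And>n. Ck n UNIV \<eta>" "\<And>t. (\<eta> has_real_derivative \<eta>' t) (at t)"
    "\<And>t. \<eta> t \<noteq> 0 \<or> \<eta>' t \<noteq> 0 \<Longrightarrow> \<alpha> \<le> t \<and> t \<le> \<beta>"
    and g: "\<And>n. Ck n ({a<..<b} \<times> UNIV) g" "\<And>z i. g z \<noteq> 0 \<Longrightarrow> \<bar>snd z $ i\<bar> \<le> R"
begin

lemma open_slab: "open ({a<..<b} \<times> (UNIV :: R3 set))" by (intro open_Times) auto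
lemma open_off: "open (- ({\<alpha>..\<beta>} \<times> (UNIV :: R3 set)))"
  by (intro open_Compl closed_Times) auto

lemma test_field_off: "z \<notin> {\<alpha>..\<beta>} \<times> UNIV \<Longrightarrow> test_field \<eta> j k g z = 0"
  using \<eta>(3)[of "fst z"] by (cases z) (auto simp: test_field_def)

lemma test_field_Ck: "Ck n UNIV (test_field \<eta> j k g)"
proof -
  have "Ck n UNIV (\<lambda>z::real\<times>R3. \<eta> (0 + fst z))" by (rule Ck_affine[OF bounded_linear_fst \<eta>(1)])
  then have e: "Ck n ({a<..<b} \<times> UNIV) (\<lambda>z::real\<times>R3. \<eta> (fst z))" by (auto intro: Ck_subset)
  have d: "Ck n ({a<..<b} \<times> UNIV) (dd v g)" for v by (intro Ck_dd g(1))
  have "Ck n ({a<..<b} \<times> UNIV) (\<lambda>z. (\<eta> (fst z) * dd (sp k) g z) *\<^sub>R axis j 1 + (-1) *\<^sub>R ((\<eta> (fst z) * dd (sp j) g z) *\<^sub>R axis k 1 :: R3))"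
    by (intro Ck_add Ck_linear[OF _ bounded_linear_scaleR_left] Ck_linear[OF _ bounded_linear_scaleR_right] Ck_mult open_slab e d)
  then have 1: "Ck n ({a<..<b} \<times> UNIV) (test_field \<eta> j k g)"
    by (simp add: test_field_def[abs_def] curl_def scaleR_diff_right)
  have 2: "Ck n (- ({\<alpha>..\<beta>} \<times> UNIV)) (test_field \<eta> j k g)"
    by (rule Ck_cong[OF open_off _ Ck_const[OF open_off, of n 0]]) (rule test_field_off[symmetric], blast)
  have "{a<..<b} \<times> UNIV \<union> - ({\<alpha>..\<beta>} \<times> UNIV) = (UNIV :: (real \<times> R3) set)" using ab by auto
  then show ?thesis using Ck_Un[OF 1 2] by simp
qed

lemma test_field_test_function:
  assumes "0 < \<alpha>" shows "test_function ({0<..} \<times> UNIV) (test_field \<eta> j k g)"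
proof (rule test_functionI)
  let ?B = "cbox (\<chi> i. - R) (\<chi> i. R) :: R3 set"
  show "compact ({\<alpha>..\<beta>} \<times> ?B)" by (intro compact_Times) auto
  show "{\<alpha>..\<beta>} \<times> ?B \<subseteq> {0<..} \<times> UNIV" using assms by auto
  have B: "(\<forall>i. \<bar>x $ i\<bar> \<le> R) \<longleftrightarrow> x \<in> ?B" for x by (auto simp: mem_box_cart abs_le_iff minus_le_iff)
  fix z assume nz: "test_field \<eta> j k g z \<noteq> 0"
  have "snd z \<in> ?B"
  proof (rule ccontr)
    assume out: "snd z \<notin> ?B"
    have op: "open (UNIV \<times> (- ?B) :: (real \<times> R3) set)" by (intro open_Times open_Compl) auto
    have "dd v g z = dd v (\<lambda>_. 0) z" for v
    proof (rule dd_cong[OF op])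
      show "z \<in> UNIV \<times> (- ?B)" using out by (cases z) auto
      show "g y = 0" if "y \<in> UNIV \<times> (- ?B)" for y
        using g(2)[of y] that B[of "snd y"] by (cases y) auto
    qed
    then have "test_field \<eta> j k g z = 0" by (simp add: test_field_def curl_def dd_def)
    with nz show False by simp
  qed
  moreover have "fst z \<in> {\<alpha>..\<beta>}" using nz test_field_off[of z] by (cases z) auto
  ultimately show "z \<in> {\<alpha>..\<beta>} \<times> ?B" by (cases z) auto
qed (rule test_field_Ck)

lemma test_field_differentiable: "test_field \<eta> j k g differentiable at z" "dd v (test_field \<eta> j k g) differentiable at z"
proof -
  show "test_field \<eta> j k g differentiable at z" by (rule Ck_differentiable[OF test_field_Ck]) simp
  show "dd v (test_field \<eta> j k g) differentiable at z" by (rule Ck_differentiable[OF Ck_dd[OF test_field_Ck]]) simp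
qed

lemma Ck_g: "Ck n ({a<..<b} \<times> UNIV) (dd v g)" by (intro Ck_dd g(1))

lemma dd_test_field:
  assumes "z \<in> {a<..<b} \<times> UNIV"
  shows "dd v (test_field \<eta> j k g) z = \<eta> (fst z) *\<^sub>R curl j k (dd v g) z + (\<eta>' (fst z) * fst v) *\<^sub>R curl j k g z"
proof -
  have "((\<lambda>z. \<eta> (fst z)) has_derivative (\<lambda>v. \<eta>' (fst z) * fst v)) (at z)"
    using has_derivative_compose[OF has_derivative_fst[OF has_derivative_ident] \<eta>(2)[of "fst z", unfolded has_field_derivative_def]] by simp
  moreover have "Ck (Suc 0) ({a<..<b} \<times> UNIV) (curl j k g)" by (rule Ck_curl[OF open_slab g(1)])
  then have "(curl j k g has_derivative (\<lambda>v. dd v (curl j k g) z)) (at z)" using assms by (intro has_derivative_dd) auto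
  ultimately have "(test_field \<eta> j k g has_derivative (\<lambda>v. \<eta> (fst z) *\<^sub>R dd v (curl j k g) z + (\<eta>' (fst z) * fst v) *\<^sub>R curl j k g z)) (at z)"
    unfolding test_field_def[abs_def] by (rule has_derivative_scaleR)
  from dd_eq[OF this] show ?thesis using curl_dd[OF open_slab g(1) assms] by simp
qed

lemma test_field_time_derivative:
  "vector_derivative (\<lambda>s. test_field \<eta> j k g (s, x)) (at t) = dd (1, 0) (test_field \<eta> j k g) (t, x)"
proof (rule vector_derivative_at)
  have lin: "linear (\<lambda>v. dd v (test_field \<eta> j k g) (t, x))"
    unfolding dd_def by (rule linear_frechet_derivative[OF test_field_differentiable(1)])
  have "dd (v, 0) (test_field \<eta> j k g) (t, x) = v *\<^sub>R dd (1, 0) (test_field \<eta> j k g) (t, x)" for v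
    using linear_cmul[OF lin, of v "(1, 0)"] by simp
  note eq = this
  have d: "((\<lambda>s. test_field \<eta> j k g (s, x)) has_derivative (\<lambda>v. dd (v, 0) (test_field \<eta> j k g) (t, x))) (at t)"
    by (rule dd_slice(2)[OF test_field_differentiable(1)])
  show "((\<lambda>s. test_field \<eta> j k g (s, x)) has_vector_derivative dd (1, 0) (test_field \<eta> j k g) (t, x)) (at t)"
    unfolding has_vector_derivative_def by (rule has_derivative_eq_rhs[OF d], rule ext, rule eq)
qed

lemma test_field_partial:
  "partial i (\<lambda>y. test_field \<eta> j k g (t, y)) = (\<lambda>x. dd (sp i) (test_field \<eta> j k g) (t, x))"
  using dd_eq[OF dd_slice(1)[OF test_field_differentiable(1)]] by (auto simp: partial_def dd_def)

lemma test_field_laplacian: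
  "laplacian (\<lambda>y. test_field \<eta> j k g (t, y)) x = (\<Sum>i\<in>UNIV. dd (sp i) (dd (sp i) (test_field \<eta> j k g)) (t, x))"
  unfolding laplacian_def test_field_partial
  using dd_eq[OF dd_slice(1)[OF test_field_differentiable(2)]] by (auto simp: partial_def dd_def)

lemma test_field_divergence: "divergence (\<lambda>y. test_field \<eta> j k g (t, y)) x = 0"
proof (cases "t \<in> {a<..<b}")
  case True
  then have z: "(t, x) \<in> {a<..<b} \<times> UNIV" by simp
  have "divergence (\<lambda>y. test_field \<eta> j k g (t, y)) x = \<eta> t * (\<Sum>i\<in>UNIV. dd (sp i) (curl j k g) (t, x) $ i)"
    unfolding divergence_def test_field_partial dd_test_field[OF z] curl_dd[OF open_slab g(1) z]
    by (simp add: sum_distrib_left)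
  then show ?thesis using curl_div_free[OF open_slab g(1) z] by simp
next
  case False
  then have z: "(t, x) \<in> - ({\<alpha>..\<beta>} \<times> UNIV)" using ab by auto
  have "dd v (test_field \<eta> j k g) (t, x) = dd v (\<lambda>_. 0) (t, x)" for v
    by (rule dd_cong[OF open_off z]) (rule test_field_off, blast)
  then show ?thesis unfolding divergence_def test_field_partial by (simp add: dd_def)
qed

lemma test_field_dd_off:
  assumes "t \<notin> {\<alpha>..\<beta>}"
  shows "dd v (test_field \<eta> j k g) (t, x) = 0" "dd w (dd v (test_field \<eta> j k g)) (t, x) = 0"
proof -
  have z: "(t, x) \<in> - ({\<alpha>..\<beta>} \<times> UNIV)" using assms by auto
  have 1: "dd v (test_field \<eta> j k g) y = 0" if "y \<in> - ({\<alpha>..\<beta>} \<times> UNIV)" for y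
  proof -
    have "dd v (test_field \<eta> j k g) y = dd v (\<lambda>_. 0) y"
      by (rule dd_cong[OF open_off that]) (rule test_field_off, blast)
    then show ?thesis by (simp add: dd_def)
  qed
  show "dd v (test_field \<eta> j k g) (t, x) = 0" by (rule 1[OF z])
  have "dd w (dd v (test_field \<eta> j k g)) (t, x) = dd w (\<lambda>_. 0) (t, x)"
    by (rule dd_cong[OF open_off z 1])
  then show "dd w (dd v (test_field \<eta> j k g)) (t, x) = 0" by (simp add: dd_def)
qed

lemma dd_dd_test_field:
  assumes z: "z \<in> {a<..<b} \<times> UNIV"
  shows "dd (sp l) (dd (sp l) (test_field \<eta> j k g)) z = \<eta> (fst z) *\<^sub>R curl j k (dd (sp l) (dd (sp l) g)) z"
proof -
  let ?h = "dd (sp l) g"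
  have "dd (sp l) (dd (sp l) (test_field \<eta> j k g)) z = dd (sp l) (\<lambda>z. \<eta> (fst z) *\<^sub>R curl j k ?h z) z"
    by (rule dd_cong[OF open_slab z]) (simp add: dd_test_field)
  also have "\<dots> = \<eta> (fst z) *\<^sub>R dd (sp l) (curl j k ?h) z"
  proof -
    have "((\<lambda>z. \<eta> (fst z)) has_derivative (\<lambda>v. \<eta>' (fst z) * fst v)) (at z)"
      using has_derivative_compose[OF has_derivative_fst[OF has_derivative_ident] \<eta>(2)[of "fst z", unfolded has_field_derivative_def]] by simp
    moreover have "Ck (Suc 0) ({a<..<b} \<times> UNIV) (curl j k ?h)" by (rule Ck_curl[OF open_slab Ck_g])
    then have "(curl j k ?h has_derivative (\<lambda>v. dd v (curl j k ?h) z)) (at z)" using z by (intro has_derivative_dd) auto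
    ultimately show ?thesis
      using dd_eq[OF has_derivative_scaleR, of "\<lambda>z. \<eta> (fst z)" _ z "curl j k ?h"] by simp
  qed
  also have "dd (sp l) (curl j k ?h) z = curl j k (dd (sp l) ?h) z" by (rule curl_dd[OF open_slab Ck_g z])
  finally show ?thesis .
qed

end

context weak_solution
begin

text \<open>The weak formulation for a localized curl: since its divergence vanishes, the pressure sees the
  zero function.\<close>

lemma NS_curl:
  assumes "0 < \<alpha>" "a < \<alpha>" "\<beta> < b"
    and \<eta>: "\<And>n. Ck n UNIV \<eta>" "\<And>t. (\<eta> has_real_derivative \<eta>' t) (at t)"
    "\<And>t. \<eta> t \<noteq> 0 \<or> \<eta>' t \<noteq> 0 \<Longrightarrow> \<alpha> \<le> t \<and> t \<le> \<beta>"
    and g: "\<And>n. Ck n ({a<..<b} \<times> UNIV) g" "\<And>z i. g z \<noteq> 0 \<Longrightarrow> \<bar>snd z $ i\<bar> \<le> R"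
  shows "(LINT t:{\<alpha>..\<beta>}|lebesgue. LINT x|lebesgue. 
        - (u t x \<bullet> (\<eta> t *\<^sub>R curl j k (dd (1, 0) g) (t, x) + \<eta>' t *\<^sub>R curl j k g (t, x))) + convection t x \<bullet> (\<eta> t *\<^sub>R curl j k g (t, x)))
     = (LINT t:{\<alpha>..\<beta>}|lebesgue. LINT x|lebesgue. u t x \<bullet> (\<Sum>l\<in>UNIV. \<eta> t *\<^sub>R curl j k (dd (sp l) (dd (sp l) g)) (t, x)))"
proof -
  let ?\<Phi> = "test_field \<eta> j k g"
  have L: "test_function ({0<..} \<times> UNIV) ?\<Phi>"
    by (rule test_field_test_function[OF assms(2,3) \<eta> g, OF _ _ assms(1)])
  have td: "vector_derivative (\<lambda>s. ?\<Phi> (s, x)) (at t) = dd (1, 0) ?\<Phi> (t, x)" for x t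
    by (rule test_field_time_derivative[OF assms(2,3) \<eta> g]; assumption)
  have tl: "laplacian (\<lambda>y. ?\<Phi> (t, y)) x = (\<Sum>i\<in>UNIV. dd (sp i) (dd (sp i) ?\<Phi>) (t, x))" for x t
    by (rule test_field_laplacian[OF assms(2,3) \<eta> g]; assumption)
  have p: "distribution_on ({0<..} \<times> UNIV) p" using NS by (simp add: navier_stokes_distributional_def)
  \<comment> \<open>By homogeneity a distribution annihilates the zero function.\<close>
  have "test_function ({0<..} \<times> UNIV) (\<lambda>_::real\<times>R3. 0::real)"
    by (rule test_functionI[where K="{}"]) (auto intro: Ck_const)
  then have "p (\<lambda>x. 0 * (\<lambda>_. 0) x) = 0 * p (\<lambda>_. 0)" using p unfolding distribution_on_def by blast
  then have p0: "p (\<lambda>(t, x). divergence (\<lambda>y. ?\<Phi> (t, y)) x) = 0"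
  proof -
    have "(\<lambda>(t, x). divergence (\<lambda>y. ?\<Phi> (t, y)) x) = (\<lambda>_. 0)"
      using test_field_divergence[OF assms(2,3) \<eta> g] by (auto simp: fun_eq_iff)
    then show ?thesis using \<open>p (\<lambda>x. 0 * (\<lambda>_. 0) x) = 0 * p (\<lambda>_. 0)\<close> by simp
  qed
  have NS1: "(LINT t:{0<..}|lebesgue. LINT x|lebesgue.
            - (u t x \<bullet> vector_derivative (\<lambda>s. ?\<Phi> (s, x)) (at t)) + (Du t x *v u t x) \<bullet> ?\<Phi> (t, x))
          - p (\<lambda>(t, x). divergence (\<lambda>y. ?\<Phi> (t, y)) x)
        = (LINT t:{0<..}|lebesgue. LINT x|lebesgue. u t x \<bullet> laplacian (\<lambda>y. ?\<Phi> (t, y)) x)"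
    using NS L unfolding navier_stokes_distributional_def by blast
  have 1: "(LINT t:{0<..}|lebesgue. LINT x|lebesgue.
            - (u t x \<bullet> vector_derivative (\<lambda>s. ?\<Phi> (s, x)) (at t)) + (Du t x *v u t x) \<bullet> ?\<Phi> (t, x)) =
     (LINT t:{\<alpha>..\<beta>}|lebesgue. LINT x|lebesgue. 
        - (u t x \<bullet> (\<eta> t *\<^sub>R curl j k (dd (1, 0) g) (t, x) + \<eta>' t *\<^sub>R curl j k g (t, x))) + convection t x \<bullet> (\<eta> t *\<^sub>R curl j k g (t, x)))"
    unfolding set_lebesgue_integral_def
  proof (intro Bochner_Integration.integral_cong refl)
    fix t
    show "indicat_real {0<..} t *\<^sub>R (LINT x|lebesgue. - (u t x \<bullet> vector_derivative (\<lambda>s. ?\<Phi> (s, x)) (at t)) + (Du t x *v u t x) \<bullet> ?\<Phi> (t, x)) =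
      indicat_real {\<alpha>..\<beta>} t *\<^sub>R (LINT x|lebesgue. 
        - (u t x \<bullet> (\<eta> t *\<^sub>R curl j k (dd (1, 0) g) (t, x) + \<eta>' t *\<^sub>R curl j k g (t, x))) + convection t x \<bullet> (\<eta> t *\<^sub>R curl j k g (t, x)))"
    proof (cases "t \<in> {\<alpha>..\<beta>}")
      case True
      then have "(t, x) \<in> {a<..<b} \<times> UNIV" for x :: R3 using assms by auto
      then have d: "dd (1, 0) ?\<Phi> (t, x) = \<eta> t *\<^sub>R curl j k (dd (1, 0) g) (t, x) + \<eta>' t *\<^sub>R curl j k g (t, x)" for x
        using dd_test_field[OF assms(2,3) \<eta> g, of "(t, x)" "(1, 0)" j k] by simp
      show ?thesis using True assms(1)
        unfolding td 
        by (simp add: d convection_def test_field_def[of \<eta> j k g "(t, _)"])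
    next
      case False
      have 0: "dd (1, 0) ?\<Phi> (t, x) = 0" "?\<Phi> (t, x) = 0" for x
        using test_field_dd_off(1)[OF assms(2,3) \<eta> g, of t] test_field_off[OF assms(2,3) \<eta> g, of "(t, x)"] False by auto
      show ?thesis using False unfolding td 0 by simp
    qed
  qed
  have 2: "(LINT t:{0<..}|lebesgue. LINT x|lebesgue. u t x \<bullet> laplacian (\<lambda>y. ?\<Phi> (t, y)) x) =
     (LINT t:{\<alpha>..\<beta>}|lebesgue. LINT x|lebesgue. u t x \<bullet> (\<Sum>l\<in>UNIV. \<eta> t *\<^sub>R curl j k (dd (sp l) (dd (sp l) g)) (t, x)))"
    unfolding set_lebesgue_integral_def
  proof (intro Bochner_Integration.integral_cong refl)
    fix t
    show "indicat_real {0<..} t *\<^sub>R (LINT x|lebesgue. u t x \<bullet> laplacian (\<lambda>y. ?\<Phi> (t, y)) x) =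
      indicat_real {\<alpha>..\<beta>} t *\<^sub>R (LINT x|lebesgue. u t x \<bullet> (\<Sum>l\<in>UNIV. \<eta> t *\<^sub>R curl j k (dd (sp l) (dd (sp l) g)) (t, x)))"
    proof (cases "t \<in> {\<alpha>..\<beta>}")
      case True
      then have "(t, x) \<in> {a<..<b} \<times> UNIV" for x :: R3 using assms by auto
      then have d: "dd (sp l) (dd (sp l) ?\<Phi>) (t, x) = \<eta> t *\<^sub>R curl j k (dd (sp l) (dd (sp l) g)) (t, x)" for x l
        using dd_dd_test_field[OF assms(2,3) \<eta> g, of "(t, x)" l j k] by simp
      show ?thesis using True assms(1) unfolding tl d by simp
    next
      case False
      have 0: "dd (sp i) (dd (sp i) ?\<Phi>) (t, x) = 0" for x i
        using test_field_dd_off(2)[OF assms(2,3) \<eta> g, of t] False by auto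
      show ?thesis using False unfolding tl 0 by simp
    qed
  qed
  show ?thesis using NS1 unfolding p0 1 2 by simp
qed

end

section \<open>Limits of pairings with the velocity\<close>

lemma in_L2_slice:
  fixes V :: "real \<times> R3 \<Rightarrow> R3"
  assumes "Ck (Suc 0) (S \<times> UNIV) V" "t \<in> S" "in_L2 W"
    "\<And>x. norm (V (t, x) :: R3) \<le> C * (W x :: real)"
  shows "(\<lambda>x. V (t, x)) \<in> borel_measurable lebesgue" "in_L2 (\<lambda>x. V (t, x))"
proof -
  show m: "(\<lambda>x. V (t, x)) \<in> borel_measurable lebesgue"
    using Ck_slice_continuous(1)[OF assms(1,2)]
    by (intro borel_imp_lebesgue_measurable borel_measurable_continuous_onI)
  show "in_L2 (\<lambda>x. V (t, x))"
    by (rule in_L2_bound(1)[OF in_L2_scaleR[OF assms(3), of C] m])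
       (use order_trans[OF assms(4) abs_ge_self] in simp)
qed

lemma curl_lim:
  assumes "Ck_lim (Suc n) U w F f"
  shows "\<exists>C. \<forall>N. \<forall>z\<in>U. norm (curl j k (F N) z) \<le> C * w z" "\<And>z. z \<in> U \<Longrightarrow> (\<lambda>N. curl j k (F N) z) \<longlonglongrightarrow> curl j k f z"
proof -
  have d: "dominated_lim U w (\<lambda>N. dd v (F N)) (dd v f)" for v by (rule Ck_lim_dominated[OF Ck_lim_dd[OF assms]])
  obtain C1 where C1: "\<And>N z. z \<in> U \<Longrightarrow> \<bar>dd (sp k) (F N) z\<bar> \<le> C1 * w z" using d[of "sp k"] unfolding dominated_lim_def by blast
  obtain C2 where C2: "\<And>N z. z \<in> U \<Longrightarrow> \<bar>dd (sp j) (F N) z\<bar> \<le> C2 * w z" using d[of "sp j"] unfolding dominated_lim_def by blast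
  have "norm (curl j k (F N) z) \<le> (C1 + C2) * w z" if "z \<in> U" for N z
    using curl_norm[of j k "F N" z] C1[OF that, of N] C2[OF that, of N] by (simp add: distrib_right)
  then show "\<exists>C. \<forall>N. \<forall>z\<in>U. norm (curl j k (F N) z) \<le> C * w z" by blast
  show "(\<lambda>N. curl j k (F N) z) \<longlonglongrightarrow> curl j k f z" if "z \<in> U" for z
    unfolding curl_def using d that unfolding dominated_lim_def by (intro tendsto_intros) blast+
qed

context weak_solution
begin

context
  fixes a b t0 t0' :: real and W :: "R3 \<Rightarrow> real"
  assumes t: "0 \<le> t0" "t0 < t0'" and ab: "a < t0" "t0' < b" and W: "in_L2 W" "\<And>x. 0 \<le> W x" "\<And>x. W x \<le> 1"
begin

lemma pairing_u_continuous:
  assumes "Ck (Suc 0) ({a<..<b} \<times> UNIV) V" "\<And>t x. t \<in> {a<..<b} \<Longrightarrow> norm (V (t, x)) \<le> C * W x"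
  shows "continuous_on {t0..t0'} (\<lambda>t. L2_inner (u t) (\<lambda>x. V (t, x)))"
  by (rule inner_continuous[OF in_L2_scaleR[OF W(1), of C], where \<sigma>="\<lambda>t. t" and \<Psi>="\<lambda>t x. V (t, x)"])
     (use t ab assms in_L2_slice(1)[OF assms(1) _ W(1) assms(2)] 
        in \<open>auto intro!: continuous_on_subset[OF Ck_slice_continuous(2)[OF assms(1)]]\<close>)

lemma pairing_u_bound:
  assumes "Ck (Suc 0) ({a<..<b} \<times> UNIV) V" "\<And>t x. t \<in> {a<..<b} \<Longrightarrow> norm (V (t, x)) \<le> C * W x" "t \<in> {t0..t0'}"
  shows "\<bar>L2_inner (u t) (\<lambda>x. V (t, x))\<bar> \<le> E * (\<bar>C\<bar> * L2_norm W)"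
proof -
  have tt: "t \<in> {a<..<b}" "0 \<le> t" using assms(3) ab t by auto
  have "\<bar>L2_inner (u t) (\<lambda>x. V (t, x))\<bar> \<le> L2_norm (u t) * L2_norm (\<lambda>x. V (t, x))"
    by (intro abs_L2_inner_le u_L2 tt in_L2_slice(2)[OF assms(1) _ W(1) assms(2)])
  also have "\<dots> \<le> E * L2_norm (\<lambda>x. C *\<^sub>R W x)"
    using tt order_trans[OF assms(2) abs_ge_self]
    by (intro mult_mono u_bound E_nonneg L2_norm_nonneg in_L2_bound(2)[OF in_L2_scaleR[OF W(1)]]
          in_L2_slice(1)[OF assms(1) _ W(1) assms(2)]) auto
  finally show ?thesis using L2_norm_scaleR[of C W] by simp
qed

text \<open>Dominated convergence in space gives convergence of the pairings at each time, and the uniform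
  bound \<open>pairing_u_bound\<close> allows a second passage to the limit under the time integral.\<close>

lemma pairing_u_limit:
  assumes V: "\<And>N. Ck (Suc 0) ({a<..<b} \<times> UNIV) (V N)" "\<And>N t x. t \<in> {a<..<b} \<Longrightarrow> norm (V N (t, x)) \<le> C * W x"
    "\<And>t x. t \<in> {a<..<b} \<Longrightarrow> (\<lambda>N. V N (t, x)) \<longlonglongrightarrow> V' (t, x)" and V': "Ck (Suc 0) ({a<..<b} \<times> UNIV) V'"
    and c: "continuous_on {t0..t0'} c"
  shows "(\<lambda>N. LINT t:{t0..t0'}|lebesgue. c t * L2_inner (u t) (\<lambda>x. V N (t, x))) \<longlonglongrightarrow> 
     (LINT t:{t0..t0'}|lebesgue. c t * L2_inner (u t) (\<lambda>x. V' (t, x)))"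
proof -
  have bV': "norm (V' (t, x)) \<le> C * W x" if "t \<in> {a<..<b}" for t x
    by (rule LIMSEQ_le_const2[OF tendsto_norm[OF V(3)[OF that]]]) (use V(2)[OF that] in auto)
  have "bounded (c ` {t0..t0'})" by (intro compact_imp_bounded compact_continuous_image c) auto
  then obtain B where "\<forall>y\<in>c ` {t0..t0'}. norm y \<le> B" unfolding bounded_iff by blast
  then have B: "\<bar>c s\<bar> \<le> B" if "s \<in> {t0..t0'}" for s using that by auto
  let ?M = "B * (E * (\<bar>C\<bar> * L2_norm W))"
  have m: "set_integrable lebesgue {t0..t0'} (\<lambda>t. c t * L2_inner (u t) (\<lambda>x. V N (t, x)))" for N
    by (intro bounded_continuous_set_integrable continuous_intros c pairing_u_continuous[OF V(1,2)])
  have m': "set_integrable lebesgue {t0..t0'} (\<lambda>t. c t * L2_inner (u t) (\<lambda>x. V' (t, x)))"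
    by (intro bounded_continuous_set_integrable continuous_intros c pairing_u_continuous[OF V' bV'])
  show ?thesis
    unfolding set_lebesgue_integral_def
  proof (rule integral_dominated_convergence[where w="\<lambda>t. indicator {t0..t0'} t * ?M"])
    show "(\<lambda>t. indicator {t0..t0'} t *\<^sub>R (c t * L2_inner (u t) (\<lambda>x. V N (t, x)))) \<in> borel_measurable lebesgue" for N
      using m[of N] unfolding set_integrable_def by (rule borel_measurable_integrable)
    show "(\<lambda>t. indicator {t0..t0'} t *\<^sub>R (c t * L2_inner (u t) (\<lambda>x. V' (t, x)))) \<in> borel_measurable lebesgue"
      using m' unfolding set_integrable_def by (rule borel_measurable_integrable)
    show "integrable lebesgue (\<lambda>t. indicator {t0..t0'} t * ?M)"
      using bounded_continuous_set_integrable[of t0 t0' "\<lambda>_. ?M"] by (simp add: set_integrable_def)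
    show "AE s in lebesgue. norm (indicator {t0..t0'} s *\<^sub>R (c s * L2_inner (u s) (\<lambda>x. V N (s, x)))) \<le> indicator {t0..t0'} s * ?M" for N
    proof (intro AE_I2)
      fix s
      show "norm (indicator {t0..t0'} s *\<^sub>R (c s * L2_inner (u s) (\<lambda>x. V N (s, x)))) \<le> indicator {t0..t0'} s * ?M"
      proof (cases "s \<in> {t0..t0'}")
        case True
        have "\<bar>c s\<bar> * \<bar>L2_inner (u s) (\<lambda>x. V N (s, x))\<bar> \<le> B * (E * (\<bar>C\<bar> * L2_norm W))"
          using B[OF True] pairing_u_bound[OF V(1,2) True] by (intro mult_mono) auto
        then show ?thesis using True by (simp add: abs_mult)
      qed simp
    qed
    show "AE s in lebesgue. (\<lambda>N. indicator {t0..t0'} s *\<^sub>R (c s * L2_inner (u s) (\<lambda>x. V N (s, x)))) \<longlonglongrightarrow> indicator {t0..t0'} s *\<^sub>R (c s * L2_inner (u s) (\<lambda>x. V' (s, x)))"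
    proof (intro AE_I2)
      fix s
      show "(\<lambda>N. indicator {t0..t0'} s *\<^sub>R (c s * L2_inner (u s) (\<lambda>x. V N (s, x)))) \<longlonglongrightarrow> indicator {t0..t0'} s *\<^sub>R (c s * L2_inner (u s) (\<lambda>x. V' (s, x)))"
      proof (cases "s \<in> {t0..t0'}")
        case True
        then have s: "s \<in> {a<..<b}" "0 \<le> s" using ab t by auto
        note L = in_L2_slice[OF V(1) s(1) W(1) V(2)[OF s(1)]]
        note L' = in_L2_slice[OF V' s(1) W(1) bV'[OF s(1)]]
        have CW: "in_L2 (\<lambda>x. C * W x)" using in_L2_scaleR[OF W(1), of C] by simp
        from L2_inner_limit[OF u_L2[OF s(2)] CW L(1) L'(1) V(2)[OF s(1)] V(3)[OF s(1)]]
        show ?thesis by (intro tendsto_intros)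
      qed simp
    qed
  qed
qed

end

end

section \<open>The Duhamel identity for divergence-free kernels\<close>

text \<open>Column \<open>j\<close> of \<open>(\<Delta> I - \<nabla>\<nabla>) G\<^sub>t\<close> for the heat kernel \<open>G\<^sub>t\<close>. It is the sum over \<open>k\<close> of the fields
  \<open>curl j k (\<partial>\<^sub>k G\<^sub>t)\<close>, hence divergence free, and it solves the heat equation.\<close>

definition div_free_kernel :: "real \<Rightarrow> R3 \<Rightarrow> 3 \<Rightarrow> R3" where
  "div_free_kernel t x j = (\<Sum>k\<in>UNIV. heat_hess t x k k *\<^sub>R axis j 1 - heat_hess t x k j *\<^sub>R axis k 1)"

context weak_solution
begin

text \<open>The test fields are \<open>\<eta>(s) curl (\<chi>\<^sub>N f)\<close> with a time cutoff \<open>\<eta>\<close> and a spatial cutoff \<open>\<chi>\<^sub>N\<close>. As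
  \<open>N \<rightarrow> \<infinity>\<close>, the terms in which the backward heat operator falls on \<open>\<chi>\<^sub>N f\<close> disappear, because \<open>f\<close>
  solves the backward heat equation; what is left are the convection term and the term with \<open>\<eta>'\<close>.
  As \<open>\<eta>\<close> tends to the indicator of \<open>{t0..t0'}\<close>, the latter tends to the boundary values. The
  remaining claims are the integrability needed to sum the identity over indices.\<close>

lemma curl_identity:
  fixes y :: R3 and i j k :: 3
  assumes t: "0 \<le> t0" "t0 < t0'" and r: "t0' < r"
  defines "f \<equiv> dd (sp i) (backward_heat r y)"
  shows "(LINT s:{t0..t0'}|lebesgue. LINT x|lebesgue. convection s x \<bullet> curl j k f (s, x)) =
     L2_inner (u t0) (\<lambda>x. curl j k f (t0, x)) - L2_inner (u t0') (\<lambda>x. curl j k f (t0', x))"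
    and "set_integrable lebesgue {t0..t0'} (\<lambda>s. LINT x|lebesgue. convection s x \<bullet> curl j k f (s, x))"
    and "s \<in> {t0..t0'} \<Longrightarrow> in_L2 (\<lambda>x. curl j k f (s, x))"
    and "s \<in> {t0..t0'} \<Longrightarrow> \<exists>C. \<forall>x. norm (curl j k f (s, x)) \<le> C"
proof -
  \<comment> \<open>A slab around the time interval on which the kernel with pole at time \<open>r\<close> is smooth; its
    left end may be negative.\<close>
  define a b where "a = t0 - 1" and "b = (t0' + r) / 2"
  define W where "W x = gauss_weight (r - a) (x - y)" for x
  define U where "U = {a<..<b} \<times> (UNIV :: R3 set)"
  define \<psi> where "\<psi> N z = cutoff N (snd z) * f z" for N z
  have ab: "a < t0" "t0' < b" "b < r" "a < b" using t r by (auto simp: a_def b_def)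
  have A: "r - a > 0" using ab t by simp
  have W: "in_L2 W" "\<And>x. 0 \<le> W x" "\<And>x. W x \<le> 1"
    unfolding W_def[abs_def] using gauss_weight_L2[OF A, of y] gauss_weight_range[OF A] by (auto intro: less_imp_le)
  have op: "open U" unfolding U_def by (intro open_Times) auto
  have B: "Ck_lim n U (\<lambda>z. W (snd z)) (\<lambda>_. backward_heat r y) (backward_heat r y)" for n
    using Ck_lim_heat_poly[OF heat_poly.const[of 1] ab(3,4), where n=n and y=y] by (simp add: U_def W_def)
  have F: "Ck_lim n U (\<lambda>z. W (snd z)) (\<lambda>_. f) f" for n unfolding f_def by (rule Ck_lim_dd[OF B])
  have \<psi>: "Ck_lim n U (\<lambda>z. W (snd z)) \<psi> f" for n
    using Ck_lim_mult1[OF op F Ck_lim_subset[OF Ck_lim_cutoff[OF bounded_linear_snd], of U]] by (simp add: \<psi>_def[abs_def])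
  have heat: "heat_op f z = 0" if "z \<in> U" for z
    unfolding f_def
  proof (rule heat_op_dd[OF op Ck_lim_imp_Ck_limit[OF B] _ that])
    show "heat_op (backward_heat r y) z = 0" if "z \<in> U" for z
      unfolding heat_op_def by (rule backward_heat_heat_equation) (use that ab in \<open>auto simp: U_def\<close>)
  qed
  define V where "V = curl j k f"
  \<comment> \<open>\<open>S1 + S2\<close> is the curl of the backward heat operator applied to the cut off potential.\<close>
  define V1 where "V1 N = curl j k (\<psi> N)" for N
  define S1 where "S1 N = curl j k (dd (1, 0) (\<psi> N))" for N
  define S2 where "S2 N z = (\<Sum>l\<in>UNIV. curl j k (dd (sp l) (dd (sp l) (\<psi> N))) z)" for N z
  have CkV: "Ck (Suc 0) U V" unfolding V_def by (rule Ck_curl[OF op Ck_lim_imp_Ck_limit[OF F]])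
  have CkV1: "Ck (Suc 0) U (V1 N)" for N unfolding V1_def by (rule Ck_curl[OF op Ck_lim_imp_Ck[OF \<psi>]])
  have CkS1: "Ck (Suc 0) U (S1 N)" for N unfolding S1_def by (rule Ck_curl[OF op Ck_lim_imp_Ck[OF Ck_lim_dd[OF \<psi>]]])
  have CkS2: "Ck (Suc 0) U (S2 N)" for N unfolding S2_def[abs_def] sum_3
    by (intro Ck_add op Ck_curl[OF op Ck_lim_imp_Ck[OF Ck_lim_dd[OF Ck_lim_dd[OF \<psi>]]]])
  obtain C1 where C1: "\<And>N z. z \<in> U \<Longrightarrow> norm (V1 N z) \<le> C1 * W (snd z)"
    using curl_lim(1)[OF \<psi>, where j=j and k=k] unfolding V1_def by blast
  have V1lim: "(\<lambda>N. V1 N z) \<longlonglongrightarrow> V z" if "z \<in> U" for z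
    unfolding V1_def V_def by (rule curl_lim(2)[OF \<psi> that])
  have bV: "norm (V z) \<le> C1 * W (snd z)" if "z \<in> U" for z
    by (rule LIMSEQ_le_const2[OF tendsto_norm[OF V1lim[OF that]]]) (use C1[OF that] in auto)
  obtain D1 where D1: "\<And>N z. z \<in> U \<Longrightarrow> norm (S1 N z) \<le> D1 * W (snd z)"
    using curl_lim(1)[OF Ck_lim_dd[OF \<psi>], where j=j and k=k] unfolding S1_def by blast
  have "\<exists>D. \<forall>N. \<forall>z\<in>U. norm (curl j k (dd (sp l) (dd (sp l) (\<psi> N))) z) \<le> D * W (snd z)" for l
    by (rule curl_lim(1)[OF Ck_lim_dd[OF Ck_lim_dd[OF \<psi>]]])
  then obtain D where D: "\<And>l N z. z \<in> U \<Longrightarrow> norm (curl j k (dd (sp l) (dd (sp l) (\<psi> N))) z) \<le> D l * W (snd z)"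
    by metis
  have D2: "norm (S2 N z) \<le> sum D UNIV * W (snd z)" if "z \<in> U" for N z
    unfolding S2_def sum_distrib_right by (rule order_trans[OF norm_sum]) (intro sum_mono D that)
  have V2lim: "(\<lambda>N. S1 N z + S2 N z) \<longlonglongrightarrow> 0" if z: "z \<in> U" for z
  proof -
    have h0: "dd v (heat_op f) z = 0" for v
    proof -
      have "dd v (heat_op f) z = dd v (\<lambda>_. 0) z" by (rule dd_cong[OF op z]) (rule heat)
      then show ?thesis by (simp add: dd_def)
    qed
    have "(\<lambda>N. S1 N z + S2 N z) \<longlonglongrightarrow> curl j k (dd (1, 0) f) z + (\<Sum>l\<in>UNIV. curl j k (dd (sp l) (dd (sp l) f)) z)"
      unfolding S1_def S2_def
      by (intro tendsto_add tendsto_sum curl_lim(2)[OF Ck_lim_dd[OF \<psi>] z] curl_lim(2)[OF Ck_lim_dd[OF Ck_lim_dd[OF \<psi>]] z])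
    also have "curl j k (dd (1, 0) f) z + (\<Sum>l\<in>UNIV. curl j k (dd (sp l) (dd (sp l) f)) z) =
      dd (sp k) (heat_op f) z *\<^sub>R axis j 1 - dd (sp j) (heat_op f) z *\<^sub>R axis k 1"
      unfolding dd_heat_op[OF Ck_lim_imp_Ck_limit[OF F] z] curl_def
      by (simp add: sum_subtractf scaleR_add_left scaleR_sum_left algebra_simps)
    also have "\<dots> = 0" by (simp add: h0)
    finally show ?thesis .
  qed
  let ?J = "{t0..t0'}"
  have JU: "(s, x) \<in> U" if "s \<in> ?J" for s x using that ab by (auto simp: U_def)
  have slab: "(s, x) \<in> U" if "s \<in> {a<..<b}" for s x using that by (auto simp: U_def)
  note ctx = t ab(1,2) W
  have cont: "continuous_on ?J (\<lambda>s. X (s, x))" if "Ck (Suc 0) U X" for X :: "real \<times> R3 \<Rightarrow> R3" and x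
    by (rule continuous_on_subset[OF Ck_slice_continuous(2)[OF that[unfolded U_def]]]) (use ab in auto)
  have meas: "(\<lambda>x. X (s, x)) \<in> borel_measurable lebesgue" if "Ck (Suc 0) U X" "s \<in> ?J" for X :: "real \<times> R3 \<Rightarrow> R3" and s
    by (intro borel_imp_lebesgue_measurable borel_measurable_continuous_onI Ck_slice_continuous(1)[OF that(1)[unfolded U_def]])
       (use ab that in auto)
  have C10: "0 \<le> C1"
  proof -
    have "0 \<le> C1 * W y" using order_trans[OF norm_ge_zero C1[OF JU, of t0 0 y]] t by simp
    moreover have "0 < W y" unfolding W_def by (rule gauss_weight_range(1)[OF A])
    ultimately show ?thesis by (simp add: zero_le_mult_iff)
  qed
  have bound1: "norm (c *\<^sub>R X) \<le> C1" if "\<bar>c\<bar> \<le> 1" "norm X \<le> C1 * W x" for c x and X :: R3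
  proof -
    have "\<bar>c\<bar> * norm X \<le> 1 * (C1 * W x)" using that by (intro mult_mono) auto
    also have "\<dots> \<le> C1 * 1" using mult_left_mono[OF W(3)[of x] C10] by simp
    finally show ?thesis by simp
  qed
  have L2: "in_L2 (\<lambda>x. X (s, x))" if "Ck (Suc 0) U X" "\<And>z. z \<in> U \<Longrightarrow> norm (X z) \<le> Z * W (snd z)" "s \<in> ?J"
    for X :: "real \<times> R3 \<Rightarrow> R3" and Z s
    by (rule in_L2_slice(2)[OF that(1)[unfolded U_def] _ W(1), where C=Z]) (use ab that JU in auto)
  \<comment> \<open>What remains when the spatial cutoff has been removed and the time cutoff is still in place.\<close>
  have main: "(LINT s:?J|lebesgue. LINT x|lebesgue. convection s x \<bullet> (time_cutoff t0 t0' m s *\<^sub>R V (s, x))) =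
     (LINT s:?J|lebesgue. time_cutoff_deriv t0 t0' m s * L2_inner (u s) (\<lambda>x. V (s, x)))" for m
  proof -
    define \<eta> \<eta>' where "\<eta> = time_cutoff t0 t0' m" and "\<eta>' = time_cutoff_deriv t0 t0' m"
    define \<alpha> \<beta> where "\<alpha> = t0 + 1 / real (Suc m)" and "\<beta> = t0' - 1 / real (Suc m)"
    have "1 / real (Suc m) > 0" by simp
    then have \<alpha>\<beta>: "0 < \<alpha>" "a < \<alpha>" "\<beta> < b" "{\<alpha>..\<beta>} \<subseteq> ?J"
      using t ab unfolding \<alpha>_def \<beta>_def atLeastatMost_subset_iff by linarith+
    have supp: "\<alpha> \<le> s \<and> s \<le> \<beta>" if "\<eta> s \<noteq> 0 \<or> \<eta>' s \<noteq> 0" for s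
      using time_cutoff_support[of t0 t0' m s] that unfolding \<eta>_def \<eta>'_def \<alpha>_def \<beta>_def by auto
    have c\<eta>: "continuous_on ?J \<eta>" "continuous_on ?J \<eta>'" unfolding \<eta>_def \<eta>'_def by (rule time_cutoff_continuous)+
    have \<eta>1: "\<bar>\<eta> s\<bar> \<le> 1" for s unfolding \<eta>_def by (rule time_cutoff_range)
    have m1: "(\<lambda>x. \<eta> s *\<^sub>R V1 N (s, x)) \<in> borel_measurable lebesgue" if "s \<in> ?J" for s N
      using meas[OF CkV1 that] by measurable
    have b1: "norm (\<eta> s *\<^sub>R V1 N (s, x)) \<le> C1" if "s \<in> ?J" for s x N
      using bound1[OF \<eta>1 C1[OF JU[OF that], unfolded snd_conv]] .
    have c1: "continuous_on ?J (\<lambda>s. \<eta> s *\<^sub>R V1 N (s, x))" for x N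
      by (intro continuous_intros c\<eta> cont CkV1)
    have N: "(LINT s:?J|lebesgue. LINT x|lebesgue. convection s x \<bullet> (\<eta> s *\<^sub>R V1 N (s, x))) =
       (LINT s:?J|lebesgue. \<eta>' s * L2_inner (u s) (\<lambda>x. V1 N (s, x))) + (LINT s:?J|lebesgue. \<eta> s * L2_inner (u s) (\<lambda>x. S1 N (s, x) + S2 N (s, x)))" for N
    proof -
      have CkN: "Ck n ({a<..<b} \<times> UNIV) (\<psi> N)" for n using Ck_lim_imp_Ck[OF \<psi>, of n N] by (simp add: U_def)
      have supN: "\<bar>snd z $ i\<bar> \<le> 2 * real (Suc N)" if "\<psi> N z \<noteq> 0" for z i
        using cutoff_support[of N "snd z" i] that by (simp add: \<psi>_def)
      have NS: "(LINT s:{\<alpha>..\<beta>}|lebesgue. LINT x|lebesgue. - (u s x \<bullet> (\<eta> s *\<^sub>R S1 N (s, x) + \<eta>' s *\<^sub>R V1 N (s, x))) + convection s x \<bullet> (\<eta> s *\<^sub>R V1 N (s, x)))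
        = (LINT s:{\<alpha>..\<beta>}|lebesgue. LINT x|lebesgue. u s x \<bullet> (\<Sum>l\<in>UNIV. \<eta> s *\<^sub>R curl j k (dd (sp l) (dd (sp l) (\<psi> N))) (s, x)))"
        unfolding S1_def V1_def
        by (rule NS_curl[OF \<alpha>\<beta>(1-3) _ _ supp CkN supN])
           (auto simp: \<eta>_def \<eta>'_def intro!: Ck_time_cutoff time_cutoff_has_derivative)
      note uL2 = u_L2[OF order_trans[OF t(1)]]
      have iB: "set_integrable lebesgue ?J (\<lambda>s. LINT x|lebesgue. convection s x \<bullet> (\<eta> s *\<^sub>R V1 N (s, x)))"
        by (rule convection_pairing_time_integrable(2)[OF t m1 b1 c1])
      have iP: "set_integrable lebesgue ?J (\<lambda>s. \<eta>' s * L2_inner (u s) (\<lambda>x. V1 N (s, x)))"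
        by (intro bounded_continuous_set_integrable continuous_intros c\<eta> pairing_u_continuous[OF ctx CkV1[unfolded U_def], where C=C1])
           (use C1[OF slab] in auto)
      have iS1: "set_integrable lebesgue ?J (\<lambda>s. \<eta> s * L2_inner (u s) (\<lambda>x. S1 N (s, x)))"
        by (intro bounded_continuous_set_integrable continuous_intros c\<eta> pairing_u_continuous[OF ctx CkS1[unfolded U_def], where C=D1])
           (use D1[OF slab] in auto)
      have iS2: "set_integrable lebesgue ?J (\<lambda>s. \<eta> s * L2_inner (u s) (\<lambda>x. S2 N (s, x)))"
        by (intro bounded_continuous_set_integrable continuous_intros c\<eta> pairing_u_continuous[OF ctx CkS2[unfolded U_def], where C="sum D UNIV"])
           (use D2[OF slab] in auto)
      \<comment> \<open>The left-hand side of the weak formulation, split into separately integrable terms and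
        extended by 0 to the whole interval.\<close>
      let ?G = "\<lambda>s. (LINT x|lebesgue. convection s x \<bullet> (\<eta> s *\<^sub>R V1 N (s, x))) - \<eta>' s * L2_inner (u s) (\<lambda>x. V1 N (s, x)) - \<eta> s * L2_inner (u s) (\<lambda>x. S1 N (s, x))"
      have iG: "set_integrable lebesgue ?J ?G" by (intro set_integral_diff(1) iB iP iS1)
      have L: "(LINT s:{\<alpha>..\<beta>}|lebesgue. LINT x|lebesgue. - (u s x \<bullet> (\<eta> s *\<^sub>R S1 N (s, x) + \<eta>' s *\<^sub>R V1 N (s, x))) + convection s x \<bullet> (\<eta> s *\<^sub>R V1 N (s, x))) =
        (LINT s:?J|lebesgue. ?G s)"
        unfolding set_lebesgue_integral_def
      proof (rule lebesgue_integral_cong_AE_total)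
        show "(\<lambda>s. indicator ?J s *\<^sub>R ?G s) \<in> borel_measurable lebesgue"
          using iG unfolding set_integrable_def by (rule borel_measurable_integrable)
        show "AE s in lebesgue. indicator ?J s *\<^sub>R ?G s = indicator {\<alpha>..\<beta>} s *\<^sub>R (LINT x|lebesgue. - (u s x \<bullet> (\<eta> s *\<^sub>R S1 N (s, x) + \<eta>' s *\<^sub>R V1 N (s, x))) + convection s x \<bullet> (\<eta> s *\<^sub>R V1 N (s, x)))"
          using good_times_AE[OF t]
        proof eventually_elim
          fix s assume g: "s \<in> ?J \<longleftrightarrow> s \<in> good_times t0 t0'"
          consider "s \<notin> ?J" | "s \<in> ?J" "s \<notin> {\<alpha>..\<beta>}" | "s \<in> {\<alpha>..\<beta>}" "s \<in> ?J" using \<alpha>\<beta>(4) by blast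
          then show "indicator ?J s *\<^sub>R ?G s = indicator {\<alpha>..\<beta>} s *\<^sub>R (LINT x|lebesgue. - (u s x \<bullet> (\<eta> s *\<^sub>R S1 N (s, x) + \<eta>' s *\<^sub>R V1 N (s, x))) + convection s x \<bullet> (\<eta> s *\<^sub>R V1 N (s, x)))"
          proof cases
            case 1 then have "s \<notin> {\<alpha>..\<beta>}" using \<alpha>\<beta>(4) by blast with 1 show ?thesis by simp
          next
            case 2 
            then have "\<eta> s = 0" "\<eta>' s = 0" using supp[of s] by auto
            then show ?thesis using 2 by simp
          next
            case 3
            then have s: "s \<in> T" "0 \<le> s" using g t by auto
            have i1: "integrable lebesgue (\<lambda>x. u s x \<bullet> S1 N (s, x))" 
              by (intro integrable_inner_L2 u_L2 s L2[OF CkS1 D1 3(2)])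
            have i2: "integrable lebesgue (\<lambda>x. u s x \<bullet> V1 N (s, x))" 
              by (intro integrable_inner_L2 u_L2 s L2[OF CkV1 C1 3(2)])
            have i3: "integrable lebesgue (\<lambda>x. convection s x \<bullet> (\<eta> s *\<^sub>R V1 N (s, x)))"
              by (rule convection_pairing(1)[OF s(1) m1[OF 3(2)] b1[OF 3(2)]])
            have "(LINT x|lebesgue. - (u s x \<bullet> (\<eta> s *\<^sub>R S1 N (s, x) + \<eta>' s *\<^sub>R V1 N (s, x))) + convection s x \<bullet> (\<eta> s *\<^sub>R V1 N (s, x)))
              = (LINT x|lebesgue. convection s x \<bullet> (\<eta> s *\<^sub>R V1 N (s, x)) - \<eta>' s * (u s x \<bullet> V1 N (s, x)) - \<eta> s * (u s x \<bullet> S1 N (s, x)))"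
              by (intro Bochner_Integration.integral_cong refl) (simp add: inner_add_right)
            also have "\<dots> = ?G s"
              unfolding L2_inner_def
              by (subst Bochner_Integration.integral_diff, intro Bochner_Integration.integrable_diff integrable_mult_right i3 i2,
                  intro integrable_mult_right i1, subst Bochner_Integration.integral_diff, rule i3, intro integrable_mult_right i2) simp
            finally show ?thesis using 3 by simp
          qed
        qed
      qed
      have Rt: "(LINT s:{\<alpha>..\<beta>}|lebesgue. LINT x|lebesgue. u s x \<bullet> (\<Sum>l\<in>UNIV. \<eta> s *\<^sub>R curl j k (dd (sp l) (dd (sp l) (\<psi> N))) (s, x))) =
        (LINT s:?J|lebesgue. \<eta> s * L2_inner (u s) (\<lambda>x. S2 N (s, x)))"
        unfolding set_lebesgue_integral_def
      proof (intro Bochner_Integration.integral_cong refl)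
        fix s
        have "(LINT x|lebesgue. u s x \<bullet> (\<Sum>l\<in>UNIV. \<eta> s *\<^sub>R curl j k (dd (sp l) (dd (sp l) (\<psi> N))) (s, x))) = \<eta> s * L2_inner (u s) (\<lambda>x. S2 N (s, x))"
          unfolding S2_def L2_inner_def scaleR_sum_right[symmetric] by simp
        moreover have "indicator {\<alpha>..\<beta>} s * \<eta> s = indicator ?J s * \<eta> s"
          using supp[of s] \<alpha>\<beta>(4) by (cases "\<eta> s = 0") (auto simp: indicator_def)
        ultimately show "indicator {\<alpha>..\<beta>} s *\<^sub>R (LINT x|lebesgue. u s x \<bullet> (\<Sum>l\<in>UNIV. \<eta> s *\<^sub>R curl j k (dd (sp l) (dd (sp l) (\<psi> N))) (s, x))) =
          indicator ?J s *\<^sub>R (\<eta> s * L2_inner (u s) (\<lambda>x. S2 N (s, x)))"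
          by (simp add: mult.assoc[symmetric])
      qed
      have "(LINT s:?J|lebesgue. ?G s) = (LINT s:?J|lebesgue. LINT x|lebesgue. convection s x \<bullet> (\<eta> s *\<^sub>R V1 N (s, x)))
         - (LINT s:?J|lebesgue. \<eta>' s * L2_inner (u s) (\<lambda>x. V1 N (s, x))) - (LINT s:?J|lebesgue. \<eta> s * L2_inner (u s) (\<lambda>x. S1 N (s, x)))"
        by (simp only: set_integral_diff(2)[OF set_integral_diff(1)[OF iB iP] iS1] set_integral_diff(2)[OF iB iP])
      moreover have "(LINT s:?J|lebesgue. \<eta> s * L2_inner (u s) (\<lambda>x. S1 N (s, x) + S2 N (s, x))) =
         (LINT s:?J|lebesgue. \<eta> s * L2_inner (u s) (\<lambda>x. S1 N (s, x))) + (LINT s:?J|lebesgue. \<eta> s * L2_inner (u s) (\<lambda>x. S2 N (s, x)))"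
      proof -
        have "(LINT s:?J|lebesgue. \<eta> s * L2_inner (u s) (\<lambda>x. S1 N (s, x) + S2 N (s, x))) =
          (LINT s:?J|lebesgue. \<eta> s * L2_inner (u s) (\<lambda>x. S1 N (s, x)) + \<eta> s * L2_inner (u s) (\<lambda>x. S2 N (s, x)))"
        proof (rule set_lebesgue_integral_cong)
          show "\<forall>s. s \<in> ?J \<longrightarrow> \<eta> s * L2_inner (u s) (\<lambda>x. S1 N (s, x) + S2 N (s, x)) = \<eta> s * L2_inner (u s) (\<lambda>x. S1 N (s, x)) + \<eta> s * L2_inner (u s) (\<lambda>x. S2 N (s, x))"
          proof (intro allI impI)
            fix s assume s: "s \<in> ?J"
            then have s0: "0 \<le> s" using t by auto
            have "L2_inner (u s) (\<lambda>x. S1 N (s, x) + S2 N (s, x)) = L2_inner (u s) (\<lambda>x. S1 N (s, x)) + L2_inner (u s) (\<lambda>x. S2 N (s, x))"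
              unfolding L2_inner_def inner_add_right
              by (intro Bochner_Integration.integral_add integrable_inner_L2 u_L2 s0 L2[OF CkS1 D1 s] L2[OF CkS2 D2 s])
            then show "\<eta> s * L2_inner (u s) (\<lambda>x. S1 N (s, x) + S2 N (s, x)) = \<eta> s * L2_inner (u s) (\<lambda>x. S1 N (s, x)) + \<eta> s * L2_inner (u s) (\<lambda>x. S2 N (s, x))"
              by (simp add: distrib_left)
          qed
        qed simp
        then show ?thesis by (simp only: set_integral_add(2)[OF iS1 iS2])
      qed
      ultimately show ?thesis using NS unfolding L Rt by simp
    qed
    have l1: "(\<lambda>N. LINT s:?J|lebesgue. LINT x|lebesgue. convection s x \<bullet> (\<eta> s *\<^sub>R V1 N (s, x))) \<longlonglongrightarrow> 
       (LINT s:?J|lebesgue. LINT x|lebesgue. convection s x \<bullet> (\<eta> s *\<^sub>R V (s, x)))"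
    proof (rule convection_pairing_time_limit[OF t m1 b1 c1])
      show "(\<lambda>x. \<eta> s *\<^sub>R V (s, x)) \<in> borel_measurable lebesgue" if "s \<in> ?J" for s
        using meas[OF CkV that] by measurable
      show "continuous_on ?J (\<lambda>s. \<eta> s *\<^sub>R V (s, x))" for x by (intro continuous_intros c\<eta> cont CkV)
      show "(\<lambda>N. \<eta> s *\<^sub>R V1 N (s, x)) \<longlonglongrightarrow> \<eta> s *\<^sub>R V (s, x)" if "s \<in> {t0<..<t0'}" for s x
        using that by (intro tendsto_intros V1lim JU) auto
      show "norm (\<eta> s *\<^sub>R V (s, x)) \<le> C1" if "s \<in> ?J" for s x
        using bound1[OF \<eta>1 bV[OF JU[OF that], unfolded snd_conv]] .
    qed
    have l2: "(\<lambda>N. LINT s:?J|lebesgue. \<eta>' s * L2_inner (u s) (\<lambda>x. V1 N (s, x))) \<longlonglongrightarrow> 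
       (LINT s:?J|lebesgue. \<eta>' s * L2_inner (u s) (\<lambda>x. V (s, x)))"
      by (rule pairing_u_limit[OF ctx CkV1[unfolded U_def] _ _ CkV[unfolded U_def] c\<eta>(2), where C=C1])
         (use C1[OF slab] V1lim[OF slab] in auto)
    have "(\<lambda>N. LINT s:?J|lebesgue. \<eta> s * L2_inner (u s) (\<lambda>x. (\<lambda>z. S1 N z + S2 N z) (s, x))) \<longlonglongrightarrow> 
       (LINT s:?J|lebesgue. \<eta> s * L2_inner (u s) (\<lambda>x. (\<lambda>_. 0) (s, x)))"
    proof (rule pairing_u_limit[OF ctx _ _ _ _ c\<eta>(1), where C="D1 + sum D UNIV"])
      show "Ck (Suc 0) ({a<..<b} \<times> UNIV) (\<lambda>z. S1 N z + S2 N z)" for N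
        using Ck_add[OF op CkS1 CkS2] by (simp add: U_def)
      show "Ck (Suc 0) ({a<..<b} \<times> UNIV) (\<lambda>_::real \<times> R3. 0 :: R3)" using Ck_const[OF op] by (simp add: U_def)
      show "norm (S1 N (s, x) + S2 N (s, x)) \<le> (D1 + sum D UNIV) * W x" if "s \<in> {a<..<b}" for N s x
        using norm_triangle_ineq[of "S1 N (s, x)" "S2 N (s, x)"] D1[OF slab[OF that], of N x] D2[OF slab[OF that], of N x]
        by (simp add: distrib_right)
      show "(\<lambda>N. S1 N (s, x) + S2 N (s, x)) \<longlonglongrightarrow> 0" if "s \<in> {a<..<b}" for s x by (rule V2lim[OF slab[OF that]])
    qed
    then have l3: "(\<lambda>N. LINT s:?J|lebesgue. \<eta> s * L2_inner (u s) (\<lambda>x. S1 N (s, x) + S2 N (s, x))) \<longlonglongrightarrow> 0"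
      by (simp add: L2_inner_def)
    show ?thesis
      using LIMSEQ_unique[OF l1[unfolded N] tendsto_add[OF l2 l3]] by (simp add: \<eta>_def \<eta>'_def)
  qed
  have r1: "(\<lambda>m. LINT s:?J|lebesgue. LINT x|lebesgue. convection s x \<bullet> (time_cutoff t0 t0' m s *\<^sub>R V (s, x))) \<longlonglongrightarrow>
     (LINT s:?J|lebesgue. LINT x|lebesgue. convection s x \<bullet> V (s, x))"
  proof (rule convection_pairing_time_limit[OF t, where C=C1])
    show "(\<lambda>m. time_cutoff t0 t0' m s *\<^sub>R V (s, x)) \<longlonglongrightarrow> V (s, x)" if "s \<in> {t0<..<t0'}" for s x
      using tendsto_scaleR[OF time_cutoff_tendsto tendsto_const, of t0 s t0' "V (s, x)"] that by simp
    show "norm (V (s, x)) \<le> C1" if "s \<in> ?J" for s x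
      using bound1[of 1 "V (s, x)" x] bV[OF JU[OF that], of x] by simp
    show "(\<lambda>x. time_cutoff t0 t0' m s *\<^sub>R V (s, x)) \<in> borel_measurable lebesgue" if "s \<in> ?J" for s m
      using meas[OF CkV that] by measurable
    show "continuous_on ?J (\<lambda>s. time_cutoff t0 t0' m s *\<^sub>R V (s, x))" for x m
      by (intro continuous_intros time_cutoff_continuous(1) cont CkV)
    show "norm (time_cutoff t0 t0' m s *\<^sub>R V (s, x)) \<le> C1" if "s \<in> ?J" for s x m
      using bound1[OF time_cutoff_range bV[OF JU[OF that], unfolded snd_conv]] .
  qed (use meas[OF CkV] cont[OF CkV] in auto)
  have r2: "(\<lambda>m. LINT s:?J|lebesgue. time_cutoff_deriv t0 t0' m s * L2_inner (u s) (\<lambda>x. V (s, x))) \<longlonglongrightarrow>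
     L2_inner (u t0) (\<lambda>x. V (t0, x)) - L2_inner (u t0') (\<lambda>x. V (t0', x))"
    by (intro time_cutoff_deriv_limit t pairing_u_continuous[OF ctx CkV[unfolded U_def], where C=C1]) (use bV[OF slab] in auto)
  show "(LINT s:{t0..t0'}|lebesgue. LINT x|lebesgue. convection s x \<bullet> curl j k f (s, x)) =
     L2_inner (u t0) (\<lambda>x. curl j k f (t0, x)) - L2_inner (u t0') (\<lambda>x. curl j k f (t0', x))"
    using LIMSEQ_unique[OF r1[unfolded main] r2] by (simp add: V_def)
  have V1: "norm (V (s, x)) \<le> C1" if "s \<in> ?J" for s x
    using bound1[of 1 "V (s, x)" x] bV[OF JU[OF that], of x] by simp
  show "set_integrable lebesgue {t0..t0'} (\<lambda>s. LINT x|lebesgue. convection s x \<bullet> curl j k f (s, x))"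
    unfolding V_def[symmetric]
    by (rule convection_pairing_time_integrable(2)[OF t meas[OF CkV] V1 cont[OF CkV]])
  show "in_L2 (\<lambda>x. curl j k f (s, x))" if "s \<in> {t0..t0'}" for s
    unfolding V_def[symmetric] by (rule L2[OF CkV bV that])
  show "\<exists>C. \<forall>x. norm (curl j k f (s, x)) \<le> C" if "s \<in> {t0..t0'}" for s
    unfolding V_def[symmetric] using V1[OF that] by blast
qed

lemma kernel_identity:
  assumes t: "0 \<le> t0" "t0 < t0'" and r: "t0' < r"
  shows "(LINT s:{t0..t0'}|lebesgue. LINT x|lebesgue. convection s x \<bullet> div_free_kernel (r - s) (x - y) j) =
     L2_inner (u t0) (\<lambda>x. div_free_kernel (r - t0) (x - y) j) - L2_inner (u t0') (\<lambda>x. div_free_kernel (r - t0') (x - y) j)"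
proof -
  let ?V = "\<lambda>k. curl j k (dd (sp k) (backward_heat r y))"
  note I = curl_identity[OF t r]
  have M: "div_free_kernel (r - s) (x - y) j = (\<Sum>k\<in>UNIV. ?V k (s, x))" if "s \<in> {t0..t0'}" for s x
    unfolding div_free_kernel_def curl_def using that r by (simp add: dd_dd_backward_heat)
  have inner: "L2_inner (u s) (\<lambda>x. div_free_kernel (r - s) (x - y) j) = (\<Sum>k\<in>UNIV. L2_inner (u s) (\<lambda>x. ?V k (s, x)))" if "s \<in> {t0..t0'}" for s
    unfolding L2_inner_def M[OF that] inner_sum_right
    by (intro Bochner_Integration.integral_sum integrable_inner_L2 I(3)[OF that] u_L2) (use that t in auto)
  have i: "set_integrable lebesgue {t0..t0'} (\<lambda>s. \<Sum>k\<in>UNIV. LINT x|lebesgue. convection s x \<bullet> ?V k (s, x))"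
    unfolding set_integrable_def scaleR_sum_right
    by (intro Bochner_Integration.integrable_sum I(2)[unfolded set_integrable_def])
  have "(LINT s:{t0..t0'}|lebesgue. LINT x|lebesgue. convection s x \<bullet> div_free_kernel (r - s) (x - y) j) =
    (LINT s:{t0..t0'}|lebesgue. \<Sum>k\<in>UNIV. LINT x|lebesgue. convection s x \<bullet> ?V k (s, x))"
    unfolding set_lebesgue_integral_def
  proof (rule lebesgue_integral_cong_AE_total)
    show "(\<lambda>s. indicator {t0..t0'} s *\<^sub>R (\<Sum>k\<in>UNIV. LINT x|lebesgue. convection s x \<bullet> ?V k (s, x))) \<in> borel_measurable lebesgue"
      using i unfolding set_integrable_def by (rule borel_measurable_integrable)
    show "AE s in lebesgue. indicator {t0..t0'} s *\<^sub>R (\<Sum>k\<in>UNIV. LINT x|lebesgue. convection s x \<bullet> ?V k (s, x)) =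
      indicator {t0..t0'} s *\<^sub>R (LINT x|lebesgue. convection s x \<bullet> div_free_kernel (r - s) (x - y) j)"
      using T_full
    proof eventually_elim
      fix s assume s: "0 \<le> s \<longrightarrow> s \<in> T"
      show "indicator {t0..t0'} s *\<^sub>R (\<Sum>k\<in>UNIV. LINT x|lebesgue. convection s x \<bullet> ?V k (s, x)) =
      indicator {t0..t0'} s *\<^sub>R (LINT x|lebesgue. convection s x \<bullet> div_free_kernel (r - s) (x - y) j)"
      proof (cases "s \<in> {t0..t0'}")
        case True
        then have sT: "s \<in> T" using s t by auto
        have "integrable lebesgue (\<lambda>x. convection s x \<bullet> ?V k (s, x))" for k
        proof -
          obtain C where "\<And>x. norm (?V k (s, x)) \<le> C" using I(4)[OF True] by blast
          then show ?thesis by (rule convection_pairing(1)[OF sT in_L2D(1)[OF I(3)[OF True]]])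
        qed
        then have "(LINT x|lebesgue. convection s x \<bullet> div_free_kernel (r - s) (x - y) j) = (\<Sum>k\<in>UNIV. LINT x|lebesgue. convection s x \<bullet> ?V k (s, x))"
          unfolding M[OF True] inner_sum_right by (intro Bochner_Integration.integral_sum)
        then show ?thesis by simp
      qed simp
    qed
  qed
  also have "\<dots> = (\<Sum>k\<in>UNIV. LINT s:{t0..t0'}|lebesgue. LINT x|lebesgue. convection s x \<bullet> ?V k (s, x))"
    using I(2) unfolding set_integrable_def set_lebesgue_integral_def scaleR_sum_right
    by (intro Bochner_Integration.integral_sum)
  also have "\<dots> = (\<Sum>k\<in>UNIV. L2_inner (u t0) (\<lambda>x. ?V k (t0, x)) - L2_inner (u t0') (\<lambda>x. ?V k (t0', x)))"
    by (simp only: I(1))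
  also have "\<dots> = L2_inner (u t0) (\<lambda>x. div_free_kernel (r - t0) (x - y) j) - L2_inner (u t0') (\<lambda>x. div_free_kernel (r - t0') (x - y) j)"
    using inner[of t0] inner[of t0'] t by (simp add: sum_subtractf)
  finally show ?thesis .
qed

end

section \<open>The heat flow of square integrable fields\<close>

lemma heat_kernel_commute: "heat_kernel t (x - y) = heat_kernel t (y - x)"
  by (simp add: heat_kernel_def norm_minus_commute)

text \<open>On Borel functions this is the heat semigroup at positive times (\<open>heat_semigroup_eq\<close>), with the
  integral taken over \<open>lborel\<close> so that Fubini applies.\<close>

definition heat_conv :: "real \<Rightarrow> (R3 \<Rightarrow> 'b::euclidean_space) \<Rightarrow> R3 \<Rightarrow> 'b" where
  "heat_conv t f x = (LINT y|lborel. heat_kernel t (x - y) *\<^sub>R f y)"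

lemma heat_semigroup_eq:
  assumes "f' \<in> borel_measurable borel" "AE x in lebesgue. f x = f' x" "t > 0" "f \<in> borel_measurable lebesgue"
  shows "heat_semigroup t f = heat_conv t f'"
proof
  fix x
  have m: "(\<lambda>y. heat_kernel t (x - y)) \<in> borel_measurable borel" by measurable
  have mf: "(\<lambda>y. heat_kernel t (x - y) *\<^sub>R f' y) \<in> borel_measurable borel" using assms(1) by measurable
  have [measurable]: "(\<lambda>y. heat_kernel t (x - y)) \<in> borel_measurable lebesgue" "f' \<in> borel_measurable lebesgue" "f \<in> borel_measurable lebesgue"
    using borel_imp_lebesgue_measurable[OF m] borel_imp_lebesgue_measurable[OF assms(1)] assms(4) by auto
  have "heat_semigroup t f x = (LINT y|lebesgue. heat_kernel t (x - y) *\<^sub>R f y)"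
    using assms(3) by (simp add: heat_semigroup_def convolve_def)
  also have "\<dots> = (LINT y|lebesgue. heat_kernel t (x - y) *\<^sub>R f' y)"
    by (rule integral_cong_AE) (use assms(2) in auto)
  also have "\<dots> = heat_conv t f' x"
    unfolding heat_conv_def by (rule integral_lebesgue_lborel[OF mf])
  finally show "heat_semigroup t f x = heat_conv t f' x" .
qed

lemma heat_conv_measurable [measurable]:
  fixes f :: "R3 \<Rightarrow> 'b::euclidean_space"
  assumes [measurable]: "f \<in> borel_measurable borel"
  shows "heat_conv t f \<in> borel_measurable borel"
proof -
  have "heat_conv t f \<in> borel_measurable lborel"
    unfolding heat_conv_def[abs_def] by (rule lborel.borel_measurable_lebesgue_integral) measurable
  then show ?thesis by simp
qed

lemma L2_borel_integrable: "in_L2 f \<Longrightarrow> f \<in> borel_measurable borel \<Longrightarrow> integrable lborel (\<lambda>x. (norm (f x))\<^sup>2)"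
  using in_L2D(2)[of f] by (subst (asm) integrable_lebesgue_lborel) auto

lemma heat_conv_integrable:
  fixes f :: "R3 \<Rightarrow> 'b::euclidean_space"
  assumes f [measurable]: "f \<in> borel_measurable borel" "in_L2 f" and t: "t > 0"
  shows "integrable lborel (\<lambda>y. heat_kernel t (x - y) *\<^sub>R f y)" 
    "(LINT y|lborel. heat_kernel t (x - y) * norm (f y)) \<le> (8 * pi * t) powr (- 3 / 4) * L2_norm f"
    "norm (heat_conv t f x) \<le> (8 * pi * t) powr (- 3 / 4) * L2_norm f"
    "norm (heat_conv t f x) \<le> (LINT y|lborel. heat_kernel t (x - y) * norm (f y))"
proof -
  have G: "in_L2 (\<lambda>y. heat_kernel t (x - y))" "L2_norm (\<lambda>y. heat_kernel t (x - y)) = (8 * pi * t) powr (- 3 / 4)"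
    using heat_kernel_L2[OF t, of x] by (simp_all add: heat_kernel_commute[of t x])
  have m: "(\<lambda>y. heat_kernel t (x - y) * norm (f y)) \<in> borel_measurable borel" by measurable
  have i: "integrable lborel (\<lambda>y. heat_kernel t (x - y) * norm (f y))"
    using L2_Cauchy_Schwarz(1)[OF G(1) f(2)] integrable_lebesgue_lborel[OF m] by (simp add: heat_kernel_nonneg)
  then show int: "integrable lborel (\<lambda>y. heat_kernel t (x - y) *\<^sub>R f y)"
    by (rule Bochner_Integration.integrable_bound) (auto simp: abs_mult)
  show 1: "(LINT y|lborel. heat_kernel t (x - y) * norm (f y)) \<le> (8 * pi * t) powr (- 3 / 4) * L2_norm f"
    using L2_Cauchy_Schwarz(2)[OF G(1) f(2)] integral_lebesgue_lborel[OF m] G(2) by (simp add: heat_kernel_nonneg)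
  show 2: "norm (heat_conv t f x) \<le> (LINT y|lborel. heat_kernel t (x - y) * norm (f y))"
    unfolding heat_conv_def
    by (rule order_trans[OF integral_norm_bound]) (simp add: heat_kernel_nonneg)
  show "norm (heat_conv t f x) \<le> (8 * pi * t) powr (- 3 / 4) * L2_norm f" using 1 2 by linarith
qed

lemma heat_pair_integrable_L1:
  fixes \<phi> :: "R3 \<Rightarrow> real"
  assumes [measurable]: "\<phi> \<in> borel_measurable borel" and i: "integrable lborel \<phi>" and t: "t > 0"
  shows "integrable (lborel \<Otimes>\<^sub>M lborel) (\<lambda>(x, y). heat_kernel t (x - y) * \<phi> x)"
    "integrable (lborel \<Otimes>\<^sub>M lborel) (\<lambda>(x, y). heat_kernel t (x - y) * \<phi> y)"
proof -
  show 1: "integrable (lborel \<Otimes>\<^sub>M lborel) (\<lambda>(x, y). heat_kernel t (x - y) * \<phi> x)"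
  proof (rule lborel_pair.Fubini_integrable)
    show "(\<lambda>(x, y). heat_kernel t (x - y) * \<phi> x) \<in> borel_measurable (lborel \<Otimes>\<^sub>M lborel)" by measurable
    have "(LINT y|lborel. norm (case (x, y) of (x, y) \<Rightarrow> heat_kernel t (x - y) * \<phi> x)) = \<bar>\<phi> x\<bar>" for x
      using heat_kernel_integral[OF t, of x] by (simp add: abs_mult heat_kernel_nonneg heat_kernel_commute[of t x])
    then show "integrable lborel (\<lambda>x. LINT y|lborel. norm (case (x, y) of (x, y) \<Rightarrow> heat_kernel t (x - y) * \<phi> x))" using i by simp
    show "AE x in lborel. integrable lborel (\<lambda>y. case (x, y) of (x, y) \<Rightarrow> heat_kernel t (x - y) * \<phi> x)"
      using heat_kernel_integral(1)[OF t] by (simp add: heat_kernel_commute[of t])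
  qed
  have "(\<lambda>(x, y). heat_kernel t (x - y) * \<phi> y) = (\<lambda>(x, y). (\<lambda>(x, y). heat_kernel t (x - y) * \<phi> x) (y, x))"
    using heat_kernel_commute by (auto simp: fun_eq_iff)
  then show "integrable (lborel \<Otimes>\<^sub>M lborel) (\<lambda>(x, y). heat_kernel t (x - y) * \<phi> y)"
    using lborel_pair.integrable_product_swap[OF 1] by (simp only:)
qed

lemma heat_pair_integrable_L2:
  fixes p q :: "R3 \<Rightarrow> real"
  assumes [measurable]: "p \<in> borel_measurable borel" "q \<in> borel_measurable borel" and L: "in_L2 p" "in_L2 q" and t: "t > 0"
  shows "integrable (lborel \<Otimes>\<^sub>M lborel) (\<lambda>(x, y). heat_kernel t (x - y) * (p x * q y))"
proof (rule Bochner_Integration.integrable_bound)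
  have i: "integrable lborel (\<lambda>x. (p x)\<^sup>2)" "integrable lborel (\<lambda>x. (q x)\<^sup>2)"
    using L2_borel_integrable[OF L(1)] L2_borel_integrable[OF L(2)] by auto
  show "integrable (lborel \<Otimes>\<^sub>M lborel) (\<lambda>z. (case z of (x, y) \<Rightarrow> heat_kernel t (x - y) * (p x)\<^sup>2) + (case z of (x, y) \<Rightarrow> heat_kernel t (x - y) * (q y)\<^sup>2))"
    by (intro Bochner_Integration.integrable_add heat_pair_integrable_L1 i t) auto
  have "\<bar>p x * q y\<bar> \<le> (p x)\<^sup>2 + (q y)\<^sup>2" for x y
    using sum_squares_bound[of "\<bar>p x\<bar>" "\<bar>q y\<bar>"] mult_nonneg_nonneg[OF abs_ge_zero[of "p x"] abs_ge_zero[of "q y"]]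
    unfolding power2_abs abs_mult by linarith
  then have "heat_kernel t (x - y) * \<bar>p x * q y\<bar> \<le> heat_kernel t (x - y) * ((p x)\<^sup>2 + (q y)\<^sup>2)" for x y
    by (intro mult_left_mono heat_kernel_nonneg)
  then show "AE z in lborel \<Otimes>\<^sub>M lborel. norm (case z of (x, y) \<Rightarrow> heat_kernel t (x - y) * (p x * q y)) \<le>
     norm ((case z of (x, y) \<Rightarrow> heat_kernel t (x - y) * (p x)\<^sup>2) + (case z of (x, y) \<Rightarrow> heat_kernel t (x - y) * (q y)\<^sup>2))"
    by (intro AE_I2) (auto simp: abs_mult heat_kernel_nonneg distrib_left)
qed measurable

lemma heat_pair_integrable_L1_L2:
  fixes p q :: "R3 \<Rightarrow> real"
  assumes [measurable]: "p \<in> borel_measurable borel" "q \<in> borel_measurable borel" and L: "integrable lborel p" "in_L2 q" and t: "t > 0"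
  shows "integrable (lborel \<Otimes>\<^sub>M lborel) (\<lambda>(x, y). heat_kernel t (x - y) * (p x * q y))"
proof (rule lborel_pair.Fubini_integrable)
  have eq: "(LINT y|lborel. norm (case (x, y) of (x, y) \<Rightarrow> heat_kernel t (x - y) * (p x * q y))) = \<bar>p x\<bar> * (LINT y|lborel. heat_kernel t (x - y) * \<bar>q y\<bar>)" for x
  proof -
    have "norm (case (x, y) of (x, y) \<Rightarrow> heat_kernel t (x - y) * (p x * q y)) = \<bar>p x\<bar> * (heat_kernel t (x - y) * \<bar>q y\<bar>)" for y
      by (simp add: abs_mult heat_kernel_nonneg)
    then show ?thesis by simp
  qed
  show "integrable lborel (\<lambda>x. LINT y|lborel. norm (case (x, y) of (x, y) \<Rightarrow> heat_kernel t (x - y) * (p x * q y)))"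
    unfolding eq
  proof (rule Bochner_Integration.integrable_bound)
    show "integrable lborel (\<lambda>x. ((8 * pi * t) powr (- 3 / 4) * L2_norm q) * \<bar>p x\<bar>)" using L(1) by simp
    have "0 \<le> (LINT y|lborel. heat_kernel t (x - y) * \<bar>q y\<bar>)" for x by (intro integral_nonneg_AE) (auto simp: heat_kernel_nonneg)
    then show "AE x in lborel. norm (\<bar>p x\<bar> * (LINT y|lborel. heat_kernel t (x - y) * \<bar>q y\<bar>)) \<le> norm (((8 * pi * t) powr (- 3 / 4) * L2_norm q) * \<bar>p x\<bar>)"
      using heat_conv_integrable(2)[OF assms(2) L(2) t]
      by (intro AE_I2) (auto simp: abs_mult mult.commute[of "\<bar>p _\<bar>"] L2_norm_nonneg intro!: mult_right_mono)
  qed measurable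
  show "AE x in lborel. integrable lborel (\<lambda>y. case (x, y) of (x, y) \<Rightarrow> heat_kernel t (x - y) * (p x * q y))"
  proof (intro AE_I2)
    fix x
    show "integrable lborel (\<lambda>y. case (x, y) of (x, y) \<Rightarrow> heat_kernel t (x - y) * (p x * q y))"
      using integrable_mult_right[of "p x" lborel "\<lambda>y. heat_kernel t (x - y) * q y"] heat_conv_integrable(1)[OF assms(2) L(2) t, of x]
      by (simp add: mult_ac)
  qed
qed measurable

text \<open>By Cauchy-Schwarz for the probability density \<open>heat_kernel t (x - y)\<close>, the square of the heat flow
  is at most the heat flow of the square, whose integral is preserved.\<close>

lemma heat_conv_L2:
  fixes f :: "R3 \<Rightarrow> 'b::euclidean_space"
  assumes f [measurable]: "f \<in> borel_measurable borel" "in_L2 f" and t: "t > 0"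
  shows "in_L2 (heat_conv t f)" "L2_norm (heat_conv t f) \<le> L2_norm f"
proof -
  let ?S = "\<lambda>x. LINT y|lborel. heat_kernel t (x - y) * (norm (f y))\<^sup>2"
  have if2: "integrable lborel (\<lambda>x. (norm (f x))\<^sup>2)" by (rule L2_borel_integrable[OF f(2,1)])
  have pair: "integrable (lborel \<Otimes>\<^sub>M lborel) (\<lambda>(x, y). heat_kernel t (x - y) * (norm (f y))\<^sup>2)"
    by (rule heat_pair_integrable_L1(2)[OF _ if2 t]) measurable
  have iS: "integrable lborel ?S" using lborel_pair.integrable_fst[OF pair] .
  have "(LINT x|lborel. ?S x) = (LINT y|lborel. LINT x|lborel. heat_kernel t (x - y) * (norm (f y))\<^sup>2)"
    by (rule lborel_pair.Fubini_integral[OF pair, symmetric])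
  also have "\<dots> = (LINT y|lborel. (norm (f y))\<^sup>2)"
    using heat_kernel_integral[OF t] by simp
  finally have S: "(LINT x|lborel. ?S x) = (LINT y|lborel. (norm (f y))\<^sup>2)" .
  have AES: "AE x in lborel. integrable lborel (\<lambda>y. heat_kernel t (x - y) * (norm (f y))\<^sup>2)"
    using lborel_pair.AE_integrable_fst[OF pair] by simp
  have le: "AE x in lborel. (norm (heat_conv t f x))\<^sup>2 \<le> ?S x"
    using AES
  proof eventually_elim
    fix x assume i: "integrable lborel (\<lambda>y. heat_kernel t (x - y) * (norm (f y))\<^sup>2)"
    let ?a = "\<lambda>y. sqrt (heat_kernel t (x - y))" and ?b = "\<lambda>y. sqrt (heat_kernel t (x - y)) * norm (f y)"
    have G1: "integrable lborel (\<lambda>y. heat_kernel t (x - y))" "(LINT y|lborel. heat_kernel t (x - y)) = 1"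
      using heat_kernel_integral[OF t, of x] by (simp_all add: heat_kernel_commute[of t x])
    have e: "(?a y)\<^sup>2 = heat_kernel t (x - y)" "(?b y)\<^sup>2 = heat_kernel t (x - y) * (norm (f y))\<^sup>2"
      "\<bar>?a y\<bar> * \<bar>?b y\<bar> = heat_kernel t (x - y) * norm (f y)" for y
      by (auto simp: heat_kernel_nonneg power_mult_distrib abs_mult mult.assoc[symmetric])
    have "(LINT y|lborel. \<bar>?a y\<bar> * \<bar>?b y\<bar>) \<le> sqrt (LINT y|lborel. (?a y)\<^sup>2) * sqrt (LINT y|lborel. (?b y)\<^sup>2)"
    proof (rule integral_Cauchy_Schwarz(2))
      show "integrable lborel (\<lambda>y. (?a y)\<^sup>2)" "integrable lborel (\<lambda>y. (?b y)\<^sup>2)" unfolding e using G1 i by auto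
    qed measurable
    then have "(LINT y|lborel. heat_kernel t (x - y) * norm (f y)) \<le> sqrt (?S x)" unfolding e G1 by simp
    then have "norm (heat_conv t f x) \<le> sqrt (?S x)" using heat_conv_integrable(4)[OF f t, of x] by linarith
    then have "(norm (heat_conv t f x))\<^sup>2 \<le> (sqrt (?S x))\<^sup>2" by (intro power_mono) auto
    moreover have "0 \<le> ?S x" by (intro integral_nonneg_AE) (auto simp: heat_kernel_nonneg)
    ultimately show "(norm (heat_conv t f x))\<^sup>2 \<le> ?S x" by simp
  qed
  have iH: "integrable lborel (\<lambda>x. (norm (heat_conv t f x))\<^sup>2)"
    by (rule Bochner_Integration.integrable_bound[OF iS]) (use le in \<open>auto elim!: eventually_mono\<close>)
  have mH: "(\<lambda>x. (norm (heat_conv t f x))\<^sup>2) \<in> borel_measurable borel" by measurable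
  show "in_L2 (heat_conv t f)"
    unfolding in_L2_def using iH integrable_lebesgue_lborel[OF mH] borel_imp_lebesgue_measurable[OF heat_conv_measurable[OF f(1)]] by simp
  have mf: "(\<lambda>x. (norm (f x))\<^sup>2) \<in> borel_measurable borel" by measurable
  have "(LINT x|lborel. (norm (heat_conv t f x))\<^sup>2) \<le> (LINT x|lborel. (norm (f x))\<^sup>2)"
    unfolding S[symmetric] by (rule integral_mono_AE[OF iH iS le])
  then show "L2_norm (heat_conv t f) \<le> L2_norm f"
    unfolding L2_norm_def integral_lebesgue_lborel[OF mH] integral_lebesgue_lborel[OF mf] by simp
qed

lemma heat_conv_symmetric:
  fixes f g :: "R3 \<Rightarrow> R3"
  assumes [measurable]: "f \<in> borel_measurable borel" "g \<in> borel_measurable borel" and L: "in_L2 f" "in_L2 g" and t: "t > 0"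
  shows "L2_inner (heat_conv t f) g = L2_inner f (heat_conv t g)"
proof -
  have n: "in_L2 (\<lambda>x. norm (f x))" "in_L2 (\<lambda>x. norm (g x))"
    using L by (auto simp: in_L2_def)
  have pair: "integrable (lborel \<Otimes>\<^sub>M lborel) (\<lambda>(x, y). heat_kernel t (x - y) * (f x \<bullet> g y))"
  proof (rule Bochner_Integration.integrable_bound[OF heat_pair_integrable_L2[OF _ _ n t]])
    show "AE z in lborel \<Otimes>\<^sub>M lborel. norm (case z of (x, y) \<Rightarrow> heat_kernel t (x - y) * (f x \<bullet> g y)) \<le> norm (case z of (x, y) \<Rightarrow> heat_kernel t (x - y) * (norm (f x) * norm (g y)))"
      by (intro AE_I2) (auto simp: abs_mult heat_kernel_nonneg intro!: mult_left_mono Cauchy_Schwarz_ineq2)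
  qed measurable
  have "L2_inner f (heat_conv t g) = (LINT x|lborel. f x \<bullet> heat_conv t g x)"
    unfolding L2_inner_def by (rule integral_lebesgue_lborel) measurable
  also have "\<dots> = (LINT x|lborel. LINT y|lborel. heat_kernel t (x - y) * (f x \<bullet> g y))"
    unfolding heat_conv_def
    by (intro Bochner_Integration.integral_cong refl, subst integral_inner_right[symmetric]) 
       (use heat_conv_integrable(1)[OF assms(2) L(2) t] in auto)
  also have "\<dots> = (LINT y|lborel. LINT x|lborel. heat_kernel t (x - y) * (f x \<bullet> g y))"
    by (rule lborel_pair.Fubini_integral[OF pair, symmetric])
  also have "\<dots> = (LINT y|lborel. heat_conv t f y \<bullet> g y)"
    unfolding heat_conv_def
    by (intro Bochner_Integration.integral_cong refl, subst integral_inner_left[symmetric]) 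
       (use heat_conv_integrable(1)[OF assms(1) L(1) t] in \<open>auto simp: heat_kernel_commute\<close>)
  also have "\<dots> = L2_inner (heat_conv t f) g"
    unfolding L2_inner_def by (rule integral_lebesgue_lborel[symmetric]) measurable
  finally show ?thesis ..
qed

lemma heat_kernel_continuous_pair: "continuous_on ({0<..} \<times> UNIV) (\<lambda>(t, x). heat_kernel t x)"
  unfolding heat_kernel_def case_prod_beta by (intro continuous_intros) auto

lemma heat_hess_continuous: "continuous_on ({0<..} \<times> UNIV) (\<lambda>(t, x). heat_hess t x i j)"
proof -
  have "continuous_on ({0<..} \<times> UNIV) (\<lambda>z. heat_kernel (fst z) (snd z))"
    using heat_kernel_continuous_pair by (simp add: case_prod_beta)
  then show ?thesis unfolding heat_hess_def case_prod_beta by (intro continuous_intros) auto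
qed

lemma heat_hess_measurable [measurable]: "(\<lambda>x. heat_hess t x i j) \<in> borel_measurable borel"
proof -
  have "(\<lambda>x::R3. x $ k) \<in> borel_measurable borel" for k by (intro borel_measurable_continuous_onI continuous_intros)
  then show ?thesis unfolding heat_hess_def by measurable
qed

lemma heat_hess_even: "heat_hess t (x - y) i j = heat_hess t (y - x) i j"
  by (simp add: heat_hess_def heat_kernel_commute[of t x] minus_mult_minus algebra_simps)

text \<open>For times in a compact interval the heat kernel and its Hessian are dominated by one heat kernel,
  at a larger time. This is the uniform decay of \<open>Ck_lim_heat_poly\<close>, read for a pole at time
  \<open>r > \<tau>2\<close> and the space point 0.\<close>

lemma heat_hess_bound:
  assumes "0 < \<tau>1" "\<tau>1 \<le> \<tau>2"
  obtains C \<sigma> where "0 \<le> C" "0 < \<sigma>" "\<And>t x. t \<in> {\<tau>1..\<tau>2} \<Longrightarrow> heat_kernel t x \<le> C * heat_kernel \<sigma> x"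
    "\<And>t x i j. t \<in> {\<tau>1..\<tau>2} \<Longrightarrow> \<bar>heat_hess t x i j\<bar> \<le> C * heat_kernel \<sigma> x"
proof -
  define r b where "r = \<tau>2 + 1" and "b = r - \<tau>1 / 2"
  have b: "b < r" "0 < b" "0 < r" using assms by (auto simp: r_def b_def)
  let ?U = "{0<..<b} \<times> (UNIV :: R3 set)"
  let ?w = "\<lambda>z::real\<times>R3. gauss_weight (r - 0) (snd z - 0)"
  have B: "Ck_lim n ?U ?w (\<lambda>_. backward_heat r 0) (backward_heat r 0)" for n
    using Ck_lim_heat_poly[OF heat_poly.const[of 1] b(1,2), where n=n and y=0] by simp
  have inU: "(r - t, x) \<in> ?U" if "t \<in> {\<tau>1..\<tau>2}" for t x using that assms by (auto simp: r_def b_def)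
  obtain C0 where C0: "\<And>z. z \<in> ?U \<Longrightarrow> \<bar>backward_heat r 0 z\<bar> \<le> C0 * ?w z"
    using Ck_lim_dominated[OF B] unfolding dominated_lim_def by blast
  have "\<exists>C. \<forall>z\<in>?U. \<bar>dd (sp (snd ij)) (dd (sp (fst ij)) (backward_heat r 0)) z\<bar> \<le> C * ?w z" for ij
    using Ck_lim_dominated[OF Ck_lim_dd[OF Ck_lim_dd[OF B]]] unfolding dominated_lim_def by blast
  then obtain D' where D': "\<And>ij. \<forall>z\<in>?U. \<bar>dd (sp (snd ij)) (dd (sp (fst ij)) (backward_heat r 0)) z\<bar> \<le> D' ij * ?w z" by metis
  define D where "D i j = D' (i, j)" for i j
  have D: "\<bar>dd (sp j) (dd (sp i) (backward_heat r 0)) z\<bar> \<le> D i j * ?w z" if "z \<in> ?U" for i j z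
    using bspec[OF D'[of "(i, j)"] that] by (simp add: D_def)
  define C where "C = \<bar>C0\<bar> + (\<Sum>i\<in>UNIV. \<Sum>j\<in>UNIV. \<bar>D i j\<bar>)"
  have s: "0 \<le> (\<Sum>i\<in>UNIV. \<Sum>j\<in>UNIV. \<bar>D i j\<bar>)" by (intro sum_nonneg) auto
  have C: "0 \<le> C" "C0 \<le> C" "D i j \<le> C" for i j
  proof -
    have "\<bar>D i j\<bar> \<le> (\<Sum>j\<in>UNIV. \<bar>D i j\<bar>)" by (rule member_le_sum) auto
    also have "\<dots> \<le> (\<Sum>i\<in>UNIV. \<Sum>j\<in>UNIV. \<bar>D i j\<bar>)" by (rule member_le_sum) (auto intro: sum_nonneg)
    finally show "D i j \<le> C" unfolding C_def by linarith
    show "0 \<le> C" "C0 \<le> C" unfolding C_def using s by linarith+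
  qed
  define c where "c = (8 * pi * r) powr (3 / 2)"
  have w: "?w z = c * heat_kernel (2 * r) (snd z)" for z using gauss_weight_eq[OF b(3)] by (simp add: c_def)
  have w0: "0 \<le> ?w z" for z by (simp add: gauss_weight_def)
  show ?thesis
  proof (rule that[of "C * c" "2 * r"])
    show "0 \<le> C * c" "0 < 2 * r" using C b by (auto simp: c_def)
    show "heat_kernel t x \<le> C * c * heat_kernel (2 * r) x" if t: "t \<in> {\<tau>1..\<tau>2}" for t x
    proof -
      have "\<bar>backward_heat r 0 (r - t, x)\<bar> \<le> C * ?w (r - t, x)"
        by (rule order_trans[OF C0[OF inU[OF t]] mult_right_mono[OF C(2) w0]])
      then show ?thesis unfolding w by (simp add: backward_heat_def mult.assoc)
    qed
    show "\<bar>heat_hess t x i j\<bar> \<le> C * c * heat_kernel (2 * r) x" if t: "t \<in> {\<tau>1..\<tau>2}" for t x i j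
    proof -
      have "\<bar>dd (sp j) (dd (sp i) (backward_heat r 0)) (r - t, x)\<bar> \<le> C * ?w (r - t, x)"
        by (rule order_trans[OF D[OF inU[OF t]] mult_right_mono[OF C(3) w0]])
      moreover have "dd (sp j) (dd (sp i) (backward_heat r 0)) (r - t, x) = heat_hess t x i j"
        using t assms by (subst dd_dd_backward_heat) auto
      ultimately show ?thesis unfolding w by (simp add: mult.assoc)
    qed
  qed
qed

lemma heat_kernel_time_derivative:
  assumes "t > 0"
  shows "((\<lambda>t. heat_kernel t x) has_real_derivative (\<Sum>k\<in>UNIV. heat_hess t x k k)) (at t)"
proof -
  define r where "r = t + 1"
  have z: "fst (1::real, x) < r" using assms by (simp add: r_def)
  have d: "backward_heat r 0 differentiable at (1, x)" using backward_heat_has_derivative[OF z] by (auto simp: differentiable_def)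
  have lin: "dd (v, 0) (backward_heat r 0) (1, x) = dd (1, 0) (backward_heat r 0) (1, x) * v" for v
    using linear_cmul[OF linear_frechet_derivative[OF d], of v "(1, 0)"] by (simp add: dd_def)
  have "((\<lambda>s. backward_heat r 0 (s, x)) has_derivative (\<lambda>v. dd (1, 0) (backward_heat r 0) (1, x) * v)) (at 1)"
    by (rule has_derivative_eq_rhs[OF dd_slice(2)[OF d]], rule ext, rule lin)
  then have 1: "((\<lambda>s. backward_heat r 0 (s, x)) has_real_derivative dd (1, 0) (backward_heat r 0) (1, x)) (at (r - t))"
    by (simp add: has_field_derivative_def r_def)
  have 2: "((\<lambda>t. r - t) has_real_derivative -1) (at t)" by (auto intro!: derivative_eq_intros)
  have "dd (1, 0) (backward_heat r 0) (1, x) = - (\<Sum>k\<in>UNIV. heat_hess t x k k)"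
    using backward_heat_heat_equation[OF z, of 0] unfolding dd_dd_backward_heat[OF z] by (simp add: r_def add_eq_0_iff2 add_eq_0_iff)
  then show ?thesis using DERIV_chain2[OF 1 2] by (simp add: backward_heat_def)
qed

text \<open>Divergence freedom tested with the functions \<open>\<partial>\<^sub>k heat_kernel t (x - \<cdot>)\<close> only. In this form the
  condition passes to heat flows and differences, and it is what makes the Hessian part of the
  kernels drop out.\<close>

definition kernel_div_free :: "(R3 \<Rightarrow> R3) \<Rightarrow> bool" where
  "kernel_div_free g \<longleftrightarrow> (\<forall>t>0. \<forall>x k. (LINT y|lborel. (\<Sum>i\<in>UNIV. g y $ i * heat_hess t (x - y) k i)) = 0)"

text \<open>The derivatives of the heat kernel lack compact support, so they are cut off; the gradients of the
  cut off functions converge in \<open>L\<^sup>2\<close>.\<close>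

lemma L2_sigma_kernel_div_free:
  assumes g [measurable]: "g \<in> borel_measurable borel" and s: "L2_sigma g"
  shows "kernel_div_free g"
  unfolding kernel_div_free_def
proof (intro allI impI)
  fix t :: real and x k assume t: "t > 0"
  have g2: "in_L2 g" using s by (simp add: L2_sigma_def)
  let ?U = "{-1<..<t/2} \<times> (UNIV :: R3 set)"
  have op: "open ?U" by (intro open_Times) auto
  have B: "Ck_lim n ?U (\<lambda>z. gauss_weight (t - (-1)) (snd z - x)) (\<lambda>_. backward_heat t x) (backward_heat t x)" for n
    using Ck_lim_heat_poly[OF heat_poly.const[of 1], where n=n and y=x and r=t and a="-1" and b="t/2"] t by simp
  define q where "q y = dd (sp k) (backward_heat t x) (0, y)" for y
  let ?w = "\<lambda>y. gauss_weight (t + 1) (y - x)"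
  have q: "Ck_lim n UNIV ?w (\<lambda>_. q) q" for n
    using Ck_lim_slice[OF Ck_lim_dd[OF B] _ op, of 0] t by (simp add: q_def[abs_def])
  define Q where "Q N y = cutoff N y * q y" for N y
  have Q: "Ck_lim n UNIV ?w Q q" for n
    using Ck_lim_mult1[OF open_UNIV q Ck_lim_cutoff[OF bounded_linear_ident]] by (simp add: Q_def[abs_def])
  have test: "test_function UNIV (Q N)" for N
  proof (rule test_functionI)
    show "Ck n UNIV (Q N)" for n by (rule Ck_lim_imp_Ck[OF Q])
    show "compact (cbox (\<chi> i. - (2 * real (Suc N))) (\<chi> i. 2 * real (Suc N)) :: R3 set)" by simp
    show "y \<in> cbox (\<chi> i. - (2 * real (Suc N))) (\<chi> i. 2 * real (Suc N))" if "Q N y \<noteq> 0" for y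
      using cutoff_support[of N y] that by (auto simp: Q_def mem_box_cart abs_le_iff minus_le_iff simp del: of_nat_Suc)
  qed simp
  have p: "gradient f y $ i = dd (axis i 1) f y" for f y i by (simp add: gradient_def partial_def dd_def)
  have "\<exists>C. \<forall>N y. \<bar>dd (axis i 1) (Q N) y\<bar> \<le> C * ?w y" for i :: 3
    using Ck_lim_dominated[OF Ck_lim_dd[OF Q]] unfolding dominated_lim_def by blast
  then obtain C where C: "\<And>i N y. \<bar>dd (axis i 1) (Q N) y\<bar> \<le> C i * ?w y" by metis
  have bd: "norm (gradient (Q N) y) \<le> sum C UNIV * ?w y" for N y
    unfolding sum_distrib_right by (rule order_trans[OF norm_le_l1_cart]) (auto intro!: sum_mono C simp: p)
  have lim: "(\<lambda>N. gradient (Q N) y) \<longlonglongrightarrow> gradient q y" for y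
    by (rule vec_tendstoI) (use Ck_lim_dominated[OF Ck_lim_dd[OF Q]] in \<open>auto simp: p dominated_lim_def\<close>)
  have W: "in_L2 (\<lambda>y. sum C UNIV * ?w y)" using in_L2_scaleR[OF gauss_weight_L2[of "t + 1" x], of "sum C UNIV"] t by simp
  have m: "gradient f \<in> borel_measurable lebesgue" if "\<And>n. Ck n UNIV f" for f
    by (rule borel_imp_lebesgue_measurable[OF gradient_measurable[OF that]])
  have "(\<lambda>N. L2_inner g (gradient (Q N))) \<longlonglongrightarrow> L2_inner g (gradient q)"
    by (rule L2_inner_limit[OF g2 W m[OF test_function_Ck[OF test]] m[OF Ck_lim_imp_Ck_limit[OF q]] bd lim])
  moreover have "L2_inner g (gradient (Q N)) = 0" for N using s test unfolding L2_sigma_def by blast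
  ultimately have "L2_inner g (gradient q) = 0" by (auto simp: LIMSEQ_const_iff)
  moreover have "g y \<bullet> gradient q y = (\<Sum>i\<in>UNIV. g y $ i * heat_hess t (x - y) k i)" for y
  proof -
    have "dd (sp k) (backward_heat t x) differentiable at (0, y)"
      by (rule Ck_differentiable[OF Ck_lim_imp_Ck_limit[OF Ck_lim_dd[OF B]]]) (use t in auto)
    then have "dd (axis i 1) q y = dd (sp i) (dd (sp k) (backward_heat t x)) (0, y)" for i
      unfolding q_def[abs_def] by (rule dd_eq[OF dd_slice(1)])
    moreover have "dd (sp i) (dd (sp k) (backward_heat t x)) (0, y) = heat_hess t (x - y) k i" for i
      using t by (subst dd_dd_backward_heat) (auto simp: heat_hess_even[of t x])
    ultimately show ?thesis by (simp add: inner_vec_def p)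
  qed
  ultimately have "(LINT y|lebesgue. (\<Sum>i\<in>UNIV. g y $ i * heat_hess t (x - y) k i)) = 0" by (simp add: L2_inner_def)
  moreover have "(\<lambda>y. \<Sum>i\<in>UNIV. g y $ i * heat_hess t (x - y) k i) \<in> borel_measurable borel"
  proof -
    have "(\<lambda>x::R3. x $ k) \<in> borel_measurable borel" for k by (intro borel_measurable_continuous_onI continuous_intros)
    then show ?thesis by measurable
  qed
  ultimately show "(LINT y|lborel. (\<Sum>i\<in>UNIV. g y $ i * heat_hess t (x - y) k i)) = 0"
    by (simp add: integral_lebesgue_lborel)
qed

section \<open>Superposition of divergence-free kernels\<close>

lemma borel_measurable_nth [measurable]: "(\<lambda>x :: real^'n. x $ k) \<in> borel_measurable borel"
  by (intro borel_measurable_continuous_onI continuous_intros)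

definition heat_hess_row :: "real \<Rightarrow> R3 \<Rightarrow> 3 \<Rightarrow> R3" where
  "heat_hess_row t x k = (\<chi> i. heat_hess t x k i)"

definition heat_hess_trace :: "real \<Rightarrow> R3 \<Rightarrow> real" where
  "heat_hess_trace t x = (\<Sum>k\<in>UNIV. heat_hess t x k k)"

lemma heat_hess_symmetric: "heat_hess t x i j = heat_hess t x j i"
  by (simp add: heat_hess_def mult.commute)

lemma div_free_kernel_eq: "div_free_kernel t x j = heat_hess_trace t x *\<^sub>R axis j 1 - heat_hess_row t x j"
proof -
  have "(\<Sum>k\<in>UNIV. heat_hess t x k j *\<^sub>R axis k 1) = heat_hess_row t x j"
    by (simp add: vec_eq_iff heat_hess_row_def axis_def heat_hess_symmetric[of t x _ j] if_distrib cong: if_cong)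
  then show ?thesis unfolding div_free_kernel_def heat_hess_trace_def by (simp add: sum_subtractf scaleR_sum_left)
qed

lemma heat_hess_row_measurable [measurable]: "(\<lambda>x. heat_hess_row t x k) \<in> borel_measurable borel"
  unfolding borel_measurable_euclidean_space[of "\<lambda>x. heat_hess_row t x k"]
proof
  fix b :: R3 assume "b \<in> Basis"
  have "(\<lambda>x. heat_hess_row t x k \<bullet> b) = (\<lambda>x. \<Sum>i\<in>UNIV. heat_hess t x k i * b $ i)" by (simp add: inner_vec_def heat_hess_row_def)
  then show "(\<lambda>x. heat_hess_row t x k \<bullet> b) \<in> borel_measurable borel" by simp
qed

lemma heat_hess_trace_measurable [measurable]: "heat_hess_trace t \<in> borel_measurable borel"
  unfolding heat_hess_trace_def[abs_def] by measurable

lemma div_free_kernel_measurable [measurable]: "(\<lambda>x. div_free_kernel t x j) \<in> borel_measurable borel"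
  unfolding div_free_kernel_eq by measurable

lemma div_free_kernel_bound:
  assumes "0 < \<tau>1" "\<tau>1 \<le> \<tau>2"
  obtains C \<sigma> where "0 \<le> C" "0 < \<sigma>" "\<And>t x. t \<in> {\<tau>1..\<tau>2} \<Longrightarrow> heat_kernel t x \<le> C * heat_kernel \<sigma> x"
    "\<And>t x. t \<in> {\<tau>1..\<tau>2} \<Longrightarrow> \<bar>heat_hess_trace t x\<bar> \<le> C * heat_kernel \<sigma> x"
    "\<And>t x k. t \<in> {\<tau>1..\<tau>2} \<Longrightarrow> norm (heat_hess_row t x k) \<le> C * heat_kernel \<sigma> x"
    "\<And>t x j. t \<in> {\<tau>1..\<tau>2} \<Longrightarrow> norm (div_free_kernel t x j) \<le> C * heat_kernel \<sigma> x"
proof -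
  obtain C \<sigma> where C: "0 \<le> C" "0 < \<sigma>" "\<And>t x. t \<in> {\<tau>1..\<tau>2} \<Longrightarrow> heat_kernel t x \<le> C * heat_kernel \<sigma> x"
    "\<And>t x i j. t \<in> {\<tau>1..\<tau>2} \<Longrightarrow> \<bar>heat_hess t x i j\<bar> \<le> C * heat_kernel \<sigma> x"
    by (rule heat_hess_bound[OF assms]) blast
  have pos: "0 \<le> C * heat_kernel \<sigma> x" for x using C heat_kernel_nonneg by simp
  have tr: "\<bar>heat_hess_trace t x\<bar> \<le> 3 * (C * heat_kernel \<sigma> x)" if "t \<in> {\<tau>1..\<tau>2}" for t x
  proof -
    have "\<bar>heat_hess_trace t x\<bar> \<le> (\<Sum>k\<in>(UNIV::3 set). C * heat_kernel \<sigma> x)"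
      unfolding heat_hess_trace_def by (rule order_trans[OF sum_abs]) (intro sum_mono C(4) that)
    then show ?thesis by simp
  qed
  have row: "norm (heat_hess_row t x k) \<le> 3 * (C * heat_kernel \<sigma> x)" if "t \<in> {\<tau>1..\<tau>2}" for t x k
  proof -
    have "norm (heat_hess_row t x k) \<le> (\<Sum>i\<in>(UNIV::3 set). C * heat_kernel \<sigma> x)"
      by (rule order_trans[OF norm_le_l1_cart]) (intro sum_mono, simp add: heat_hess_row_def C(4)[OF that])
    then show ?thesis by simp
  qed
  have k: "norm (div_free_kernel t x j) \<le> 6 * (C * heat_kernel \<sigma> x)" if "t \<in> {\<tau>1..\<tau>2}" for t x j
    unfolding div_free_kernel_eq
    by (rule order_trans[OF norm_triangle_ineq4]) (use tr[OF that, of x] row[OF that, of x j] in simp)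
  show ?thesis
  proof (rule that[of "6 * C" \<sigma>])
    fix t x k j assume t: "t \<in> {\<tau>1..\<tau>2}"
    show "heat_kernel t x \<le> 6 * C * heat_kernel \<sigma> x" using C(3)[OF t, of x] pos[of x] by simp
    show "\<bar>heat_hess_trace t x\<bar> \<le> 6 * C * heat_kernel \<sigma> x" using tr[OF t, of x] pos[of x] by simp
    show "norm (heat_hess_row t x k) \<le> 6 * C * heat_kernel \<sigma> x" using row[OF t, of x k] pos[of x] by simp
    show "norm (div_free_kernel t x j) \<le> 6 * C * heat_kernel \<sigma> x" using k[OF t, of x j] by simp
  qed (use C in auto)
qed

lemma div_free_kernel_bound_at:
  assumes "0 < t"
  obtains C \<sigma> where "0 \<le> C" "0 < \<sigma>" "\<And>x. \<bar>heat_hess_trace t x\<bar> \<le> C * heat_kernel \<sigma> x"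
    "\<And>x k. norm (heat_hess_row t x k) \<le> C * heat_kernel \<sigma> x" "\<And>x j. norm (div_free_kernel t x j) \<le> C * heat_kernel \<sigma> x"
proof (rule div_free_kernel_bound[OF assms order_refl])
  fix C \<sigma> :: real
  assume "0 \<le> C" "0 < \<sigma>" "\<And>s x. s \<in> {t..t} \<Longrightarrow> \<bar>heat_hess_trace s x\<bar> \<le> C * heat_kernel \<sigma> x"
    "\<And>s x k. s \<in> {t..t} \<Longrightarrow> norm (heat_hess_row s x k) \<le> C * heat_kernel \<sigma> x"
    "\<And>s x j. s \<in> {t..t} \<Longrightarrow> norm (div_free_kernel s x j) \<le> C * heat_kernel \<sigma> x"
  then show thesis by (intro that[of C \<sigma>]) simp_all
qed

lemma kernel_div_free_iff: "kernel_div_free g \<longleftrightarrow> (\<forall>t>0. \<forall>x k. (LINT y|lborel. g y \<bullet> heat_hess_row t (x - y) k) = 0)"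
  by (simp add: kernel_div_free_def heat_hess_row_def inner_vec_def)

lemma lborel_integral_translation:
  fixes F :: "'a::euclidean_space \<Rightarrow> 'b::{banach, second_countable_topology}"
  assumes "F \<in> borel_measurable borel"
  shows "(LINT y|lborel. F (c + y)) = (LINT y|lborel. F y)"
proof -
  have "(LINT y|lborel. F y) = (LINT y|distr lborel borel ((+) c). F y)" by (simp add: lborel_distr_plus)
  also have "\<dots> = (LINT y|lborel. F (c + y))" using assms by (intro integral_distr) auto
  finally show ?thesis ..
qed

lemma lborel_integrable_translation:
  fixes F :: "'a::euclidean_space \<Rightarrow> 'b::{banach, second_countable_topology}"
  assumes "F \<in> borel_measurable borel" "integrable lborel F"
  shows "integrable lborel (\<lambda>y. F (c + y))"
proof -
  have "integrable (distr lborel borel ((+) c)) F" using assms by (simp add: lborel_distr_plus)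
  then show ?thesis using assms(1) by (subst (asm) integrable_distr_eq) auto
qed

text \<open>The heat flow is an average of translates of \<open>f\<close>, and the condition is invariant under
  translation.\<close>

lemma kernel_div_free_heat_conv:
  assumes f [measurable]: "f \<in> borel_measurable borel" "in_L2 f" and k: "kernel_div_free f" and a: "a > 0"
  shows "kernel_div_free (heat_conv a f)"
  unfolding kernel_div_free_iff
proof (intro allI impI)
  fix t :: real and x k assume t: "t > 0"
  obtain C \<sigma> where C: "0 \<le> C" "0 < \<sigma>" "\<And>x. \<bar>heat_hess_trace t x\<bar> \<le> C * heat_kernel \<sigma> x"
    "\<And>x k. norm (heat_hess_row t x k) \<le> C * heat_kernel \<sigma> x" "\<And>x j. norm (div_free_kernel t x j) \<le> C * heat_kernel \<sigma> x"
    by (rule div_free_kernel_bound_at[OF t]) (rule that)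
  let ?h = "\<lambda>y. heat_hess_row t (x - y) k"
  have shift: "heat_conv a f y = (LINT z|lborel. heat_kernel a z *\<^sub>R f (y + z))" for y
    unfolding heat_conv_def
    by (subst lborel_integral_translation[where c=y, symmetric]) (auto simp: heat_kernel_def)
  have 1: "integrable lborel (\<lambda>y. f (y + z) \<bullet> ?h y)" "(LINT y|lborel. \<bar>f (y + z) \<bullet> ?h y\<bar>) \<le> C * ((8 * pi * \<sigma>) powr (- 3 / 4) * L2_norm f)"
    "(LINT y|lborel. f (y + z) \<bullet> ?h y) = 0" for z
  proof -
    let ?F = "\<lambda>y. f y \<bullet> heat_hess_row t ((x + z) - y) k"
    have e: "f (y + z) \<bullet> ?h y = ?F (z + y)" for y by (simp add: add.commute)
    have iG: "integrable lborel (\<lambda>y. C * (heat_kernel \<sigma> ((x + z) - y) * norm (f y)))"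
    proof -
      have "in_L2 (\<lambda>y. norm (f y))" using f(2) by (auto simp: in_L2_def)
      then show ?thesis using heat_conv_integrable(1)[of "\<lambda>y. norm (f y)" \<sigma> "x + z"] C(2) by simp
    qed
    have b: "\<bar>?F y\<bar> \<le> C * (heat_kernel \<sigma> ((x + z) - y) * norm (f y))" for y
    proof -
      have "\<bar>?F y\<bar> \<le> norm (f y) * norm (heat_hess_row t ((x + z) - y) k)" by (rule Cauchy_Schwarz_ineq2)
      also have "\<dots> \<le> norm (f y) * (C * heat_kernel \<sigma> ((x + z) - y))" by (intro mult_left_mono C(4)) auto
      finally show ?thesis by (simp add: mult_ac)
    qed
    have mF: "?F \<in> borel_measurable borel" by measurable
    have iF: "integrable lborel ?F"
      by (rule Bochner_Integration.integrable_bound[OF iG]) (use mF b order_trans[OF b abs_ge_self] in auto)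
    show "integrable lborel (\<lambda>y. f (y + z) \<bullet> ?h y)" unfolding e by (rule lborel_integrable_translation[OF mF iF])
    have "(LINT y|lborel. \<bar>f (y + z) \<bullet> ?h y\<bar>) = (LINT y|lborel. \<bar>?F y\<bar>)"
      unfolding e by (rule lborel_integral_translation) measurable
    also have "\<dots> \<le> (LINT y|lborel. C * (heat_kernel \<sigma> ((x + z) - y) * norm (f y)))"
      using iF iG b by (intro integral_mono) auto
    also have "\<dots> \<le> C * ((8 * pi * \<sigma>) powr (- 3 / 4) * L2_norm f)"
      using heat_conv_integrable(2)[OF f C(2), of "x + z"] C(1) by (auto intro: mult_left_mono)
    finally show "(LINT y|lborel. \<bar>f (y + z) \<bullet> ?h y\<bar>) \<le> C * ((8 * pi * \<sigma>) powr (- 3 / 4) * L2_norm f)" .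
    have "(LINT y|lborel. f (y + z) \<bullet> ?h y) = (LINT y|lborel. ?F y)"
      unfolding e by (rule lborel_integral_translation[OF mF])
    then show "(LINT y|lborel. f (y + z) \<bullet> ?h y) = 0" using k t unfolding kernel_div_free_iff by simp
  qed
  have ia: "integrable lborel (heat_kernel a)" using heat_kernel_integral(1)[OF a, of 0] by simp
  have pair: "integrable (lborel \<Otimes>\<^sub>M lborel) (\<lambda>(z, y). heat_kernel a z * (f (y + z) \<bullet> ?h y))"
  proof (rule lborel_pair.Fubini_integrable)
    show "(\<lambda>(z, y). heat_kernel a z * (f (y + z) \<bullet> ?h y)) \<in> borel_measurable (lborel \<Otimes>\<^sub>M lborel)" by measurable
    show "integrable lborel (\<lambda>z. LINT y|lborel. norm (case (z, y) of (z, y) \<Rightarrow> heat_kernel a z * (f (y + z) \<bullet> ?h y)))"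
    proof (rule Bochner_Integration.integrable_bound)
      show "integrable lborel (\<lambda>z. (C * ((8 * pi * \<sigma>) powr (- 3 / 4) * L2_norm f)) * heat_kernel a z)" using ia by simp
      have "(LINT y|lborel. norm (case (z, y) of (z, y) \<Rightarrow> heat_kernel a z * (f (y + z) \<bullet> ?h y))) = heat_kernel a z * (LINT y|lborel. \<bar>f (y + z) \<bullet> ?h y\<bar>)" for z
        by (simp add: abs_mult heat_kernel_nonneg)
      moreover have "0 \<le> (LINT y|lborel. \<bar>f (y + z) \<bullet> ?h y\<bar>)" for z by (intro integral_nonneg_AE) auto
      moreover have "heat_kernel a z * (LINT y|lborel. \<bar>f (y + z) \<bullet> ?h y\<bar>) \<le> heat_kernel a z * (C * ((8 * pi * \<sigma>) powr (- 3 / 4) * L2_norm f))" for z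
        by (intro mult_left_mono 1 heat_kernel_nonneg)
      ultimately show "AE z in lborel. norm (LINT y|lborel. norm (case (z, y) of (z, y) \<Rightarrow> heat_kernel a z * (f (y + z) \<bullet> ?h y))) \<le> norm ((C * ((8 * pi * \<sigma>) powr (- 3 / 4) * L2_norm f)) * heat_kernel a z)"
        by (intro AE_I2) (simp only: real_norm_def abs_of_nonneg heat_kernel_nonneg mult_nonneg_nonneg order_trans[OF _ abs_ge_self] mult.commute[of "heat_kernel a _"])
    qed measurable
    show "AE z in lborel. integrable lborel (\<lambda>y. case (z, y) of (z, y) \<Rightarrow> heat_kernel a z * (f (y + z) \<bullet> ?h y))"
      using 1(1) by simp
  qed
  have fz: "integrable lborel (\<lambda>z. heat_kernel a z *\<^sub>R f (y + z))" for y
  proof -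
    have "integrable lborel (\<lambda>z. heat_kernel a (y - (y + z)) *\<^sub>R f (y + z))"
      by (rule lborel_integrable_translation[OF _ heat_conv_integrable(1)[OF f a, of y]]) measurable
    then show ?thesis by (simp add: heat_kernel_def)
  qed
  have "(LINT y|lborel. heat_conv a f y \<bullet> ?h y) = (LINT y|lborel. LINT z|lborel. heat_kernel a z * (f (y + z) \<bullet> ?h y))"
    unfolding shift by (intro Bochner_Integration.integral_cong refl, subst integral_inner_left[symmetric]) (use fz in auto)
  also have "\<dots> = (LINT z|lborel. LINT y|lborel. heat_kernel a z * (f (y + z) \<bullet> ?h y))"
    using lborel_pair.Fubini_integral[OF pair] by simp
  also have "\<dots> = 0" using 1(3) by simp
  finally show "(LINT y|lborel. heat_conv a f y \<bullet> ?h y) = 0" .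
qed

text \<open>The time derivative of \<open>heat_conv t g\<close>, by \<open>heat_conv_quotient\<close>.\<close>

definition heat_conv_deriv :: "real \<Rightarrow> (R3 \<Rightarrow> R3) \<Rightarrow> R3 \<Rightarrow> R3" where
  "heat_conv_deriv t g x = (LINT y|lborel. heat_hess_trace t (x - y) *\<^sub>R g y)"

lemma heat_conv_deriv_measurable [measurable]:
  assumes [measurable]: "g \<in> borel_measurable borel"
  shows "heat_conv_deriv t g \<in> borel_measurable borel"
proof -
  have "heat_conv_deriv t g \<in> borel_measurable lborel"
    unfolding heat_conv_deriv_def[abs_def] by (rule lborel.borel_measurable_lebesgue_integral) measurable
  then show ?thesis by simp
qed

text \<open>Bounds for convolution kernels are transferred to convolutions with \<open>g\<close>; the majorant
  \<open>heat_conv \<sigma> (\<lambda>y. norm (g y))\<close> is both bounded and square integrable.\<close>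

lemma dominated_convolution:
  fixes g :: "R3 \<Rightarrow> R3" and k :: "R3 \<Rightarrow> real"
  assumes g [measurable]: "g \<in> borel_measurable borel" "in_L2 g" and \<sigma>: "0 < \<sigma>" 
    and k [measurable]: "k \<in> borel_measurable borel" and b: "\<And>x. \<bar>k x\<bar> \<le> C * heat_kernel \<sigma> x"
  shows "integrable lborel (\<lambda>y. k (x - y) *\<^sub>R g y)"
    "norm (LINT y|lborel. k (x - y) *\<^sub>R g y) \<le> C * heat_conv \<sigma> (\<lambda>y. norm (g y)) x"
    "integrable lborel (\<lambda>y. C * (heat_kernel \<sigma> (x - y) * norm (g y)))"
proof -
  have n: "in_L2 (\<lambda>y. norm (g y))" using g(2) by (auto simp: in_L2_def)
  show i: "integrable lborel (\<lambda>y. C * (heat_kernel \<sigma> (x - y) * norm (g y)))"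
    using heat_conv_integrable(1)[OF _ n \<sigma>, of x] by simp
  have le: "norm (k (x - y) *\<^sub>R g y) \<le> C * (heat_kernel \<sigma> (x - y) * norm (g y))" for y
    using mult_right_mono[OF b[of "x - y"] norm_ge_zero[of "g y"]] by (simp add: mult_ac)
  show int: "integrable lborel (\<lambda>y. k (x - y) *\<^sub>R g y)"
    by (rule Bochner_Integration.integrable_bound[OF i]) (use order_trans[OF le abs_ge_self] in auto)
  have "norm (LINT y|lborel. k (x - y) *\<^sub>R g y) \<le> (LINT y|lborel. C * (heat_kernel \<sigma> (x - y) * norm (g y)))"
    using Bochner_Integration.integral_norm_bound_integral[OF int i] le by simp
  then show "norm (LINT y|lborel. k (x - y) *\<^sub>R g y) \<le> C * heat_conv \<sigma> (\<lambda>y. norm (g y)) x"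
    by (simp add: heat_conv_def)
qed

lemma dominated_convolution_continuous:
  fixes g :: "R3 \<Rightarrow> R3" and k :: "real \<Rightarrow> R3 \<Rightarrow> real"
  assumes g [measurable]: "g \<in> borel_measurable borel" "in_L2 g" and \<sigma>: "0 < \<sigma>" 
    and k [measurable]: "\<And>t. k t \<in> borel_measurable borel" and b: "\<And>t x. t \<in> S \<Longrightarrow> \<bar>k t x\<bar> \<le> C * heat_kernel \<sigma> x"
    and c: "\<And>x. continuous_on S (\<lambda>t. k t x)"
  shows "continuous_on S (\<lambda>t. LINT y|lborel. k t (x - y) *\<^sub>R g y)"
proof (rule continuous_on_sequentiallyI)
  fix X a assume X: "\<forall>n. X n \<in> S" "a \<in> S" "X \<longlonglongrightarrow> a"
  show "(\<lambda>n. LINT y|lborel. k (X n) (x - y) *\<^sub>R g y) \<longlonglongrightarrow> (LINT y|lborel. k a (x - y) *\<^sub>R g y)"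
  proof (rule integral_dominated_convergence[where w="\<lambda>y. C * (heat_kernel \<sigma> (x - y) * norm (g y))"])
    show "integrable lborel (\<lambda>y. C * (heat_kernel \<sigma> (x - y) * norm (g y)))"
      by (rule dominated_convolution(3)[OF g \<sigma> k[of a]]) (use b[OF X(2)] in auto)
    show "AE y in lborel. (\<lambda>n. k (X n) (x - y) *\<^sub>R g y) \<longlonglongrightarrow> k a (x - y) *\<^sub>R g y"
      using continuous_on_tendsto_compose[OF c X(3,2)] X(1) by (intro AE_I2 tendsto_intros) auto
    show "AE y in lborel. norm (k (X n) (x - y) *\<^sub>R g y) \<le> C * (heat_kernel \<sigma> (x - y) * norm (g y))" for n
    proof (intro AE_I2)
      fix y
      show "norm (k (X n) (x - y) *\<^sub>R g y) \<le> C * (heat_kernel \<sigma> (x - y) * norm (g y))"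
        using mult_right_mono[OF b[of "X n" "x - y"] norm_ge_zero[of "g y"]] X(1) by (simp add: mult.assoc)
    qed
  qed measurable
qed

text \<open>By the mean value theorem in time, the difference quotients of the kernel have the same Gaussian
  bound as its derivative. The bound does not depend on \<open>t\<close>, so the limit can be taken under
  integrals over \<open>t\<close> as well.\<close>

lemma heat_conv_quotient:
  fixes g :: "R3 \<Rightarrow> R3"
  assumes g [measurable]: "g \<in> borel_measurable borel" "in_L2 g" and \<tau>: "0 < \<tau>1" 
    and C: "0 < \<sigma>" "\<And>t x. t \<in> {\<tau>1..\<tau>2} \<Longrightarrow> heat_kernel t x \<le> C * heat_kernel \<sigma> x"
      "\<And>t x. t \<in> {\<tau>1..\<tau>2} \<Longrightarrow> \<bar>heat_hess_trace t x\<bar> \<le> C * heat_kernel \<sigma> x"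
    and t: "t \<in> {\<tau>1..\<tau>2}"
  shows "\<And>h. h \<noteq> 0 \<Longrightarrow> t + h \<in> {\<tau>1..\<tau>2} \<Longrightarrow> norm ((heat_conv (t + h) g x - heat_conv t g x) /\<^sub>R h) \<le> C * heat_conv \<sigma> (\<lambda>y. norm (g y)) x"
    and "\<And>h. (\<And>n. h n \<noteq> 0 \<and> t + h n \<in> {\<tau>1..\<tau>2}) \<Longrightarrow> h \<longlonglongrightarrow> 0 \<Longrightarrow>
       (\<lambda>n. (heat_conv (t + h n) g x - heat_conv t g x) /\<^sub>R h n) \<longlonglongrightarrow> heat_conv_deriv t g x"
proof -
  define k where "k h z = (heat_kernel (t + h) z - heat_kernel t z) / h" for h z
  have [measurable]: "k h \<in> borel_measurable borel" for h unfolding k_def[abs_def] by measurable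
  have G: "\<bar>heat_kernel s z\<bar> \<le> C * heat_kernel \<sigma> z" if "s \<in> {\<tau>1..\<tau>2}" for s z
    using C(2)[OF that] by (simp add: heat_kernel_nonneg)
  have kb: "\<bar>k h z\<bar> \<le> C * heat_kernel \<sigma> z" if h: "h \<noteq> 0" "t + h \<in> {\<tau>1..\<tau>2}" for h z
  proof -
    have "norm (heat_kernel (t + h) z - heat_kernel t z) \<le> C * heat_kernel \<sigma> z * norm (t + h - t)"
      by (rule field_differentiable_bound[of "{\<tau>1..\<tau>2}" _ "\<lambda>s. heat_hess_trace s z"])
         (use \<tau> t h C(3) heat_kernel_time_derivative[folded heat_hess_trace_def] in \<open>auto intro: has_field_derivative_at_within\<close>)
    then show ?thesis using h(1) by (simp add: k_def abs_div divide_le_eq)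
  qed
  have eq: "(heat_conv (t + h) g x - heat_conv t g x) /\<^sub>R h = (LINT y|lborel. k h (x - y) *\<^sub>R g y)" if h: "t + h \<in> {\<tau>1..\<tau>2}" for h
  proof -
    have "(LINT y|lborel. k h (x - y) *\<^sub>R g y) = (LINT y|lborel. (1 / h) *\<^sub>R (heat_kernel (t + h) (x - y) *\<^sub>R g y - heat_kernel t (x - y) *\<^sub>R g y))"
      by (intro Bochner_Integration.integral_cong refl) (simp add: k_def scaleR_diff_left[symmetric])
    also have "\<dots> = (1 / h) *\<^sub>R (heat_conv (t + h) g x - heat_conv t g x)"
      unfolding heat_conv_def
      using dominated_convolution(1)[OF g C(1) heat_kernel_measurable G[OF h], of x] dominated_convolution(1)[OF g C(1) heat_kernel_measurable G[OF t], of x]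
      by simp
    finally show ?thesis by (simp add: divide_inverse)
  qed
  show "norm ((heat_conv (t + h) g x - heat_conv t g x) /\<^sub>R h) \<le> C * heat_conv \<sigma> (\<lambda>y. norm (g y)) x" if "h \<noteq> 0" "t + h \<in> {\<tau>1..\<tau>2}" for h
    unfolding eq[OF that(2)] by (rule dominated_convolution(2)[OF g C(1) _ kb[OF that]]) measurable
  show "(\<lambda>n. (heat_conv (t + h n) g x - heat_conv t g x) /\<^sub>R h n) \<longlonglongrightarrow> heat_conv_deriv t g x"
    if h: "\<And>n. h n \<noteq> 0 \<and> t + h n \<in> {\<tau>1..\<tau>2}" "h \<longlonglongrightarrow> 0" for h
  proof -
    have "(\<lambda>n. LINT y|lborel. k (h n) (x - y) *\<^sub>R g y) \<longlonglongrightarrow> (LINT y|lborel. heat_hess_trace t (x - y) *\<^sub>R g y)"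
    proof (rule integral_dominated_convergence[where w="\<lambda>y. C * (heat_kernel \<sigma> (x - y) * norm (g y))"])
      show "integrable lborel (\<lambda>y. C * (heat_kernel \<sigma> (x - y) * norm (g y)))"
        by (rule dominated_convolution(3)[OF g C(1) heat_hess_trace_measurable C(3)[OF t]])
      have "(\<lambda>n. k (h n) z) \<longlonglongrightarrow> heat_hess_trace t z" for z
      proof -
        have "((\<lambda>h. k h z) \<longlongrightarrow> heat_hess_trace t z) (at 0)"
          using heat_kernel_time_derivative[of t z] t \<tau> by (simp add: DERIV_def k_def heat_hess_trace_def)
        then show ?thesis using h by (auto simp: tendsto_at_iff_sequentially o_def)
      qed
      then show "AE y in lborel. (\<lambda>n. k (h n) (x - y) *\<^sub>R g y) \<longlonglongrightarrow> heat_hess_trace t (x - y) *\<^sub>R g y"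
        by (intro AE_I2 tendsto_intros)
      show "AE y in lborel. norm (k (h n) (x - y) *\<^sub>R g y) \<le> C * (heat_kernel \<sigma> (x - y) * norm (g y))" for n
      proof (intro AE_I2)
        fix y
        show "norm (k (h n) (x - y) *\<^sub>R g y) \<le> C * (heat_kernel \<sigma> (x - y) * norm (g y))"
          using mult_right_mono[OF kb[of "h n" "x - y"] norm_ge_zero[of "g y"]] h(1)[of n] by (simp add: mult.assoc)
      qed
    qed measurable
    then show ?thesis using eq h(1) by (simp add: heat_conv_deriv_def)
  qed
qed

text \<open>For fixed \<open>y\<close>, the sum over \<open>j\<close> of \<open>g\<^sub>j(y)\<close> times column \<open>j\<close> is \<open>\<Delta>G\<^sub>t g(y) - \<nabla>\<nabla>G\<^sub>t g(y)\<close>. Integrated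
  over \<open>y\<close>, the Hessian part vanishes since \<open>g\<close> is divergence free, and the Laplacian part is the
  time derivative of the heat flow. The pairing is needed for velocities, which are in \<open>L\<^sup>2\<close>, and
  for the convection term, which is in \<open>L\<^sup>1\<close>.\<close>

lemma kernel_pairing_Fubini:
  fixes f g :: "R3 \<Rightarrow> R3"
  assumes [measurable]: "f \<in> borel_measurable borel" and f: "in_L2 f \<or> integrable lborel f"
    and g [measurable]: "g \<in> borel_measurable borel" "in_L2 g" "kernel_div_free g" and t: "t > 0"
  shows "(LINT y|lborel. (\<Sum>j\<in>UNIV. g y $ j * (LINT x|lborel. f x \<bullet> div_free_kernel t (x - y) j))) = (LINT x|lborel. f x \<bullet> heat_conv_deriv t g x)"
    and "integrable lborel (\<lambda>y. \<Sum>j\<in>UNIV. g y $ j * (LINT x|lborel. f x \<bullet> div_free_kernel t (x - y) j))"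
proof -
  obtain C \<sigma> where C: "0 \<le> C" "0 < \<sigma>" "\<And>x. \<bar>heat_hess_trace t x\<bar> \<le> C * heat_kernel \<sigma> x"
    "\<And>x k. norm (heat_hess_row t x k) \<le> C * heat_kernel \<sigma> x" "\<And>x j. norm (div_free_kernel t x j) \<le> C * heat_kernel \<sigma> x"
    by (rule div_free_kernel_bound_at[OF t]) (rule that)
  define V where "V y x = heat_hess_trace t (x - y) *\<^sub>R g y - (\<Sum>j\<in>UNIV. g y $ j *\<^sub>R heat_hess_row t (x - y) j)" for x y
  have V: "V y x = (\<Sum>j\<in>UNIV. g y $ j *\<^sub>R div_free_kernel t (x - y) j)" for x y
  proof -
    have e: "(\<Sum>j\<in>UNIV. g y $ j *\<^sub>R axis j 1) = g y" using basis_expansion[of "g y"] by (simp add: scalar_mult_eq_scaleR)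
    have "heat_hess_trace t (x - y) *\<^sub>R g y = (\<Sum>j\<in>UNIV. heat_hess_trace t (x - y) *\<^sub>R g y $ j *\<^sub>R axis j 1)"
      by (rule trans[OF arg_cong[where f="\<lambda>v. heat_hess_trace t (x - y) *\<^sub>R v", OF e[symmetric]] scaleR_sum_right])
    then show ?thesis unfolding V_def div_free_kernel_eq by (simp add: scaleR_diff_right sum_subtractf mult.commute)
  qed
  have ng: "in_L2 (\<lambda>y. norm (g y))" using g(2) by (auto simp: in_L2_def)
  have pair0: "integrable (lborel \<Otimes>\<^sub>M lborel) (\<lambda>(x, y). heat_kernel \<sigma> (x - y) * (norm (f x) * norm (g y)))"
    using f
  proof
    assume "in_L2 f"
    then have "in_L2 (\<lambda>x. norm (f x))" by (auto simp: in_L2_def)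
    then show ?thesis by (intro heat_pair_integrable_L2 ng C) auto
  next
    assume "integrable lborel f"
    then show ?thesis by (intro heat_pair_integrable_L1_L2 ng C) auto
  qed
  have fx: "integrable lborel (\<lambda>x. f x \<bullet> div_free_kernel t (x - y) j)" for y j
  proof -
    have i: "integrable lborel (\<lambda>x. heat_kernel \<sigma> (x - y) * norm (f x))"
      using f
    proof
      assume "in_L2 f"
      then have "in_L2 (\<lambda>x. norm (f x))" by (auto simp: in_L2_def)
      from heat_conv_integrable(1)[OF _ this C(2), of y] show ?thesis by (simp add: heat_kernel_commute[of \<sigma> y])
    next
      assume L1: "integrable lborel f"
      obtain B where B: "\<And>x. heat_kernel \<sigma> (x - y) \<le> B"
      proof
        show "heat_kernel \<sigma> (x - y) \<le> (4 * pi * \<sigma>) powr (- 3 / 2)" for x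
          unfolding heat_kernel_def using C(2) by (intro mult_left_le) auto
      qed
      show ?thesis
      proof (rule Bochner_Integration.integrable_bound)
        show "integrable lborel (\<lambda>x. B * norm (f x))" using L1 by simp
        show "AE x in lborel. norm (heat_kernel \<sigma> (x - y) * norm (f x)) \<le> norm (B * norm (f x))"
          using mult_right_mono[OF B norm_ge_zero] by (intro AE_I2) (auto simp: heat_kernel_nonneg abs_mult intro!: mult_right_mono order_trans[OF B abs_ge_self])
      qed measurable
    qed
    show ?thesis
    proof (rule Bochner_Integration.integrable_bound[OF integrable_mult_right[OF i, of C]])
      have "\<bar>f x \<bullet> div_free_kernel t (x - y) j\<bar> \<le> C * (heat_kernel \<sigma> (x - y) * norm (f x))" for x
        using order_trans[OF Cauchy_Schwarz_ineq2 mult_left_mono[OF C(5) norm_ge_zero]] by (simp add: mult_ac)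
      then show "AE x in lborel. norm (f x \<bullet> div_free_kernel t (x - y) j) \<le> norm (C * (heat_kernel \<sigma> (x - y) * norm (f x)))"
        by (intro AE_I2) (use order_trans[OF _ abs_ge_self] in auto)
    qed measurable
  qed
  have pair: "integrable (lborel \<Otimes>\<^sub>M lborel) (\<lambda>(x, y). f x \<bullet> V y x)"
  proof (rule Bochner_Integration.integrable_bound[OF integrable_mult_right[OF pair0, of "3 * C"]])
    have "norm (V y x) \<le> 3 * C * (heat_kernel \<sigma> (x - y) * norm (g y))" for x y
    proof -
      have "norm (g y $ j *\<^sub>R div_free_kernel t (x - y) j) \<le> norm (g y) * (C * heat_kernel \<sigma> (x - y))" for j
        unfolding norm_scaleR by (intro mult_mono C(5)) (auto simp: component_le_norm_cart)
      then have "norm (V y x) \<le> (\<Sum>j\<in>(UNIV::3 set). norm (g y) * (C * heat_kernel \<sigma> (x - y)))"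
        unfolding V by (intro order_trans[OF norm_sum] sum_mono)
      then show ?thesis by (simp add: mult_ac)
    qed
    note nV = this
    have "\<bar>f x \<bullet> V y x\<bar> \<le> 3 * C * (heat_kernel \<sigma> (x - y) * (norm (f x) * norm (g y)))" for x y
      using order_trans[OF Cauchy_Schwarz_ineq2 mult_left_mono[OF nV[of y x] norm_ge_zero[of "f x"]]] by (simp add: mult_ac)
    then show "AE z in lborel \<Otimes>\<^sub>M lborel. norm (case z of (x, y) \<Rightarrow> f x \<bullet> V y x) \<le> norm (3 * C * (case z of (x, y) \<Rightarrow> heat_kernel \<sigma> (x - y) * (norm (f x) * norm (g y))))"
      by (intro AE_I2) (use order_trans[OF _ abs_ge_self] in auto)
    show "(\<lambda>(x, y). f x \<bullet> V y x) \<in> borel_measurable (lborel \<Otimes>\<^sub>M lborel)"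
      unfolding V_def by measurable
  qed
  have inner_x: "(\<Sum>j\<in>UNIV. g y $ j * (LINT x|lborel. f x \<bullet> div_free_kernel t (x - y) j)) = (LINT x|lborel. f x \<bullet> V y x)" for y
  proof -
    have "(LINT x|lborel. f x \<bullet> V y x) = (LINT x|lborel. (\<Sum>j\<in>UNIV. g y $ j * (f x \<bullet> div_free_kernel t (x - y) j)))"
      unfolding V by (intro Bochner_Integration.integral_cong refl) (simp add: inner_sum_right)
    also have "\<dots> = (\<Sum>j\<in>UNIV. LINT x|lborel. g y $ j * (f x \<bullet> div_free_kernel t (x - y) j))"
      by (intro Bochner_Integration.integral_sum integrable_mult_right fx)
    finally show ?thesis by simp
  qed
  have inner_y: "(LINT y|lborel. f x \<bullet> V y x) = f x \<bullet> heat_conv_deriv t g x" for x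
  proof -
    have i1: "integrable lborel (\<lambda>y. heat_hess_trace t (x - y) *\<^sub>R g y)"
      by (rule dominated_convolution(1)[OF g(1,2) C(2) heat_hess_trace_measurable C(3)])
    have ih: "integrable lborel (\<lambda>y. g y $ j *\<^sub>R heat_hess_row t (x - y) j)" for j
    proof (rule Bochner_Integration.integrable_bound[OF dominated_convolution(3)[OF g(1,2) C(2) heat_hess_trace_measurable C(3), of x]])
      have "norm (g y $ j *\<^sub>R heat_hess_row t (x - y) j) \<le> norm (g y) * (C * heat_kernel \<sigma> (x - y))" for y
        unfolding norm_scaleR by (intro mult_mono C(4)) (auto simp: component_le_norm_cart)
      then have "norm (g y $ j *\<^sub>R heat_hess_row t (x - y) j) \<le> C * (heat_kernel \<sigma> (x - y) * norm (g y))" for y by (simp add: mult_ac)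
      then show "AE y in lborel. norm (g y $ j *\<^sub>R heat_hess_row t (x - y) j) \<le> norm (C * (heat_kernel \<sigma> (x - y) * norm (g y)))"
        by (intro AE_I2) (use order_trans[OF _ abs_ge_self] in auto)
    qed measurable
    have i2: "integrable lborel (\<lambda>y. \<Sum>j\<in>UNIV. g y $ j *\<^sub>R heat_hess_row t (x - y) j)" by (intro Bochner_Integration.integrable_sum ih)
    have "(LINT y|lborel. (\<Sum>j\<in>UNIV. g y $ j *\<^sub>R heat_hess_row t (x - y) j)) \<bullet> axis k 1 = 0" for k
    proof -
      have "(LINT y|lborel. (\<Sum>j\<in>UNIV. g y $ j *\<^sub>R heat_hess_row t (x - y) j)) \<bullet> axis k 1 = (LINT y|lborel. (\<Sum>j\<in>UNIV. g y $ j *\<^sub>R heat_hess_row t (x - y) j) \<bullet> axis k 1)"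
        by (rule integral_inner_left[symmetric]) (use i2 in simp)
      also have "\<dots> = (LINT y|lborel. g y \<bullet> heat_hess_row t (x - y) k)"
      proof (intro Bochner_Integration.integral_cong refl)
        fix y
        show "(\<Sum>j\<in>UNIV. g y $ j *\<^sub>R heat_hess_row t (x - y) j) \<bullet> axis k 1 = g y \<bullet> heat_hess_row t (x - y) k"
          by (simp add: inner_axis inner_vec_def[of "g y"] heat_hess_row_def heat_hess_symmetric[of t _ k])
      qed
      finally show ?thesis using g(3) t by (simp add: kernel_div_free_iff)
    qed
    then have z: "(LINT y|lborel. (\<Sum>j\<in>UNIV. g y $ j *\<^sub>R heat_hess_row t (x - y) j)) = 0" by (simp add: vec_eq_iff inner_axis)
    have "(LINT y|lborel. f x \<bullet> V y x) = f x \<bullet> (LINT y|lborel. V y x)"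
      by (rule integral_inner_right) (use i1 i2 in \<open>auto simp: V_def\<close>)
    also have "(LINT y|lborel. V y x) = heat_conv_deriv t g x"
      unfolding V_def heat_conv_deriv_def using Bochner_Integration.integral_diff[OF i1 i2] z by simp
    finally show ?thesis .
  qed
  show "(LINT y|lborel. (\<Sum>j\<in>UNIV. g y $ j * (LINT x|lborel. f x \<bullet> div_free_kernel t (x - y) j))) = (LINT x|lborel. f x \<bullet> heat_conv_deriv t g x)"
    unfolding inner_x using lborel_pair.Fubini_integral[of "\<lambda>x y. f x \<bullet> V y x"] pair by (simp add: inner_y)
  show "integrable lborel (\<lambda>y. \<Sum>j\<in>UNIV. g y $ j * (LINT x|lborel. f x \<bullet> div_free_kernel t (x - y) j))"
    unfolding inner_x using lborel_pair.integrable_snd[of "\<lambda>x y. f x \<bullet> V y x"] pair by simp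
qed

text \<open>On a ball \<open>f\<close> is integrable and the supremum norm of the heat flow decays; outside a large ball
  \<open>f\<close> is small in \<open>L\<^sup>2\<close> and the heat flow is a contraction.\<close>

lemma heat_pairing_vanishes:
  fixes f g :: "R3 \<Rightarrow> R3"
  assumes f [measurable]: "f \<in> borel_measurable borel" "in_L2 f" and g [measurable]: "g \<in> borel_measurable borel" "in_L2 g"
  shows "((\<lambda>t. L2_inner f (heat_conv t g)) \<longlongrightarrow> 0) at_top"
proof (rule tendstoI)
  fix e :: real assume e: "e > 0"
  define F where "F n x = indicator (cball 0 (real n)) x *\<^sub>R f x" for n x
  have mF [measurable]: "F n \<in> borel_measurable borel" for n
    unfolding F_def[abs_def] using f(1) by (intro borel_measurable_scaleR borel_measurable_indicator) auto
  have bF: "norm (F n x) \<le> norm (f x)" for n x by (auto simp: F_def indicator_def)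
  have nf: "in_L2 (\<lambda>x. norm (f x))" using f(2) by (auto simp: in_L2_def)
  have F2: "in_L2 (F n)" for n by (rule in_L2_bound(1)[OF f(2) borel_imp_lebesgue_measurable[OF mF] bF])
  have lim: "(\<lambda>n. F n x) \<longlonglongrightarrow> f x" for x
  proof (rule tendsto_eventually)
    obtain N where N: "norm x \<le> real N" using real_arch_simple by blast
    have "F n x = f x" if "n \<ge> N" for n
    proof -
      have "norm x \<le> real n" using N that by (meson of_nat_mono order_trans)
      then show ?thesis by (simp add: F_def)
    qed
    then show "\<forall>\<^sub>F n in sequentially. F n x = f x" unfolding eventually_sequentially by blast
  qed
  have approx: "(\<lambda>n. L2_norm (\<lambda>x. F n x - f x)) \<longlonglongrightarrow> 0"
    by (rule L2_dominated_convergence(2)[OF nf borel_imp_lebesgue_measurable[OF mF] in_L2D(1)[OF f(2)] bF lim])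
  have gn: "L2_norm g + 1 > 0" using L2_norm_nonneg[of g] by linarith
  have "\<forall>\<^sub>F n in sequentially. L2_norm (\<lambda>x. F n x - f x) < e / 2 / (L2_norm g + 1)"
    by (rule order_tendstoD(2)[OF approx]) (use e gn in auto)
  then obtain n where n: "L2_norm (\<lambda>x. F n x - f x) < e / 2 / (L2_norm g + 1)" by (meson eventually_sequentially order_refl)
  define I where "I = (LINT x|lebesgue. norm (F n x))"
  have iF: "integrable lebesgue (\<lambda>x. norm (F n x))"
  proof -
    have "integrable lebesgue (\<lambda>x. norm (indicator (cball 0 (real n)) x :: real) * norm (f x))"
      by (intro L2_Cauchy_Schwarz(1) f in_L2_indicator) auto
    then show ?thesis by (simp add: F_def)
  qed
  have I: "0 \<le> I" unfolding I_def by (intro integral_nonneg_AE) auto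
  have lim0: "((\<lambda>t. I * ((8 * pi * t) powr (- 3 / 4) * L2_norm g)) \<longlongrightarrow> 0) at_top"
  proof -
    have "((\<lambda>t::real. (8 * pi * t) powr (- 3 / 4)) \<longlongrightarrow> 0) at_top"
      by (rule tendsto_neg_powr) (auto intro!: filterlim_tendsto_pos_mult_at_top[OF tendsto_const] filterlim_ident)
    from tendsto_mult[OF tendsto_const tendsto_mult[OF this tendsto_const]] show ?thesis by simp
  qed
  have "\<forall>\<^sub>F t in at_top. I * ((8 * pi * t) powr (- 3 / 4) * L2_norm g) < e / 2"
    by (rule order_tendstoD(2)[OF lim0]) (use e in simp)
  then show "\<forall>\<^sub>F t in at_top. dist (L2_inner f (heat_conv t g)) 0 < e"
    using eventually_gt_at_top[of 0]
  proof eventually_elim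
    fix t :: real assume t: "I * ((8 * pi * t) powr (- 3 / 4) * L2_norm g) < e / 2" "0 < t"
    note H = heat_conv_L2[OF g t(2)]
    have 1: "\<bar>L2_inner (\<lambda>x. F n x - f x) (heat_conv t g)\<bar> \<le> e / 2"
    proof -
      have "\<bar>L2_inner (\<lambda>x. F n x - f x) (heat_conv t g)\<bar> \<le> L2_norm (\<lambda>x. F n x - f x) * L2_norm (heat_conv t g)"
        by (intro abs_L2_inner_le in_L2_diff F2 f H)
      also have "\<dots> \<le> (e / 2 / (L2_norm g + 1)) * (L2_norm g + 1)"
        using H(2) n e gn by (intro mult_mono) (auto simp: L2_norm_nonneg)
      also have "\<dots> = e / 2" using gn by (metis nonzero_eq_divide_eq less_irrefl)
      finally show ?thesis .
    qed
    have 2: "\<bar>L2_inner (F n) (heat_conv t g)\<bar> \<le> I * ((8 * pi * t) powr (- 3 / 4) * L2_norm g)"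
    proof -
      have "\<bar>L2_inner (F n) (heat_conv t g)\<bar> \<le> (LINT x|lebesgue. norm (F n x) * ((8 * pi * t) powr (- 3 / 4) * L2_norm g))"
        unfolding L2_inner_def
      proof (rule Bochner_Integration.integral_norm_bound_integral[OF integrable_inner_L2[OF F2 H(1)], unfolded real_norm_def])
        show "integrable lebesgue (\<lambda>x. norm (F n x) * ((8 * pi * t) powr (- 3 / 4) * L2_norm g))" using iF by simp
        show "\<bar>F n x \<bullet> heat_conv t g x\<bar> \<le> norm (F n x) * ((8 * pi * t) powr (- 3 / 4) * L2_norm g)" for x
          by (rule order_trans[OF Cauchy_Schwarz_ineq2 mult_left_mono[OF heat_conv_integrable(3)[OF g t(2)]]]) simp
      qed
      then show ?thesis by (simp add: I_def)
    qed
    have "L2_inner f (heat_conv t g) = L2_inner (F n) (heat_conv t g) - L2_inner (\<lambda>x. F n x - f x) (heat_conv t g)"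
      using L2_inner_diff_left[OF F2 f(2) H(1), of n] by simp
    then show "dist (L2_inner f (heat_conv t g)) 0 < e" using 1 2 t(1) by (simp add: dist_real_def)
  qed
qed

lemma kernel_div_free_diff:
  assumes f: "f \<in> borel_measurable borel" "in_L2 f" "kernel_div_free f" and g: "g \<in> borel_measurable borel" "in_L2 g" "kernel_div_free g"
  shows "kernel_div_free (\<lambda>x. f x - g x)"
  unfolding kernel_div_free_iff
proof (intro allI impI)
  fix t :: real and x k assume t: "t > 0"
  obtain C \<sigma> where C: "0 \<le> C" "0 < \<sigma>" "\<And>x. \<bar>heat_hess_trace t x\<bar> \<le> C * heat_kernel \<sigma> x"
    "\<And>x k. norm (heat_hess_row t x k) \<le> C * heat_kernel \<sigma> x" "\<And>x j. norm (div_free_kernel t x j) \<le> C * heat_kernel \<sigma> x"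
    by (rule div_free_kernel_bound_at[OF t]) (rule that)
  have i: "integrable lborel (\<lambda>y. h y \<bullet> heat_hess_row t (x - y) k)" if h: "h \<in> borel_measurable borel" "in_L2 h" for h
  proof (rule Bochner_Integration.integrable_bound[OF dominated_convolution(3)[OF h C(2) heat_hess_trace_measurable C(3), of x]])
    have "\<bar>h y \<bullet> heat_hess_row t (x - y) k\<bar> \<le> C * (heat_kernel \<sigma> (x - y) * norm (h y))" for y
      using order_trans[OF Cauchy_Schwarz_ineq2 mult_left_mono[OF C(4) norm_ge_zero]] by (simp add: mult_ac)
    then show "AE y in lborel. norm (h y \<bullet> heat_hess_row t (x - y) k) \<le> norm (C * (heat_kernel \<sigma> (x - y) * norm (h y)))"
      by (intro AE_I2) (use order_trans[OF _ abs_ge_self] in auto)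
    show "(\<lambda>y. h y \<bullet> heat_hess_row t (x - y) k) \<in> borel_measurable lborel" using h(1) by measurable
  qed
  show "(LINT y|lborel. (f y - g y) \<bullet> heat_hess_row t (x - y) k) = 0"
    unfolding inner_diff_left using Bochner_Integration.integral_diff[OF i[OF f(1,2)] i[OF g(1,2)]] f(3) g(3) t
    by (simp add: kernel_div_free_iff)
qed

lemma div_free_kernel_continuous:
  "continuous_on ({0<..} \<times> UNIV) (\<lambda>(t, x). div_free_kernel t x j)"
  using heat_hess_continuous unfolding div_free_kernel_def case_prod_beta by (intro continuous_intros) auto

section \<open>The Duhamel identity, differentiated\<close>

context weak_solution
begin

context
  fixes t0 t0' :: real
  assumes t: "0 \<le> t0" "t0 < t0'"
begin

text \<open>The identity \<open>kernel_identity\<close> for the pole \<open>y\<close> and column \<open>j\<close> is multiplied with \<open>g\<^sub>j(y)\<close> and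
  integrated over \<open>y\<close>. Integrals over \<open>x\<close> and \<open>y\<close> are exchanged by \<open>kernel_pairing_Fubini\<close>.
  Exchanging those over \<open>s\<close> and \<open>y\<close> requires joint measurability of the pairing with the
  convection term, supplied by \<open>convection_pairing_measurable\<close> with parameter \<open>(s, y)\<close>.\<close>

lemma kernel_identity_integrated:
  fixes g :: "R3 \<Rightarrow> R3"
  assumes g [measurable]: "g \<in> borel_measurable borel" "in_L2 g" "kernel_div_free g" and r: "t0' < r"
  shows "L2_inner (u t0) (heat_conv_deriv (r - t0) g) - L2_inner (u t0') (heat_conv_deriv (r - t0') g)
     = (LINT s:{t0..t0'}|lebesgue. LINT x|lebesgue. convection s x \<bullet> heat_conv_deriv (r - s) g x)"
proof -
  let ?J = "{t0..t0'}" and ?S = "good_times t0 t0'"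
  let ?K = "\<lambda>s y j x. div_free_kernel (r - s) (x - y) j"
  obtain C \<sigma> where C: "0 \<le> C" "0 < \<sigma>" "\<And>s x. s \<in> {r - t0'..r - t0} \<Longrightarrow> heat_kernel s x \<le> C * heat_kernel \<sigma> x"
    "\<And>s x. s \<in> {r - t0'..r - t0} \<Longrightarrow> \<bar>heat_hess_trace s x\<bar> \<le> C * heat_kernel \<sigma> x"
    "\<And>s x k. s \<in> {r - t0'..r - t0} \<Longrightarrow> norm (heat_hess_row s x k) \<le> C * heat_kernel \<sigma> x"
    "\<And>s x j. s \<in> {r - t0'..r - t0} \<Longrightarrow> norm (div_free_kernel s x j) \<le> C * heat_kernel \<sigma> x"
    by (rule div_free_kernel_bound[of "r - t0'" "r - t0"]) (use t r in auto)
  have rs: "r - s \<in> {r - t0'..r - t0}" "0 < r - s" if "s \<in> ?J" for s using that r by auto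
  define B where "B = (4 * pi * \<sigma>) powr (- 3 / 2)"
  have B: "heat_kernel \<sigma> x \<le> B" for x
    unfolding heat_kernel_def B_def using C(2) by (intro mult_left_le) auto
  have K_bound: "norm (?K s y j x) \<le> C * B" if "s \<in> ?J" for s y j x
    using order_trans[OF C(6)[OF rs(1)[OF that]] mult_left_mono[OF B C(1)]] .
  have K_meas: "?K s y j \<in> borel_measurable lebesgue" for s y j
    by (rule borel_imp_lebesgue_measurable) measurable
  have K_cont: "continuous_on (?J \<times> UNIV) (\<lambda>p. ?K (fst p) (snd p) j x)" for j x
  proof -
    have "continuous_on (?J \<times> UNIV) (\<lambda>p. (\<lambda>(t, x). div_free_kernel t x j) (r - fst p, x - snd p))"
      by (rule continuous_on_compose2[OF div_free_kernel_continuous]) (use r in \<open>auto intro!: continuous_intros\<close>)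
    then show ?thesis by simp
  qed
  have K_cont': "continuous_on ?J (\<lambda>s. ?K s y j x)" for y j x
  proof -
    have "continuous_on ?J (\<lambda>s. (\<lambda>p. ?K (fst p) (snd p) j x) (s, y))"
      by (rule continuous_on_compose2[OF K_cont]) (auto intro!: continuous_intros)
    then show ?thesis by simp
  qed
  define b where "b j s y = (LINT x|lebesgue. convection s x \<bullet> ?K s y j x)" for j s y
  have b_meas: "(\<lambda>p. indicator ?S (fst p) * b j (fst p) (snd p)) \<in> borel_measurable borel" for j
  proof -
    have "(\<lambda>p. indicator {p \<in> ?J \<times> UNIV. fst p \<in> T} p * (LINT x|lebesgue. convection (fst p) x \<bullet> ?K (fst p) (snd p) j x)) \<in> borel_measurable borel"
    proof (rule convection_pairing_measurable[where C="C * B"])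
      show "?J \<times> UNIV \<in> sets (borel :: (real \<times> R3) measure)" by (intro borel_closed closed_Times) auto
      show "fst \<in> borel_measurable (borel :: (real \<times> R3) measure)" by (intro borel_measurable_continuous_onI continuous_intros)
      show "continuous_on (?J \<times> (UNIV :: R3 set)) fst" by (intro continuous_intros)
    qed (use K_meas K_bound K_cont t in auto)
    moreover have "indicator {p \<in> ?J \<times> UNIV. fst p \<in> T} p = (indicator ?S (fst p) :: real)" for p :: "real \<times> R3"
      by (cases p) (auto simp: indicator_def)
    ultimately show ?thesis by (simp add: b_def)
  qed
  have b_int: "set_integrable lebesgue ?J (\<lambda>s. b j s y)" "(\<lambda>s. indicator ?S s * b j s y) \<in> borel_measurable borel" for j y
  proof -
    show "set_integrable lebesgue ?J (\<lambda>s. b j s y)"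
      unfolding b_def by (rule convection_pairing_time_integrable(2)[OF t K_meas K_bound K_cont'])
    show "(\<lambda>s. indicator ?S s * b j s y) \<in> borel_measurable borel"
      unfolding b_def using convection_pairing_time_integrable(1)[OF t K_meas K_bound K_cont', of y j] .
  qed
  have b_eq: "(LINT s|lborel. indicator ?S s * b j s y) = L2_inner (u t0) (?K t0 y j) - L2_inner (u t0') (?K t0' y j)" for j y
    using kernel_identity[OF t r, where y=y and j=j] good_times_integral[OF t b_int(2)] by (simp add: b_def)
  have Bv: "\<exists>f'. f' \<in> borel_measurable borel \<and> integrable lborel f' \<and> (AE x in lebesgue. convection s x = f' x) \<and> (LINT x|lborel. norm (f' x)) \<le> E * L2_norm (Du s)"
    if "s \<in> T" for s
  proof -
    note c = convection_L1[OF that]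
    obtain f' where f': "f' \<in> borel_measurable borel" "AE x in lebesgue. convection s x = f' x" by (rule borel_version[OF c(1)])
    have m: "f' \<in> borel_measurable lebesgue" by (rule borel_imp_lebesgue_measurable[OF f'(1)])
    have "integrable lebesgue (convection s)" using c(1,2) by (simp add: integrable_norm_iff)
    then have "integrable lebesgue f'" by (rule integrable_cong_AE_imp) (use f' m in auto)
    then have i: "integrable lborel f'" using integrable_lebesgue_lborel[OF f'(1)] by simp
    have "(LINT x|lborel. norm (f' x)) = (LINT x|lebesgue. norm (f' x))"
      by (rule integral_lebesgue_lborel[symmetric]) (use f'(1) in measurable)
    also have "\<dots> = (LINT x|lebesgue. norm (convection s x))"
      by (rule integral_cong_AE) (use f'(2) m c(1) in auto)
    also have "\<dots> \<le> E * L2_norm (Du s)" by (rule c(3))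
    finally show ?thesis using f' i by blast
  qed
  \<comment> \<open>Borel versions of the convection term, chosen separately for each time; no measurability in
    time is claimed.\<close>
  define cb where "cb s = (SOME f'. f' \<in> borel_measurable borel \<and> integrable lborel f' \<and> (AE x in lebesgue. convection s x = f' x)
      \<and> (LINT x|lborel. norm (f' x)) \<le> E * L2_norm (Du s))" for s
  have "cb s \<in> borel_measurable borel \<and> integrable lborel (cb s) \<and> (AE x in lebesgue. convection s x = cb s x)
      \<and> (LINT x|lborel. norm (cb s x)) \<le> E * L2_norm (Du s)" if "s \<in> T" for s
    unfolding cb_def by (rule someI_ex[OF Bv[OF that]])
  then have cb: "\<And>s. s \<in> T \<Longrightarrow> cb s \<in> borel_measurable borel" "\<And>s. s \<in> T \<Longrightarrow> integrable lborel (cb s)"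
    "\<And>s. s \<in> T \<Longrightarrow> AE x in lebesgue. convection s x = cb s x" "\<And>s. s \<in> T \<Longrightarrow> (LINT x|lborel. norm (cb s x)) \<le> E * L2_norm (Du s)"
    by blast+
  have pair_eq: "(LINT x|lebesgue. convection s x \<bullet> \<phi> x) = (LINT x|lborel. cb s x \<bullet> \<phi> x)" if "s \<in> T" "\<phi> \<in> borel_measurable borel" for s \<phi>
  proof -
    have "(LINT x|lebesgue. convection s x \<bullet> \<phi> x) = (LINT x|lebesgue. cb s x \<bullet> \<phi> x)"
      by (rule integral_cong_AE)
         (use cb(3)[OF that(1)] convection_L1(1)[OF that(1)] borel_imp_lebesgue_measurable[OF cb(1)[OF that(1)]] borel_imp_lebesgue_measurable[OF that(2)] in auto)
    also have "\<dots> = (LINT x|lborel. cb s x \<bullet> \<phi> x)"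
      by (rule integral_lebesgue_lborel) (use cb(1)[OF that(1)] that(2) in measurable)
    finally show ?thesis .
  qed
  \<comment> \<open>The integrand of the double integral over \<open>s\<close> and \<open>y\<close>, set to 0 outside the interval and at
    exceptional times.\<close>
  define \<Psi> where "\<Psi> s y = (\<Sum>j\<in>UNIV. g y $ j * (indicator ?S s * b j s y))" for s y
  have \<Psi>_meas: "(\<lambda>(s, y). \<Psi> s y) \<in> borel_measurable (lborel \<Otimes>\<^sub>M lborel)"
  proof -
    have [measurable]: "(\<lambda>p. indicator ?S (fst p) * b j (fst p) (snd p)) \<in> borel_measurable (borel \<Otimes>\<^sub>M borel)" for j
      using b_meas[of j] by (simp add: borel_prod)
    have "(\<lambda>p. \<Sum>j\<in>UNIV. g (snd p) $ j * (indicator ?S (fst p) * b j (fst p) (snd p))) \<in> borel_measurable (borel \<Otimes>\<^sub>M borel)"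
      by measurable
    then show ?thesis unfolding \<Psi>_def by (simp add: case_prod_beta)
  qed
  have \<Psi>_good: "(LINT y|lborel. \<Psi> s y) = indicator ?S s * (LINT x|lebesgue. convection s x \<bullet> heat_conv_deriv (r - s) g x)"
    "integrable lborel (\<Psi> s)"
    "(LINT y|lborel. \<bar>\<Psi> s y\<bar>) \<le> indicator ?S s * (3 * C * ((8 * pi * \<sigma>) powr (- 3 / 4) * L2_norm g) * (E * L2_norm (Du s)))" for s
  proof -
    consider "s \<notin> ?S" | "s \<in> ?S" by blast
    then have "(LINT y|lborel. \<Psi> s y) = indicator ?S s * (LINT x|lebesgue. convection s x \<bullet> heat_conv_deriv (r - s) g x) \<and> integrable lborel (\<Psi> s) \<and>
      (LINT y|lborel. \<bar>\<Psi> s y\<bar>) \<le> indicator ?S s * (3 * C * ((8 * pi * \<sigma>) powr (- 3 / 4) * L2_norm g) * (E * L2_norm (Du s)))"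
    proof cases
      case 1
      then show ?thesis by (simp add: \<Psi>_def[abs_def])
    next
      case 2
      then have s: "s \<in> T" "s \<in> ?J" "0 < r - s" using r by auto
      have [measurable]: "cb s \<in> borel_measurable borel" by (rule cb(1)[OF s(1)])
      have b': "b j s y = (LINT x|lborel. cb s x \<bullet> ?K s y j x)" for j y
        unfolding b_def by (rule pair_eq[OF s(1)]) measurable
      have \<Psi>': "\<Psi> s = (\<lambda>y. \<Sum>j\<in>UNIV. g y $ j * (LINT x|lborel. cb s x \<bullet> div_free_kernel (r - s) (x - y) j))"
        using 2 by (auto simp: \<Psi>_def b')
      have F: "(LINT y|lborel. \<Psi> s y) = (LINT x|lborel. cb s x \<bullet> heat_conv_deriv (r - s) g x)" "integrable lborel (\<Psi> s)"
        unfolding \<Psi>' using kernel_pairing_Fubini[OF cb(1)[OF s(1)] disjI2[OF cb(2)[OF s(1)]] g s(3)] by auto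
      have "(LINT x|lborel. cb s x \<bullet> heat_conv_deriv (r - s) g x) = (LINT x|lebesgue. convection s x \<bullet> heat_conv_deriv (r - s) g x)"
        by (rule pair_eq[OF s(1), symmetric]) measurable
      moreover have "(LINT y|lborel. \<bar>\<Psi> s y\<bar>) \<le> 3 * C * ((8 * pi * \<sigma>) powr (- 3 / 4) * L2_norm g) * (E * L2_norm (Du s))"
      proof -
        have ng: "in_L2 (\<lambda>y. norm (g y))" using g(2) by (auto simp: in_L2_def)
        have nc: "integrable lborel (\<lambda>x. norm (cb s x))" using cb(2)[OF s(1)] by simp
        have pair: "integrable (lborel \<Otimes>\<^sub>M lborel) (\<lambda>(x, y). heat_kernel \<sigma> (x - y) * (norm (cb s x) * norm (g y)))"
          by (intro heat_pair_integrable_L1_L2 nc ng C(2)) auto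
        have hx: "integrable lborel (\<lambda>x. heat_kernel \<sigma> (x - y) * norm (cb s x))" for y
        proof (rule Bochner_Integration.integrable_bound)
          show "integrable lborel (\<lambda>x. B * norm (cb s x))" using nc by simp
          show "AE x in lborel. norm (heat_kernel \<sigma> (x - y) * norm (cb s x)) \<le> norm (B * norm (cb s x))"
            using B by (intro AE_I2) (auto simp: heat_kernel_nonneg abs_mult intro!: mult_right_mono order_trans[OF B abs_ge_self])
        qed measurable
        have bb: "\<bar>b j s y\<bar> \<le> C * (LINT x|lborel. heat_kernel \<sigma> (x - y) * norm (cb s x))" for j y
        proof -
          have le: "\<bar>cb s x \<bullet> ?K s y j x\<bar> \<le> C * (heat_kernel \<sigma> (x - y) * norm (cb s x))" for x
            using order_trans[OF Cauchy_Schwarz_ineq2 mult_left_mono[OF C(6)[OF rs(1)[OF s(2)]] norm_ge_zero]] by (simp add: mult_ac)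
          have i: "integrable lborel (\<lambda>x. cb s x \<bullet> ?K s y j x)"
            by (rule Bochner_Integration.integrable_bound[OF integrable_mult_right[OF hx, of C]])
               (use order_trans[OF le abs_ge_self] in auto)
          show ?thesis unfolding b'
            using Bochner_Integration.integral_norm_bound_integral[OF i integrable_mult_right[OF hx, of C]] le by simp
        qed
        have pt: "\<bar>\<Psi> s y\<bar> \<le> 3 * C * (LINT x|lborel. heat_kernel \<sigma> (x - y) * (norm (cb s x) * norm (g y)))" for y
        proof -
          have "\<bar>g y $ j * b j s y\<bar> \<le> norm (g y) * (C * (LINT x|lborel. heat_kernel \<sigma> (x - y) * norm (cb s x)))" for j
            unfolding abs_mult by (intro mult_mono bb) (auto simp: component_le_norm_cart)
          then have "\<bar>\<Psi> s y\<bar> \<le> (\<Sum>j\<in>(UNIV::3 set). norm (g y) * (C * (LINT x|lborel. heat_kernel \<sigma> (x - y) * norm (cb s x))))"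
            unfolding \<Psi>_def using 2 by (intro order_trans[OF sum_abs] sum_mono) simp
          also have "\<dots> = 3 * C * (LINT x|lborel. norm (g y) * (heat_kernel \<sigma> (x - y) * norm (cb s x)))" by simp
          finally show ?thesis by (simp add: mult_ac)
        qed
        have "(LINT y|lborel. \<bar>\<Psi> s y\<bar>) \<le> (LINT y|lborel. 3 * C * (LINT x|lborel. heat_kernel \<sigma> (x - y) * (norm (cb s x) * norm (g y))))"
          using F(2) lborel_pair.integrable_snd[OF pair] pt by (intro integral_mono) auto
        also have "\<dots> = 3 * C * (LINT x|lborel. LINT y|lborel. heat_kernel \<sigma> (x - y) * (norm (cb s x) * norm (g y)))"
          using lborel_pair.Fubini_integral[OF pair] by simp
        also have "\<dots> \<le> 3 * C * (LINT x|lborel. ((8 * pi * \<sigma>) powr (- 3 / 4) * L2_norm g) * norm (cb s x))"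
        proof (intro mult_left_mono integral_mono)
          show "integrable lborel (\<lambda>x. LINT y|lborel. heat_kernel \<sigma> (x - y) * (norm (cb s x) * norm (g y)))"
            using lborel_pair.integrable_fst[OF pair] .
          show "integrable lborel (\<lambda>x. ((8 * pi * \<sigma>) powr (- 3 / 4) * L2_norm g) * norm (cb s x))" using nc by simp
          show "(LINT y|lborel. heat_kernel \<sigma> (x - y) * (norm (cb s x) * norm (g y))) \<le> ((8 * pi * \<sigma>) powr (- 3 / 4) * L2_norm g) * norm (cb s x)" for x
          proof -
            have "(LINT y|lborel. heat_kernel \<sigma> (x - y) * (norm (cb s x) * norm (g y))) = norm (cb s x) * (LINT y|lborel. heat_kernel \<sigma> (x - y) * norm (g y))"
              by (subst integral_mult_right_zero[symmetric]) (simp add: mult_ac)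
            also have "\<dots> \<le> norm (cb s x) * ((8 * pi * \<sigma>) powr (- 3 / 4) * L2_norm g)"
              by (intro mult_left_mono heat_conv_integrable(2)[OF g(1,2) C(2)]) auto
            finally show ?thesis by (simp add: mult.commute)
          qed
        qed (use C in auto)
        also have "\<dots> = 3 * C * ((8 * pi * \<sigma>) powr (- 3 / 4) * L2_norm g) * (LINT x|lborel. norm (cb s x))" by simp
        also have "\<dots> \<le> 3 * C * ((8 * pi * \<sigma>) powr (- 3 / 4) * L2_norm g) * (E * L2_norm (Du s))"
          using C(1) by (intro mult_left_mono cb(4) s(1)) (auto simp: L2_norm_nonneg)
        finally show ?thesis .
      qed
      ultimately show ?thesis using 2 F by simp
    qed
    then show "(LINT y|lborel. \<Psi> s y) = indicator ?S s * (LINT x|lebesgue. convection s x \<bullet> heat_conv_deriv (r - s) g x)"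
      "integrable lborel (\<Psi> s)"
      "(LINT y|lborel. \<bar>\<Psi> s y\<bar>) \<le> indicator ?S s * (3 * C * ((8 * pi * \<sigma>) powr (- 3 / 4) * L2_norm g) * (E * L2_norm (Du s)))" by auto
  qed
  have pair: "integrable (lborel \<Otimes>\<^sub>M lborel) (\<lambda>(s, y). \<Psi> s y)"
  proof (rule lborel_pair.Fubini_integrable[OF \<Psi>_meas])
    let ?c = "3 * C * ((8 * pi * \<sigma>) powr (- 3 / 4) * L2_norm g) * E"
    have m: "(\<lambda>s. LINT y|lborel. \<bar>\<Psi> s y\<bar>) \<in> borel_measurable lborel"
      by (rule lborel.borel_measurable_lebesgue_integral) (use \<Psi>_meas in measurable)
    have "integrable lebesgue (\<lambda>s. LINT y|lborel. \<bar>\<Psi> s y\<bar>)"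
    proof (rule Bochner_Integration.integrable_bound)
      show "integrable lebesgue (\<lambda>s. ?c * (indicator ?J s *\<^sub>R L2_norm (Du s)))"
        using Du_integrable(1)[OF t] unfolding set_integrable_def by (intro integrable_mult_right)
      show "(\<lambda>s. LINT y|lborel. \<bar>\<Psi> s y\<bar>) \<in> borel_measurable lebesgue" using m by (intro borel_imp_lebesgue_measurable) simp
      have "0 \<le> (LINT y|lborel. \<bar>\<Psi> s y\<bar>)" for s by (intro integral_nonneg_AE) auto
      moreover have "(LINT y|lborel. \<bar>\<Psi> s y\<bar>) \<le> ?c * (indicator ?J s *\<^sub>R L2_norm (Du s))" for s
      proof (rule order_trans[OF \<Psi>_good(3)])
        show "indicator ?S s * (3 * C * ((8 * pi * \<sigma>) powr (- 3 / 4) * L2_norm g) * (E * L2_norm (Du s))) \<le> ?c * (indicator ?J s *\<^sub>R L2_norm (Du s))"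
          using C(1) E_nonneg by (auto simp: indicator_def L2_norm_nonneg mult.assoc)
      qed
      ultimately show "AE s in lebesgue. norm (LINT y|lborel. \<bar>\<Psi> s y\<bar>) \<le> norm (?c * (indicator ?J s *\<^sub>R L2_norm (Du s)))"
        by (intro AE_I2) (simp only: real_norm_def abs_of_nonneg order_trans[OF _ abs_ge_self])
    qed
    then show "integrable lborel (\<lambda>s. LINT y|lborel. norm (case (s, y) of (s, y) \<Rightarrow> \<Psi> s y))"
      using m integrable_lebesgue_lborel[of "\<lambda>s. LINT y|lborel. \<bar>\<Psi> s y\<bar>"] by simp
    show "AE s in lborel. integrable lborel (\<lambda>y. case (s, y) of (s, y) \<Rightarrow> \<Psi> s y)" using \<Psi>_good(2) by simp
  qed
  have swap: "(LINT y|lborel. LINT s|lborel. \<Psi> s y) = (LINT s|lborel. LINT y|lborel. \<Psi> s y)"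
    by (rule lborel_pair.Fubini_integral[OF pair])
  have ys: "(LINT s|lborel. \<Psi> s y) = (\<Sum>j\<in>UNIV. g y $ j * (L2_inner (u t0) (?K t0 y j) - L2_inner (u t0') (?K t0' y j)))" for y
  proof -
    have "integrable lborel (\<lambda>s. indicator ?S s * b j s y)" for j
    proof -
      have "integrable lebesgue (\<lambda>s. indicator ?S s * b j s y)"
        by (rule integrable_cong_AE_imp[OF b_int(1)[of j y, unfolded set_integrable_def]])
           (use good_times_AE[OF t] borel_imp_lebesgue_measurable[OF b_int(2)] in \<open>auto elim!: eventually_mono simp: indicator_def\<close>)
      then show ?thesis using integrable_lebesgue_lborel[OF b_int(2)] by simp
    qed
    then show ?thesis unfolding \<Psi>_def by (subst Bochner_Integration.integral_sum) (auto simp: b_eq)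
  qed
  have outer: "(LINT y|lborel. (\<Sum>j\<in>UNIV. g y $ j * L2_inner (u s) (?K s y j))) = L2_inner (u s) (heat_conv_deriv (r - s) g)"
    "integrable lborel (\<lambda>y. \<Sum>j\<in>UNIV. g y $ j * L2_inner (u s) (?K s y j))" if "s \<in> ?J" for s
  proof -
    have s: "0 \<le> s" "0 < r - s" using that t r by auto
    obtain f' where f': "f' \<in> borel_measurable borel" "AE x in lebesgue. u s x = f' x" by (rule borel_version[OF in_L2D(1)[OF u_L2[OF s(1)]]])
    have L: "in_L2 f'" by (rule in_L2_cong_AE[OF u_L2[OF s(1)] f'(2,1)])
    have e: "L2_inner (u s) \<phi> = (LINT x|lborel. f' x \<bullet> \<phi> x)" if "\<phi> \<in> borel_measurable borel" for \<phi>
      unfolding L2_inner_cong_AE[OF u_L2[OF s(1)] f'(2,1) that] unfolding L2_inner_def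
      by (rule integral_lebesgue_lborel) (use f'(1) that in measurable)
    have e1: "L2_inner (u s) (?K s y j) = (LINT x|lborel. f' x \<bullet> ?K s y j x)" for y j by (rule e) measurable
    have e2: "L2_inner (u s) (heat_conv_deriv (r - s) g) = (LINT x|lborel. f' x \<bullet> heat_conv_deriv (r - s) g x)" by (rule e) measurable
    show "(LINT y|lborel. (\<Sum>j\<in>UNIV. g y $ j * L2_inner (u s) (?K s y j))) = L2_inner (u s) (heat_conv_deriv (r - s) g)"
      unfolding e1 e2 by (rule kernel_pairing_Fubini(1)[OF f'(1) disjI1[OF L] g s(2)])
    show "integrable lborel (\<lambda>y. \<Sum>j\<in>UNIV. g y $ j * L2_inner (u s) (?K s y j))"
      unfolding e1 by (rule kernel_pairing_Fubini(2)[OF f'(1) disjI1[OF L] g s(2)])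
  qed
  have m: "(\<lambda>s. indicator ?S s * (LINT x|lebesgue. convection s x \<bullet> heat_conv_deriv (r - s) g x)) \<in> borel_measurable borel"
  proof -
    have "(\<lambda>s. LINT y|lborel. \<Psi> s y) \<in> borel_measurable lborel"
      by (rule lborel.borel_measurable_lebesgue_integral) (use \<Psi>_meas in measurable)
    then show ?thesis unfolding \<Psi>_good(1) by simp
  qed
  have t01: "t0 \<in> ?J" "t0' \<in> ?J" using t by auto
  have "L2_inner (u t0) (heat_conv_deriv (r - t0) g) - L2_inner (u t0') (heat_conv_deriv (r - t0') g) = (LINT y|lborel. LINT s|lborel. \<Psi> s y)"
    unfolding ys right_diff_distrib sum_subtractf
    using outer[OF t01(1)] outer[OF t01(2)] by simp
  also have "\<dots> = (LINT s:?J|lebesgue. LINT x|lebesgue. convection s x \<bullet> heat_conv_deriv (r - s) g x)"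
    unfolding swap \<Psi>_good(1) by (rule good_times_integral[OF t m, symmetric])
  finally show ?thesis .
qed

end

end

section \<open>The Duhamel identity and the estimate\<close>

context weak_solution
begin

context
  fixes t0 t0' :: real
  assumes t: "0 \<le> t0" "t0 < t0'"
begin

context
  fixes g :: "R3 \<Rightarrow> R3"
  assumes g: "g \<in> borel_measurable borel" "in_L2 g" "kernel_div_free g"
begin

lemma heat_conv_admissible:
  assumes r: "t0' < r"
  shows "heat_conv (r - s) g \<in> borel_measurable lebesgue"
    "s \<in> {t0..t0'} \<Longrightarrow> norm (heat_conv (r - s) g x) \<le> (8 * pi * (r - t0')) powr (- 3 / 4) * L2_norm g"
    "continuous_on {t0..t0'} (\<lambda>s. heat_conv (r - s) g x)"
proof -
  show "heat_conv (r - s) g \<in> borel_measurable lebesgue"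
    by (rule borel_imp_lebesgue_measurable[OF heat_conv_measurable[OF g(1)]])
  show "norm (heat_conv (r - s) g x) \<le> (8 * pi * (r - t0')) powr (- 3 / 4) * L2_norm g" if "s \<in> {t0..t0'}"
  proof -
    have "norm (heat_conv (r - s) g x) \<le> (8 * pi * (r - s)) powr (- 3 / 4) * L2_norm g"
      by (rule heat_conv_integrable(3)[OF g(1,2)]) (use that r in auto)
    also have "\<dots> \<le> (8 * pi * (r - t0')) powr (- 3 / 4) * L2_norm g"
      by (intro mult_right_mono powr_mono2' L2_norm_nonneg) (use that r in auto)
    finally show ?thesis .
  qed
  obtain C \<sigma> where C: "0 \<le> C" "0 < \<sigma>" "\<And>s x. s \<in> {r - t0'..r - t0} \<Longrightarrow> heat_kernel s x \<le> C * heat_kernel \<sigma> x"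
    "\<And>s x. s \<in> {r - t0'..r - t0} \<Longrightarrow> \<bar>heat_hess_trace s x\<bar> \<le> C * heat_kernel \<sigma> x"
    "\<And>s x k. s \<in> {r - t0'..r - t0} \<Longrightarrow> norm (heat_hess_row s x k) \<le> C * heat_kernel \<sigma> x"
    "\<And>s x j. s \<in> {r - t0'..r - t0} \<Longrightarrow> norm (div_free_kernel s x j) \<le> C * heat_kernel \<sigma> x"
    by (rule div_free_kernel_bound[of "r - t0'" "r - t0"]) (use t r in auto)
  have "continuous_on {r - t0'..r - t0} (\<lambda>t. heat_conv t g x)"
    unfolding heat_conv_def
  proof (rule dominated_convolution_continuous[OF g(1,2) C(2) heat_kernel_measurable])
    show "\<bar>heat_kernel s x\<bar> \<le> C * heat_kernel \<sigma> x" if "s \<in> {r - t0'..r - t0}" for s x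
      using C(3)[OF that] by (simp add: heat_kernel_nonneg)
    have "continuous_on {r - t0'..r - t0} (\<lambda>s. (\<lambda>(t, x). heat_kernel t x) (s, x))" for x
      by (rule continuous_on_compose2[OF heat_kernel_continuous_pair]) (use r in \<open>auto intro!: continuous_intros\<close>)
    then show "continuous_on {r - t0'..r - t0} (\<lambda>t. heat_kernel t x)" for x by simp
  qed
  then show "continuous_on {t0..t0'} (\<lambda>s. heat_conv (r - s) g x)"
    by (rule continuous_on_compose2) (auto intro!: continuous_intros)
qed

definition duhamel_defect :: "real \<Rightarrow> real" where
  "duhamel_defect r = L2_inner (u t0) (heat_conv (r - t0) g) - L2_inner (u t0') (heat_conv (r - t0') g)
     - (LINT s:{t0..t0'}|lebesgue. LINT x|lebesgue. convection s x \<bullet> heat_conv (r - s) g x)"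

text \<open>The difference quotients in \<open>r\<close> are dominated by a fixed function \<open>W\<close>, bounded and in \<open>L\<^sup>2\<close>,
  uniformly in \<open>s\<close>. So the derivative may be taken under all pairings, and
  \<open>kernel_identity_integrated\<close> says that the result is 0.\<close>

lemma duhamel_defect_derivative:
  assumes r: "t0' < r"
  shows "(duhamel_defect has_real_derivative 0) (at r)"
  unfolding DERIV_def
proof -
  let ?J = "{t0..t0'}"
  \<comment> \<open>With \<open>\<bar>h\<bar> < d\<close>, all times \<open>r + h - s\<close> stay in a compact interval of positive times.\<close>
  define d where "d = (r - t0') / 2"
  have d: "d > 0" "r - t0' = 2 * d" using r by (auto simp: d_def)
  obtain C \<sigma> where C: "0 \<le> C" "0 < \<sigma>" "\<And>s x. s \<in> {d..r - t0 + d} \<Longrightarrow> heat_kernel s x \<le> C * heat_kernel \<sigma> x"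
    "\<And>s x. s \<in> {d..r - t0 + d} \<Longrightarrow> \<bar>heat_hess_trace s x\<bar> \<le> C * heat_kernel \<sigma> x"
    "\<And>s x k. s \<in> {d..r - t0 + d} \<Longrightarrow> norm (heat_hess_row s x k) \<le> C * heat_kernel \<sigma> x"
    "\<And>s x j. s \<in> {d..r - t0 + d} \<Longrightarrow> norm (div_free_kernel s x j) \<le> C * heat_kernel \<sigma> x"
    by (rule div_free_kernel_bound[of d "r - t0 + d"]) (use t r d in auto)
  define W where "W x = C * heat_conv \<sigma> (\<lambda>y. norm (g y)) x" for x
  have ng: "in_L2 (\<lambda>y. norm (g y))" "(\<lambda>y. norm (g y)) \<in> borel_measurable borel" using g(1,2) by (auto simp: in_L2_def)
  have W: "in_L2 W" using in_L2_scaleR[OF heat_conv_L2(1)[OF ng(2,1) C(2)], of C] by (simp add: W_def[abs_def])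
  define M where "M = C * ((8 * pi * \<sigma>) powr (- 3 / 4) * L2_norm (\<lambda>y. norm (g y)))"
  have WM: "W x \<le> M" for x
    unfolding W_def M_def using heat_conv_integrable(3)[OF ng(2,1) C(2), of x] C(1) by (intro mult_left_mono) auto
  have ts: "r - s \<in> {d..r - t0 + d}" if "s \<in> ?J" for s using that r d by auto
  have lim: "(\<lambda>n. (duhamel_defect (r + X n) - duhamel_defect r) / X n) \<longlonglongrightarrow> 0"
    if X: "\<And>n. X n \<in> {-d<..<d} - {0}" "X \<longlonglongrightarrow> 0" for X
  proof -
    define q where "q n s x = (heat_conv (r - s + X n) g x - heat_conv (r - s) g x) /\<^sub>R X n" for n s x
    have rX: "t0' < r + X n" "X n \<noteq> 0" for n using X(1)[of n] d by auto
    have sX: "r - s + X n \<in> {d..r - t0 + d}" if "s \<in> ?J" for n s using that X(1)[of n] d by auto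
    have q_alt: "q n s x = inverse (X n) *\<^sub>R (heat_conv ((r + X n) - s) g x - heat_conv (r - s) g x)" for n s x
      by (simp add: q_def algebra_simps)
    have q_meas: "q n s \<in> borel_measurable lebesgue" for n s
      unfolding q_alt[abs_def] using heat_conv_admissible(1)[OF rX(1)] heat_conv_admissible(1)[OF r] by measurable
    have q_bound: "norm (q n s x) \<le> W x" if "s \<in> ?J" for n s x
      unfolding q_def W_def
      by (rule heat_conv_quotient(1)[OF g(1,2) d(1) C(2,3,4) ts[OF that]]) (use rX sX[OF that] in auto)
    have q_cont: "continuous_on ?J (\<lambda>s. q n s x)" for n x
      unfolding q_alt by (intro continuous_intros heat_conv_admissible(3) rX r)
    have q_lim: "(\<lambda>n. q n s x) \<longlonglongrightarrow> heat_conv_deriv (r - s) g x" if "s \<in> ?J" for s x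
      unfolding q_def
      by (rule heat_conv_quotient(2)[OF g(1,2) d(1) C(2,3,4) ts[OF that] _ X(2)]) (use rX sX[OF that] in auto)
    have Y_meas: "heat_conv_deriv (r - s) g \<in> borel_measurable lebesgue" for s
      by (rule borel_imp_lebesgue_measurable[OF heat_conv_deriv_measurable[OF g(1)]])
    have Y_bound: "norm (heat_conv_deriv (r - s) g x) \<le> W x" if "s \<in> ?J" for s x
      unfolding heat_conv_deriv_def W_def
      by (rule dominated_convolution(2)[OF g(1,2) C(2) heat_hess_trace_measurable C(4)[OF ts[OF that]]])
    have Y_cont: "continuous_on ?J (\<lambda>s. heat_conv_deriv (r - s) g x)" for x
    proof -
      have "continuous_on {d..r - t0 + d} (\<lambda>t. heat_conv_deriv t g x)"
        unfolding heat_conv_deriv_def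
      proof (rule dominated_convolution_continuous[OF g(1,2) C(2) heat_hess_trace_measurable C(4)])
        have h: "continuous_on {d..r - t0 + d} (\<lambda>s. heat_hess s x i j)" for x i j
        proof -
          have "continuous_on {d..r - t0 + d} (\<lambda>s. (\<lambda>(t, x). heat_hess t x i j) (s, x))"
            by (rule continuous_on_compose2[OF heat_hess_continuous]) (use d in \<open>auto intro!: continuous_intros\<close>)
          then show ?thesis by simp
        qed
        show "continuous_on {d..r - t0 + d} (\<lambda>t. heat_hess_trace t x)" for x
          unfolding heat_hess_trace_def by (intro continuous_intros h)
      qed
      then show ?thesis by (rule continuous_on_compose2) (use ts d in \<open>auto intro!: continuous_intros\<close>)
    qed
    have tJ: "t0 \<in> ?J" "t0' \<in> ?J" using t by auto
    have l1: "(\<lambda>n. L2_inner (u s) (q n s)) \<longlonglongrightarrow> L2_inner (u s) (heat_conv_deriv (r - s) g)" if "s \<in> ?J" for s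
      by (rule L2_inner_limit[OF u_L2 W q_meas Y_meas q_bound[OF that] q_lim[OF that]]) (use that t in auto)
    have l2: "(\<lambda>n. LINT s:?J|lebesgue. LINT x|lebesgue. convection s x \<bullet> q n s x) \<longlonglongrightarrow>
       (LINT s:?J|lebesgue. LINT x|lebesgue. convection s x \<bullet> heat_conv_deriv (r - s) g x)"
    proof (rule convection_pairing_time_limit[OF t q_meas _ q_cont Y_meas Y_cont])
      show "norm (q n s x) \<le> M" if "s \<in> ?J" for n s x using order_trans[OF q_bound[OF that] WM] .
      show "norm (heat_conv_deriv (r - s) g x) \<le> M" if "s \<in> ?J" for s x using order_trans[OF Y_bound[OF that] WM] .
      show "(\<lambda>n. q n s x) \<longlonglongrightarrow> heat_conv_deriv (r - s) g x" if "s \<in> {t0<..<t0'}" for s x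
        using that by (intro q_lim) auto
    qed
    have qu: "L2_inner (u s) (q n s) = inverse (X n) * (L2_inner (u s) (heat_conv ((r + X n) - s) g) - L2_inner (u s) (heat_conv (r - s) g))"
      if "s \<in> ?J" for n s
    proof -
      have "0 \<le> s" "0 < r + X n - s" "0 < r - s" using that t r rX(1)[of n] by auto
      then show ?thesis
        using L2_inner_diff_right[OF u_L2 heat_conv_L2(1)[OF g(1,2)] heat_conv_L2(1)[OF g(1,2)], of s "r + X n - s" "r - s"]
        unfolding q_alt[abs_def] by (simp add: L2_inner_def)
    qed
    have qc: "(LINT s:?J|lebesgue. LINT x|lebesgue. convection s x \<bullet> q n s x) = inverse (X n) *
      ((LINT s:?J|lebesgue. LINT x|lebesgue. convection s x \<bullet> heat_conv ((r + X n) - s) g x) - (LINT s:?J|lebesgue. LINT x|lebesgue. convection s x \<bullet> heat_conv (r - s) g x))" for n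
      unfolding q_alt by (rule convection_pairing_time_linear[OF t heat_conv_admissible[OF rX(1)] heat_conv_admissible[OF r]])
    have "(duhamel_defect (r + X n) - duhamel_defect r) / X n =
      L2_inner (u t0) (q n t0) - L2_inner (u t0') (q n t0') - (LINT s:?J|lebesgue. LINT x|lebesgue. convection s x \<bullet> q n s x)" for n
      unfolding duhamel_defect_def qu[OF tJ(1)] qu[OF tJ(2)] qc by (simp add: divide_inverse algebra_simps)
    moreover have "(\<lambda>n. L2_inner (u t0) (q n t0) - L2_inner (u t0') (q n t0') - (LINT s:?J|lebesgue. LINT x|lebesgue. convection s x \<bullet> q n s x))
      \<longlonglongrightarrow> L2_inner (u t0) (heat_conv_deriv (r - t0) g) - L2_inner (u t0') (heat_conv_deriv (r - t0') g)
        - (LINT s:?J|lebesgue. LINT x|lebesgue. convection s x \<bullet> heat_conv_deriv (r - s) g x)"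
      by (intro tendsto_diff l1 l2 tJ)
    ultimately show ?thesis using kernel_identity_integrated[OF t g r] by simp
  qed
  have "((\<lambda>h. (duhamel_defect (r + h) - duhamel_defect r) / h) \<longlongrightarrow> 0) (at 0 within {-d<..<d})"
    unfolding tendsto_at_iff_sequentially o_def using lim by blast
  then show "(\<lambda>h. (duhamel_defect (r + h) - duhamel_defect r) / h) \<midarrow>0\<rightarrow> 0"
    using d by (simp add: at_within_open[of 0 "{-d<..<d}"])
qed

text \<open>The pairings with the velocity vanish in the limit by \<open>heat_pairing_vanishes\<close>, and the integral
  since the supremum norm of the heat flow decays.\<close>

lemma duhamel_defect_vanishes: "(duhamel_defect \<longlongrightarrow> 0) at_top"
proof -
  have shift: "filterlim (\<lambda>r. r - s) at_top at_top" for s :: real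
    unfolding filterlim_at_top
  proof
    fix Z
    show "\<forall>\<^sub>F r in at_top. Z \<le> r - s" using eventually_ge_at_top[of "Z + s"] by eventually_elim simp
  qed
  have v: "((\<lambda>r. L2_inner (u s) (heat_conv (r - s) g)) \<longlongrightarrow> 0) at_top" if s: "0 \<le> s" for s
  proof -
    obtain f where f: "f \<in> borel_measurable borel" "AE x in lebesgue. u s x = f x" by (rule borel_version[OF in_L2D(1)[OF u_L2[OF s]]])
    have "L2_inner (u s) (heat_conv t g) = L2_inner f (heat_conv t g)" for t
      by (rule L2_inner_cong_AE[OF u_L2[OF s] f(2,1) heat_conv_measurable[OF g(1)]])
    then show ?thesis
      using filterlim_compose[OF heat_pairing_vanishes[OF f(1) in_L2_cong_AE[OF u_L2[OF s] f(2,1)] g(1,2)] shift] by simp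
  qed
  have c: "((\<lambda>r. LINT s:{t0..t0'}|lebesgue. LINT x|lebesgue. convection s x \<bullet> heat_conv (r - s) g x) \<longlongrightarrow> 0) at_top"
  proof (rule Lim_null_comparison)
    show "\<forall>\<^sub>F r in at_top. norm (LINT s:{t0..t0'}|lebesgue. LINT x|lebesgue. convection s x \<bullet> heat_conv (r - s) g x) \<le>
      ((8 * pi * (r - t0')) powr (- 3 / 4) * L2_norm g) * E * gradient_time_integral t0 t0'"
      using eventually_gt_at_top[of t0']
    proof eventually_elim
      fix r assume "t0' < r"
      from convection_pairing_time_bound[OF t heat_conv_admissible[OF this]]
      show "norm (LINT s:{t0..t0'}|lebesgue. LINT x|lebesgue. convection s x \<bullet> heat_conv (r - s) g x) \<le>
        ((8 * pi * (r - t0')) powr (- 3 / 4) * L2_norm g) * E * gradient_time_integral t0 t0'" by simp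
    qed
    have "((\<lambda>t::real. (8 * pi * t) powr (- 3 / 4)) \<longlongrightarrow> 0) at_top"
      by (rule tendsto_neg_powr) (auto intro!: filterlim_tendsto_pos_mult_at_top[OF tendsto_const] filterlim_ident)
    from filterlim_compose[OF this shift] have "((\<lambda>r. (8 * pi * (r - t0')) powr (- 3 / 4)) \<longlongrightarrow> 0) at_top" .
    from tendsto_mult[OF tendsto_mult[OF tendsto_mult[OF this tendsto_const] tendsto_const] tendsto_const]
    show "((\<lambda>r. ((8 * pi * (r - t0')) powr (- 3 / 4) * L2_norm g) * E * gradient_time_integral t0 t0') \<longlongrightarrow> 0) at_top" by simp
  qed
  show ?thesis
    unfolding duhamel_defect_def[abs_def] using tendsto_diff[OF tendsto_diff[OF v v] c, of t0 t0'] t by simp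
qed

lemma heat_flow_identity:
  assumes "t0' < r"
  shows "L2_inner (u t0) (heat_conv (r - t0) g) - L2_inner (u t0') (heat_conv (r - t0') g)
     = (LINT s:{t0..t0'}|lebesgue. LINT x|lebesgue. convection s x \<bullet> heat_conv (r - s) g x)"
proof -
  have "\<exists>c. \<forall>r\<in>{t0'<..}. duhamel_defect r = c"
    by (rule has_field_derivative_zero_constant)
       (auto intro: has_field_derivative_at_within duhamel_defect_derivative)
  then obtain c where c: "\<And>r. t0' < r \<Longrightarrow> duhamel_defect r = c" by auto
  have "\<forall>\<^sub>F r in at_top. duhamel_defect r = c"
    using eventually_gt_at_top[of t0'] by eventually_elim (rule c)
  then have "(duhamel_defect \<longlongrightarrow> c) at_top" by (rule tendsto_eventually)
  then have "c = 0" using duhamel_defect_vanishes by (intro tendsto_unique[OF _ _ duhamel_defect_vanishes]) auto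
  then show ?thesis using c[OF assms] by (simp add: duhamel_defect_def)
qed

lemma heat_flow_difference_bound:
  assumes "t0' < r"
  shows "\<bar>L2_inner (u t0) (heat_conv (r - t0) g) - L2_inner (u t0') (heat_conv (r - t0') g)\<bar>
     \<le> ((8 * pi * (r - t0')) powr (- 3 / 4) * L2_norm g) * E * gradient_time_integral t0 t0'"
  unfolding heat_flow_identity[OF assms] by (rule convection_pairing_time_bound[OF t heat_conv_admissible[OF assms]])

end

end

end

text \<open>The exceptional times of the weak gradient lie in a Borel set of measure zero; \<open>T\<close> is its
  complement in \<open>{0..}\<close>.\<close>

lemma leray_hopf_weak_solution:
  assumes "leray_hopf_solution u0 u"
  obtains Du p T where "weak_solution u Du p (L2_norm u0) T"
    "\<And>t. 0 \<le> t \<Longrightarrow> 2 * (LINT s:{0..t}|lebesgue. (L2_norm (Du s))\<^sup>2) \<le> (L2_norm u0)\<^sup>2"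
proof -
  obtain Du p where D: "AE t in lebesgue. 0 \<le> t \<longrightarrow> in_L2 (Du t) \<and> weak_gradient (u t) (Du t)"
    "set_integrable lebesgue {0..} (\<lambda>t. (L2_norm (Du t))\<^sup>2)" "navier_stokes_distributional u Du p"
    "\<And>t. 0 \<le> t \<Longrightarrow> (L2_norm (u t))\<^sup>2 + 2 * (LINT s:{0..t}|lebesgue. (L2_norm (Du s))\<^sup>2) \<le> (L2_norm u0)\<^sup>2"
    using assms unfolding leray_hopf_solution_def by blast
  obtain N where N: "N \<in> null_sets lebesgue" "{t. \<not> (0 \<le> t \<longrightarrow> in_L2 (Du t) \<and> weak_gradient (u t) (Du t))} \<subseteq> N"
    using D(1) unfolding eventually_ae_filter by auto
  then obtain N' where N': "N' \<in> null_sets lborel" "N \<subseteq> N'" using null_sets_completion_iff2 by blast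
  define T where "T = {0..} - N'"
  have T: "in_L2 (Du t)" "weak_gradient (u t) (Du t)" "0 \<le> t" if "t \<in> T" for t
    using that N(2) N'(2) unfolding T_def by auto
  have nonneg: "0 \<le> (LINT s:{0..t}|lebesgue. (L2_norm (Du s))\<^sup>2)" for t
    unfolding set_lebesgue_integral_def by (intro integral_nonneg_AE) auto
  have u: "L2_sigma (u t)" if "0 \<le> t" for t using assms that by (simp add: leray_hopf_solution_def)
  show ?thesis
  proof (rule that[of Du p T])
    show "weak_solution u Du p (L2_norm u0) T"
    proof
      show "in_L2 (u t)" if "0 \<le> t" for t using u[OF that] by (simp add: L2_sigma_def)
      show "L2_norm (u t) \<le> L2_norm u0" if "0 \<le> t" for t
        by (rule power2_le_imp_le) (use D(4)[OF that] nonneg[of t] L2_norm_nonneg in auto)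
      show "continuous_on {0..} (\<lambda>t. L2_inner (u t) g)" if "in_L2 g" for g
        using assms that by (simp add: leray_hopf_solution_def)
      show "T \<in> sets borel" using N'(1) by (auto simp: T_def null_sets_def)
      have "AE t in lebesgue. t \<notin> N'" by (rule AE_completion[OF AE_not_in[OF N'(1)]])
      then show "AE t in lebesgue. 0 \<le> t \<longrightarrow> t \<in> T" by eventually_elim (simp add: T_def)
    qed (use T D in auto)
    show "2 * (LINT s:{0..t}|lebesgue. (L2_norm (Du s))\<^sup>2) \<le> (L2_norm u0)\<^sup>2" if "0 \<le> t" for t
      using D(4)[OF that] zero_le_power2[of "L2_norm (u t)"] by linarith
  qed
qed

theorem theorem2p2:
  fixes u0 :: "R3 \<Rightarrow> R3" and u v v' :: "real \<Rightarrow> R3 \<Rightarrow> R3" and t0 t0' K :: real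
  assumes "L2_sigma u0"
    and "leray_hopf_solution u0 u"
    and "0 \<le> t0" and "t0 < t0'"
    and "v = (\<lambda>t. heat_semigroup (t - t0) (u t0))"
    and "v' = (\<lambda>t. heat_semigroup (t - t0') (u t0'))"
    and "K = (8 * pi) powr (- 3 / 4)"
  shows "\<forall>t>t0'. L2_norm (\<lambda>x. v t x - v' t x)
           \<le> K / sqrt 2 * (L2_norm u0)\<^sup>2 * (t0' - t0) powr (1 / 2) * (t - t0') powr (- 3 / 4)"
proof (intro allI impI)
  fix t assume t: "t0' < t"
  obtain Du p T where ws: "weak_solution u Du p (L2_norm u0) T"
    and energy: "\<And>t. 0 \<le> t \<Longrightarrow> 2 * (LINT s:{0..t}|lebesgue. (L2_norm (Du s))\<^sup>2) \<le> (L2_norm u0)\<^sup>2"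
    by (rule leray_hopf_weak_solution[OF assms(2)]) blast
  interpret weak_solution u Du p "L2_norm u0" T by (rule ws)
  let ?E = "L2_norm u0"
  have sig: "L2_sigma (u s)" if "0 \<le> s" for s using assms(2) that by (simp add: leray_hopf_solution_def)
  have t0: "0 \<le> t0'" "0 < t - t0" "0 < t - t0'" using assms(3,4) t by auto
  obtain U where U: "U \<in> borel_measurable borel" "AE x in lebesgue. u t0 x = U x"
    by (rule borel_version[OF in_L2D(1)[OF u_L2[OF assms(3)]]])
  obtain U' where U': "U' \<in> borel_measurable borel" "AE x in lebesgue. u t0' x = U' x"
    by (rule borel_version[OF in_L2D(1)[OF u_L2[OF t0(1)]]])
  note sU = L2_sigma_cong_AE[OF sig[OF assms(3)] U(2,1)]
  note sU' = L2_sigma_cong_AE[OF sig[OF t0(1)] U'(2,1)]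
  have L: "in_L2 U" "in_L2 U'" using sU sU' by (auto simp: L2_sigma_def)
  have v: "v t = heat_conv (t - t0) U"
    unfolding assms(5) by (rule heat_semigroup_eq[OF U t0(2) in_L2D(1)[OF u_L2[OF assms(3)]]])
  have v': "v' t = heat_conv (t - t0') U'"
    unfolding assms(6) by (rule heat_semigroup_eq[OF U' t0(3) in_L2D(1)[OF u_L2[OF t0(1)]]])
  note V = heat_conv_measurable[OF U(1)] heat_conv_L2(1)[OF U(1) L(1) t0(2)]
    kernel_div_free_heat_conv[OF U(1) L(1) L2_sigma_kernel_div_free[OF U(1) sU] t0(2)]
  note V' = heat_conv_measurable[OF U'(1)] heat_conv_L2(1)[OF U'(1) L(2) t0(3)]
    kernel_div_free_heat_conv[OF U'(1) L(2) L2_sigma_kernel_div_free[OF U'(1) sU'] t0(3)]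
  \<comment> \<open>The Duhamel identity is applied to the difference of the heat flows itself.\<close>
  define g where "g x = heat_conv (t - t0) U x - heat_conv (t - t0') U' x" for x
  have g: "g \<in> borel_measurable borel" "in_L2 g" "kernel_div_free g"
    unfolding g_def[abs_def] using V(1) V'(1) in_L2_diff[OF V(2) V'(2)] kernel_div_free_diff[OF V V'] by auto
  define k where "k = (8 * pi * (t - t0')) powr (- 3 / 4)"
  define D where "D = gradient_time_integral t0 t0'"
  have "(L2_norm g)\<^sup>2 = L2_inner g g" unfolding L2_norm_power2 L2_inner_def power2_norm_eq_inner ..
  also have "\<dots> = L2_inner (heat_conv (t - t0) U) g - L2_inner (heat_conv (t - t0') U') g"
    using L2_inner_diff_left[OF V(2) V'(2) g(2)] by (simp add: g_def[abs_def])
  also have "\<dots> = L2_inner U (heat_conv (t - t0) g) - L2_inner U' (heat_conv (t - t0') g)"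
    using heat_conv_symmetric[OF U(1) g(1) L(1) g(2) t0(2)] heat_conv_symmetric[OF U'(1) g(1) L(2) g(2) t0(3)] by simp
  also have "\<dots> = L2_inner (u t0) (heat_conv (t - t0) g) - L2_inner (u t0') (heat_conv (t - t0') g)"
    using L2_inner_cong_AE[OF u_L2[OF assms(3)] U(2,1) heat_conv_measurable[OF g(1)]]
      L2_inner_cong_AE[OF u_L2[OF t0(1)] U'(2,1) heat_conv_measurable[OF g(1)]] by simp
  also have "\<dots> \<le> (k * L2_norm g) * ?E * D"
    using heat_flow_difference_bound[OF assms(3,4) g t] unfolding k_def D_def by linarith
  finally have sq: "L2_norm g * L2_norm g \<le> L2_norm g * (k * ?E * D)" by (simp add: power2_eq_square mult_ac)
  have k0: "0 \<le> k" by (simp add: k_def)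
  have D0: "0 \<le> D" unfolding D_def gradient_time_integral_def[OF assms(3,4)] set_lebesgue_integral_def
    by (intro integral_nonneg_AE) (auto simp: L2_norm_nonneg)
  have gle: "L2_norm g \<le> k * ?E * D"
  proof (cases "L2_norm g = 0")
    case True
    then show ?thesis using k0 D0 L2_norm_nonneg[of u0] by simp
  next
    case False
    then have "L2_norm g > 0" using L2_norm_nonneg[of g] by simp
    then show ?thesis using sq by (simp only: mult_le_cancel_left_pos)
  qed
  have Dle: "D \<le> sqrt (t0' - t0) * (?E / sqrt 2)"
  proof -
    have "(LINT s:{t0..t0'}|lebesgue. (L2_norm (Du s))\<^sup>2) \<le> (LINT s:{0..t0'}|lebesgue. (L2_norm (Du s))\<^sup>2)"
      unfolding set_lebesgue_integral_def
    proof (rule integral_mono)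
      have i: "set_integrable lebesgue I (\<lambda>s. (L2_norm (Du s))\<^sup>2)" if "I \<in> sets lebesgue" "I \<subseteq> {0..}" for I
        by (rule set_integrable_subset[OF Du_square_integrable that])
      show "integrable lebesgue (\<lambda>s. indicator {t0..t0'} s *\<^sub>R (L2_norm (Du s))\<^sup>2)"
        "integrable lebesgue (\<lambda>s. indicator {0..t0'} s *\<^sub>R (L2_norm (Du s))\<^sup>2)"
        using i[of "{t0..t0'}"] i[of "{0..t0'}"] assms(3) by (auto simp: set_integrable_def)
    qed (use assms(3) in \<open>auto simp: indicator_def\<close>)
    also have "\<dots> \<le> ?E\<^sup>2 / 2" using energy[OF t0(1)] by simp
    finally have "sqrt (LINT s:{t0..t0'}|lebesgue. (L2_norm (Du s))\<^sup>2) \<le> sqrt (?E\<^sup>2 / 2)" by (rule real_sqrt_le_mono)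
    also have "sqrt (?E\<^sup>2 / 2) = ?E / sqrt 2" using L2_norm_nonneg[of u0] by (simp add: real_sqrt_divide)
    finally have "sqrt (LINT s:{t0..t0'}|lebesgue. (L2_norm (Du s))\<^sup>2) \<le> ?E / sqrt 2" .
    from order_trans[OF gradient_time_integral_bound[OF assms(3,4)] mult_left_mono[OF this]]
    show ?thesis using assms(4) unfolding D_def by simp
  qed
  have "L2_norm (\<lambda>x. v t x - v' t x) = L2_norm g" unfolding v v' by (simp add: g_def[abs_def])
  also have "\<dots> \<le> k * ?E * (sqrt (t0' - t0) * (?E / sqrt 2))"
    using order_trans[OF gle mult_left_mono[OF Dle]] k0 L2_norm_nonneg[of u0] by simp
  also have "k = K * (t - t0') powr (- 3 / 4)"
    unfolding k_def assms(7) by (rule powr_mult)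
  also have "sqrt (t0' - t0) = (t0' - t0) powr (1 / 2)" using assms(4) by (simp add: powr_half_sqrt)
  also have "K * (t - t0') powr (- 3 / 4) * ?E * ((t0' - t0) powr (1 / 2) * (?E / sqrt 2)) =
    K / sqrt 2 * ?E\<^sup>2 * (t0' - t0) powr (1 / 2) * (t - t0') powr (- 3 / 4)"
    by (simp add: power2_eq_square)
  finally show "L2_norm (\<lambda>x. v t x - v' t x)
           \<le> K / sqrt 2 * (L2_norm u0)\<^sup>2 * (t0' - t0) powr (1 / 2) * (t - t0') powr (- 3 / 4)" .
qed

end
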